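(* Let $T>0$. Assume that the drift $f$ satisfies $(\mathbf{a1})$, the running cost $g$ satisfies $(\mathbf{a2})$, the terminal function $p$ satisfies $(\mathbf P)$ with $L_p\le\bar L_p:=\max\{\bar L_k,L_0^*\}$, and $$\sup_{(x,\mu,\alpha)}\|\partial_\alpha\partial_\alpha f(x,\mu,\alpha)\|_{\mathcal L(\mathbb R^{d_\alpha}\times\mathbb R^{d_\alpha};\mathbb R^{d_x})}\,(1+|x|+\|\mu\|_1)\le\frac{\lambda_g}{40\max\{\bar L_k,L_0^*\}}$$ (see context). Then there exists a constant $\epsilon_1=\epsilon_1(\bar L_p;L_f,\Lambda_f,\bar l_f,L_g,\Lambda_g,\bar l_g,L_\alpha)>0$ such that for any $0\le t_0\le\tilde T\le T$ with $\tilde T-t_0\le\epsilon_1$, there exists a unique continuous decoupling field $\gamma:[t_0,\tilde T]\times\mathbb R^{d_x}\times\mathcal P_2(\mathbb R^{d_x})\to\mathbb R^{d_x}$ for the FBODE system with terminal data $p$ on $[t_0,\tilde T]$ satisfying $$|||\gamma|||_{1,[t_0,\tilde T]}:=\sup_{s\in[t_0,\tilde T],\,x,\,\mu}\frac{|\gamma(s,x,\mu)|}{1+|x|+\|\mu\|_1}\le2\bar L_p.$$ Moreover, for any $m\in\mathcal P_2(\mathbb R^{d_x})$ and $t\in[t_0,\tilde T]$, define $X^{t,m}_s(x)$ by $$X^{t,m}_s(x)=x+\int_t^sf\big(X^{t,m}_\tau(x),X^{t,m}_\tau\#m,\alpha(X^{t,m}_\tau(x),X^{t,m}_\tau\#m,\gamma(\tau,X^{t,m}_\tau(x),X^{t,m}_\tau\#m))\big)d\tau$$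 and $Z^{t,m}_s(x)=\gamma(s,X^{t,m}_s(x),X^{t,m}_s\#m)$. Then $(X^{t,m}_s(x),Z^{t,m}_s(x))_{x\in\mathbb R^{d_x},s\in[t,\tilde T]}$ is a solution of the FBODE system; each component is continuous in $(t,m,x)\in[t_0,\tilde T]\times\mathcal P_2(\mathbb R^{d_x})\times\mathbb R^{d_x}$ and continuously differentiable in $s\in[t,\tilde T]$; and $$|Z^{t,m}_s(x)|\le2\bar L_p\big(1+|X^{t,m}_s(x)|+\|X^{t,m}_s\|_{L^1_m}\big),$$ i.e. $(X^{t,m}_s(x),X^{t,m}_s\#m,Z^{t,m}_s(x))\in c_{k_0}$. In addition, $X$ has the flow property $X^{t,m}_\tau(x)=X^{s,X^{t,m}_s\#m}_\tau(X^{t,m}_s(x))$ for any $t_0\le t\le s\le\tau\le\tilde T$.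
   Context: **Notation.** $\mathcal P_2(\mathbb R^d)$: Borel probability measures on $\mathbb R^d$ with finite second moment; $W_p$: $p$-Wasserstein metric; $\|\mu\|_p=(\int|x|^pd\mu)^{1/p}$; $\delta_0$: Dirac mass at $0$; $X\#m$: push-forward; $\|X\|_{L^1_m}=\int|X|dm$; $\|\cdot\|$: operator norm of (multi)linear maps; $a\vee b=\max\{a,b\}$. For $z\in\mathbb R^{d_x}$: $\partial_xf\cdot z=\sum_iz_i\partial_xf_i$, and similarly for $\partial_\alpha f\cdot z$, $\partial_\mu f(\cdot)(\tilde x)\cdot z$. **Derivatives in measure.** $h:\mathcal P_2(\mathbb R^d)\to\mathbb R$ has linear functional derivative $\frac{\delta h}{\delta\mu}(\mu)(x)$ if this function is jointly continuous, $|\frac{\delta h}{\delta\mu}(\mu)(x)|\le c(\mu)(1+|x|^2)$ with $c$ bounded on bounded sets, and $h(\nu_1)-h(\nu_2)=\int_0^1\int\frac{\delta h}{\delta\mu}(\theta\nu_1+(1-\theta)\nu_2)(x)\,d(\nu_1-\nu_2)(x)d\theta$; normalization $\int\frac{\delta h}{\delta\mu}(\mu)d\mu=0$. A second-order linear functional derivative $\frac{\delta^2h}{\delta\mu^2}(\mu)(x,\tilde x)$ is jointly continuous, bounded by $c(\mu)(1+|x|^2+|\tilde x|^2)$, has zero $\mu$-integral in each variable, and satisfies $h(\nu_1)-h(\nu_2)=\int\frac{\delta h}{\delta\mu}(\nu_2)d(\nu_1-\nu_2)+\int_0^1\int_0^1\iint\theta\frac{\delta^2h}{\delta\mu^2}(\nu_2+\lambda\theta(\nu_1-\nu_2))(x,\tilde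 x)d(\nu_1-\nu_2)(x)d(\nu_1-\nu_2)(\tilde x)d\lambda d\theta$. $h$ is second-order regularly differentiable if both exist and $\partial_x\partial_x\frac{\delta h}{\delta\mu}$, $\partial_x\partial_{\tilde x}\frac{\delta^2h}{\delta\mu^2}$ are jointly continuous and bounded by $c(\mu)$. $h$ is $L$-differentiable at $\mu$ if the lift $X\mapsto h(\mathrm{Law}(X))$ on square-integrable random vectors is Fréchet differentiable at some $X$ with law $\mu$; the derivative is represented by $\partial_\mu h(\mu)(X)$, and $\partial_\mu h(\mu)(x)=\partial_x\frac{\delta h}{\delta\mu}(\mu)(x)$ for regularly differentiable $h$. Also $\partial_\mu\partial_\mu h(\mu)(\tilde x,\hat x)=\partial_{\tilde x}\partial_{\hat x}\frac{\delta^2h}{\delta\mu^2}(\mu)(\tilde x,\hat x)$. For vector-valued maps everything is componentwise. **(a1)** $f:\mathbb R^{d_x}\times\mathcal P_2(\mathbb R^{d_x})\times\mathbb R^{d_\alpha}\to\mathbb R^{d_x}$ is twice differentiable in $x,\alpha$, second-order regularly differentiable in $\mu$, with jointly continuous derivatives, and for constants $\lambda_f,\Lambda_f,\bar l_f,\mathrm{Lip}_f>0$ and all arguments: (i) $\sum_{i,j}(\xi_i\partial_\alpha f_i)\cdot(\xi_j\partial_\alpha f_j)\ge\lambda_f|\xi|^2$ for $\xi\in\mathbb R^{d_x}$; (ii) $\|\partial_\alpha f\|\vee\|\partial_\mu f(x,\mu,\alpha)(\tilde x)\|\vee\|\partial_xf\|\le\Lambda_f$; (iii) each of $\partial_\mu\partial_\mu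 f(x,\mu,\alpha)(\tilde x,\hat x)$, $\partial_\alpha\partial_\alpha f$, $\partial_\mu\partial_\alpha f(\cdot)(\tilde x)$, $\partial_\alpha\partial_xf$, $\partial_x\partial_xf$, $\partial_{\tilde x}\partial_\mu f(\cdot)(\tilde x)$, $\partial_x\partial_\mu f(\cdot)(\tilde x)$ has norm at most $\bar l_f/(1+|x|+\|\mu\|_1)$; (iv) each of these is jointly Lipschitz with constant $\mathrm{Lip}_f/(1+\max\{|x|,|x'|\}+\max\{\|\mu\|_1,\|\mu'\|_1\})$ with respect to $|x-x'|+W_2(\mu,\mu')+|\alpha-\alpha'|$ (plus $|\tilde x-\tilde x'|$, $|\hat x-\hat x'|$ when these variables occur). **(a2)** $g:\mathbb R^{d_x}\times\mathcal P_2(\mathbb R^{d_x})\times\mathbb R^{d_\alpha}\to\mathbb R$ is twice differentiable in $x,\alpha$, second-order regularly differentiable in $\mu$, with jointly Lipschitz second-order derivatives, and for constants $\lambda_g,\Lambda_g,\bar l_g>0$, $l_g\ge0$: (i) $\xi^\top\partial_\alpha\partial_\alpha g\,\xi\ge\lambda_g|\xi|^2$; (ii) with $G(x,\mu,\alpha):=g(x,\mu,\alpha)+\int\frac{\delta}{\delta\mu}g(\tilde x,\mu,\alpha)(x)d\mu(\tilde x)$: $\xi^\top\partial_x\partial_xG\,\xi\ge\lambda_g|\xi|^2$ and $\int(G(x,\mu',\alpha)-G(x,\mu,\alpha))d(\mu'-\mu)(x)\ge-l_g|\int y\,d(\mu-\mu')(y)|^2$ for all $\mu,\mu',\alpha$,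 with $l_g\le\frac12\lambda_g$; (iii) the norms of $\partial_\mu\partial_\mu g(\cdot)(\tilde x,\hat x)$, $\partial_\alpha\partial_\alpha g$, $\partial_x\partial_\mu g(\cdot)(\tilde x)$, $\partial_x\partial_xg$, $\partial_{\tilde x}\partial_\mu g(\cdot)(\tilde x)$ are $\le\Lambda_g$, and those of $\partial_x\partial_\alpha g$, $\partial_\alpha\partial_\mu g(\cdot)(\tilde x)$ are $\le\bar l_g$. **(P)** $p:\mathbb R^{d_x}\times\mathcal P_2(\mathbb R^{d_x})\to\mathbb R^{d_x}$ is differentiable in $x$ and $L$-differentiable in $\mu$, with first-order derivatives Lipschitz continuous in their arguments, and $\|\partial_xp(x,\mu)\|\vee\|\partial_\mu p(x,\mu)(\tilde x)\|\le L_p$, $|p(x,\mu)|\le\bar L_p(1+|x|+\|\mu\|_1)$ for all $x,\mu,\tilde x$. **Constants.** $\lambda_k,\Lambda_k>0$ are given constants (in the paper, the convexity and second-derivative bounds of the terminal cost $k$). $\bar L_k=3\Lambda_k$; $\lambda_z=\frac{\lambda_f^2}{\Lambda_g+\lambda_g/20}$, $\lambda_x=\frac{17}{20}\lambda_g$, $\bar\lambda_k=\frac14\lambda_k$, $\bar\lambda_z=\frac12\lambda_z$, $\bar\lambda_x=\frac1{40}\lambda_g$; $\kappa_1=\min\{\frac{\lambda_k}4,\frac{\lambda_z}2,\frac{\lambda_g}{40}\}$, $\kappa_2=\min\{\frac{\lambda_k}4,\frac{\lambda_z}4,\frac{\lambda_g}5\}$; $L_1^*=\max\{\frac{4\Lambda_k^2}{\lambda_k},\frac1{\lambda_z}(2\Lambda_g+\frac3{20}\lambda_g),\frac1{\lambda_x}(\frac52\Lambda_f+2\Lambda_g+\frac3{20}\lambda_g)\}$;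 $L_4^*=\max\{\frac{\Lambda_k^2}{\kappa_1\lambda_k},\frac1{4\kappa_1\lambda_x}(\frac{25}{16}\Lambda_f^2+(2\Lambda_g+\frac15\lambda_g)^2)\}$; $L_5^*=\max\{\frac{9\Lambda_k^2}{4\kappa_2\bar\lambda_k},\frac{25\Lambda_f^2}{64\kappa_2\bar\lambda_z},\frac1{4\kappa_2\bar\lambda_x}(\frac{25}{16}\Lambda_f^2+9(\frac1{10}\lambda_g+\Lambda_g)^2)\}$; $L_6^*=\max\{\frac{27\Lambda_k^2}{\bar\lambda_k},\frac{\Lambda_g+\lambda_g/10}{\bar\lambda_x},\frac{\Lambda_g+\lambda_g/10}{\bar\lambda_z},\frac{12\Lambda_k^2}{\lambda_k},\frac{2\Lambda_g+\lambda_g/5}{\lambda_x},\frac{6\Lambda_k^2}{\bar\lambda_k},\frac{2\Lambda_g+3\lambda_g/20}{\bar\lambda_x},\frac{\frac{15}4\Lambda_f+7\Lambda_g+\frac{13}{20}\lambda_g}{\bar\lambda_z}\}$; $L_0^*=d_x\max\{L_1^*,\sqrt{(L_4^*(2+L_5^* )+1)L_1^*L_6^*}\}$; $k_0=4\max\{\bar L_k,L_0^*\}$; $L_f=\max\{\Lambda_f,|f(0,\delta_0,0)|\}$; $L_g=\max\{|\partial_\mu g(0,\delta_0,0)(0)|,|\partial_xg(0,\delta_0,0)|,|\partial_\alpha g(0,\delta_0,0)|,\Lambda_g,\bar l_g\}$. **Optimal control.** $c_{k_0}=\{(x,\mu,z)\in\mathbb R^{d_x}\times\mathcal P_2(\mathbb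 R^{d_x})\times\mathbb R^{d_x}:|z|\le\frac12k_0(1+|x|+\|\mu\|_1)\}$. For $(x,\mu,z)\in c_{k_0}$, $\alpha(x,\mu,z)\in\mathbb R^{d_\alpha}$ is the unique minimizer of $a\mapsto f(x,\mu,a)\cdot z+g(x,\mu,a)$, characterized by $\partial_\alpha f(x,\mu,\alpha)\cdot z+\partial_\alpha g(x,\mu,\alpha)=0$. $L_\alpha:=\max\{\frac{20\Lambda_f}{19\lambda_g},\frac{20(\bar l_g+\frac12k_0\bar l_f)}{19\lambda_g},|\alpha(0,\delta_0,0)|\}$. **FBODE system.** For maps $X,Z:\mathbb R^{d_x}\to\mathbb R^{d_x}$ put $a_x=\alpha(X(x),X\#m,Z(x))$ and $\Phi(X,Z,m)(x)=\partial_xf(X(x),X\#m,a_x)\cdot Z(x)+\partial_xg(X(x),X\#m,a_x)+\int\big(\partial_\mu f(X(\tilde x),X\#m,a_{\tilde x})(X(x))\cdot Z(\tilde x)+\partial_\mu g(X(\tilde x),X\#m,a_{\tilde x})(X(x))\big)dm(\tilde x)$. The FBODE system on $[t,\tilde T]$ with terminal data $p$: for all $x$, $s\in[t,\tilde T]$, $\frac d{ds}X^{t,m}_s(x)=f(X^{t,m}_s(x),X^{t,m}_s\#m,\alpha(X^{t,m}_s(x),X^{t,m}_s\#m,Z^{t,m}_s(x)))$, $X^{t,m}_t(x)=x$; $\frac d{ds}Z^{t,m}_s(x)=-\Phi(X^{t,m}_s,Z^{t,m}_s,m)(x)$, $Z^{t,m}_{\tilde T}(x)=p(X^{t,m}_{\tilde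 T}(x),X^{t,m}_{\tilde T}\#m)$. **Decoupling field.** $\gamma:[t_0,\tilde T]\times\mathbb R^{d_x}\times\mathcal P_2(\mathbb R^{d_x})\to\mathbb R^{d_x}$ is a decoupling field on $[t_0,\tilde T]$ if for all $s\in[t_0,\tilde T]$, $x$, $m$: $\gamma(s,x,m)=p(X^{s,m}_{\tilde T}(x),X^{s,m}_{\tilde T}\#m)+\int_s^{\tilde T}\Phi(X^{s,m}_\tau,Z^{s,m}_\tau,m)(x)d\tau$, where $Z^{s,m}_\tau(x)=\gamma(\tau,X^{s,m}_\tau(x),X^{s,m}_\tau\#m)$ and $X^{s,m}_\tau(x)=x+\int_s^\tau f(X^{s,m}_r(x),X^{s,m}_r\#m,\alpha(X^{s,m}_r(x),X^{s,m}_r\#m,\gamma(r,X^{s,m}_r(x),X^{s,m}_r\#m)))dr$. *)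

theory Defs
  imports "HOL-Probability.Probability"
begin

section \<open>Square-integrable probability measures and Wasserstein distance\<close>

definition P2 :: "'x::euclidean_space measure set" where
  "P2 = {\<mu>. prob_space \<mu> \<and> sets \<mu> = sets borel \<and> integrable \<mu> (\<lambda>x. (norm x)\<^sup>2)}"

definition mnorm :: "real \<Rightarrow> 'x::euclidean_space measure \<Rightarrow> real" where
  "mnorm p \<mu> = (\<integral>x. norm x powr p \<partial>\<mu>) powr (1 / p)"

definition couplings :: "'x::euclidean_space measure \<Rightarrow> 'x measure \<Rightarrow> ('x \<times> 'x) measure set" where
  "couplings \<mu> \<nu> = {\<pi>. sets \<pi> = sets borel \<and> distr \<pi> borel fst = \<mu> \<and> distr \<pi> borel snd = \<nu>}"

definition Wass :: "real \<Rightarrow> 'x::euclidean_space measure \<Rightarrow> 'x measure \<Rightarrow> real" where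
  "Wass p \<mu> \<nu> =
     enn2real (INF \<pi>\<in>couplings \<mu> \<nu>. \<integral>\<^sup>+z. ennreal (norm (fst z - snd z) powr p) \<partial>\<pi>) powr (1 / p)"

abbreviation pushfwd :: "('x::euclidean_space \<Rightarrow> 'x) \<Rightarrow> 'x measure \<Rightarrow> 'x measure" where
  "pushfwd X m \<equiv> distr m borel X"

abbreviation dirac0 :: "'x::euclidean_space measure" where
  "dirac0 \<equiv> return borel 0"

text \<open>The convex combination \<open>\<theta> \<nu>1 + (1 - \<theta>) \<nu>2\<close>, for \<open>\<theta> \<in> [0, 1]\<close>.\<close>

definition mix :: "real \<Rightarrow> 'x::euclidean_space measure \<Rightarrow> 'x measure \<Rightarrow> 'x measure" where
  "mix \<theta> \<nu>1 \<nu>2 = measure_of UNIV (sets borel)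
     (\<lambda>A. ennreal \<theta> * emeasure \<nu>1 A + ennreal (1 - \<theta>) * emeasure \<nu>2 A)"

text \<open>The integral against the signed measure \<open>\<nu>1 - \<nu>2\<close>.\<close>

definition sint :: "('x \<Rightarrow> 'b::{banach, second_countable_topology}) \<Rightarrow> 'x measure \<Rightarrow> 'x measure \<Rightarrow> 'b" where
  "sint F \<nu>1 \<nu>2 = (\<integral>x. F x \<partial>\<nu>1) - (\<integral>x. F x \<partial>\<nu>2)"

text \<open>Joint continuity of a map of \<open>(z, \<mu>) \<in> S \<times> P2\<close>, with \<open>P2\<close> metrized by \<open>W\<^sub>2\<close>; several
  finite-dimensional variables are collected in the tuple \<open>z\<close>.\<close>

definition cont_P2_on :: "'z::metric_space set \<Rightarrow> ('z \<Rightarrow> 'x::euclidean_space measure \<Rightarrow> 'b::metric_space) \<Rightarrow> bool" where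
  "cont_P2_on S F \<longleftrightarrow>
     (\<forall>z\<in>S. \<forall>\<mu>\<in>P2. \<forall>e>0. \<exists>d>0. \<forall>z'\<in>S. \<forall>\<mu>'\<in>P2.
        dist z' z < d \<and> Wass 2 \<mu>' \<mu> < d \<longrightarrow> dist (F z' \<mu>') (F z \<mu>) < e)"

definition bounded_on_bounded :: "('x::euclidean_space measure \<Rightarrow> real) \<Rightarrow> bool" where
  "bounded_on_bounded c \<longleftrightarrow> (\<forall>R. \<exists>C. \<forall>\<mu>\<in>P2. mnorm 2 \<mu> \<le> R \<longrightarrow> \<bar>c \<mu>\<bar> \<le> C)"


section \<open>Frechet derivatives in Euclidean variables\<close>

definition fderiv :: "('a::real_normed_vector \<Rightarrow> 'b::real_normed_vector) \<Rightarrow> 'a \<Rightarrow> 'a \<Rightarrow>\<^sub>L 'b" where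
  "fderiv F x = Blinfun (frechet_derivative F (at x))"

definition twice_diff :: "('a::real_normed_vector \<Rightarrow> 'b::real_normed_vector) \<Rightarrow> bool" where
  "twice_diff F \<longleftrightarrow> (\<forall>x. F differentiable at x) \<and> (\<forall>x. fderiv F differentiable at x)"

text \<open>\<open>contr A z\<close> is \<open>\<Sum>\<^sub>i z\<^sub>i A\<^sub>i\<close>, where \<open>A\<^sub>i\<close> is the gradient of the \<open>i\<close>-th component of the linear
  map \<open>A\<close>; with \<open>A\<close> the derivative of \<open>f\<close> this is what is written \<open>\<partial>f \<cdot> z\<close>.\<close>

definition contr :: "((real^'c) \<Rightarrow>\<^sub>L (real^'n)) \<Rightarrow> real^'n \<Rightarrow> real^'c" where
  "contr A z = (\<Sum>i\<in>UNIV. (z $ i) *\<^sub>R row i (matrix (blinfun_apply A)))"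

definition grad :: "((real^'c) \<Rightarrow>\<^sub>L real) \<Rightarrow> real^'c" where
  "grad A = (\<chi> j. blinfun_apply A (axis j 1))"


section \<open>Derivatives in the measure variable\<close>

text \<open>Vector-valued maps are treated directly; the Bochner integrals make this the same as the
  componentwise notion.\<close>

definition is_lfd :: "('x::euclidean_space measure \<Rightarrow> 'b::{banach, second_countable_topology})
    \<Rightarrow> ('x measure \<Rightarrow> 'x \<Rightarrow> 'b) \<Rightarrow> bool" where
  "is_lfd h D \<longleftrightarrow>
     cont_P2_on UNIV (\<lambda>x \<mu>. D \<mu> x) \<and>
     (\<exists>c. bounded_on_bounded c \<and> (\<forall>\<mu>\<in>P2. \<forall>x. norm (D \<mu> x) \<le> c \<mu> * (1 + (norm x)\<^sup>2))) \<and>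
     (\<forall>\<nu>1\<in>P2. \<forall>\<nu>2\<in>P2.
        ((\<lambda>\<theta>. sint (D (mix \<theta> \<nu>1 \<nu>2)) \<nu>1 \<nu>2) has_integral (h \<nu>1 - h \<nu>2)) {0..1}) \<and>
     (\<forall>\<mu>\<in>P2. (\<integral>x. D \<mu> x \<partial>\<mu>) = 0)"

text \<open>By the normalization the linear functional derivative is unique on \<open>P2\<close>.\<close>

definition lfd :: "('x::euclidean_space measure \<Rightarrow> 'b::{banach, second_countable_topology})
    \<Rightarrow> 'x measure \<Rightarrow> 'x \<Rightarrow> 'b" where
  "lfd h = (SOME D. is_lfd h D)"

text \<open>The conditions below determine a second-order linear functional derivative only up to an
  antisymmetric part, so it is a predicate rather than an operator.\<close>

definition is_lfd2 :: "('x::euclidean_space measure \<Rightarrow> 'b::{banach, second_countable_topology})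
    \<Rightarrow> ('x measure \<Rightarrow> 'x \<Rightarrow> 'x \<Rightarrow> 'b) \<Rightarrow> bool" where
  "is_lfd2 h K \<longleftrightarrow>
     cont_P2_on UNIV (\<lambda>(x, y) \<mu>. K \<mu> x y) \<and>
     (\<exists>c. bounded_on_bounded c \<and>
        (\<forall>\<mu>\<in>P2. \<forall>x y. norm (K \<mu> x y) \<le> c \<mu> * (1 + (norm x)\<^sup>2 + (norm y)\<^sup>2))) \<and>
     (\<forall>\<mu>\<in>P2. (\<forall>y. (\<integral>x. K \<mu> x y \<partial>\<mu>) = 0) \<and> (\<forall>x. (\<integral>y. K \<mu> x y \<partial>\<mu>) = 0)) \<and>
     (\<forall>\<nu>1\<in>P2. \<forall>\<nu>2\<in>P2.
        ((\<lambda>\<theta>. integral {0..1} (\<lambda>l. \<theta> *\<^sub>R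
             sint (\<lambda>y. sint (\<lambda>x. K (mix (l * \<theta>) \<nu>1 \<nu>2) x y) \<nu>1 \<nu>2) \<nu>1 \<nu>2))
         has_integral (h \<nu>1 - h \<nu>2 - sint (lfd h \<nu>2) \<nu>1 \<nu>2)) {0..1})"

definition mixed_deriv :: "('x::real_normed_vector \<Rightarrow> 'x \<Rightarrow> 'b::real_normed_vector) \<Rightarrow> 'x \<Rightarrow> 'x \<Rightarrow> 'x \<Rightarrow>\<^sub>L 'x \<Rightarrow>\<^sub>L 'b" where
  "mixed_deriv k x y = fderiv (\<lambda>u. fderiv (k u) y) x"

text \<open>Second-order regular differentiability, \<open>K\<close> being a second-order linear functional
  derivative.\<close>

definition regular2 :: "('x::euclidean_space measure \<Rightarrow> 'b::{banach, second_countable_topology})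
    \<Rightarrow> ('x measure \<Rightarrow> 'x \<Rightarrow> 'x \<Rightarrow> 'b) \<Rightarrow> bool" where
  "regular2 h K \<longleftrightarrow>
     (\<exists>D. is_lfd h D) \<and> is_lfd2 h K \<and>
     (\<forall>\<mu>\<in>P2. twice_diff (lfd h \<mu>)) \<and>
     cont_P2_on UNIV (\<lambda>x \<mu>. fderiv (fderiv (lfd h \<mu>)) x) \<and>
     (\<forall>\<mu>\<in>P2. \<forall>x y. K \<mu> x differentiable at y \<and> (\<lambda>u. fderiv (K \<mu> u) y) differentiable at x) \<and>
     cont_P2_on UNIV (\<lambda>(x, y) \<mu>. mixed_deriv (K \<mu>) x y) \<and>
     (\<exists>c. bounded_on_bounded c \<and>
        (\<forall>\<mu>\<in>P2. \<forall>x y. norm (fderiv (fderiv (lfd h \<mu>)) x) \<le> c \<mu> \<and> norm (mixed_deriv (K \<mu>) x y) \<le> c \<mu>))"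

text \<open>L-derivatives. The lift is taken on the atomless space \<open>[0, 1]\<close> with Lebesgue measure, on which
  every law in \<open>P2\<close> is realized. \<open>has_L_deriv h D \<mu>\<close> says that the lift \<open>X \<mapsto> h (Law X)\<close> is
  Frechet differentiable in \<open>L\<^sup>2\<close> at some \<open>X\<close> of law \<open>\<mu>\<close>, with derivative represented by \<open>D(X)\<close>.\<close>

abbreviation Om :: "real measure" where
  "Om \<equiv> uniform_measure lborel {0..1}"

definition sq_int :: "(real \<Rightarrow> 'x::euclidean_space) \<Rightarrow> bool" where
  "sq_int Y \<longleftrightarrow> Y \<in> borel_measurable Om \<and> integrable Om (\<lambda>w. (norm (Y w))\<^sup>2)"

definition has_L_deriv :: "('x::euclidean_space measure \<Rightarrow> 'b::{banach, second_countable_topology})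
    \<Rightarrow> ('x \<Rightarrow> 'x \<Rightarrow>\<^sub>L 'b) \<Rightarrow> 'x measure \<Rightarrow> bool" where
  "has_L_deriv h D \<mu> \<longleftrightarrow>
     D \<in> borel_measurable borel \<and> integrable \<mu> (\<lambda>x. (norm (D x))\<^sup>2) \<and>
     (\<exists>X. sq_int X \<and> distr Om borel X = \<mu> \<and>
        (\<forall>e>0. \<exists>d>0. \<forall>Y. sq_int Y \<and> sqrt (\<integral>w. (norm (Y w))\<^sup>2 \<partial>Om) < d \<longrightarrow>
           norm (h (distr Om borel (\<lambda>w. X w + Y w)) - h \<mu> - (\<integral>w. blinfun_apply (D (X w)) (Y w) \<partial>Om))
             \<le> e * sqrt (\<integral>w. (norm (Y w))\<^sup>2 \<partial>Om)))"


section \<open>Partial derivatives of maps of state, measure and control\<close>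

definition dx :: "('x::euclidean_space \<Rightarrow> 'x measure \<Rightarrow> 'a::euclidean_space \<Rightarrow> 'b::real_normed_vector)
    \<Rightarrow> 'x \<Rightarrow> 'x measure \<Rightarrow> 'a \<Rightarrow> 'x \<Rightarrow>\<^sub>L 'b" where
  "dx f x \<mu> \<alpha> = fderiv (\<lambda>y. f y \<mu> \<alpha>) x"

definition da :: "('x::euclidean_space \<Rightarrow> 'x measure \<Rightarrow> 'a::euclidean_space \<Rightarrow> 'b::real_normed_vector)
    \<Rightarrow> 'x \<Rightarrow> 'x measure \<Rightarrow> 'a \<Rightarrow> 'a \<Rightarrow>\<^sub>L 'b" where
  "da f x \<mu> \<alpha> = fderiv (f x \<mu>) \<alpha>"

text \<open>\<open>lf f x \<mu> \<alpha> u\<close> is \<open>\<delta>f/\<delta>\<mu> (x, \<mu>, \<alpha>)(u)\<close>, and \<open>dm f x \<mu> \<alpha> u\<close> is \<open>\<partial>\<^sub>\<mu> f (x, \<mu>, \<alpha>)(u)\<close>.\<close>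

definition lf :: "('x::euclidean_space \<Rightarrow> 'x measure \<Rightarrow> 'a::euclidean_space \<Rightarrow> 'b::{banach, second_countable_topology})
    \<Rightarrow> 'x \<Rightarrow> 'x measure \<Rightarrow> 'a \<Rightarrow> 'x \<Rightarrow> 'b" where
  "lf f x \<mu> \<alpha> u = lfd (\<lambda>\<nu>. f x \<nu> \<alpha>) \<mu> u"

definition dm :: "('x::euclidean_space \<Rightarrow> 'x measure \<Rightarrow> 'a::euclidean_space \<Rightarrow> 'b::{banach, second_countable_topology})
    \<Rightarrow> 'x \<Rightarrow> 'x measure \<Rightarrow> 'a \<Rightarrow> 'x \<Rightarrow> 'x \<Rightarrow>\<^sub>L 'b" where
  "dm f x \<mu> \<alpha> u = fderiv (lf f x \<mu> \<alpha>) u"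

text \<open>The next three predicates take a map of \<open>(x, \<mu>, \<alpha>, u, v)\<close>; a derivative not depending on \<open>u\<close> or
  \<open>v\<close> is passed with dummy arguments, whose distances then drop out (take \<open>u' = u\<close>, \<open>v' = v\<close>).\<close>

definition bounded_by :: "('x::euclidean_space \<Rightarrow> 'x measure \<Rightarrow> 'a::euclidean_space \<Rightarrow> 'x \<Rightarrow> 'x \<Rightarrow> 'b::real_normed_vector)
    \<Rightarrow> ('x \<Rightarrow> 'x measure \<Rightarrow> real) \<Rightarrow> bool" where
  "bounded_by F B \<longleftrightarrow> (\<forall>x. \<forall>\<mu>\<in>P2. \<forall>\<alpha> u v. norm (F x \<mu> \<alpha> u v) \<le> B x \<mu>)"

definition lipschitz_by :: "('x::euclidean_space \<Rightarrow> 'x measure \<Rightarrow> 'a::euclidean_space \<Rightarrow> 'x \<Rightarrow> 'x \<Rightarrow> 'b::real_normed_vector)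
    \<Rightarrow> ('x \<Rightarrow> 'x \<Rightarrow> 'x measure \<Rightarrow> 'x measure \<Rightarrow> real) \<Rightarrow> bool" where
  "lipschitz_by F C \<longleftrightarrow>
     (\<forall>x x'. \<forall>\<mu>\<in>P2. \<forall>\<mu>'\<in>P2. \<forall>\<alpha> \<alpha>' u u' v v'.
        norm (F x \<mu> \<alpha> u v - F x' \<mu>' \<alpha>' u' v')
          \<le> C x x' \<mu> \<mu>' * (norm (x - x') + Wass 2 \<mu> \<mu>' + norm (\<alpha> - \<alpha>') + norm (u - u') + norm (v - v')))"

definition decaying :: "('x::euclidean_space \<Rightarrow> 'x measure \<Rightarrow> 'a::euclidean_space \<Rightarrow> 'x \<Rightarrow> 'x \<Rightarrow> 'b::real_normed_vector)
    \<Rightarrow> real \<Rightarrow> real \<Rightarrow> bool" where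
  "decaying F l Lip \<longleftrightarrow>
     bounded_by F (\<lambda>x \<mu>. l / (1 + norm x + mnorm 1 \<mu>)) \<and>
     lipschitz_by F (\<lambda>x x' \<mu> \<mu>'. Lip / (1 + max (norm x) (norm x') + max (mnorm 1 \<mu>) (mnorm 1 \<mu>')))"


section \<open>Standing assumptions\<close>

text \<open>\<open>K x \<alpha>\<close> is a second-order linear functional derivative of \<open>f x \<cdot> \<alpha>\<close>, and \<open>M x \<mu> \<alpha> u\<close> is
  \<open>\<partial>\<^sub>\<mu> \<partial>\<^sub>\<alpha> f (x, \<mu>, \<alpha>)(u)\<close>, that is, for every control direction \<open>b\<close> its \<open>b\<close>-component is the
  L-derivative of \<open>\<partial>\<^sub>\<alpha> f (x, \<cdot>, \<alpha>) b\<close>. Joint continuity of the second-order derivatives is contained in their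
  Lipschitz bounds.\<close>

definition assm_a1 :: "(real^'n \<Rightarrow> (real^'n) measure \<Rightarrow> real^'k \<Rightarrow> real^'n)
    \<Rightarrow> real \<Rightarrow> real \<Rightarrow> real \<Rightarrow> real \<Rightarrow> bool" where
  "assm_a1 f lam_f Lam_f lbar_f Lip_f \<longleftrightarrow>
     0 < lam_f \<and> 0 < Lam_f \<and> 0 < lbar_f \<and> 0 < Lip_f \<and>
     (\<forall>\<mu>\<in>P2. twice_diff (\<lambda>(x, \<alpha>). f x \<mu> \<alpha>)) \<and>
     cont_P2_on UNIV (\<lambda>(x, \<alpha>) \<mu>. dx f x \<mu> \<alpha>) \<and>
     cont_P2_on UNIV (\<lambda>(x, \<alpha>) \<mu>. da f x \<mu> \<alpha>) \<and>
     cont_P2_on UNIV (\<lambda>(x, \<alpha>, u) \<mu>. lf f x \<mu> \<alpha> u) \<and>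
     cont_P2_on UNIV (\<lambda>(x, \<alpha>, u) \<mu>. dm f x \<mu> \<alpha> u) \<and>
     (\<forall>x. \<forall>\<mu>\<in>P2. \<forall>\<alpha> u. (\<lambda>y. dm f y \<mu> \<alpha> u) differentiable at x) \<and>
     (\<forall>x. \<forall>\<mu>\<in>P2. \<forall>\<alpha> \<xi>.
        (\<Sum>i\<in>UNIV. \<Sum>j\<in>UNIV.
           ((\<xi> $ i) *\<^sub>R row i (matrix (blinfun_apply (da f x \<mu> \<alpha>)))) \<bullet>
           ((\<xi> $ j) *\<^sub>R row j (matrix (blinfun_apply (da f x \<mu> \<alpha>)))))
        \<ge> lam_f * (norm \<xi>)\<^sup>2) \<and>
     (\<forall>x. \<forall>\<mu>\<in>P2. \<forall>\<alpha> u.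
        norm (da f x \<mu> \<alpha>) \<le> Lam_f \<and> norm (dm f x \<mu> \<alpha> u) \<le> Lam_f \<and> norm (dx f x \<mu> \<alpha>) \<le> Lam_f) \<and>
     (\<exists>K (M :: real^'n \<Rightarrow> (real^'n) measure \<Rightarrow> real^'k \<Rightarrow> real^'n \<Rightarrow> ((real^'n) \<Rightarrow>\<^sub>L (real^'k) \<Rightarrow>\<^sub>L (real^'n))).
        (\<forall>x \<alpha>. regular2 (\<lambda>\<nu>. f x \<nu> \<alpha>) (K x \<alpha>)) \<and>
        cont_P2_on UNIV (\<lambda>(x, \<alpha>, u, v) \<mu>. K x \<alpha> \<mu> u v) \<and>
        (\<forall>x. \<forall>\<mu>\<in>P2. \<forall>\<alpha> b. has_L_deriv (\<lambda>\<nu>. blinfun_apply (da f x \<nu> \<alpha>) b)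
           (\<lambda>u. Blinfun (\<lambda>y. blinfun_apply (blinfun_apply (M x \<mu> \<alpha> u) y) b)) \<mu>) \<and>
        decaying (\<lambda>x \<mu> \<alpha> u v. mixed_deriv (K x \<alpha> \<mu>) u v) lbar_f Lip_f \<and>
        decaying (\<lambda>x \<mu> \<alpha> u v. fderiv (da f x \<mu>) \<alpha>) lbar_f Lip_f \<and>
        decaying (\<lambda>x \<mu> \<alpha> u v. M x \<mu> \<alpha> u) lbar_f Lip_f \<and>
        decaying (\<lambda>x \<mu> \<alpha> u v. fderiv (dx f x \<mu>) \<alpha>) lbar_f Lip_f \<and>
        decaying (\<lambda>x \<mu> \<alpha> u v. fderiv (\<lambda>y. dx f y \<mu> \<alpha>) x) lbar_f Lip_f \<and>
        decaying (\<lambda>x \<mu> \<alpha> u v. fderiv (dm f x \<mu> \<alpha>) u) lbar_f Lip_f \<and>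
        decaying (\<lambda>x \<mu> \<alpha> u v. fderiv (\<lambda>y. dm f y \<mu> \<alpha> u) x) lbar_f Lip_f)"

definition G_of :: "('x::euclidean_space \<Rightarrow> 'x measure \<Rightarrow> 'a::euclidean_space \<Rightarrow> real)
    \<Rightarrow> 'x \<Rightarrow> 'x measure \<Rightarrow> 'a \<Rightarrow> real" where
  "G_of g x \<mu> \<alpha> = g x \<mu> \<alpha> + (\<integral>y. lf g y \<mu> \<alpha> x \<partial>\<mu>)"

definition assm_a2 :: "(real^'n \<Rightarrow> (real^'n) measure \<Rightarrow> real^'k \<Rightarrow> real)
    \<Rightarrow> real \<Rightarrow> real \<Rightarrow> real \<Rightarrow> real \<Rightarrow> bool" where
  "assm_a2 g lam_g Lam_g lbar_g l_g \<longleftrightarrow>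
     0 < lam_g \<and> 0 < Lam_g \<and> 0 < lbar_g \<and> 0 \<le> l_g \<and> l_g \<le> lam_g / 2 \<and>
     (\<forall>\<mu>\<in>P2. twice_diff (\<lambda>(x, \<alpha>). g x \<mu> \<alpha>)) \<and>
     (\<forall>x. \<forall>\<mu>\<in>P2. \<forall>\<alpha> u. (\<lambda>y. dm g y \<mu> \<alpha> u) differentiable at x \<and>
                        (\<lambda>b. dm g x \<mu> b u) differentiable at \<alpha>) \<and>
     (\<forall>x. \<forall>\<mu>\<in>P2. \<forall>\<alpha> \<xi>. blinfun_apply (blinfun_apply (fderiv (da g x \<mu>) \<alpha>) \<xi>) \<xi> \<ge> lam_g * (norm \<xi>)\<^sup>2) \<and>
     (\<forall>\<mu>\<in>P2. \<forall>\<alpha>. twice_diff (\<lambda>x. G_of g x \<mu> \<alpha>)) \<and>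
     (\<forall>x. \<forall>\<mu>\<in>P2. \<forall>\<alpha> \<xi>.
        blinfun_apply (blinfun_apply (fderiv (\<lambda>y. dx (G_of g) y \<mu> \<alpha>) x) \<xi>) \<xi> \<ge> lam_g * (norm \<xi>)\<^sup>2) \<and>
     (\<forall>\<mu>\<in>P2. \<forall>\<mu>'\<in>P2. \<forall>\<alpha>.
        sint (\<lambda>x. G_of g x \<mu>' \<alpha> - G_of g x \<mu> \<alpha>) \<mu>' \<mu> \<ge> - l_g * (norm (sint (\<lambda>y. y) \<mu> \<mu>'))\<^sup>2) \<and>
     (\<exists>K C.
        (\<forall>x \<alpha>. regular2 (\<lambda>\<nu>. g x \<nu> \<alpha>) (K x \<alpha>)) \<and>
        lipschitz_by (\<lambda>x \<mu> \<alpha> u v. mixed_deriv (K x \<alpha> \<mu>) u v) (\<lambda>_ _ _ _. C) \<and>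
        lipschitz_by (\<lambda>x \<mu> \<alpha> u v. fderiv (da g x \<mu>) \<alpha>) (\<lambda>_ _ _ _. C) \<and>
        lipschitz_by (\<lambda>x \<mu> \<alpha> u v. fderiv (\<lambda>y. dm g y \<mu> \<alpha> u) x) (\<lambda>_ _ _ _. C) \<and>
        lipschitz_by (\<lambda>x \<mu> \<alpha> u v. fderiv (\<lambda>y. dx g y \<mu> \<alpha>) x) (\<lambda>_ _ _ _. C) \<and>
        lipschitz_by (\<lambda>x \<mu> \<alpha> u v. fderiv (dm g x \<mu> \<alpha>) u) (\<lambda>_ _ _ _. C) \<and>
        lipschitz_by (\<lambda>x \<mu> \<alpha> u v. fderiv (\<lambda>y. da g y \<mu> \<alpha>) x) (\<lambda>_ _ _ _. C) \<and>
        lipschitz_by (\<lambda>x \<mu> \<alpha> u v. fderiv (\<lambda>b. dm g x \<mu> b u) \<alpha>) (\<lambda>_ _ _ _. C) \<and>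
        bounded_by (\<lambda>x \<mu> \<alpha> u v. mixed_deriv (K x \<alpha> \<mu>) u v) (\<lambda>_ _. Lam_g) \<and>
        bounded_by (\<lambda>x \<mu> \<alpha> u v. fderiv (da g x \<mu>) \<alpha>) (\<lambda>_ _. Lam_g) \<and>
        bounded_by (\<lambda>x \<mu> \<alpha> u v. fderiv (\<lambda>y. dm g y \<mu> \<alpha> u) x) (\<lambda>_ _. Lam_g) \<and>
        bounded_by (\<lambda>x \<mu> \<alpha> u v. fderiv (\<lambda>y. dx g y \<mu> \<alpha>) x) (\<lambda>_ _. Lam_g) \<and>
        bounded_by (\<lambda>x \<mu> \<alpha> u v. fderiv (dm g x \<mu> \<alpha>) u) (\<lambda>_ _. Lam_g) \<and>
        bounded_by (\<lambda>x \<mu> \<alpha> u v. fderiv (\<lambda>y. da g y \<mu> \<alpha>) x) (\<lambda>_ _. lbar_g) \<and>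
        bounded_by (\<lambda>x \<mu> \<alpha> u v. fderiv (\<lambda>b. dm g x \<mu> b u) \<alpha>) (\<lambda>_ _. lbar_g))"

text \<open>An L-derivative is determined only up to null sets, so \<open>Q\<close> is the version of \<open>\<partial>\<^sub>\<mu> p\<close> that is
  Lipschitz and bounded.\<close>

definition assm_P :: "(real^'n \<Rightarrow> (real^'n) measure \<Rightarrow> real^'n) \<Rightarrow> real \<Rightarrow> real \<Rightarrow> bool" where
  "assm_P p L_p Lbar_p \<longleftrightarrow>
     (\<forall>x. \<forall>\<mu>\<in>P2. (\<lambda>y. p y \<mu>) differentiable at x) \<and>
     (\<exists>C. \<forall>x x'. \<forall>\<mu>\<in>P2. \<forall>\<mu>'\<in>P2.
        norm (fderiv (\<lambda>y. p y \<mu>) x - fderiv (\<lambda>y. p y \<mu>') x') \<le> C * (norm (x - x') + Wass 2 \<mu> \<mu>')) \<and>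
     (\<forall>x. \<forall>\<mu>\<in>P2. norm (fderiv (\<lambda>y. p y \<mu>) x) \<le> L_p) \<and>
     (\<exists>Q. (\<forall>x. \<forall>\<mu>\<in>P2. has_L_deriv (p x) (Q x \<mu>) \<mu>) \<and>
        (\<exists>C. \<forall>x x'. \<forall>\<mu>\<in>P2. \<forall>\<mu>'\<in>P2. \<forall>u u'.
           norm (Q x \<mu> u - Q x' \<mu>' u') \<le> C * (norm (x - x') + Wass 2 \<mu> \<mu>' + norm (u - u'))) \<and>
        (\<forall>x. \<forall>\<mu>\<in>P2. \<forall>u. norm (Q x \<mu> u) \<le> L_p)) \<and>
     (\<forall>x. \<forall>\<mu>\<in>P2. norm (p x \<mu>) \<le> Lbar_p * (1 + norm x + mnorm 1 \<mu>))"


section \<open>Constants\<close>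

definition Lbar_k_const :: "real \<Rightarrow> real" where
  "Lbar_k_const Lam_k = 3 * Lam_k"

definition L0_star :: "nat \<Rightarrow> real \<Rightarrow> real \<Rightarrow> real \<Rightarrow> real \<Rightarrow> real \<Rightarrow> real \<Rightarrow> real" where
  "L0_star d_x lam_f Lam_f lam_g Lam_g lam_k Lam_k =
    (let lam_z = lam_f\<^sup>2 / (Lam_g + lam_g / 20);
         lam_x = 17 / 20 * lam_g;
         lamb_k = 1 / 4 * lam_k;
         lamb_z = 1 / 2 * lam_z;
         lamb_x = 1 / 40 * lam_g;
         kappa1 = Min {lam_k / 4, lam_z / 2, lam_g / 40};
         kappa2 = Min {lam_k / 4, lam_z / 4, lam_g / 5};
         L1 = Max {4 * Lam_k\<^sup>2 / lam_k,
                   1 / lam_z * (2 * Lam_g + 3 / 20 * lam_g),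
                   1 / lam_x * (5 / 2 * Lam_f + 2 * Lam_g + 3 / 20 * lam_g)};
         L4 = max (Lam_k\<^sup>2 / (kappa1 * lam_k))
                  (1 / (4 * kappa1 * lam_x) * (25 / 16 * Lam_f\<^sup>2 + (2 * Lam_g + 1 / 5 * lam_g)\<^sup>2));
         L5 = Max {9 * Lam_k\<^sup>2 / (4 * kappa2 * lamb_k),
                   25 * Lam_f\<^sup>2 / (64 * kappa2 * lamb_z),
                   1 / (4 * kappa2 * lamb_x) * (25 / 16 * Lam_f\<^sup>2 + 9 * (1 / 10 * lam_g + Lam_g)\<^sup>2)};
         L6 = Max {27 * Lam_k\<^sup>2 / lamb_k,
                   (Lam_g + lam_g / 10) / lamb_x,
                   (Lam_g + lam_g / 10) / lamb_z,
                   12 * Lam_k\<^sup>2 / lam_k,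
                   (2 * Lam_g + lam_g / 5) / lam_x,
                   6 * Lam_k\<^sup>2 / lamb_k,
                   (2 * Lam_g + 3 * lam_g / 20) / lamb_x,
                   (15 / 4 * Lam_f + 7 * Lam_g + 13 / 20 * lam_g) / lamb_z}
     in real d_x * max L1 (sqrt ((L4 * (2 + L5) + 1) * L1 * L6)))"

definition L_f_const :: "(real^'n \<Rightarrow> (real^'n) measure \<Rightarrow> real^'k \<Rightarrow> real^'n) \<Rightarrow> real \<Rightarrow> real" where
  "L_f_const f Lam_f = max Lam_f (norm (f 0 dirac0 0))"

definition L_g_const :: "(real^'n \<Rightarrow> (real^'n) measure \<Rightarrow> real^'k \<Rightarrow> real) \<Rightarrow> real \<Rightarrow> real \<Rightarrow> real" where
  "L_g_const g Lam_g lbar_g =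
     Max {norm (dm g 0 dirac0 0 0), norm (dx g 0 dirac0 0), norm (da g 0 dirac0 0), Lam_g, lbar_g}"


section \<open>Optimal control, FBODE system and decoupling fields\<close>

definition ctrl_cone :: "real \<Rightarrow> ('x::euclidean_space \<times> 'x measure \<times> 'x) set" where
  "ctrl_cone k0 = {(x, \<mu>, z). \<mu> \<in> P2 \<and> norm z \<le> 1 / 2 * k0 * (1 + norm x + mnorm 1 \<mu>)}"

text \<open>Meaningful only on \<open>ctrl_cone k0\<close>, where the minimizer exists and is unique.\<close>

definition opt_ctrl :: "('x::euclidean_space \<Rightarrow> 'x measure \<Rightarrow> 'a::euclidean_space \<Rightarrow> 'x)
    \<Rightarrow> ('x \<Rightarrow> 'x measure \<Rightarrow> 'a \<Rightarrow> real) \<Rightarrow> 'x \<Rightarrow> 'x measure \<Rightarrow> 'x \<Rightarrow> 'a" where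
  "opt_ctrl f g x \<mu> z = (THE a. is_arg_min (\<lambda>b. f x \<mu> b \<bullet> z + g x \<mu> b) (\<lambda>_. True) a)"

definition L_alpha_const :: "(real^'n \<Rightarrow> (real^'n) measure \<Rightarrow> real^'k \<Rightarrow> real^'n)
    \<Rightarrow> (real^'n \<Rightarrow> (real^'n) measure \<Rightarrow> real^'k \<Rightarrow> real)
    \<Rightarrow> real \<Rightarrow> real \<Rightarrow> real \<Rightarrow> real \<Rightarrow> real \<Rightarrow> real" where
  "L_alpha_const f g k0 Lam_f lbar_f lam_g lbar_g =
     Max {20 * Lam_f / (19 * lam_g), 20 * (lbar_g + 1 / 2 * k0 * lbar_f) / (19 * lam_g),
          norm (opt_ctrl f g 0 dirac0 0)}"

definition drift :: "(real^'n \<Rightarrow> (real^'n) measure \<Rightarrow> real^'k \<Rightarrow> real^'n)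
    \<Rightarrow> (real^'n \<Rightarrow> (real^'n) measure \<Rightarrow> real^'k \<Rightarrow> real)
    \<Rightarrow> real^'n \<Rightarrow> (real^'n) measure \<Rightarrow> real^'n \<Rightarrow> real^'n" where
  "drift f g x \<mu> z = f x \<mu> (opt_ctrl f g x \<mu> z)"

text \<open>The integrand, in \<open>y\<close>, of the nonlocal term of \<open>\<Phi>\<close>.\<close>

definition Phi_nonlocal :: "(real^'n \<Rightarrow> (real^'n) measure \<Rightarrow> real^'k \<Rightarrow> real^'n)
    \<Rightarrow> (real^'n \<Rightarrow> (real^'n) measure \<Rightarrow> real^'k \<Rightarrow> real)
    \<Rightarrow> (real^'n \<Rightarrow> real^'n) \<Rightarrow> (real^'n \<Rightarrow> real^'n) \<Rightarrow> (real^'n) measure \<Rightarrow> real^'n \<Rightarrow> real^'n \<Rightarrow> real^'n" where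
  "Phi_nonlocal f g X Z m x y =
     (let \<mu> = pushfwd X m; a = opt_ctrl f g (X y) \<mu> (Z y)
      in contr (dm f (X y) \<mu> a (X x)) (Z y) + grad (dm g (X y) \<mu> a (X x)))"

definition Phi :: "(real^'n \<Rightarrow> (real^'n) measure \<Rightarrow> real^'k \<Rightarrow> real^'n)
    \<Rightarrow> (real^'n \<Rightarrow> (real^'n) measure \<Rightarrow> real^'k \<Rightarrow> real)
    \<Rightarrow> (real^'n \<Rightarrow> real^'n) \<Rightarrow> (real^'n \<Rightarrow> real^'n) \<Rightarrow> (real^'n) measure \<Rightarrow> real^'n \<Rightarrow> real^'n" where
  "Phi f g X Z m x =
     (let \<mu> = pushfwd X m; a = opt_ctrl f g (X x) \<mu> (Z x)
      in contr (dx f (X x) \<mu> a) (Z x) + grad (dx g (X x) \<mu> a) + (\<integral>y. Phi_nonlocal f g X Z m x y \<partial>m))"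

definition fbode_solution :: "(real^'n \<Rightarrow> (real^'n) measure \<Rightarrow> real^'k \<Rightarrow> real^'n)
    \<Rightarrow> (real^'n \<Rightarrow> (real^'n) measure \<Rightarrow> real^'k \<Rightarrow> real)
    \<Rightarrow> (real^'n \<Rightarrow> (real^'n) measure \<Rightarrow> real^'n)
    \<Rightarrow> real \<Rightarrow> real \<Rightarrow> (real^'n) measure
    \<Rightarrow> (real \<Rightarrow> real^'n \<Rightarrow> real^'n) \<Rightarrow> (real \<Rightarrow> real^'n \<Rightarrow> real^'n) \<Rightarrow> bool" where
  "fbode_solution f g p t T' m X Z \<longleftrightarrow>
     (\<forall>s\<in>{t..T'}. X s \<in> borel_measurable borel \<and> Z s \<in> borel_measurable borel \<and>
        pushfwd (X s) m \<in> P2 \<and> (\<forall>x. integrable m (Phi_nonlocal f g (X s) (Z s) m x))) \<and>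
     (\<forall>x. X t x = x) \<and>
     (\<forall>x. Z T' x = p (X T' x) (pushfwd (X T') m)) \<and>
     (\<forall>x. \<forall>s\<in>{t..T'}.
        ((\<lambda>r. X r x) has_vector_derivative drift f g (X s x) (pushfwd (X s) m) (Z s x)) (at s within {t..T'}) \<and>
        ((\<lambda>r. Z r x) has_vector_derivative - Phi f g (X s) (Z s) m x) (at s within {t..T'}))"

definition Z_of :: "(real \<Rightarrow> real^'n \<Rightarrow> (real^'n) measure \<Rightarrow> real^'n) \<Rightarrow> (real^'n) measure
    \<Rightarrow> (real \<Rightarrow> real^'n \<Rightarrow> real^'n) \<Rightarrow> real \<Rightarrow> real^'n \<Rightarrow> real^'n" where
  "Z_of \<gamma> m X s x = \<gamma> s (X s x) (pushfwd (X s) m)"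

text \<open>\<open>X\<close> solves the forward integral equation driven by \<open>\<gamma>\<close> from time \<open>t\<close> and initial law \<open>m\<close>. The
  measurability and continuity conditions make the laws and the integral meaningful.\<close>

definition is_flow :: "(real^'n \<Rightarrow> (real^'n) measure \<Rightarrow> real^'k \<Rightarrow> real^'n)
    \<Rightarrow> (real^'n \<Rightarrow> (real^'n) measure \<Rightarrow> real^'k \<Rightarrow> real)
    \<Rightarrow> (real \<Rightarrow> real^'n \<Rightarrow> (real^'n) measure \<Rightarrow> real^'n)
    \<Rightarrow> real \<Rightarrow> real \<Rightarrow> (real^'n) measure \<Rightarrow> (real \<Rightarrow> real^'n \<Rightarrow> real^'n) \<Rightarrow> bool" where
  "is_flow f g \<gamma> t T' m X \<longleftrightarrow>
     (\<forall>s\<in>{t..T'}. X s \<in> borel_measurable borel \<and> pushfwd (X s) m \<in> P2 \<and>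
        ((\<lambda>r. Wass 2 (pushfwd (X r) m) (pushfwd (X s) m)) \<longlongrightarrow> 0) (at s within {t..T'})) \<and>
     (\<forall>x. \<forall>s\<in>{t..T'}.
        ((\<lambda>r. drift f g (X r x) (pushfwd (X r) m) (Z_of \<gamma> m X r x)) has_integral (X s x - x)) {t..s})"

definition decoupling_field :: "(real^'n \<Rightarrow> (real^'n) measure \<Rightarrow> real^'k \<Rightarrow> real^'n)
    \<Rightarrow> (real^'n \<Rightarrow> (real^'n) measure \<Rightarrow> real^'k \<Rightarrow> real)
    \<Rightarrow> (real^'n \<Rightarrow> (real^'n) measure \<Rightarrow> real^'n)
    \<Rightarrow> real \<Rightarrow> real \<Rightarrow> (real \<Rightarrow> real^'n \<Rightarrow> (real^'n) measure \<Rightarrow> real^'n) \<Rightarrow> bool" where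
  "decoupling_field f g p t0 T' \<gamma> \<longleftrightarrow>
     (\<forall>s\<in>{t0..T'}. \<forall>m\<in>P2. \<exists>X. is_flow f g \<gamma> s T' m X \<and>
        (\<forall>x. (\<forall>r\<in>{s..T'}. integrable m (Phi_nonlocal f g (X r) (Z_of \<gamma> m X r) m x)) \<and>
           ((\<lambda>r. Phi f g (X r) (Z_of \<gamma> m X r) m x) has_integral
              (\<gamma> s x m - p (X T' x) (pushfwd (X T') m))) {s..T'}))"

definition tri_norm :: "real \<Rightarrow> real \<Rightarrow> (real \<Rightarrow> 'x::euclidean_space \<Rightarrow> 'x measure \<Rightarrow> 'x) \<Rightarrow> ereal" where
  "tri_norm t0 T' \<gamma> =
     (SUP (s, x, \<mu>)\<in>{t0..T'} \<times> UNIV \<times> P2. ereal (norm (\<gamma> s x \<mu>) / (1 + norm x + mnorm 1 \<mu>)))"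

definition cont_diff_on :: "(real \<Rightarrow> 'x::real_normed_vector) \<Rightarrow> real set \<Rightarrow> bool" where
  "cont_diff_on F S \<longleftrightarrow>
     (\<exists>F'. continuous_on S F' \<and> (\<forall>s\<in>S. (F has_vector_derivative F' s) (at s within S)))"

end

theory Submission
  imports Defs
begin

text \<open>A function of measures with bounded derivatives is Lipschitz along couplings:
  \<open>|h \<mu> - h \<mu>'| \<le> l * cost \<pi>\<close> for every coupling \<open>\<pi>\<close> of \<open>\<mu>\<close> and \<open>\<mu>'\<close>, where \<open>cost \<pi> = \<integral> |x - y| d\<pi>\<close>. The
  second-order bounds of the coefficients decay like \<open>1 / (1 + |x| + \<parallel>\<mu>\<parallel>\<^sub>1)\<close>, which compensates the
  growth of \<open>z\<close> on the cone \<open>|z| \<le> 2 b (1 + |x| + \<parallel>\<mu>\<parallel>\<^sub>1)\<close>. On the cone the Hamiltonian is strongly convex in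
  the control, so the optimal control, and with it the right-hand side of the FBODE system, is
  Lipschitz there with a constant \<open>L\<close> depending only on the listed parameters. For horizons short
  compared with \<open>1 / L\<close> the Picard map preserves the cone and contracts, from any \<open>(t, m)\<close>, in the
  sup norm weighted by \<open>1 + |x| + \<parallel>m\<parallel>\<^sub>1\<close>; the decoupling field is \<open>\<gamma> t x m = Z\<^sub>t x\<close>. Stability of
  solutions under a coupling of the initial laws gives the Lipschitz continuity of \<open>\<gamma>\<close>, and the flow
  property is uniqueness. A second decoupling field with the same growth is compared with \<open>\<gamma>\<close>
  along its own flow, and the short horizon halves any bound on the difference.\<close>

text \<open>The obstacle is the form of the second-order hypotheses. In the measure variable this
  means moving a small mass from one point to another. \<open>M\<close> is only an L-derivative: the
  lift is differentiable at some unspecified random variable, which may already use all the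
  randomness of [0, 1], so a coupling can be carried over to it only approximately. A decaying bound
  is comparable with its value at the base point only within a fraction of the weight; farther away
  the first-order bounds suffice. Averages stay under pointwise control because the weight,
  integrated against m, is at most twice its value at any point. The horizon may not depend on the
  convexity constant of the running cost; the ratio \<Lambda>_f / \<lambda>_g inside
  \<open>L_alpha\<close> takes its place.\<close>

lemma borel_measurable_eq_borel:
  "sets a = sets borel \<Longrightarrow> F \<in> borel_measurable a \<longleftrightarrow> F \<in> borel_measurable borel"
  using measurable_cong_sets[of a borel] by auto

section \<open>Square-integrable laws and random variables\<close>

lemma P2D:
  assumes "\<mu> \<in> P2"
  shows "prob_space \<mu>" "sets \<mu> = sets borel" "space \<mu> = UNIV" "integrable \<mu> (\<lambda>x. (norm x)\<^sup>2)"
    "integrable \<mu> norm" "integrable \<mu> (\<lambda>x. x)"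
proof -
  show 1: "prob_space \<mu>" and 2[measurable_cong]: "sets \<mu> = sets borel" and 3: "integrable \<mu> (\<lambda>x. (norm x)\<^sup>2)"
    using assms by (auto simp: P2_def)
  show "space \<mu> = UNIV" using sets_eq_imp_space_eq[OF 2] by simp
  interpret prob_space \<mu> by fact
  show 4: "integrable \<mu> norm"
  proof (rule Bochner_Integration.integrable_bound)
    show "integrable \<mu> (\<lambda>x. 1 + (norm x)\<^sup>2)" using 3 by simp
    show "AE x in \<mu>. norm (norm x) \<le> norm (1 + (norm x)\<^sup>2)"
    proof (intro AE_I2)
      fix x :: 'a
      have "0 \<le> (norm x - 1)\<^sup>2 + (norm x)\<^sup>2 + 1" by simp
      then have "2 * norm x \<le> 2 * (1 + (norm x)\<^sup>2)" by (simp add: power2_eq_square algebra_simps)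
      then show "norm (norm x) \<le> norm (1 + (norm x)\<^sup>2)" by simp
    qed
  qed simp
  then show "integrable \<mu> (\<lambda>x. x)"
    by (rule Bochner_Integration.integrable_bound) auto
qed

lemma P2I:
  assumes "prob_space \<mu>" "sets \<mu> = sets borel" "integrable \<mu> (\<lambda>x. (norm x)\<^sup>2)"
  shows "\<mu> \<in> P2"
  using assms by (auto simp: P2_def)

lemma mnorm_1:
  assumes "\<mu> \<in> P2"
  shows "mnorm 1 \<mu> = (\<integral>x. norm x \<partial>\<mu>)"
  by (simp add: mnorm_def)

lemma mnorm_1_nonneg [simp]: "0 \<le> mnorm 1 \<mu>"
  by (simp add: mnorm_def)

text \<open>Jensen's inequality for the square, read off from the nonnegativity of the
  variance.\<close>

lemma (in prob_space) integral_le_sqrt: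
  fixes Y :: "'a \<Rightarrow> real"
  assumes "Y \<in> borel_measurable M" "integrable M (\<lambda>x. (Y x)\<^sup>2)"
  shows "integrable M Y" "(\<integral>x. Y x \<partial>M) \<le> sqrt (\<integral>x. (Y x)\<^sup>2 \<partial>M)"
proof -
  show 1: "integrable M Y" using assms by (rule square_integrable_imp_integrable)
  have "0 \<le> variance Y" by (rule variance_positive)
  also have "variance Y = (\<integral>x. (Y x)\<^sup>2 \<partial>M) - (\<integral>x. Y x \<partial>M)\<^sup>2"
    using 1 assms(2) by (rule variance_eq)
  finally have "(\<integral>x. Y x \<partial>M)\<^sup>2 \<le> (\<integral>x. (Y x)\<^sup>2 \<partial>M)" by simp
  then show "(\<integral>x. Y x \<partial>M) \<le> sqrt (\<integral>x. (Y x)\<^sup>2 \<partial>M)"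
    by (rule real_le_rsqrt)
qed

text \<open>The base space is left free: random variables live on \<open>Om\<close> for
  L-derivatives, on a coupling when two laws are compared, and on m itself for the flow.\<close>

definition sqi :: "'w measure \<Rightarrow> ('w \<Rightarrow> 'x::euclidean_space) \<Rightarrow> bool" where
  "sqi M X \<longleftrightarrow> X \<in> borel_measurable M \<and> integrable M (\<lambda>w. (norm (X w))\<^sup>2)"

lemma sqi_distr_P2:
  assumes "prob_space M" "sqi M X"
  shows "distr M borel X \<in> P2"
proof (rule P2I)
  have X: "X \<in> borel_measurable M" "integrable M (\<lambda>w. (norm (X w))\<^sup>2)" using assms by (auto simp: sqi_def)
  show "prob_space (distr M borel X)" using assms(1) X by (simp add: prob_space.prob_space_distr)
  show "integrable (distr M borel X) (\<lambda>x. (norm x)\<^sup>2)"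
    using X by (subst integrable_distr_eq) auto
qed simp

lemma sqi_iff_P2:
  assumes "prob_space M" "X \<in> borel_measurable M"
  shows "sqi M X \<longleftrightarrow> distr M borel X \<in> P2"
  using assms sqi_distr_P2[of M X] P2D(4)[of "distr M borel X"]
  by (auto simp: sqi_def integrable_distr_eq)

lemma sqi_bound:
  assumes "prob_space M" "sqi M X" "Y \<in> borel_measurable M" "\<And>w. norm (Y w) \<le> a + b * norm (X w)" "0 \<le> a" "0 \<le> b"
  shows "sqi M Y"
  unfolding sqi_def
proof
  interpret prob_space M by fact
  show "integrable M (\<lambda>w. (norm (Y w))\<^sup>2)"
  proof (rule Bochner_Integration.integrable_bound)
    show "integrable M (\<lambda>w. 2 * a\<^sup>2 + 2 * b\<^sup>2 * (norm (X w))\<^sup>2)" using assms(2) by (simp add: sqi_def)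
    show "AE w in M. norm ((norm (Y w))\<^sup>2) \<le> norm (2 * a\<^sup>2 + 2 * b\<^sup>2 * (norm (X w))\<^sup>2)"
    proof (intro AE_I2)
      fix w
      have "(norm (Y w))\<^sup>2 \<le> (a + b * norm (X w))\<^sup>2" using assms(4)[of w] by (intro power_mono) auto
      also have "\<dots> \<le> (a + b * norm (X w))\<^sup>2 + (a - b * norm (X w))\<^sup>2" by simp
      also have "\<dots> = 2 * a\<^sup>2 + 2 * b\<^sup>2 * (norm (X w))\<^sup>2" by (simp add: power2_eq_square algebra_simps)
      finally show "norm ((norm (Y w))\<^sup>2) \<le> norm (2 * a\<^sup>2 + 2 * b\<^sup>2 * (norm (X w))\<^sup>2)" by simp
    qed
  qed (use assms(3) in simp)
qed fact

lemma sqi_integrable: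
  assumes "prob_space M" "sqi M X"
  shows "integrable M (\<lambda>w. norm (X w))"
proof (rule prob_space.integral_le_sqrt(1)[OF assms(1)])
  show "(\<lambda>w. norm (X w)) \<in> borel_measurable M" "integrable M (\<lambda>w. (norm (X w))\<^sup>2)"
    using assms(2) by (auto simp: sqi_def)
qed

lemma sqi_add:
  assumes "prob_space M" "sqi M X" "sqi M Y"
  shows "sqi M (\<lambda>w. X w + Y w)"
  unfolding sqi_def
proof
  have [measurable]: "X \<in> borel_measurable M" "Y \<in> borel_measurable M" using assms by (auto simp: sqi_def)
  show "(\<lambda>w. X w + Y w) \<in> borel_measurable M" by measurable
  show "integrable M (\<lambda>w. (norm (X w + Y w))\<^sup>2)"
  proof (rule Bochner_Integration.integrable_bound)
    show "integrable M (\<lambda>w. 2 * (norm (X w))\<^sup>2 + 2 * (norm (Y w))\<^sup>2)" using assms by (simp add: sqi_def)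
    show "AE w in M. norm ((norm (X w + Y w))\<^sup>2) \<le> norm (2 * (norm (X w))\<^sup>2 + 2 * (norm (Y w))\<^sup>2)"
    proof (intro AE_I2)
      fix w
      have "(norm (X w + Y w))\<^sup>2 \<le> (norm (X w) + norm (Y w))\<^sup>2"
        by (intro power_mono norm_triangle_ineq) auto
      also have "\<dots> \<le> (norm (X w) + norm (Y w))\<^sup>2 + (norm (X w) - norm (Y w))\<^sup>2" by simp
      also have "\<dots> = 2 * (norm (X w))\<^sup>2 + 2 * (norm (Y w))\<^sup>2" by (simp add: power2_eq_square algebra_simps)
      finally show "norm ((norm (X w + Y w))\<^sup>2) \<le> norm (2 * (norm (X w))\<^sup>2 + 2 * (norm (Y w))\<^sup>2)" by simp
    qed
  qed measurable
qed

lemma sqi_scale: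
  assumes "sqi M X" shows "sqi M (\<lambda>w. c *\<^sub>R X w)"
proof -
  have "(norm (c *\<^sub>R X w))\<^sup>2 = c\<^sup>2 * (norm (X w))\<^sup>2" for w by (simp add: power_mult_distrib)
  then show ?thesis using assms by (auto simp: sqi_def)
qed

lemma sqi_diff:
  assumes "prob_space M" "sqi M X" "sqi M Y"
  shows "sqi M (\<lambda>w. X w - Y w)"
  using sqi_add[OF assms(1,2) sqi_scale[OF assms(3), of "-1"]] by simp

subsection \<open>Couplings\<close>

text \<open>The cost of one given coupling, not an infimum. Estimates are stated for every coupling,
  so no optimal one has to exist; the infimum appears only when a small \<open>Wass 2\<close>
  distance has to yield a coupling of small cost.\<close>

definition cost :: "('x::euclidean_space \<times> 'x) measure \<Rightarrow> real" where
  "cost \<pi> = (\<integral>z. norm (fst z - snd z) \<partial>\<pi>)"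

lemma cost_nonneg [simp]: "0 \<le> cost \<pi>"
  by (simp add: cost_def)

lemma couplingD:
  assumes "\<pi> \<in> couplings \<mu> \<nu>" "\<mu> \<in> P2" "\<nu> \<in> P2"
  shows "prob_space \<pi>" "sets \<pi> = sets borel" "space \<pi> = UNIV" "distr \<pi> borel fst = \<mu>" "distr \<pi> borel snd = \<nu>"
    "fst \<in> borel_measurable \<pi>" "snd \<in> borel_measurable \<pi>" "sqi \<pi> fst" "sqi \<pi> snd"
    "integrable \<pi> (\<lambda>z. norm (fst z - snd z))" "integrable \<pi> (\<lambda>z. (norm (fst z - snd z))\<^sup>2)"
proof -
  show s[measurable_cong]: "sets \<pi> = sets borel" and d: "distr \<pi> borel fst = \<mu>" "distr \<pi> borel snd = \<nu>"
    using assms(1) by (auto simp: couplings_def)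
  show sp: "space \<pi> = UNIV" using sets_eq_imp_space_eq[OF s] by simp
  have f: "fst \<in> borel_measurable (borel :: ('a \<times> 'a) measure)" "snd \<in> borel_measurable (borel :: ('a \<times> 'a) measure)"
    by (auto intro!: borel_measurable_continuous_onI continuous_intros)
  then show m[measurable]: "fst \<in> borel_measurable \<pi>" "snd \<in> borel_measurable \<pi>"
    using measurable_cong_sets[OF s refl] by auto
  show ps: "prob_space \<pi>"
  proof
    \<comment> \<open>\<open>couplings\<close> does not ask for a probability measure; the mass is
      read off from the first marginal.\<close>
    have "1 = emeasure (distr \<pi> borel fst) UNIV"
      using prob_space.emeasure_space_1[OF P2D(1)[OF assms(2)]] P2D(3)[OF assms(2)] d by simp
    also have "\<dots> = emeasure \<pi> (space \<pi>)" by (subst emeasure_distr) auto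
    finally show "emeasure \<pi> (space \<pi>) = 1" by simp
  qed
  show q: "sqi \<pi> fst" "sqi \<pi> snd" using sqi_iff_P2[OF ps m(1)] sqi_iff_P2[OF ps m(2)] d assms(2,3) by simp_all
  have "sqi \<pi> (\<lambda>z. fst z - snd z)" using ps q by (rule sqi_diff)
  then show "integrable \<pi> (\<lambda>z. norm (fst z - snd z))" "integrable \<pi> (\<lambda>z. (norm (fst z - snd z))\<^sup>2)"
    using sqi_integrable[OF ps, of "\<lambda>z. fst z - snd z"] by (simp_all add: sqi_def)
qed

lemma measurable_Pair_borel:
  fixes X :: "'w \<Rightarrow> 'x::euclidean_space" and Y :: "'w \<Rightarrow> 'y::euclidean_space"
  assumes "X \<in> borel_measurable M" "Y \<in> borel_measurable M"
  shows "(\<lambda>w. (X w, Y w)) \<in> borel_measurable M"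
  using assms by (rule borel_measurable_Pair)

lemma measurable_fst_snd_borel [measurable]:
  "fst \<in> borel_measurable (borel :: ('x::euclidean_space \<times> 'y::euclidean_space) measure)"
  "snd \<in> borel_measurable (borel :: ('x::euclidean_space \<times> 'y::euclidean_space) measure)"
  by (auto intro!: borel_measurable_continuous_onI continuous_intros)

text \<open>For two processes on one space, the law term of a Lipschitz bound becomes the mean
  distance between the processes.\<close>

lemma coupling_distr:
  assumes "X \<in> borel_measurable M" "Y \<in> borel_measurable M"
  shows "distr M borel (\<lambda>w. (X w, Y w)) \<in> couplings (distr M borel X) (distr M borel Y)"
    "cost (distr M borel (\<lambda>w. (X w, Y w))) = (\<integral>w. norm (X w - Y w) \<partial>M)"
proof -
  have [measurable]: "(\<lambda>w. (X w, Y w)) \<in> borel_measurable M" using assms by (rule measurable_Pair_borel)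
  show "distr M borel (\<lambda>w. (X w, Y w)) \<in> couplings (distr M borel X) (distr M borel Y)"
    using assms by (auto simp: couplings_def distr_distr comp_def)
  show "cost (distr M borel (\<lambda>w. (X w, Y w))) = (\<integral>w. norm (X w - Y w) \<partial>M)"
    unfolding cost_def by (subst integral_distr) auto
qed

lemma mnorm_distr:
  assumes "prob_space M" "sqi M X"
  shows "mnorm 1 (distr M borel X) = (\<integral>w. norm (X w) \<partial>M)"
  using assms by (subst mnorm_1[OF sqi_distr_P2[OF assms]]) (subst integral_distr, auto simp: sqi_def)

lemma coupling_integral:
  fixes F :: "'x::euclidean_space \<Rightarrow> 'b::{banach, second_countable_topology}"
  assumes "\<pi> \<in> couplings \<mu> \<nu>" "\<mu> \<in> P2" "\<nu> \<in> P2" "F \<in> borel_measurable borel"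
  shows "(\<integral>x. F x \<partial>\<mu>) = (\<integral>z. F (fst z) \<partial>\<pi>)" "(\<integral>x. F x \<partial>\<nu>) = (\<integral>z. F (snd z) \<partial>\<pi>)"
    "integrable \<mu> F \<longleftrightarrow> integrable \<pi> (\<lambda>z. F (fst z))" "integrable \<nu> F \<longleftrightarrow> integrable \<pi> (\<lambda>z. F (snd z))"
  using couplingD[OF assms(1-3)] assms(4)
    integral_distr[of fst \<pi> borel F] integral_distr[of snd \<pi> borel F]
    integrable_distr_eq[of fst \<pi> borel F] integrable_distr_eq[of snd \<pi> borel F] by auto

lemma sint_coupling:
  fixes F :: "'x::euclidean_space \<Rightarrow> 'b::{banach, second_countable_topology}"
  assumes "\<pi> \<in> couplings \<mu> \<nu>" "\<mu> \<in> P2" "\<nu> \<in> P2" "integrable \<mu> F" "integrable \<nu> F"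
  shows "sint F \<mu> \<nu> = (\<integral>z. (F (fst z) - F (snd z)) \<partial>\<pi>)"
proof -
  have F: "F \<in> borel_measurable borel"
    using borel_measurable_integrable[OF assms(4)] by (simp add: borel_measurable_eq_borel[OF P2D(2)[OF assms(2)]])
  note c = coupling_integral[OF assms(1-3) F]
  show ?thesis unfolding sint_def c using c assms(4,5) by simp
qed

text \<open>The easy half of Kantorovich duality, valid for any coupling.\<close>

lemma norm_sint_le:
  fixes F :: "'x::euclidean_space \<Rightarrow> 'b::{banach, second_countable_topology}"
  assumes "\<pi> \<in> couplings \<mu> \<nu>" "\<mu> \<in> P2" "\<nu> \<in> P2" "integrable \<mu> F" "integrable \<nu> F"
    and l: "\<And>x y. norm (F x - F y) \<le> l * norm (x - y)"
  shows "norm (sint F \<mu> \<nu>) \<le> l * cost \<pi>"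
proof -
  have "norm (sint F \<mu> \<nu>) \<le> (\<integral>z. norm (F (fst z) - F (snd z)) \<partial>\<pi>)"
    unfolding sint_coupling[OF assms(1-5)] by (rule integral_norm_bound)
  also have "\<dots> \<le> (\<integral>z. l * norm (fst z - snd z) \<partial>\<pi>)"
    by (rule integral_mono') (use couplingD(10)[OF assms(1-3)] l order_trans[OF norm_ge_zero l] in auto)
  also have "\<dots> = l * cost \<pi>" by (simp add: cost_def)
  finally show ?thesis .
qed

lemma mnorm_diff_le_cost:
  assumes "\<pi> \<in> couplings \<mu> \<nu>" "\<mu> \<in> P2" "\<nu> \<in> P2"
  shows "\<bar>mnorm 1 \<mu> - mnorm 1 \<nu>\<bar> \<le> cost \<pi>"
proof -
  have "norm (sint norm \<mu> \<nu>) \<le> 1 * cost \<pi>"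
    by (rule norm_sint_le[OF assms]) (use P2D(5) assms in \<open>auto simp: norm_triangle_ineq3\<close>)
  then show ?thesis using assms by (simp add: sint_def mnorm_1)
qed

lemma borel_prod_measure:
  fixes \<mu> :: "'x::euclidean_space measure" and \<nu> :: "'y::euclidean_space measure"
  assumes "sets \<mu> = sets borel" "sets \<nu> = sets borel"
  shows "sets (\<mu> \<Otimes>\<^sub>M \<nu>) = sets borel"
  using assms by (simp add: borel_prod[symmetric] cong: sets_pair_measure_cong)

text \<open>Supplies a coupling for any pair of laws, which makes the infimum in
  \<open>Wass 2\<close> finite. With \<open>dirac0\<close> as second law it also turns Lipschitz
  bounds into growth bounds.\<close>

lemma product_coupling:
  assumes "\<mu> \<in> P2" "\<nu> \<in> P2"
  shows "\<mu> \<Otimes>\<^sub>M \<nu> \<in> couplings \<mu> \<nu>"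
proof -
  interpret a: prob_space \<mu> using assms P2D by auto
  interpret b: prob_space \<nu> using assms P2D by auto
  interpret p: pair_prob_space \<mu> \<nu> ..
  have s: "sets (\<mu> \<Otimes>\<^sub>M \<nu>) = sets borel" using assms P2D by (intro borel_prod_measure) auto
  have "distr (\<mu> \<Otimes>\<^sub>M \<nu>) borel fst = distr (\<mu> \<Otimes>\<^sub>M \<nu>) \<mu> fst"
    "distr (\<mu> \<Otimes>\<^sub>M \<nu>) borel snd = distr (\<mu> \<Otimes>\<^sub>M \<nu>) \<nu> snd"
    using P2D(2) assms by (auto intro!: distr_cong)
  moreover have "distr (\<mu> \<Otimes>\<^sub>M \<nu>) \<mu> fst = \<mu>" by (rule b.distr_pair_fst)
  moreover have "distr (\<mu> \<Otimes>\<^sub>M \<nu>) \<nu> snd = \<nu>"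
  proof (rule measure_eqI)
    fix A assume A: "A \<in> sets (distr (\<mu> \<Otimes>\<^sub>M \<nu>) \<nu> snd)"
    then have "emeasure (distr (\<mu> \<Otimes>\<^sub>M \<nu>) \<nu> snd) A = emeasure (\<mu> \<Otimes>\<^sub>M \<nu>) (space \<mu> \<times> A)"
      using sets.sets_into_space[of A \<nu>]
      by (auto simp: emeasure_distr space_pair_measure intro!: arg_cong[where f="emeasure _"])
    also have "\<dots> = emeasure \<nu> A" using A by (simp add: b.emeasure_pair_measure_Times a.emeasure_space_1)
    finally show "emeasure (distr (\<mu> \<Otimes>\<^sub>M \<nu>) \<nu> snd) A = emeasure \<nu> A" .
  qed simp
  ultimately show ?thesis using s by (simp add: couplings_def)
qed

lemma Wass2_le:
  assumes "\<pi> \<in> couplings \<mu> \<nu>" "\<mu> \<in> P2" "\<nu> \<in> P2"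
  shows "Wass 2 \<mu> \<nu> \<le> sqrt (\<integral>z. (norm (fst z - snd z))\<^sup>2 \<partial>\<pi>)"
proof -
  let ?I = "INF \<pi>\<in>couplings \<mu> \<nu>. \<integral>\<^sup>+z. ennreal (norm (fst z - snd z) powr 2) \<partial>\<pi>"
  have "?I \<le> (\<integral>\<^sup>+z. ennreal (norm (fst z - snd z) powr 2) \<partial>\<pi>)"
    using assms(1) by (rule INF_lower)
  also have "\<dots> = ennreal (\<integral>z. (norm (fst z - snd z))\<^sup>2 \<partial>\<pi>)"
    using couplingD(11)[OF assms] by (subst nn_integral_eq_integral[symmetric]) auto
  finally have "enn2real ?I \<le> (\<integral>z. (norm (fst z - snd z))\<^sup>2 \<partial>\<pi>)"
    by (intro enn2real_leI integral_nonneg_AE AE_I2) auto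
  then show ?thesis
    by (simp add: Wass_def powr_half_sqrt)
qed

lemma Wass2_less_coupling:
  assumes "\<mu> \<in> P2" "\<nu> \<in> P2" "Wass 2 \<mu> \<nu> < d"
  obtains \<pi> where "\<pi> \<in> couplings \<mu> \<nu>" "cost \<pi> < d"
proof -
  let ?c = "\<lambda>\<pi>. \<integral>\<^sup>+z. ennreal (norm (fst z - snd z) powr 2) \<partial>\<pi>"
  let ?I = "INF \<pi>\<in>couplings \<mu> \<nu>. ?c \<pi>"
  have eq: "?c \<pi> = ennreal (\<integral>z. (norm (fst z - snd z))\<^sup>2 \<partial>\<pi>)" if "\<pi> \<in> couplings \<mu> \<nu>" for \<pi>
    using couplingD(11)[OF that assms(1,2)] by (subst nn_integral_eq_integral[symmetric]) auto
  \<comment> \<open>Finiteness matters: \<open>enn2real\<close> sends an infinite infimum to 0, and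
    then no coupling of small cost could be extracted.\<close>
  have "?I \<le> ?c (\<mu> \<Otimes>\<^sub>M \<nu>)" by (intro INF_lower product_coupling assms)
  then have fin: "?I < \<infinity>" unfolding eq[OF product_coupling[OF assms(1,2)]]
    by (rule le_less_trans) simp
  have w0: "0 \<le> Wass 2 \<mu> \<nu>" by (simp add: Wass_def)
  have d: "0 < d" using assms(3) w0 by simp
  have sqrt_less_power2: "sqrt x < d \<longleftrightarrow> x < d\<^sup>2" for x
    using d real_sqrt_less_iff[of x "d\<^sup>2"] by simp
  have "sqrt (enn2real ?I) < d" using assms(3) by (simp add: Wass_def powr_half_sqrt)
  then have "enn2real ?I < d\<^sup>2" using d by (simp add: sqrt_less_power2)
  then have "ennreal (enn2real ?I) < ennreal (d\<^sup>2)" by (intro ennreal_lessI) (use d in auto)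
  then have "?I < ennreal (d\<^sup>2)" using ennreal_enn2real[of ?I] fin unfolding infinity_ennreal_def by simp
  then obtain \<pi> where p: "\<pi> \<in> couplings \<mu> \<nu>" "?c \<pi> < ennreal (d\<^sup>2)"
    by (auto simp: INF_less_iff)
  from p have "(\<integral>z. (norm (fst z - snd z))\<^sup>2 \<partial>\<pi>) < d\<^sup>2"
    using eq[OF p(1)] by (simp add: ennreal_less_iff)
  then have "sqrt (\<integral>z. (norm (fst z - snd z))\<^sup>2 \<partial>\<pi>) < d"
    by (simp add: sqrt_less_power2)
  moreover have "cost \<pi> \<le> sqrt (\<integral>z. (norm (fst z - snd z))\<^sup>2 \<partial>\<pi>)"
    unfolding cost_def
  proof (rule prob_space.integral_le_sqrt(2)[OF couplingD(1)[OF p(1) assms(1,2)]])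
    show "(\<lambda>z. norm (fst z - snd z)) \<in> borel_measurable \<pi>"
      using couplingD(10)[OF p(1) assms(1,2)] by (rule borel_measurable_integrable)
  qed (rule couplingD(11)[OF p(1) assms(1,2)])
  ultimately have "cost \<pi> < d" by linarith
  then show ?thesis using p(1) that by blast
qed

subsection \<open>Mixtures\<close>

text \<open>A mixture is a draw from a or b decided by a coin. This shows that the set function in
  \<open>mix\<close> is a measure, and brings in the integral calculus of
  \<open>bind\<close>.\<close>

lemma mix_eq_bind:
  fixes a b :: "'x::euclidean_space measure"
  assumes "prob_space a" "prob_space b" "sets a = sets borel" "sets b = sets borel" "0 \<le> \<theta>" "\<theta> \<le> 1"
  shows "mix \<theta> a b = measure_pmf (bernoulli_pmf \<theta>) \<bind> (\<lambda>c. if c then a else b)" (is "_ = ?B")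
    and "(\<lambda>c. if c then a else b) \<in> measure_pmf (bernoulli_pmf \<theta>) \<rightarrow>\<^sub>M subprob_algebra borel"
proof -
  show M: "(\<lambda>c. if c then a else b) \<in> measure_pmf (bernoulli_pmf \<theta>) \<rightarrow>\<^sub>M subprob_algebra borel"
    using assms by (auto simp: measurable_def space_subprob_algebra prob_space_imp_subprob_space)
  have s: "sets ?B = sets borel" using assms by (intro sets_bind) auto
  have e: "emeasure ?B A = ennreal \<theta> * emeasure a A + ennreal (1 - \<theta>) * emeasure b A" if "A \<in> sets borel" for A
    using assms that by (subst emeasure_bind[OF _ M]) (auto simp: mult.commute)
  have "mix \<theta> a b = measure_of UNIV (sets borel) (emeasure ?B)"
    unfolding mix_def using sets.sigma_sets_eq[of "borel :: 'x measure"] e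
    by (intro measure_of_eq) auto
  also have "\<dots> = ?B"
    using measure_of_of_measure[of ?B] s sets_eq_imp_space_eq[OF s] by simp
  finally show "mix \<theta> a b = ?B" .
qed

lemma sets_mix [simp]: "sets (mix \<theta> a b) = sets borel"
  using sets.sigma_sets_eq[of "borel :: 'a measure"] by (simp add: mix_def)

lemma space_mix [simp]: "space (mix \<theta> a b) = UNIV"
  using sets_eq_imp_space_eq[OF sets_mix, of \<theta> a b] by simp

context
  fixes a b :: "'x::euclidean_space measure" and \<theta> :: real
  assumes ab: "prob_space a" "prob_space b" "sets a = sets borel" "sets b = sets borel" and \<theta>: "0 \<le> \<theta>" "\<theta> \<le> 1"
begin

lemma nn_integral_mix:
  assumes "F \<in> borel_measurable borel"
  shows "(\<integral>\<^sup>+x. F x \<partial>mix \<theta> a b) = ennreal \<theta> * (\<integral>\<^sup>+x. F x \<partial>a) + ennreal (1 - \<theta>) * (\<integral>\<^sup>+x. F x \<partial>b)"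
  unfolding mix_eq_bind(1)[OF ab \<theta>]
  by (subst nn_integral_bind[OF assms mix_eq_bind(2)[OF ab \<theta>]]) (use \<theta> in \<open>auto simp: mult.commute\<close>)

lemma emeasure_mix:
  assumes "A \<in> sets borel"
  shows "emeasure (mix \<theta> a b) A = ennreal \<theta> * emeasure a A + ennreal (1 - \<theta>) * emeasure b A"
  using nn_integral_mix[of "indicator A"] assms ab by (simp add: nn_integral_indicator)

lemma prob_space_mix: "prob_space (mix \<theta> a b)"
proof
  have "space a = UNIV" "space b = UNIV" using ab sets_eq_imp_space_eq[of a borel] sets_eq_imp_space_eq[of b borel] by auto
  then have "emeasure a UNIV = 1" "emeasure b UNIV = 1"
    using ab(1,2)[THEN prob_space.emeasure_space_1] by auto
  then show "emeasure (mix \<theta> a b) (space (mix \<theta> a b)) = 1"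
    using \<theta> by (simp add: emeasure_mix flip: ennreal_plus)
qed

lemma integrable_mix:
  fixes F :: "'x \<Rightarrow> 'b::{banach, second_countable_topology}"
  assumes "integrable a F" "integrable b F"
  shows "integrable (mix \<theta> a b) F"
proof (rule integrableI_bounded)
  have F: "F \<in> borel_measurable borel"
    using borel_measurable_integrable[OF assms(1)] by (simp add: borel_measurable_eq_borel[OF ab(3)])
  then show "F \<in> borel_measurable (mix \<theta> a b)" by (simp add: borel_measurable_eq_borel[OF sets_mix])
  show "(\<integral>\<^sup>+ x. ennreal (norm (F x)) \<partial>mix \<theta> a b) < \<infinity>"
    using assms F by (subst nn_integral_mix) (auto simp: integrable_iff_bounded ennreal_mult_less_top)
qed

lemma integral_mix_real:
  fixes F :: "'x \<Rightarrow> real"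
  assumes "integrable a F" "integrable b F"
  shows "(\<integral>x. F x \<partial>mix \<theta> a b) = \<theta> * (\<integral>x. F x \<partial>a) + (1 - \<theta>) * (\<integral>x. F x \<partial>b)"
proof -
  have F[measurable]: "F \<in> borel_measurable borel"
    using borel_measurable_integrable[OF assms(1)] by (simp add: borel_measurable_eq_borel[OF ab(3)])
  have *: "enn2real (ennreal \<theta> * u + ennreal (1 - \<theta>) * v) = \<theta> * enn2real u + (1 - \<theta>) * enn2real v"
    if "u < \<infinity>" "v < \<infinity>" for u v
    using that \<theta> by (subst enn2real_plus) (auto simp: ennreal_mult_less_top enn2real_mult)
  have fin: "(\<integral>\<^sup>+ x. ennreal (F x) \<partial>c) < \<infinity>" "(\<integral>\<^sup>+ x. ennreal (- F x) \<partial>c) < \<infinity>" if "integrable c F" for c :: "'x measure"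
    using that by (auto simp: real_integrable_def less_top)
  show ?thesis
    unfolding real_lebesgue_integral_def[OF integrable_mix[OF assms]] real_lebesgue_integral_def[OF assms(1)]
      real_lebesgue_integral_def[OF assms(2)]
    using fin[OF assms(1)] fin[OF assms(2)]
    by (simp add: nn_integral_mix * algebra_simps)
qed

lemma integral_mix:
  fixes F :: "'x \<Rightarrow> 'b::euclidean_space"
  assumes "integrable a F" "integrable b F"
  shows "(\<integral>x. F x \<partial>mix \<theta> a b) = \<theta> *\<^sub>R (\<integral>x. F x \<partial>a) + (1 - \<theta>) *\<^sub>R (\<integral>x. F x \<partial>b)"
proof (rule euclidean_eqI)
  fix e :: 'b assume "e \<in> Basis"
  have "(\<integral>x. F x \<partial>mix \<theta> a b) \<bullet> e = (\<integral>x. F x \<bullet> e \<partial>mix \<theta> a b)"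
    by (rule integral_inner_left[symmetric]) (intro integrable_mix assms)
  also have "\<dots> = \<theta> * (\<integral>x. F x \<bullet> e \<partial>a) + (1 - \<theta>) * (\<integral>x. F x \<bullet> e \<partial>b)"
    by (rule integral_mix_real) (auto intro: assms)
  finally show "(\<integral>x. F x \<partial>mix \<theta> a b) \<bullet> e = (\<theta> *\<^sub>R (\<integral>x. F x \<partial>a) + (1 - \<theta>) *\<^sub>R (\<integral>x. F x \<partial>b)) \<bullet> e"
    using assms by (simp add: inner_add_left)
qed

end

lemma mix_P2:
  assumes "a \<in> P2" "b \<in> P2" "0 \<le> \<theta>" "\<theta> \<le> 1"
  shows "mix \<theta> a b \<in> P2" "mnorm 1 (mix \<theta> a b) = \<theta> * mnorm 1 a + (1 - \<theta>) * mnorm 1 b"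
proof -
  note p = P2D(1)[OF assms(1)] P2D(1)[OF assms(2)] P2D(2)[OF assms(1)] P2D(2)[OF assms(2)] assms(3,4)
  show *: "mix \<theta> a b \<in> P2"
    by (rule P2I[OF prob_space_mix[OF p] sets_mix integrable_mix[OF p P2D(4)[OF assms(1)] P2D(4)[OF assms(2)]]])
  show "mnorm 1 (mix \<theta> a b) = \<theta> * mnorm 1 a + (1 - \<theta>) * mnorm 1 b"
    unfolding mnorm_1[OF *] mnorm_1[OF assms(1)] mnorm_1[OF assms(2)] by (rule integral_mix_real[OF p P2D(5)[OF assms(1)] P2D(5)[OF assms(2)]])
qed

lemma mix_self:
  assumes "a \<in> P2" "0 \<le> \<theta>" "\<theta> \<le> 1"
  shows "mix \<theta> a a = a"
proof (rule measure_eqI)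
  fix A assume "A \<in> sets (mix \<theta> a a)"
  then have "emeasure (mix \<theta> a a) A = ennreal \<theta> * emeasure a A + ennreal (1 - \<theta>) * emeasure a A"
    using assms P2D by (intro emeasure_mix) auto
  also have "\<dots> = (ennreal \<theta> + ennreal (1 - \<theta>)) * emeasure a A" by (simp add: distrib_right)
  also have "\<dots> = emeasure a A" using assms by (simp flip: ennreal_plus)
  finally show "emeasure (mix \<theta> a a) A = emeasure a A" .
qed (simp add: P2D(2)[OF assms(1)])

lemma return_P2: "return borel (u::'x::euclidean_space) \<in> P2"
  by (rule P2I) (auto intro!: prob_space_return simp: integrable_iff_bounded nn_integral_return)

lemma mnorm_return: "mnorm 1 (return borel (u::'x::euclidean_space)) = norm u"
  by (subst mnorm_1[OF return_P2]) (subst integral_return, auto)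

lemma return_coupling:
  "return borel (u, v) \<in> couplings (return borel u) (return borel (v::'x::euclidean_space))"
  "cost (return borel (u, v)) = norm (u - v)"
proof -
  show "return borel (u, v) \<in> couplings (return borel u) (return borel v)"
    by (auto simp: couplings_def distr_return)
  show "cost (return borel (u, v)) = norm (u - v)"
    unfolding cost_def by (subst integral_return) auto
qed

lemma diag_coupling:
  assumes "\<mu> \<in> P2"
  shows "distr \<mu> borel (\<lambda>x. (x, x)) \<in> couplings \<mu> \<mu>" "cost (distr \<mu> borel (\<lambda>x. (x, x))) = 0"
proof -
  have [measurable]: "(\<lambda>x. x) \<in> borel_measurable \<mu>" by (simp add: borel_measurable_eq_borel[OF P2D(2)[OF assms]])
  have "distr \<mu> borel (\<lambda>x. x) = \<mu>" using distr_id2[OF P2D(2)[OF assms, symmetric]] by (simp add: id_def)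
  then show "distr \<mu> borel (\<lambda>x. (x, x)) \<in> couplings \<mu> \<mu>" "cost (distr \<mu> borel (\<lambda>x. (x, x))) = 0"
    using coupling_distr[of "\<lambda>x. x" \<mu> "\<lambda>x. x"] by auto
qed

lemma distr_mix:
  assumes "prob_space a" "prob_space b" "sets a = sets borel" "sets b = sets borel" "0 \<le> \<theta>" "\<theta> \<le> 1"
    and [measurable]: "\<phi> \<in> borel_measurable borel"
  shows "distr (mix \<theta> a b) borel \<phi> = mix \<theta> (distr a borel \<phi>) (distr b borel \<phi>)"
proof (rule measure_eqI)
  have m[measurable]: "\<phi> \<in> borel_measurable a" "\<phi> \<in> borel_measurable b" "\<phi> \<in> borel_measurable (mix \<theta> a b)"
    using assms(3,4,7) by (simp_all add: borel_measurable_eq_borel[OF assms(3)] borel_measurable_eq_borel[OF assms(4)]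
        borel_measurable_eq_borel[OF sets_mix])
  have sp: "space a = UNIV" "space b = UNIV"
    using sets_eq_imp_space_eq[OF assms(3)] sets_eq_imp_space_eq[OF assms(4)] by auto
  fix A assume "A \<in> sets (distr (mix \<theta> a b) borel \<phi>)"
  then have A[measurable]: "A \<in> sets borel" by simp
  have "\<phi> -` A \<in> sets borel" using measurable_sets[OF assms(7) A] by simp
  then show "emeasure (distr (mix \<theta> a b) borel \<phi>) A = emeasure (mix \<theta> (distr a borel \<phi>) (distr b borel \<phi>)) A"
    using assms(1-6) m A sp prob_space.prob_space_distr[OF assms(1) m(1)] prob_space.prob_space_distr[OF assms(2) m(2)]
    by (subst emeasure_mix) (auto simp: emeasure_distr emeasure_mix)
qed simp

text \<open>Mixing couplings couples the mixtures. When the second coupling is diagonal, only the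
  mass \<theta> moves, and the cost scales with \<theta>.\<close>

lemma mix_coupling:
  assumes "\<pi> \<in> couplings a b" "\<pi>' \<in> couplings a' b'" "a \<in> P2" "b \<in> P2" "a' \<in> P2" "b' \<in> P2" "0 \<le> \<theta>" "\<theta> \<le> 1"
  shows "mix \<theta> \<pi> \<pi>' \<in> couplings (mix \<theta> a a') (mix \<theta> b b')"
    "cost (mix \<theta> \<pi> \<pi>') = \<theta> * cost \<pi> + (1 - \<theta>) * cost \<pi>'"
    "(\<integral>z. (norm (fst z - snd z))\<^sup>2 \<partial>mix \<theta> \<pi> \<pi>') =
       \<theta> * (\<integral>z. (norm (fst z - snd z))\<^sup>2 \<partial>\<pi>) + (1 - \<theta>) * (\<integral>z. (norm (fst z - snd z))\<^sup>2 \<partial>\<pi>')"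
proof -
  note 1 = couplingD[OF assms(1,3,4)] and 2 = couplingD[OF assms(2,5,6)]
  note p = 1(1) 2(1) 1(2) 2(2) assms(7,8)
  show "mix \<theta> \<pi> \<pi>' \<in> couplings (mix \<theta> a a') (mix \<theta> b b')"
    using distr_mix[OF p, of fst] distr_mix[OF p, of snd] 1 2 by (simp add: couplings_def)
  show "cost (mix \<theta> \<pi> \<pi>') = \<theta> * cost \<pi> + (1 - \<theta>) * cost \<pi>'"
    unfolding cost_def by (rule integral_mix_real[OF p]) (use 1 2 in auto)
  show "(\<integral>z. (norm (fst z - snd z))\<^sup>2 \<partial>mix \<theta> \<pi> \<pi>') =
       \<theta> * (\<integral>z. (norm (fst z - snd z))\<^sup>2 \<partial>\<pi>) + (1 - \<theta>) * (\<integral>z. (norm (fst z - snd z))\<^sup>2 \<partial>\<pi>')"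
    by (rule integral_mix_real[OF p]) (use 1 2 in auto)
qed

subsection \<open>Displacement interpolation\<close>

text \<open>Mass travels along straight lines. Unlike along \<open>mix\<close>, the squared cost of
  a step is quadratic in its length, which is what differentiability of the lift in the mean square
  requires.\<close>

definition disp :: "('x::euclidean_space \<times> 'x) measure \<Rightarrow> real \<Rightarrow> 'x measure" where
  "disp \<pi> \<theta> = distr \<pi> borel (\<lambda>z. (1 - \<theta>) *\<^sub>R fst z + \<theta> *\<^sub>R snd z)"

context
  fixes \<pi> :: "('x::euclidean_space \<times> 'x) measure" and \<mu> \<nu>
  assumes \<pi>: "\<pi> \<in> couplings \<mu> \<nu>" "\<mu> \<in> P2" "\<nu> \<in> P2"
begin

lemma disp_sqi: "sqi \<pi> (\<lambda>z. (1 - \<theta>) *\<^sub>R fst z + \<theta> *\<^sub>R snd z)"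
  using couplingD[OF \<pi>] by (intro sqi_add sqi_scale) auto

lemma disp_P2: "disp \<pi> \<theta> \<in> P2"
  unfolding disp_def using couplingD(1)[OF \<pi>] disp_sqi by (rule sqi_distr_P2)

lemma disp_0: "disp \<pi> 0 = \<mu>" and disp_1: "disp \<pi> 1 = \<nu>"
  using couplingD[OF \<pi>] by (auto simp: disp_def)

lemma disp_coupling:
  obtains \<rho> where "\<rho> \<in> couplings (disp \<pi> \<theta>) (disp \<pi> \<theta>')" "cost \<rho> = \<bar>\<theta> - \<theta>'\<bar> * cost \<pi>"
    "(\<integral>z. (norm (fst z - snd z))\<^sup>2 \<partial>\<rho>) = (\<theta> - \<theta>')\<^sup>2 * (\<integral>z. (norm (fst z - snd z))\<^sup>2 \<partial>\<pi>)"
proof -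
  let ?Z = "\<lambda>\<theta> (z::'x\<times>'x). (1 - \<theta>) *\<^sub>R fst z + \<theta> *\<^sub>R snd z"
  let ?\<rho> = "distr \<pi> borel (\<lambda>z. (?Z \<theta> z, ?Z \<theta>' z))"
  have m[measurable]: "?Z \<theta> \<in> borel_measurable \<pi>" for \<theta> using disp_sqi[of \<theta>] by (simp add: sqi_def)
  have d: "norm (?Z \<theta> z - ?Z \<theta>' z) = \<bar>\<theta> - \<theta>'\<bar> * norm (fst z - snd z)" for z
  proof -
    have "?Z \<theta> z - ?Z \<theta>' z = (\<theta>' - \<theta>) *\<^sub>R (fst z - snd z)" by (simp add: algebra_simps)
    then show ?thesis by (simp add: abs_minus_commute)
  qed
  have mp[measurable]: "(\<lambda>z. (?Z \<theta> z, ?Z \<theta>' z)) \<in> borel_measurable \<pi>" by (rule measurable_Pair_borel) auto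
  show thesis
  proof
    show "?\<rho> \<in> couplings (disp \<pi> \<theta>) (disp \<pi> \<theta>')" unfolding disp_def by (rule coupling_distr) auto
    have "cost ?\<rho> = (\<integral>z. norm (?Z \<theta> z - ?Z \<theta>' z) \<partial>\<pi>)" by (rule coupling_distr) auto
    then show "cost ?\<rho> = \<bar>\<theta> - \<theta>'\<bar> * cost \<pi>" by (simp only: d) (simp add: cost_def)
    have "(\<integral>z. (norm (fst z - snd z))\<^sup>2 \<partial>?\<rho>) = (\<integral>z. (norm (?Z \<theta> z - ?Z \<theta>' z))\<^sup>2 \<partial>\<pi>)"
      by (subst integral_distr) auto
    then show "(\<integral>z. (norm (fst z - snd z))\<^sup>2 \<partial>?\<rho>) = (\<theta> - \<theta>')\<^sup>2 * (\<integral>z. (norm (fst z - snd z))\<^sup>2 \<partial>\<pi>)"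
      by (simp only: d) (simp add: power_mult_distrib)
  qed
qed

lemma mnorm_disp:
  assumes "0 \<le> \<theta>" "\<theta> \<le> 1"
  shows "\<bar>mnorm 1 (disp \<pi> \<theta>) - mnorm 1 \<mu>\<bar> \<le> cost \<pi>"
proof -
  obtain \<rho> where "\<rho> \<in> couplings (disp \<pi> \<theta>) (disp \<pi> 0)" "cost \<rho> = \<bar>\<theta> - 0\<bar> * cost \<pi>" by (rule disp_coupling)
  then have "\<bar>mnorm 1 (disp \<pi> \<theta>) - mnorm 1 \<mu>\<bar> \<le> \<theta> * cost \<pi>"
    using mnorm_diff_le_cost[of \<rho> "disp \<pi> \<theta>" \<mu>] disp_P2 disp_0 \<pi> assms by simp
  also have "\<dots> \<le> 1 * cost \<pi>" using assms by (intro mult_right_mono) auto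
  finally show ?thesis by simp
qed

end

lemma has_integral_norm_le:
  fixes f :: "real \<Rightarrow> 'b::euclidean_space"
  assumes "(f has_integral i) {a..b}" "a \<le> b" "0 \<le> B" "\<And>x. a \<le> x \<Longrightarrow> x \<le> b \<Longrightarrow> norm (f x) \<le> B"
  shows "norm i \<le> B * (b - a)"
  using has_integral_bound_real[OF assms(3) finite.emptyI assms(1)] assms by auto

subsection \<open>Lipschitz bounds and derivatives\<close>

lemma fderiv_works:
  assumes "F differentiable at x"
  shows "(F has_derivative blinfun_apply (fderiv F x)) (at x)"
proof -
  have 1: "(F has_derivative frechet_derivative F (at x)) (at x)"
    using assms by (simp add: frechet_derivative_works)
  then have "bounded_linear (frechet_derivative F (at x))" by (rule has_derivative_bounded_linear)
  then show ?thesis using 1 by (simp add: fderiv_def bounded_linear_Blinfun_apply)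
qed

lemma fderiv_eqI:
  assumes "(F has_derivative blinfun_apply A) (at x)"
  shows "fderiv F x = A"
  using frechet_derivative_at[OF assms] by (simp add: fderiv_def blinfun_apply_inverse flip: frechet_derivative_at[OF assms])

lemma lipschitz_of_fderiv:
  fixes F :: "'a::real_normed_vector \<Rightarrow> 'b::real_normed_vector"
  assumes "convex S" "\<And>y. y \<in> S \<Longrightarrow> F differentiable at y" "\<And>y. y \<in> S \<Longrightarrow> norm (fderiv F y) \<le> l"
    and "x \<in> S" "y \<in> S"
  shows "norm (F x - F y) \<le> l * norm (x - y)"
proof (rule differentiable_bound[OF assms(1) _ _ assms(4,5)])
  fix z assume z: "z \<in> S"
  show "(F has_derivative blinfun_apply (fderiv F z)) (at z within S)"
    using fderiv_works[OF assms(2)[OF z]] by (rule has_derivative_at_withinI)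
  show "onorm (blinfun_apply (fderiv F z)) \<le> l" using assms(3)[OF z] by (simp add: norm_blinfun.rep_eq)
qed

text \<open>Converse of the mean value inequality. Only increments near x are asked for, since
  weighted bounds are at hand only near a base point.\<close>

lemma norm_fderiv_le_of_lipschitz:
  fixes F :: "'a::real_normed_vector \<Rightarrow> 'b::real_normed_vector"
  assumes "F differentiable at x" "0 < r" "0 \<le> l"
    and lip: "\<And>y. norm (y - x) < r \<Longrightarrow> norm (F y - F x) \<le> l * norm (y - x)"
  shows "norm (fderiv F x) \<le> l"
proof (rule norm_blinfun_bound[OF assms(3)])
  fix v
  show "norm (blinfun_apply (fderiv F x) v) \<le> l * norm v"
  proof (cases "v = 0")
    case False
    have "norm (blinfun_apply (fderiv F x) v) \<le> (l + e) * norm v" if e: "e > 0" for e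
    proof -
      obtain d where d: "d > 0" "\<And>y. norm (y - x) < d \<Longrightarrow>
          norm (F y - F x - blinfun_apply (fderiv F x) (y - x)) \<le> e * norm (y - x)"
        using fderiv_works[OF assms(1)] e unfolding has_derivative_at_alt by blast
      define t where "t = min d r / 2 / norm v"
      have t: "t > 0" "norm (t *\<^sub>R v) < d" "norm (t *\<^sub>R v) < r"
        using False d(1) assms(2) by (auto simp: t_def)
      have "norm (t *\<^sub>R blinfun_apply (fderiv F x) v) =
          norm ((F (x + t *\<^sub>R v) - F x) - (F (x + t *\<^sub>R v) - F x - blinfun_apply (fderiv F x) (t *\<^sub>R v)))"
        by (simp add: blinfun.scaleR_right)
      also have "\<dots> \<le> norm (F (x + t *\<^sub>R v) - F x) + norm (F (x + t *\<^sub>R v) - F x - blinfun_apply (fderiv F x) (t *\<^sub>R v))"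
        by (rule norm_triangle_ineq4)
      also have "\<dots> \<le> l * norm (t *\<^sub>R v) + e * norm (t *\<^sub>R v)"
        using d(2)[of "x + t *\<^sub>R v"] lip[of "x + t *\<^sub>R v"] t by (intro add_mono) auto
      also have "\<dots> = t * ((l + e) * norm v)" using t(1) by (simp add: algebra_simps)
      finally have "t * norm (blinfun_apply (fderiv F x) v) \<le> t * ((l + e) * norm v)" using t(1) by simp
      then show ?thesis using t(1) by simp
    qed
    then have *: "norm (blinfun_apply (fderiv F x) v) \<le> l * norm v + e * norm v" if "e > 0" for e
      using that by (simp add: algebra_simps)
    show ?thesis
    proof (rule field_le_epsilon)
      fix e :: real assume "e > 0"
      then show "norm (blinfun_apply (fderiv F x) v) \<le> l * norm v + e"
        using *[of "e / norm v"] False by simp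
    qed
  qed simp
qed

lemma fderiv_diff:
  assumes "F differentiable at x" "G differentiable at x"
  shows "(\<lambda>y. F y - G y) differentiable at x" "fderiv (\<lambda>y. F y - G y) x = fderiv F x - fderiv G x"
proof -
  have "((\<lambda>y. F y - G y) has_derivative (\<lambda>v. blinfun_apply (fderiv F x) v - blinfun_apply (fderiv G x) v)) (at x)"
    by (intro has_derivative_diff fderiv_works assms)
  then have *: "((\<lambda>y. F y - G y) has_derivative blinfun_apply (fderiv F x - fderiv G x)) (at x)"
    by (rule has_derivative_eq_rhs) (simp add: blinfun.diff_left fun_eq_iff)
  then show "fderiv (\<lambda>y. F y - G y) x = fderiv F x - fderiv G x" by (rule fderiv_eqI)
  show "(\<lambda>y. F y - G y) differentiable at x" using * unfolding differentiable_def by blast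
qed

text \<open>The left side is a second difference, symmetric in the pair (F, G) and the pair (b, b').
  Followed by \<open>fderiv_diff_le\<close> in the other variable, it exchanges the order of two
  differentiations.\<close>

lemma increment_diff_le:
  fixes F G :: "'a::real_normed_vector \<Rightarrow> 'b::real_normed_vector"
  assumes "convex S" "\<And>b. b \<in> S \<Longrightarrow> F differentiable at b" "\<And>b. b \<in> S \<Longrightarrow> G differentiable at b"
    and "\<And>b. b \<in> S \<Longrightarrow> norm (fderiv F b - fderiv G b) \<le> l" "b \<in> S" "b' \<in> S"
  shows "norm ((F b - G b) - (F b' - G b')) \<le> l * norm (b - b')"
proof (rule lipschitz_of_fderiv[OF assms(1) _ _ assms(5,6)])
  fix y assume y: "y \<in> S"
  note d = fderiv_diff[OF assms(2)[OF y] assms(3)[OF y]]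
  show "(\<lambda>y. F y - G y) differentiable at y" by (rule d)
  show "norm (fderiv (\<lambda>y. F y - G y) y) \<le> l" unfolding d(2) using assms(4)[OF y] .
qed

lemma fderiv_diff_le:
  fixes F G :: "'a::real_normed_vector \<Rightarrow> 'b::real_normed_vector"
  assumes "F differentiable at b" "G differentiable at b" "0 < r" "0 \<le> l"
    and "\<And>b'. norm (b' - b) < r \<Longrightarrow> norm ((F b' - G b') - (F b - G b)) \<le> l * norm (b' - b)"
  shows "norm (fderiv F b - fderiv G b) \<le> l"
  unfolding fderiv_diff(2)[OF assms(1,2), symmetric]
  by (rule norm_fderiv_le_of_lipschitz[OF fderiv_diff(1)[OF assms(1,2)] assms(3,4)]) (use assms(5) in auto)

subsection \<open>Linear functional derivatives\<close>

lemma Wass2_self: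
  assumes "\<mu> \<in> P2" shows "Wass 2 \<mu> \<mu> = 0"
proof -
  have "Wass 2 \<mu> \<mu> \<le> sqrt (\<integral>z. (norm (fst z - snd z))\<^sup>2 \<partial>distr \<mu> borel (\<lambda>x. (x, x)))"
    by (rule Wass2_le[OF diag_coupling(1)[OF assms] assms assms])
  also have "(\<integral>z. (norm (fst z - snd z))\<^sup>2 \<partial>distr \<mu> borel (\<lambda>x. (x, x))) = (\<integral>x. 0 \<partial>\<mu>)"
  proof (subst integral_distr)
    have "(\<lambda>x. x) \<in> borel_measurable \<mu>" by (simp add: borel_measurable_eq_borel[OF P2D(2)[OF assms]])
    then show "(\<lambda>x. (x, x)) \<in> borel_measurable \<mu>" by (intro measurable_Pair_borel)
  qed auto
  finally have "Wass 2 \<mu> \<mu> \<le> 0" by simp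
  moreover have "0 \<le> Wass 2 \<mu> \<mu>" by (simp add: Wass_def)
  ultimately show ?thesis by simp
qed

lemma cont_P2_on_continuous:
  assumes "cont_P2_on S F" "\<mu> \<in> P2"
  shows "continuous_on S (\<lambda>z. F z \<mu>)"
  unfolding continuous_on_iff
proof (intro ballI allI impI)
  fix z and e :: real assume z: "z \<in> S" and "e > 0"
  then obtain d where d: "d > 0" "\<forall>z'\<in>S. \<forall>\<mu>'\<in>P2. dist z' z < d \<and> Wass 2 \<mu>' \<mu> < d \<longrightarrow> dist (F z' \<mu>') (F z \<mu>) < e"
    using assms unfolding cont_P2_on_def by blast
  show "\<exists>d>0. \<forall>z'\<in>S. dist z' z < d \<longrightarrow> dist (F z' \<mu>) (F z \<mu>) < e"
    using d assms(2) Wass2_self[OF assms(2)] by (intro exI[of _ d]) auto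
qed

lemma cont_P2_on_diff:
  fixes F G :: "'z::metric_space \<Rightarrow> 'x::euclidean_space measure \<Rightarrow> 'b::real_normed_vector"
  assumes "cont_P2_on S F" "cont_P2_on S G"
  shows "cont_P2_on S (\<lambda>z \<mu>. F z \<mu> - G z \<mu>)"
  unfolding cont_P2_on_def
proof (intro ballI allI impI)
  fix z and \<mu> :: "'x measure" and e :: real assume z: "z \<in> S" "\<mu> \<in> P2" "e > 0"
  then have e: "e / 2 > 0" by simp
  obtain d where d: "d > 0" "\<forall>z'\<in>S. \<forall>\<mu>'\<in>P2. dist z' z < d \<and> Wass 2 \<mu>' \<mu> < d \<longrightarrow> dist (F z' \<mu>') (F z \<mu>) < e / 2"
    using assms(1) z(1,2) e unfolding cont_P2_on_def by blast
  obtain d' where d': "d' > 0" "\<forall>z'\<in>S. \<forall>\<mu>'\<in>P2. dist z' z < d' \<and> Wass 2 \<mu>' \<mu> < d' \<longrightarrow> dist (G z' \<mu>') (G z \<mu>) < e / 2"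
    using assms(2) z(1,2) e unfolding cont_P2_on_def by blast
  show "\<exists>d>0. \<forall>z'\<in>S. \<forall>\<mu>'\<in>P2. dist z' z < d \<and> Wass 2 \<mu>' \<mu> < d \<longrightarrow> dist (F z' \<mu>' - G z' \<mu>') (F z \<mu> - G z \<mu>) < e"
  proof (intro exI[of _ "min d d'"] conjI ballI impI)
    fix z' and \<mu>' :: "'x measure" assume "z' \<in> S" "\<mu>' \<in> P2" "dist z' z < min d d' \<and> Wass 2 \<mu>' \<mu> < min d d'"
    then have "dist (F z' \<mu>') (F z \<mu>) < e / 2" "dist (G z' \<mu>') (G z \<mu>) < e / 2" using d d' by auto
    then show "dist (F z' \<mu>' - G z' \<mu>') (F z \<mu> - G z \<mu>) < e"
      using norm_triangle_ineq4[of "F z' \<mu>' - F z \<mu>" "G z' \<mu>' - G z \<mu>"] by (simp add: dist_norm algebra_simps)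
  qed (use d d' in auto)
qed

lemma integrable_quadratic_growth:
  fixes F :: "'x::euclidean_space \<Rightarrow> 'b::{banach, second_countable_topology}"
  assumes "\<nu> \<in> P2" "continuous_on UNIV F" "\<And>x. norm (F x) \<le> c * (1 + (norm x)\<^sup>2)"
  shows "integrable \<nu> F"
proof (rule Bochner_Integration.integrable_bound)
  interpret prob_space \<nu> by (rule P2D(1)[OF assms(1)])
  show "integrable \<nu> (\<lambda>x. c * (1 + (norm x)\<^sup>2))" using P2D(4)[OF assms(1)] by simp
  show "F \<in> borel_measurable \<nu>"
    using borel_measurable_continuous_onI[OF assms(2)] by (simp add: borel_measurable_eq_borel[OF P2D(2)[OF assms(1)]])
  show "AE x in \<nu>. norm (F x) \<le> norm (c * (1 + (norm x)\<^sup>2))"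
    using order_trans[OF assms(3) abs_ge_self] by simp
qed

lemma integrable_lipschitz:
  fixes F :: "'x::euclidean_space \<Rightarrow> 'b::{banach, second_countable_topology}"
  assumes "\<nu> \<in> P2" "\<And>x y. norm (F x - F y) \<le> L * norm (x - y)"
  shows "integrable \<nu> F" "continuous_on UNIV F"
proof -
  have L: "norm (F x - F y) \<le> \<bar>L\<bar> * norm (x - y)" for x y
    using assms(2)[of x y] mult_right_mono[OF abs_ge_self[of L] norm_ge_zero[of "x - y"]] by linarith
  show c: "continuous_on UNIV F"
    using L by (intro lipschitz_on_continuous_on[of "\<bar>L\<bar>"] lipschitz_onI) (auto simp: dist_norm)
  show "integrable \<nu> F"
  proof (rule integrable_quadratic_growth[OF assms(1) c])
    fix x :: 'x
    have "norm x \<le> 1 + (norm x)\<^sup>2"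
    proof -
      have "norm x * 2 \<le> 1 + norm x * norm x"
        using zero_le_power2[of "norm x - 1"] by (simp add: power2_eq_square algebra_simps)
      then show ?thesis unfolding power2_eq_square using norm_ge_zero[of x] by linarith
    qed
    then have "\<bar>L\<bar> * norm x \<le> \<bar>L\<bar> * (1 + (norm x)\<^sup>2)" by (rule mult_left_mono) simp
    moreover have "norm (F 0) \<le> norm (F 0) * (1 + (norm x)\<^sup>2)"
      using mult_left_mono[of 1 "1 + (norm x)\<^sup>2" "norm (F 0)"] by simp
    moreover have "norm (F x) \<le> norm (F 0) + \<bar>L\<bar> * norm x"
      using L[of x 0] norm_triangle_ineq2[of "F x" "F 0"] by simp
    ultimately show "norm (F x) \<le> (norm (F 0) + \<bar>L\<bar>) * (1 + (norm x)\<^sup>2)"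
      unfolding distrib_right by linarith
  qed
qed

lemma is_lfdD:
  assumes "is_lfd h D"
  shows "cont_P2_on UNIV (\<lambda>x \<mu>. D \<mu> x)"
    "\<mu> \<in> P2 \<Longrightarrow> continuous_on UNIV (D \<mu>)"
    "\<mu> \<in> P2 \<Longrightarrow> \<nu> \<in> P2 \<Longrightarrow> integrable \<nu> (D \<mu>)"
    "\<mu> \<in> P2 \<Longrightarrow> \<nu> \<in> P2 \<Longrightarrow> ((\<lambda>\<theta>. sint (D (mix \<theta> \<mu> \<nu>)) \<mu> \<nu>) has_integral (h \<mu> - h \<nu>)) {0..1}"
proof -
  show 1: "cont_P2_on UNIV (\<lambda>x \<mu>. D \<mu> x)" using assms by (simp add: is_lfd_def)
  show 2: "continuous_on UNIV (D \<mu>)" if "\<mu> \<in> P2" for \<mu> using cont_P2_on_continuous[OF 1 that] .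
  obtain c where c: "\<forall>\<mu>\<in>P2. \<forall>x. norm (D \<mu> x) \<le> c \<mu> * (1 + (norm x)\<^sup>2)" using assms unfolding is_lfd_def by blast
  show "integrable \<nu> (D \<mu>)" if "\<mu> \<in> P2" "\<nu> \<in> P2"
    using integrable_quadratic_growth[OF that(2) 2[OF that(1)]] c that(1) by blast
  show "((\<lambda>\<theta>. sint (D (mix \<theta> \<mu> \<nu>)) \<mu> \<nu>) has_integral (h \<mu> - h \<nu>)) {0..1}" if "\<mu> \<in> P2" "\<nu> \<in> P2"
    using assms that unfolding is_lfd_def by blast
qed

lemma is_lfd_near:
  assumes "is_lfd h D" "\<mu> \<in> P2" "0 < e"
  obtains d where "0 < d" "\<And>\<mu>'. \<mu>' \<in> P2 \<Longrightarrow> Wass 2 \<mu>' \<mu> < d \<Longrightarrow> norm (D \<mu>' u - D \<mu> u) < e"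
proof -
  have "\<exists>d>0. \<forall>z'\<in>UNIV. \<forall>\<mu>'\<in>P2. dist z' u < d \<and> Wass 2 \<mu>' \<mu> < d \<longrightarrow> dist (D \<mu>' z') (D \<mu> u) < e"
    using is_lfdD(1)[OF assms(1), unfolded cont_P2_on_def, rule_format, OF UNIV_I assms(2,3)] .
  then obtain d where d: "d > 0" "\<And>z' \<mu>'. \<mu>' \<in> P2 \<Longrightarrow> dist z' u < d \<Longrightarrow> Wass 2 \<mu>' \<mu> < d \<Longrightarrow> dist (D \<mu>' z') (D \<mu> u) < e"
    by auto
  show thesis
    by (rule that[OF d(1)]) (use d(2)[of _ u] d(1) in \<open>simp add: dist_norm\<close>)
qed

lemma sint_diff:
  assumes "integrable \<mu> F" "integrable \<nu> F" "integrable \<mu> G" "integrable \<nu> G"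
  shows "sint (\<lambda>x. F x - G x) \<mu> \<nu> = sint F \<mu> \<nu> - sint G \<mu> \<nu>"
  using assms by (simp add: sint_def)

text \<open>Taken for two parameter values of one coefficient, it makes the increment in the
  parameter a function of the measure with its own derivative, so that a mixed bound becomes a
  first-order one.\<close>

lemma is_lfd_diff:
  fixes h h' :: "'x::euclidean_space measure \<Rightarrow> 'b::{banach, second_countable_topology}"
  assumes "is_lfd h D" "is_lfd h' D'"
  shows "is_lfd (\<lambda>\<nu>. h \<nu> - h' \<nu>) (\<lambda>\<mu> x. D \<mu> x - D' \<mu> x)"
  unfolding is_lfd_def
proof (intro conjI ballI)
  note d = is_lfdD[OF assms(1)] and d' = is_lfdD[OF assms(2)]
  show "cont_P2_on UNIV (\<lambda>x \<mu>. D \<mu> x - D' \<mu> x)" using cont_P2_on_diff[OF d(1) d'(1)] .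
  obtain c where c: "bounded_on_bounded c" "\<forall>\<mu>\<in>P2. \<forall>x. norm (D \<mu> x) \<le> c \<mu> * (1 + (norm x)\<^sup>2)"
    using assms(1) unfolding is_lfd_def by blast
  obtain c' where c': "bounded_on_bounded c'" "\<forall>\<mu>\<in>P2. \<forall>x. norm (D' \<mu> x) \<le> c' \<mu> * (1 + (norm x)\<^sup>2)"
    using assms(2) unfolding is_lfd_def by blast
  show "\<exists>c. bounded_on_bounded c \<and> (\<forall>\<mu>\<in>P2. \<forall>x. norm (D \<mu> x - D' \<mu> x) \<le> c \<mu> * (1 + (norm x)\<^sup>2))"
  proof (intro exI[of _ "\<lambda>\<mu>. c \<mu> + c' \<mu>"] conjI ballI allI)
    show "bounded_on_bounded (\<lambda>\<mu>. c \<mu> + c' \<mu>)"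
      unfolding bounded_on_bounded_def
    proof
      fix R
      obtain C where C: "\<forall>\<mu>\<in>P2. mnorm 2 \<mu> \<le> R \<longrightarrow> \<bar>c \<mu>\<bar> \<le> C" using c(1) unfolding bounded_on_bounded_def by blast
      obtain C' where C': "\<forall>\<mu>\<in>P2. mnorm 2 \<mu> \<le> R \<longrightarrow> \<bar>c' \<mu>\<bar> \<le> C'" using c'(1) unfolding bounded_on_bounded_def by blast
      show "\<exists>C. \<forall>\<mu>\<in>P2. mnorm 2 \<mu> \<le> R \<longrightarrow> \<bar>c \<mu> + c' \<mu>\<bar> \<le> C"
        using C C' by (intro exI[of _ "C + C'"]) (auto intro: order_trans[OF abs_triangle_ineq] add_mono)
    qed
    fix \<mu> :: "'x measure" and x :: 'x assume "\<mu> \<in> P2"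
    then have "norm (D \<mu> x) \<le> c \<mu> * (1 + (norm x)\<^sup>2)" "norm (D' \<mu> x) \<le> c' \<mu> * (1 + (norm x)\<^sup>2)" using c c' by auto
    then show "norm (D \<mu> x - D' \<mu> x) \<le> (c \<mu> + c' \<mu>) * (1 + (norm x)\<^sup>2)"
      unfolding distrib_right using norm_triangle_ineq4[of "D \<mu> x" "D' \<mu> x"] by linarith
  qed
  fix \<mu> :: "'x measure" assume \<mu>: "\<mu> \<in> P2"
  have z: "(\<integral>x. D \<mu> x \<partial>\<mu>) = 0" "(\<integral>x. D' \<mu> x \<partial>\<mu>) = 0" using assms \<mu> unfolding is_lfd_def by blast+
  show "(\<integral>x. D \<mu> x - D' \<mu> x \<partial>\<mu>) = 0"
    using Bochner_Integration.integral_diff[OF d(3)[OF \<mu> \<mu>] d'(3)[OF \<mu> \<mu>]] z by simp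
  fix \<nu> :: "'x measure" assume \<nu>: "\<nu> \<in> P2"
  have "((\<lambda>\<theta>. sint (D (mix \<theta> \<mu> \<nu>)) \<mu> \<nu> - sint (D' (mix \<theta> \<mu> \<nu>)) \<mu> \<nu>) has_integral ((h \<mu> - h \<nu>) - (h' \<mu> - h' \<nu>))) {0..1}"
    by (intro has_integral_diff d(4) d'(4) \<mu> \<nu>)
  moreover have "sint (D (mix \<theta> \<mu> \<nu>)) \<mu> \<nu> - sint (D' (mix \<theta> \<mu> \<nu>)) \<mu> \<nu> =
      sint (\<lambda>x. D (mix \<theta> \<mu> \<nu>) x - D' (mix \<theta> \<mu> \<nu>) x) \<mu> \<nu>" if "\<theta> \<in> {0..1}" for \<theta>
  proof -
    have m: "mix \<theta> \<mu> \<nu> \<in> P2" using mix_P2(1)[OF \<mu> \<nu>] that by auto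
    show ?thesis
      by (rule sint_diff[OF d(3)[OF m \<mu>] d(3)[OF m \<nu>] d'(3)[OF m \<mu>] d'(3)[OF m \<nu>], symmetric])
  qed
  ultimately have "((\<lambda>\<theta>. sint (\<lambda>x. D (mix \<theta> \<mu> \<nu>) x - D' (mix \<theta> \<mu> \<nu>) x) \<mu> \<nu>) has_integral
      ((h \<mu> - h \<nu>) - (h' \<mu> - h' \<nu>))) {0..1}" by (rule has_integral_eq[rotated])
  then show "((\<lambda>\<theta>. sint (\<lambda>x. D (mix \<theta> \<mu> \<nu>) x - D' (mix \<theta> \<mu> \<nu>) x) \<mu> \<nu>) has_integral
      (h \<mu> - h' \<mu> - (h \<nu> - h' \<nu>))) {0..1}" by (simp add: algebra_simps)
qed

text \<open>The derivative is integrated along the mixtures of \<mu> and \<nu>. At each \<theta> the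
  signed measure is still \<mu> - \<nu>, so one coupling of the end points serves for all
  \<theta>.\<close>

lemma lfd_imp_lipschitz:
  fixes h :: "'x::euclidean_space measure \<Rightarrow> 'b::euclidean_space"
  assumes "is_lfd h D" "\<pi> \<in> couplings \<mu> \<nu>" "\<mu> \<in> P2" "\<nu> \<in> P2" "0 \<le> l"
    and "\<And>\<theta> x y. 0 \<le> \<theta> \<Longrightarrow> \<theta> \<le> 1 \<Longrightarrow> norm (D (mix \<theta> \<mu> \<nu>) x - D (mix \<theta> \<mu> \<nu>) y) \<le> l * norm (x - y)"
  shows "norm (h \<mu> - h \<nu>) \<le> l * cost \<pi>"
proof -
  have "norm (h \<mu> - h \<nu>) \<le> (l * cost \<pi>) * (1 - 0)"
  proof (rule has_integral_norm_le[OF is_lfdD(4)[OF assms(1,3,4)]])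
    fix \<theta> :: real assume t: "0 \<le> \<theta>" "\<theta> \<le> 1"
    have m: "mix \<theta> \<mu> \<nu> \<in> P2" using mix_P2(1)[OF assms(3,4) t] .
    show "norm (sint (D (mix \<theta> \<mu> \<nu>)) \<mu> \<nu>) \<le> l * cost \<pi>"
      by (rule norm_sint_le[OF assms(2-4) is_lfdD(3)[OF assms(1) m assms(3)] is_lfdD(3)[OF assms(1) m assms(4)] assms(6)[OF t]])
  qed (use assms(5) in auto)
  then show ?thesis by simp
qed

subsection \<open>Probing a linear functional derivative by point masses\<close>

abbreviation pm :: "real \<Rightarrow> 'x::euclidean_space \<Rightarrow> 'x measure \<Rightarrow> 'x measure" where
  "pm \<epsilon> u \<mu> \<equiv> mix \<epsilon> (return borel u) \<mu>"

text \<open>The common background (1 - \<epsilon>) \<mu> cancels, so the pair of probes isolates one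
  increment of \<open>F\<close>.\<close>

lemma sint_pm:
  fixes F :: "'x::euclidean_space \<Rightarrow> 'b::euclidean_space"
  assumes "\<mu> \<in> P2" "0 \<le> \<epsilon>" "\<epsilon> \<le> 1" "continuous_on UNIV F" "integrable \<mu> F"
  shows "sint F (pm \<epsilon> u \<mu>) (pm \<epsilon> v \<mu>) = \<epsilon> *\<^sub>R (F u - F v)"
proof -
  have m: "F \<in> borel_measurable borel" using assms(4) by (rule borel_measurable_continuous_onI)
  have i: "integrable (return borel u) F" for u
    using m by (simp add: integrable_iff_bounded nn_integral_return)
  have "(\<integral>x. F x \<partial>pm \<epsilon> u \<mu>) = \<epsilon> *\<^sub>R F u + (1 - \<epsilon>) *\<^sub>R (\<integral>x. F x \<partial>\<mu>)" for u
    using integral_mix[OF P2D(1)[OF return_P2] P2D(1)[OF assms(1)] _ P2D(2)[OF assms(1)] assms(2,3) i assms(5)] m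
    by (simp add: integral_return)
  from this[of u] this[of v] show ?thesis unfolding sint_def by (simp add: scaleR_diff_right)
qed

text \<open>Carrying the mass \<epsilon> at a point over to \<mu> has squared cost proportional to
  \<epsilon>. Couplings mix, so the whole segment between the two probes is close to \<mu>,
  uniformly in \<theta>.\<close>

lemma pm_near:
  fixes u v :: "'x::euclidean_space"
  assumes "\<mu> \<in> P2" "0 < d"
  obtains \<epsilon>0 where "0 < \<epsilon>0" "\<epsilon>0 \<le> 1"
    "\<And>\<epsilon> \<theta>. 0 < \<epsilon> \<Longrightarrow> \<epsilon> \<le> \<epsilon>0 \<Longrightarrow> 0 \<le> \<theta> \<Longrightarrow> \<theta> \<le> 1 \<Longrightarrow> Wass 2 (mix \<theta> (pm \<epsilon> u \<mu>) (pm \<epsilon> v \<mu>)) \<mu> < d"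
proof -
  define prd where "prd u = return borel u \<Otimes>\<^sub>M \<mu>" for u :: 'x
  define q where "q u = (\<integral>z. (norm (fst z - snd z))\<^sup>2 \<partial>prd u)" for u
  have q0: "0 \<le> q u" for u by (simp add: q_def)
  define c where "c = q u + q v + 1"
  have c: "0 < c" using q0[of u] q0[of v] by (simp add: c_def)
  \<comment> \<open>Makes \<epsilon> * c at most d^2 / 2; the 1 in \<open>c\<close> excludes a zero
    divisor.\<close>
  define \<epsilon>0 where "\<epsilon>0 = min 1 (d\<^sup>2 / (2 * c))"
  show thesis
  proof
    show "0 < \<epsilon>0" "\<epsilon>0 \<le> 1" using c assms(2) by (auto simp: \<epsilon>0_def)
    fix \<epsilon> \<theta> :: real assume e: "0 < \<epsilon>" "\<epsilon> \<le> \<epsilon>0" and t: "0 \<le> \<theta>" "\<theta> \<le> 1"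
    then have e': "0 \<le> \<epsilon>" "\<epsilon> \<le> 1" by (auto simp: \<epsilon>0_def)
    note dc = diag_coupling(1)[OF assms(1)]
    have pc: "prd u \<in> couplings (return borel u) \<mu>" for u unfolding prd_def by (rule product_coupling[OF return_P2 assms(1)])
    define \<rho> where "\<rho> u = mix \<epsilon> (prd u) (distr \<mu> borel (\<lambda>x. (x, x)))" for u
    have sq0: "(\<integral>z. (norm (fst z - snd z))\<^sup>2 \<partial>distr \<mu> borel (\<lambda>x. (x, x))) = 0"
    proof (subst integral_distr)
      have "(\<lambda>x. x) \<in> borel_measurable \<mu>" by (simp add: borel_measurable_eq_borel[OF P2D(2)[OF assms(1)]])
      then show "(\<lambda>x. (x, x)) \<in> borel_measurable \<mu>" by (intro measurable_Pair_borel)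
    qed auto
    have r: "\<rho> u \<in> couplings (pm \<epsilon> u \<mu>) \<mu>" "(\<integral>z. (norm (fst z - snd z))\<^sup>2 \<partial>\<rho> u) = \<epsilon> * q u" for u
    proof -
      note mc = mix_coupling[OF pc[of u] dc return_P2 assms(1) assms(1) assms(1) e']
      show "\<rho> u \<in> couplings (pm \<epsilon> u \<mu>) \<mu>" using mc(1) mix_self[OF assms(1) e'] by (simp add: \<rho>_def)
      show "(\<integral>z. (norm (fst z - snd z))\<^sup>2 \<partial>\<rho> u) = \<epsilon> * q u" using mc(3) sq0 by (simp add: \<rho>_def q_def)
    qed
    have p: "pm \<epsilon> u \<mu> \<in> P2" for u by (rule mix_P2(1)[OF return_P2 assms(1) e'])
    note mc = mix_coupling[OF r(1)[of u] r(1)[of v] p assms(1) p assms(1) t]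
    have mm: "mix \<theta> (pm \<epsilon> u \<mu>) (pm \<epsilon> v \<mu>) \<in> P2" by (rule mix_P2(1)[OF p p t])
    have "Wass 2 (mix \<theta> (pm \<epsilon> u \<mu>) (pm \<epsilon> v \<mu>)) \<mu> \<le> sqrt (\<theta> * (\<epsilon> * q u) + (1 - \<theta>) * (\<epsilon> * q v))"
      using Wass2_le[OF mc(1)] mm assms(1) mc(3) r(2) by (simp add: mix_self[OF assms(1) t])
    also have "\<dots> \<le> sqrt (\<epsilon> * c)"
    proof (rule real_sqrt_le_mono)
      have "\<theta> * (\<epsilon> * q u) \<le> 1 * (\<epsilon> * q u)" "(1 - \<theta>) * (\<epsilon> * q v) \<le> 1 * (\<epsilon> * q v)"
        using t e q0 by (intro mult_right_mono; simp)+
      then show "\<theta> * (\<epsilon> * q u) + (1 - \<theta>) * (\<epsilon> * q v) \<le> \<epsilon> * c"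
        using e unfolding c_def distrib_left by linarith
    qed
    also have "\<dots> < sqrt (d\<^sup>2)"
    proof (rule real_sqrt_less_mono)
      have "\<epsilon> * c \<le> d\<^sup>2 / (2 * c) * c" using e(2) c by (intro mult_right_mono) (auto simp: \<epsilon>0_def)
      also have "\<dots> = d\<^sup>2 / 2" using c by simp
      also have "\<dots> < d\<^sup>2" using assms(2) by simp
      finally show "\<epsilon> * c < d\<^sup>2" .
    qed
    also have "\<dots> = d" using assms(2) by simp
    finally show "Wass 2 (mix \<theta> (pm \<epsilon> u \<mu>) (pm \<epsilon> v \<mu>)) \<mu> < d" .
  qed
qed

lemma mnorm_pm_ge:
  assumes "\<mu> \<in> P2" "0 \<le> \<epsilon>" "\<epsilon> \<le> 1"
  shows "(1 - \<epsilon>) * mnorm 1 \<mu> \<le> mnorm 1 (pm \<epsilon> u \<mu>)"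
  using mix_P2(2)[OF return_P2 assms, of u] assms by (simp add: mnorm_return)

text \<open>Moving the mass \<open>\<epsilon>\<close> from \<open>u\<close> to \<open>v\<close> costs \<open>\<epsilon> |u - v|\<close> and, to first order, changes \<open>h\<close> by
  \<open>\<epsilon>\<close> times the increment of its linear functional derivative.\<close>

lemma lipschitz_imp_lfd_lipschitz:
  fixes h :: "'x::euclidean_space measure \<Rightarrow> 'b::euclidean_space"
  assumes lfd: "is_lfd h D" and \<mu>: "\<mu> \<in> P2" and \<rho>: "\<rho> < mnorm 1 \<mu>"
    and lip: "\<And>\<nu> \<nu>' \<pi>. \<nu> \<in> P2 \<Longrightarrow> \<nu>' \<in> P2 \<Longrightarrow> \<pi> \<in> couplings \<nu> \<nu>' \<Longrightarrow> \<rho> \<le> mnorm 1 \<nu> \<Longrightarrow>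
      norm (h \<nu> - h \<nu>') \<le> l * cost \<pi>"
  shows "norm (D \<mu> u - D \<mu> v) \<le> l * norm (u - v)"
proof (rule field_le_epsilon)
  fix e :: real assume "e > 0"
  then have e2: "e / 2 > 0" by simp
  obtain du where du: "du > 0" "\<And>\<mu>'. \<mu>' \<in> P2 \<Longrightarrow> Wass 2 \<mu>' \<mu> < du \<Longrightarrow> norm (D \<mu>' u - D \<mu> u) < e / 2"
    using is_lfd_near[OF lfd \<mu> e2, of u] by metis
  obtain dv where dv: "dv > 0" "\<And>\<mu>'. \<mu>' \<in> P2 \<Longrightarrow> Wass 2 \<mu>' \<mu> < dv \<Longrightarrow> norm (D \<mu>' v - D \<mu> v) < e / 2"
    using is_lfd_near[OF lfd \<mu> e2, of v] by metis
  have "0 < min du dv" using du dv by simp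
  then obtain \<epsilon>0 where e0: "0 < \<epsilon>0" "\<epsilon>0 \<le> 1"
    "\<And>\<epsilon> \<theta>. 0 < \<epsilon> \<Longrightarrow> \<epsilon> \<le> \<epsilon>0 \<Longrightarrow> 0 \<le> \<theta> \<Longrightarrow> \<theta> \<le> 1 \<Longrightarrow> Wass 2 (mix \<theta> (pm \<epsilon> u \<mu>) (pm \<epsilon> v \<mu>)) \<mu> < min du dv"
    using pm_near[OF \<mu>, of "min du dv" u v] by metis
  define m where "m = mnorm 1 \<mu>"
  \<comment> \<open>Small enough that the probe at u keeps a first moment of at least \<rho>, where
    \<open>lip\<close> applies; m + 1 avoids a zero divisor.\<close>
  define \<epsilon> where "\<epsilon> = min \<epsilon>0 ((m - \<rho>) / (m + 1))"
  have m0: "0 \<le> m" by (simp add: m_def)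
  have "0 < (m - \<rho>) / (m + 1)" using \<rho> m0 unfolding m_def[symmetric] by (intro divide_pos_pos) linarith+
  then have eps: "0 < \<epsilon>" "\<epsilon> \<le> \<epsilon>0" "0 \<le> \<epsilon>" "\<epsilon> \<le> 1" using e0(1,2) by (auto simp: \<epsilon>_def)
  have "\<epsilon> * m \<le> \<epsilon> * (m + 1)" using eps by (simp add: distrib_left)
  also have "\<dots> \<le> (m - \<rho>) / (m + 1) * (m + 1)" using m0 by (intro mult_right_mono) (auto simp: \<epsilon>_def)
  also have "\<dots> = m - \<rho>" using m0 by simp
  finally have "\<rho> \<le> (1 - \<epsilon>) * m" by (simp add: algebra_simps)
  then have r: "\<rho> \<le> mnorm 1 (pm \<epsilon> u \<mu>)" using mnorm_pm_ge[OF \<mu> eps(3,4), of u] by (simp add: m_def)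
  have p: "pm \<epsilon> u \<mu> \<in> P2" for u by (rule mix_P2(1)[OF return_P2 \<mu> eps(3,4)])
  note mc = mix_coupling(1,2)[OF return_coupling(1)[of u v] diag_coupling(1)[OF \<mu>] return_P2 return_P2 \<mu> \<mu> eps(3,4)]
  have h: "norm (h (pm \<epsilon> u \<mu>) - h (pm \<epsilon> v \<mu>)) \<le> l * (\<epsilon> * norm (u - v))"
    using lip[OF p p mc(1) r] mc(2) by (simp add: return_coupling diag_coupling[OF \<mu>])
  let ?W = "D \<mu> u - D \<mu> v"
  \<comment> \<open>The integrand is compared with its value at \<mu>. On the segment of mixtures it
    differs by at most \<epsilon> * e, and the final division by \<epsilon> leaves the error
    e.\<close>
  have "((\<lambda>\<theta>. sint (D (mix \<theta> (pm \<epsilon> u \<mu>) (pm \<epsilon> v \<mu>))) (pm \<epsilon> u \<mu>) (pm \<epsilon> v \<mu>) - \<epsilon> *\<^sub>R ?W)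
      has_integral (h (pm \<epsilon> u \<mu>) - h (pm \<epsilon> v \<mu>) - (1 - 0) *\<^sub>R (\<epsilon> *\<^sub>R ?W))) {0..1}"
    by (intro has_integral_diff is_lfdD(4)[OF lfd] p) (use has_integral_const_real[of "\<epsilon> *\<^sub>R ?W" 0 1] in simp)
  then have "norm (h (pm \<epsilon> u \<mu>) - h (pm \<epsilon> v \<mu>) - (1 - 0) *\<^sub>R (\<epsilon> *\<^sub>R ?W)) \<le> (\<epsilon> * e) * (1 - 0)"
  proof (rule has_integral_norm_le)
    fix \<theta> :: real assume t: "0 \<le> \<theta>" "\<theta> \<le> 1"
    let ?m = "mix \<theta> (pm \<epsilon> u \<mu>) (pm \<epsilon> v \<mu>)"
    have mP: "?m \<in> P2" by (rule mix_P2(1)[OF p p t])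
    have "Wass 2 ?m \<mu> < min du dv" using e0(3) eps t by simp
    then have "norm (D ?m u - D \<mu> u) < e / 2" "norm (D ?m v - D \<mu> v) < e / 2" using du(2)[OF mP] dv(2)[OF mP] by auto
    then have *: "norm ((D ?m u - D ?m v) - ?W) \<le> e"
      using norm_triangle_ineq4[of "D ?m u - D \<mu> u" "D ?m v - D \<mu> v"] by (simp add: algebra_simps)
    have "sint (D ?m) (pm \<epsilon> u \<mu>) (pm \<epsilon> v \<mu>) - \<epsilon> *\<^sub>R ?W = \<epsilon> *\<^sub>R ((D ?m u - D ?m v) - ?W)"
      by (subst sint_pm[OF \<mu> eps(3,4) is_lfdD(2)[OF lfd mP] is_lfdD(3)[OF lfd mP \<mu>]]) (simp add: algebra_simps)
    then show "norm (sint (D ?m) (pm \<epsilon> u \<mu>) (pm \<epsilon> v \<mu>) - \<epsilon> *\<^sub>R ?W) \<le> \<epsilon> * e"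
      using * eps by simp
  qed (use eps \<open>e > 0\<close> in auto)
  then have "norm (\<epsilon> *\<^sub>R ?W) \<le> \<epsilon> * (l * norm (u - v) + e)"
    using h norm_triangle_ineq4[of "h (pm \<epsilon> u \<mu>) - h (pm \<epsilon> v \<mu>)" "h (pm \<epsilon> u \<mu>) - h (pm \<epsilon> v \<mu>) - \<epsilon> *\<^sub>R ?W"]
    by (simp add: algebra_simps)
  then show "norm ?W \<le> l * norm (u - v) + e" using eps by simp
qed

subsection \<open>Second-order expansion\<close>

text \<open>The second difference of \<open>K\<close> is at most l |a - b| |y - y'|. Integrating
  against \<mu> - \<nu> in each variable, through the coupling, replaces each factor by the cost.
  The threshold \<rho> survives on the segment because \<open>mnorm 1\<close> is affine under
  \<open>mix\<close>.\<close>

lemma second_order_bound: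
  fixes h :: "'x::euclidean_space measure \<Rightarrow> 'b::euclidean_space"
  assumes K: "is_lfd2 h K"
    and diff: "\<And>\<mu> x y. \<mu> \<in> P2 \<Longrightarrow> K \<mu> x differentiable at y \<and> (\<lambda>u. fderiv (K \<mu> u) y) differentiable at x"
    and bnd: "\<And>\<mu> x y. \<mu> \<in> P2 \<Longrightarrow> \<rho> \<le> mnorm 1 \<mu> \<Longrightarrow> norm (mixed_deriv (K \<mu>) x y) \<le> l"
    and l: "0 \<le> l" and \<pi>: "\<pi> \<in> couplings \<mu> \<nu>" "\<mu> \<in> P2" "\<nu> \<in> P2" and \<rho>: "\<rho> \<le> mnorm 1 \<mu>" "\<rho> \<le> mnorm 1 \<nu>"
  shows "norm (h \<mu> - h \<nu> - sint (lfd h \<nu>) \<mu> \<nu>) \<le> l * (cost \<pi>)\<^sup>2"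
proof -
  have C: "cont_P2_on UNIV (\<lambda>(x, y) \<mu>. K \<mu> x y)" using K by (simp add: is_lfd2_def)
  obtain c where c: "\<forall>\<mu>\<in>P2. \<forall>x y. norm (K \<mu> x y) \<le> c \<mu> * (1 + (norm x)\<^sup>2 + (norm y)\<^sup>2)"
    using K unfolding is_lfd2_def by blast
  have key: "norm (sint (\<lambda>y. sint (\<lambda>x. K m x y) \<mu> \<nu>) \<mu> \<nu>) \<le> l * (cost \<pi>)\<^sup>2"
    if m: "m \<in> P2" "\<rho> \<le> mnorm 1 m" for m
  proof -
    have lipu: "norm (fderiv (K m a) y - fderiv (K m b) y) \<le> l * norm (a - b)" for a b y
    proof (rule lipschitz_of_fderiv[of UNIV "\<lambda>u. fderiv (K m u) y"])
      fix x
      show "(\<lambda>u. fderiv (K m u) y) differentiable at x" using diff[OF m(1)] by blast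
      show "norm (fderiv (\<lambda>u. fderiv (K m u) y) x) \<le> l"
        using bnd[OF m, of x y] by (simp add: mixed_deriv_def)
    qed auto
    have mix2: "norm ((K m a y - K m b y) - (K m a y' - K m b y')) \<le> (l * norm (a - b)) * norm (y - y')" for a b y y'
      by (rule increment_diff_le[of UNIV]) (use diff[OF m(1)] lipu in auto)
    have mix2': "norm ((K m a y - K m a y') - (K m b y - K m b y')) \<le> (l * norm (y - y')) * norm (a - b)" for a b y y'
    proof -
      have eq: "(K m a y - K m a y') - (K m b y - K m b y') = (K m a y - K m b y) - (K m a y' - K m b y')" by simp
      show ?thesis unfolding eq using mix2[of a y b y'] by (simp add: ac_simps)
    qed
    have cx: "continuous_on UNIV (\<lambda>x. K m x y)" for y
    proof -
      have "continuous_on UNIV (\<lambda>x. (x, y))" by (intro continuous_intros)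
      then show ?thesis using continuous_on_compose2[OF cont_P2_on_continuous[OF C m(1)], of UNIV "\<lambda>x. (x, y)"] by simp
    qed
    have ix: "integrable \<nu>' (\<lambda>x. K m x y)" if "\<nu>' \<in> P2" for \<nu>' y
    proof (rule integrable_quadratic_growth[OF that cx, of _ "\<bar>c m\<bar> * (1 + (norm y)\<^sup>2)"])
      fix x
      have "norm (K m x y) \<le> \<bar>c m\<bar> * (1 + (norm x)\<^sup>2 + (norm y)\<^sup>2)"
        using c[rule_format, OF m(1), of x y] by (rule order_trans) (intro mult_right_mono, auto)
      also have "\<dots> \<le> \<bar>c m\<bar> * ((1 + (norm y)\<^sup>2) * (1 + (norm x)\<^sup>2))"
        by (intro mult_left_mono) (auto simp: algebra_simps)
      finally show "norm (K m x y) \<le> \<bar>c m\<bar> * (1 + (norm y)\<^sup>2) * (1 + (norm x)\<^sup>2)" by (simp add: ac_simps)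
    qed
    let ?k = "\<lambda>y. sint (\<lambda>x. K m x y) \<mu> \<nu>"
    have k: "norm (?k y - ?k y') \<le> (l * cost \<pi>) * norm (y - y')" for y y'
    proof -
      have "?k y - ?k y' = sint (\<lambda>x. K m x y - K m x y') \<mu> \<nu>"
        by (rule sint_diff[symmetric]; rule ix; rule \<pi>)
      also have "norm \<dots> \<le> (l * norm (y - y')) * cost \<pi>"
        by (rule norm_sint_le[OF \<pi>]) (use ix \<pi> mix2' in auto)
      finally show ?thesis by (simp add: ac_simps)
    qed
    have "norm (sint ?k \<mu> \<nu>) \<le> (l * cost \<pi>) * cost \<pi>"
      by (rule norm_sint_le[OF \<pi> integrable_lipschitz(1)[OF \<pi>(2) k] integrable_lipschitz(1)[OF \<pi>(3) k] k])
    then show ?thesis by (simp add: power2_eq_square ac_simps)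
  qed
  have "((\<lambda>\<theta>. integral {0..1} (\<lambda>s. \<theta> *\<^sub>R sint (\<lambda>y. sint (\<lambda>x. K (mix (s * \<theta>) \<mu> \<nu>) x y) \<mu> \<nu>) \<mu> \<nu>))
         has_integral (h \<mu> - h \<nu> - sint (lfd h \<nu>) \<mu> \<nu>)) {0..1}"
    using K \<pi>(2,3) unfolding is_lfd2_def by blast
  then have "norm (h \<mu> - h \<nu> - sint (lfd h \<nu>) \<mu> \<nu>) \<le> (l * (cost \<pi>)\<^sup>2) * (1 - 0)"
  proof (rule has_integral_norm_le)
    fix \<theta> :: real assume t: "0 \<le> \<theta>" "\<theta> \<le> 1"
    let ?F = "\<lambda>s. \<theta> *\<^sub>R sint (\<lambda>y. sint (\<lambda>x. K (mix (s * \<theta>) \<mu> \<nu>) x y) \<mu> \<nu>) \<mu> \<nu>"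
    have F: "norm (?F s) \<le> l * (cost \<pi>)\<^sup>2" if s: "0 \<le> s" "s \<le> 1" for s
    proof -
      have st: "0 \<le> s * \<theta>" "s * \<theta> \<le> 1" using s t mult_le_one by auto
      note mP = mix_P2[OF \<pi>(2,3) st]
      have "\<rho> = s * \<theta> * \<rho> + (1 - s * \<theta>) * \<rho>" by (simp add: algebra_simps)
      also have "\<dots> \<le> mnorm 1 (mix (s * \<theta>) \<mu> \<nu>)"
        unfolding mP(2) using st \<rho> by (intro add_mono mult_left_mono) auto
      finally have "norm (sint (\<lambda>y. sint (\<lambda>x. K (mix (s * \<theta>) \<mu> \<nu>) x y) \<mu> \<nu>) \<mu> \<nu>) \<le> l * (cost \<pi>)\<^sup>2"
        using key[OF mP(1)] by blast
      then have "\<theta> * norm (sint (\<lambda>y. sint (\<lambda>x. K (mix (s * \<theta>) \<mu> \<nu>) x y) \<mu> \<nu>) \<mu> \<nu>) \<le> 1 * (l * (cost \<pi>)\<^sup>2)"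
        using t l by (intro mult_mono) auto
      then show ?thesis using t by simp
    qed
    show "norm (integral {0..1} ?F) \<le> l * (cost \<pi>)\<^sup>2"
    \<comment> \<open>\<open>integral\<close> is 0 for a non-integrable inner function, and then the
      bound is trivial.\<close>
    proof (cases "?F integrable_on {0..1}")
      case True
      then show ?thesis using has_integral_norm_le[OF integrable_integral[OF True], of "l * (cost \<pi>)\<^sup>2"] F l by auto
    next
      case False
      then show ?thesis unfolding not_integrable_integral[OF False] using l by simp
    qed
  qed (use l in auto)
  then show ?thesis by simp
qed

lemma norm_diff3: "norm (a - b - c) \<le> norm a + norm b + norm (c :: 'a::real_normed_vector)"
  using norm_triangle_ineq4[of "a - b" c] norm_triangle_ineq4[of a b] by linarith

lemma norm_sum5:
  "norm (w - (a - b) + (c - d)) \<le> norm w + norm a + norm b + norm c + norm (d :: 'a::real_normed_vector)"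
  using norm_triangle_ineq[of "w - (a - b)" "c - d"] norm_triangle_ineq4[of w "a - b"]
    norm_triangle_ineq4[of a b] norm_triangle_ineq4[of c d] by linarith

lemma diff_rearrange:
  fixes a b c p q r :: "'a::ab_group_add"
  shows "p - (q - r) = (a - c - q) - (b - c - r) - (a - b - p)"
  by (simp add: algebra_simps)

text \<open>As for \<open>C\<^sup>1\<^sup>,\<^sup>1\<close> functions, comparing first-order expansions at neighbouring points of a fine
  subdivision of the displacement path, with a probe whose size is that of the mesh, gives the Lipschitz bound.\<close>

lemma lfd_lipschitz_measure:
  fixes h :: "'x::euclidean_space measure \<Rightarrow> 'b::euclidean_space"
  assumes lfd: "is_lfd h D" and \<pi>: "\<pi> \<in> couplings \<mu> \<nu>" "\<mu> \<in> P2" "\<nu> \<in> P2" and l: "0 \<le> l"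
    and \<rho>: "\<rho> < mnorm 1 \<mu> - cost \<pi>"
    and E: "\<And>\<mu> \<nu> \<pi>. \<pi> \<in> couplings \<mu> \<nu> \<Longrightarrow> \<mu> \<in> P2 \<Longrightarrow> \<nu> \<in> P2 \<Longrightarrow> \<rho> \<le> mnorm 1 \<mu> \<Longrightarrow> \<rho> \<le> mnorm 1 \<nu> \<Longrightarrow>
      norm (h \<mu> - h \<nu> - sint (D \<nu>) \<mu> \<nu>) \<le> l * (cost \<pi>)\<^sup>2"
  shows "norm ((D \<mu> v - D \<mu> u) - (D \<nu> v - D \<nu> u)) \<le> 6 * l * cost \<pi> * norm (v - u)"
proof (cases "v = u")
  case False
  define r where "r = norm (v - u)"
  have r: "0 < r" using False by (simp add: r_def)
  \<comment> \<open>A strict upper bound c of the cost keeps the mesh c / N positive even when the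
    cost is 0; e absorbs the replacement of the end measures by their probes.\<close>
  have main: "norm ((D \<mu> v - D \<mu> u) - (D \<nu> v - D \<nu> u)) \<le> 6 * l * c * r + e" if c: "cost \<pi> < c" and e: "0 < e" for c e
  proof -
    have c0: "0 < c" using c cost_nonneg[of \<pi>] by linarith
    have e4: "e / 4 > 0" using e by simp
    have near: "\<exists>\<epsilon>0>0. \<epsilon>0 \<le> 1 \<and> (\<forall>\<epsilon>. 0 < \<epsilon> \<and> \<epsilon> \<le> \<epsilon>0 \<longrightarrow>
        norm (D (pm \<epsilon> u m) v - D m v) \<le> e / 4 \<and> norm (D (pm \<epsilon> u m) u - D m u) \<le> e / 4)" if m: "m \<in> P2" for m
    proof -
      obtain du where du: "du > 0" "\<And>\<mu>'. \<mu>' \<in> P2 \<Longrightarrow> Wass 2 \<mu>' m < du \<Longrightarrow> norm (D \<mu>' u - D m u) < e / 4"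
        using is_lfd_near[OF lfd m e4, of u] by metis
      obtain dv where dv: "dv > 0" "\<And>\<mu>'. \<mu>' \<in> P2 \<Longrightarrow> Wass 2 \<mu>' m < dv \<Longrightarrow> norm (D \<mu>' v - D m v) < e / 4"
        using is_lfd_near[OF lfd m e4, of v] by metis
      have "0 < min du dv" using du dv by simp
      then obtain \<epsilon>0 where e0: "0 < \<epsilon>0" "\<epsilon>0 \<le> 1"
        "\<And>\<epsilon> \<theta>. 0 < \<epsilon> \<Longrightarrow> \<epsilon> \<le> \<epsilon>0 \<Longrightarrow> 0 \<le> \<theta> \<Longrightarrow> \<theta> \<le> 1 \<Longrightarrow> Wass 2 (mix \<theta> (pm \<epsilon> u m) (pm \<epsilon> u m)) m < min du dv"
        using pm_near[OF m, of "min du dv" u u] by metis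
      show ?thesis
      proof (intro exI[of _ \<epsilon>0] conjI allI impI)
        fix \<epsilon> assume ee: "0 < \<epsilon> \<and> \<epsilon> \<le> \<epsilon>0"
        have pP: "pm \<epsilon> u m \<in> P2" by (rule mix_P2(1)[OF return_P2 m]) (use ee e0 in auto)
        have "Wass 2 (pm \<epsilon> u m) m < min du dv"
          using e0(3)[of \<epsilon> 0] ee mix_self[OF pP, of 0] by simp
        then show "norm (D (pm \<epsilon> u m) v - D m v) \<le> e / 4" "norm (D (pm \<epsilon> u m) u - D m u) \<le> e / 4"
          using du(2)[OF pP] dv(2)[OF pP] by auto
      qed (use e0 in auto)
    qed
    obtain a where a: "0 < a" "a \<le> 1" "\<And>\<epsilon>. 0 < \<epsilon> \<Longrightarrow> \<epsilon> \<le> a \<Longrightarrow>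
        norm (D (pm \<epsilon> u \<mu>) v - D \<mu> v) \<le> e / 4 \<and> norm (D (pm \<epsilon> u \<mu>) u - D \<mu> u) \<le> e / 4"
      using near[OF \<pi>(2)] by blast
    obtain b where b: "0 < b" "b \<le> 1" "\<And>\<epsilon>. 0 < \<epsilon> \<Longrightarrow> \<epsilon> \<le> b \<Longrightarrow>
        norm (D (pm \<epsilon> u \<nu>) v - D \<nu> v) \<le> e / 4 \<and> norm (D (pm \<epsilon> u \<nu>) u - D \<nu> u) \<le> e / 4"
      using near[OF \<pi>(3)] by blast
    \<comment> \<open>A lower bound for the first moment along the whole displacement path.\<close>
    define M where "M = max 0 (mnorm 1 \<mu> - cost \<pi>)"
    have M: "0 \<le> M" "\<rho> < M" using \<rho> by (auto simp: M_def)
    define s where "s = min (min a b) ((M - \<rho>) / (M + 1))"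
    have s: "0 < s" "s \<le> a" "s \<le> b" "s \<le> (M - \<rho>) / (M + 1)" using a b M by (auto simp: s_def)
    obtain N :: nat where N: "c / (r * s) < real N" using reals_Archimedean2 by blast
    have N0: "0 < real N" using N c0 r s by (meson divide_pos_pos less_trans mult_pos_pos)
    \<comment> \<open>The probing mass is tied to the mesh: moving \<epsilon> over the distance r
      costs exactly c / N, the order of one step of the path. A mass that does not shrink with the
      mesh would leave quadratic errors that do not sum up to a bounded quantity.\<close>
    define \<epsilon> where "\<epsilon> = c / (r * real N)"
    have eps: "0 < \<epsilon>" using c0 r N0 by (simp add: \<epsilon>_def)
    have epss: "\<epsilon> \<le> s" using N r s N0 by (simp add: \<epsilon>_def field_simps)
    have eps1: "0 \<le> \<epsilon>" "\<epsilon> \<le> 1" using eps epss s a by auto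
    have er: "\<epsilon> * r = c / real N" using r N0 by (simp add: \<epsilon>_def)
    define A where "A i = disp \<pi> (real i / real N)" for i :: nat
    define P where "P i = pm \<epsilon> v (A i)" for i
    define Q where "Q i = pm \<epsilon> u (A i)" for i
    have AP: "A i \<in> P2" for i unfolding A_def by (rule disp_P2[OF \<pi>])
    have PP: "P i \<in> P2" "Q i \<in> P2" for i unfolding P_def Q_def by (rule mix_P2(1)[OF return_P2 AP eps1])+
    have "\<epsilon> * M \<le> \<epsilon> * (M + 1)" using eps by (simp add: distrib_left)
    also have "\<dots> \<le> (M - \<rho>) / (M + 1) * (M + 1)" using M epss s(4) by (intro mult_right_mono) auto
    also have "\<dots> = M - \<rho>" using M by simp
    finally have eM: "\<rho> \<le> (1 - \<epsilon>) * M" by (simp add: algebra_simps)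
    have rA: "\<rho> \<le> (1 - \<epsilon>) * mnorm 1 (A i)" if "i \<le> N" for i
    proof -
      have "0 \<le> real i / real N" "real i / real N \<le> 1" using that N0 by auto
      then have "\<bar>mnorm 1 (A i) - mnorm 1 \<mu>\<bar> \<le> cost \<pi>" unfolding A_def by (rule mnorm_disp[OF \<pi>])
      then have "M \<le> mnorm 1 (A i)" by (simp add: M_def)
      then have "(1 - \<epsilon>) * M \<le> (1 - \<epsilon>) * mnorm 1 (A i)" using eps1 by (intro mult_left_mono) auto
      then show ?thesis using eM by linarith
    qed
    have rho: "\<rho> \<le> mnorm 1 (P i)" "\<rho> \<le> mnorm 1 (Q i)" if "i \<le> N" for i
      using rA[OF that] mnorm_pm_ge[OF AP eps1, of i v] mnorm_pm_ge[OF AP eps1, of i u] by (auto simp: P_def Q_def)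
    define W where "W i = D (Q i) v - D (Q i) u" for i
    have sW: "sint (D (Q j)) (P i) (Q i) = \<epsilon> *\<^sub>R (D (Q j) v - D (Q j) u)" for i j
      unfolding P_def Q_def[of i]
      by (rule sint_pm[OF AP eps1 is_lfdD(2)[OF lfd PP(2)] is_lfdD(3)[OF lfd PP(2) AP]])
    have step: "norm (W i - W (Suc i)) \<le> 6 * l * c * r / real N" if i: "i < N" for i
    proof -
      have i': "i \<le> N" "Suc i \<le> N" using i by auto
      obtain \<tau> where tau: "\<tau> \<in> couplings (A i) (A (Suc i))" "cost \<tau> = \<bar>real i / real N - real (Suc i) / real N\<bar> * cost \<pi>"
        using disp_coupling[OF \<pi>, of "real i / real N" "real (Suc i) / real N"] unfolding A_def by metis
      have "\<bar>real i / real N - real (Suc i) / real N\<bar> = 1 / real N" using N0 by (simp add: field_simps)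
      then have ct: "cost \<tau> = cost \<pi> / real N" using tau(2) by simp
      have ct': "(1 - \<epsilon>) * cost \<tau> \<le> c / real N"
      proof -
        have "(1 - \<epsilon>) * cost \<tau> \<le> 1 * (c / real N)"
          unfolding ct using eps1 c N0 by (intro mult_mono divide_right_mono) auto
        then show ?thesis by simp
      qed
      note c1 = mix_coupling(1,2)[OF return_coupling(1)[of v u] diag_coupling(1)[OF AP[of i]] return_P2 return_P2 AP AP eps1]
      note c2 = mix_coupling(1,2)[OF return_coupling(1)[of v u] tau(1) return_P2 return_P2 AP AP eps1]
      note c3 = mix_coupling(1,2)[OF return_coupling(1)[of u u] tau(1) return_P2 return_P2 AP AP eps1]
      \<comment> \<open>P_i is expanded at Q_i and at Q_{i+1}, and Q_i at Q_{i+1}. The values of h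
        cancel and the increment of W remains. The costs are at most 1, 2 and 1 mesh units; their
        squares add up to the factor 6.\<close>
      let ?e1 = "h (P i) - h (Q i) - sint (D (Q i)) (P i) (Q i)"
      let ?e2 = "h (P i) - h (Q (Suc i)) - sint (D (Q (Suc i))) (P i) (Q (Suc i))"
      let ?e3 = "h (Q i) - h (Q (Suc i)) - sint (D (Q (Suc i))) (Q i) (Q (Suc i))"
      have mono: "l * x\<^sup>2 \<le> l * y\<^sup>2" if "0 \<le> x" "x \<le> y" for x y :: real
        using that l by (intro mult_left_mono power_mono) auto
      have cn: "0 \<le> (1 - \<epsilon>) * cost \<tau>" using eps1 by simp
      define k1 where "k1 = mix \<epsilon> (return borel (v, u)) (distr (A i) borel (\<lambda>x. (x, x)))"
      define k2 where "k2 = mix \<epsilon> (return borel (v, u)) \<tau>"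
      define k3 where "k3 = mix \<epsilon> (return borel (u, u)) \<tau>"
      have k: "k1 \<in> couplings (P i) (Q i)" "k2 \<in> couplings (P i) (Q (Suc i))" "k3 \<in> couplings (Q i) (Q (Suc i))"
        unfolding k1_def k2_def k3_def P_def Q_def by (rule c1(1) c2(1) c3(1))+
      have kc: "cost k1 = \<epsilon> * r" "cost k2 = \<epsilon> * r + (1 - \<epsilon>) * cost \<tau>" "cost k3 = (1 - \<epsilon>) * cost \<tau>"
        unfolding k1_def k2_def k3_def c1(2) c2(2) c3(2) return_coupling(2) diag_coupling(2)[OF AP] r_def by simp_all
      have e1: "norm ?e1 \<le> l * (c / real N)\<^sup>2"
        using E[OF k(1) PP(1) PP(2) rho(1)[OF i'(1)] rho(2)[OF i'(1)]] unfolding kc er .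
      have "norm ?e2 \<le> l * (\<epsilon> * r + (1 - \<epsilon>) * cost \<tau>)\<^sup>2"
        using E[OF k(2) PP(1) PP(2) rho(1)[OF i'(1)] rho(2)[OF i'(2)]] unfolding kc .
      also have "\<dots> \<le> l * (2 * (c / real N))\<^sup>2" unfolding er using cn ct' c0 N0 by (intro mono) auto
      also have "\<dots> = 4 * (l * (c / real N)\<^sup>2)" by (simp add: power2_eq_square)
      finally have e2: "norm ?e2 \<le> 4 * (l * (c / real N)\<^sup>2)" .
      have "norm ?e3 \<le> l * ((1 - \<epsilon>) * cost \<tau>)\<^sup>2"
        using E[OF k(3) PP(2) PP(2) rho(2)[OF i'(1)] rho(2)[OF i'(2)]] unfolding kc .
      also have "\<dots> \<le> l * (c / real N)\<^sup>2" using cn ct' by (intro mono) auto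
      finally have e3: "norm ?e3 \<le> l * (c / real N)\<^sup>2" .
      have add3: "x + y + z \<le> 6 * B" if "x \<le> 4 * B" "y \<le> B" "z \<le> B" for x y z B :: real using that by linarith
      have ss: "sint (D (Q (Suc i))) (P i) (Q (Suc i)) - sint (D (Q (Suc i))) (Q i) (Q (Suc i)) = \<epsilon> *\<^sub>R W (Suc i)"
        using sW[of "Suc i" i] by (simp add: sint_def W_def)
      have w1: "\<epsilon> *\<^sub>R W i = sint (D (Q i)) (P i) (Q i)" unfolding W_def by (rule sW[symmetric])
      have eq: "\<epsilon> *\<^sub>R (W i - W (Suc i)) = ?e2 - ?e3 - ?e1"
        unfolding scaleR_diff_right w1 ss[symmetric] by (rule diff_rearrange)
      have "norm (\<epsilon> *\<^sub>R (W i - W (Suc i))) \<le> norm ?e2 + norm ?e3 + norm ?e1"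
        unfolding eq by (rule norm_diff3)
      also have "\<dots> \<le> 6 * (l * (c / real N)\<^sup>2)" by (rule add3[OF e2 e3 e1])
      also have "\<dots> = 6 * l * c / real N * (\<epsilon> * r)"
        unfolding er by (simp add: power2_eq_square)
      also have "\<dots> = \<epsilon> * (6 * l * c * r / real N)" by simp
      finally have "\<epsilon> * norm (W i - W (Suc i)) \<le> \<epsilon> * (6 * l * c * r / real N)"
        using eps by (simp only: norm_scaleR abs_of_pos)
      then show ?thesis using eps by (rule mult_left_le_imp_le)
    qed
    have tele: "i \<le> N \<Longrightarrow> norm (W 0 - W i) \<le> real i * (6 * l * c * r / real N)" for i
    proof (induction i)
      case (Suc i)
      then have "norm (W 0 - W i) \<le> real i * (6 * l * c * r / real N)" "norm (W i - W (Suc i)) \<le> 6 * l * c * r / real N"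
        using step[of i] by auto
      moreover have "norm (W 0 - W (Suc i)) \<le> norm (W 0 - W i) + norm (W i - W (Suc i))"
        using norm_triangle_ineq[of "W 0 - W i" "W i - W (Suc i)"] by simp
      ultimately show ?case unfolding of_nat_Suc distrib_right by linarith
    qed simp
    have WN: "norm (W 0 - W N) \<le> 6 * l * c * r" using tele[of N] N0 by simp
    have Q0: "Q 0 = pm \<epsilon> u \<mu>" "Q N = pm \<epsilon> u \<nu>" using N0 disp_0[OF \<pi>] disp_1[OF \<pi>] by (simp_all add: Q_def A_def)
    have "norm (D (Q 0) v - D \<mu> v) \<le> e / 4" "norm (D (Q 0) u - D \<mu> u) \<le> e / 4"
      "norm (D (Q N) v - D \<nu> v) \<le> e / 4" "norm (D (Q N) u - D \<nu> u) \<le> e / 4"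
      unfolding Q0 using a(3)[of \<epsilon>] b(3)[of \<epsilon>] eps epss s by auto
    moreover have "(D \<mu> v - D \<mu> u) - (D \<nu> v - D \<nu> u) = (W 0 - W N)
        - ((D (Q 0) v - D \<mu> v) - (D (Q 0) u - D \<mu> u)) + ((D (Q N) v - D \<nu> v) - (D (Q N) u - D \<nu> u))"
      by (simp add: W_def)
    then have "norm ((D \<mu> v - D \<mu> u) - (D \<nu> v - D \<nu> u)) \<le> norm (W 0 - W N) + norm (D (Q 0) v - D \<mu> v)
        + norm (D (Q 0) u - D \<mu> u) + norm (D (Q N) v - D \<nu> v) + norm (D (Q N) u - D \<nu> u)"
      by (simp only: norm_sum5)
    ultimately show ?thesis using WN by linarith
  qed
  show ?thesis
  proof (rule field_le_epsilon)
    fix e :: real assume e: "0 < e"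
    define k where "k = 6 * l * r + 1"
    have k: "0 < k" using l r by (simp add: k_def add_nonneg_pos)
    have "norm ((D \<mu> v - D \<mu> u) - (D \<nu> v - D \<nu> u)) \<le> 6 * l * (cost \<pi> + e / (2 * k)) * r + e / 2"
      using main[of "cost \<pi> + e / (2 * k)" "e / 2"] e k by simp
    also have "\<dots> = 6 * l * cost \<pi> * r + (6 * l * r) * (e / (2 * k)) + e / 2" by (simp add: algebra_simps)
    also have "(6 * l * r) * (e / (2 * k)) \<le> k * (e / (2 * k))" using e k by (intro mult_right_mono) (auto simp: k_def)
    also have "k * (e / (2 * k)) = e / 2" using k by simp
    finally show "norm ((D \<mu> v - D \<mu> u) - (D \<nu> v - D \<nu> u)) \<le> 6 * l * cost \<pi> * norm (v - u) + e"
      by (simp add: r_def)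
  qed
qed simp

subsection \<open>Transferring couplings to a given random variable\<close>

lemma prob_space_Om: "prob_space Om"
  by (rule prob_space_uniform_measure) auto

lemma sets_Om [simp]: "sets Om = sets borel" by simp

lemma measurable_Om: "X \<in> borel_measurable Om \<longleftrightarrow> X \<in> borel_measurable borel"
  by (rule borel_measurable_eq_borel) simp

lemma sq_int_sqi: "sq_int Y \<longleftrightarrow> sqi Om Y"
  by (simp add: sq_int_def sqi_def)

lemma nn_integral_Om:
  assumes "F \<in> borel_measurable borel"
  shows "(\<integral>\<^sup>+w. F w \<partial>Om) = (\<integral>\<^sup>+w. F w * indicator {0..1} w \<partial>lborel)"
  using assms by (subst nn_integral_uniform_measure) (auto simp: divide_ennreal_def)

context
  fixes A :: "real set"
  assumes A: "A \<in> sets borel" "A \<subseteq> {0..1}" and pos: "0 < measure lborel A"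
begin

lemma A_fin: "emeasure lborel A \<noteq> \<infinity>" "emeasure lborel A \<noteq> 0" "A \<in> fmeasurable lborel"
proof -
  have "emeasure lborel A \<le> emeasure lborel {0..1::real}" using A by (intro emeasure_mono) auto
  then show *: "emeasure lborel A \<noteq> \<infinity>" using order_trans by (fastforce simp: top_unique)
  show "emeasure lborel A \<noteq> 0" using pos by (auto simp: measure_def)
  show "A \<in> fmeasurable lborel" using A * by (intro fmeasurableI) (auto simp: less_top)
qed

text \<open>\<open>ucdf\<close> pushes the uniform law on \<open>A\<close> to the uniform law on \<open>[0, 1]\<close>.\<close>

definition ucdf :: "real \<Rightarrow> real" where
  "ucdf w = measure lborel (A \<inter> {..w}) / measure lborel A"

lemma ucdf_lipschitz:
  assumes "w \<le> w'"
  shows "ucdf w \<le> ucdf w'" "ucdf w' - ucdf w \<le> (w' - w) / measure lborel A"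
proof -
  have f: "A \<inter> S \<in> fmeasurable lborel" if "S \<in> sets borel" for S
    using A_fin(3) that by (simp add: fmeasurable_Int_fmeasurable)
  have "measure lborel (A \<inter> {..w}) \<le> measure lborel (A \<inter> {..w'})"
    using assms A by (intro measure_mono_fmeasurable f) auto
  then show "ucdf w \<le> ucdf w'" using pos by (simp add: ucdf_def divide_right_mono)
  have "A \<inter> {..w'} = (A \<inter> {..w}) \<union> (A \<inter> {w<..w'})" using assms by auto
  then have "measure lborel (A \<inter> {..w'}) \<le> measure lborel (A \<inter> {..w}) + measure lborel (A \<inter> {w<..w'})"
    using measure_Un_le[of "A \<inter> {..w}" lborel "A \<inter> {w<..w'}"] f[of "{..w}", THEN fmeasurableD] f[of "{w<..w'}", THEN fmeasurableD]
    by simp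
  also have "measure lborel (A \<inter> {w<..w'}) \<le> measure lborel {w<..w'}"
  proof (rule measure_mono_fmeasurable)
    show "{w<..w'} \<in> fmeasurable lborel" using assms by (intro fmeasurableI) auto
  qed (use A in auto)
  also have "measure lborel {w<..w'} = w' - w" using assms by simp
  finally have "measure lborel (A \<inter> {..w'}) - measure lborel (A \<inter> {..w}) \<le> w' - w" by simp
  then show "ucdf w' - ucdf w \<le> (w' - w) / measure lborel A"
    using pos by (simp add: ucdf_def divide_right_mono flip: diff_divide_distrib)
qed

lemma continuous_ucdf: "continuous_on UNIV ucdf"
proof -
  have "\<bar>ucdf w - ucdf w'\<bar> \<le> 1 / measure lborel A * \<bar>w - w'\<bar>" for w w'
  proof (cases "w \<le> w'")
    case True then show ?thesis using ucdf_lipschitz[of w w'] by simp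
  next
    case False then show ?thesis using ucdf_lipschitz[of w' w] by simp
  qed
  then show ?thesis using pos
    by (intro lipschitz_on_continuous_on[of "1 / measure lborel A"] lipschitz_onI) (auto simp: dist_real_def)
qed

lemma ucdf_0: "w < 0 \<Longrightarrow> ucdf w = 0" and ucdf_1: "1 \<le> w \<Longrightarrow> ucdf w = 1"
proof -
  show "ucdf w = 0" if "w < 0"
  proof -
    have "A \<inter> {..w} = {}" using A that by auto
    then show ?thesis by (simp add: ucdf_def)
  qed
  show "ucdf w = 1" if "1 \<le> w"
  proof -
    have "A \<inter> {..w} = A" using A that by auto
    then show ?thesis using pos by (simp add: ucdf_def)
  qed
qed

lemma ucdf_nonneg: "0 \<le> ucdf w" and ucdf_le_1: "ucdf w \<le> 1"
  using ucdf_lipschitz(1)[of w "max w 1"] ucdf_1[of "max w 1"] by (auto simp: ucdf_def)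

text \<open>The probability integral transform. By continuity each sublevel set of
  \<open>ucdf\<close> for a level in [0, 1) is a half-line whose end point is mapped to that level,
  so the two distribution functions agree.\<close>

lemma distr_ucdf: "distr (uniform_measure lborel A) borel ucdf = Om"
proof -
  have m[measurable]: "ucdf \<in> borel_measurable borel" using continuous_ucdf by (rule borel_measurable_continuous_onI)
  have m': "ucdf \<in> borel_measurable (uniform_measure lborel A)" using m by (simp add: borel_measurable_eq_borel[of "uniform_measure lborel A"])
  interpret p: prob_space "uniform_measure lborel A" by (rule prob_space_uniform_measure) (use A_fin in auto)
  interpret d: prob_space "distr (uniform_measure lborel A) borel ucdf" by (rule p.prob_space_distr[OF m'])
  interpret o: prob_space Om by (rule prob_space_Om)
  have mu: "measure (uniform_measure lborel A) S = measure lborel (A \<inter> S) / measure lborel A" if "S \<in> sets borel" for S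
    using A_fin that by (intro measure_uniform_measure) auto
  have c1: "measure (distr (uniform_measure lborel A) borel ucdf) {..u} = max 0 (min 1 u)" for u
  proof -
    have "measure (distr (uniform_measure lborel A) borel ucdf) {..u} = measure (uniform_measure lborel A) {w. ucdf w \<le> u}"
      using m' by (subst measure_distr) (auto simp: vimage_def)
    also have "\<dots> = max 0 (min 1 u)"
    proof -
      consider "u < 0" | "1 \<le> u" | "0 \<le> u" "u < 1" by linarith
      then show ?thesis
      proof cases
        case 1
        then have "{w. ucdf w \<le> u} = {}" using ucdf_nonneg by (auto simp: not_le intro: less_le_trans)
        then show ?thesis using 1 by simp
      next
        case 2
        then have "{w. ucdf w \<le> u} = UNIV" using order_trans[OF ucdf_le_1] by auto
        then show ?thesis using 2 p.prob_space by simp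
      next
        case 3
        let ?S = "{w. ucdf w \<le> u}"
        have cl: "closed ?S" using continuous_ucdf by (intro closed_Collect_le) auto
        have "-1 \<in> ?S" using ucdf_0[of "-1"] 3 by simp
        then have ne: "?S \<noteq> {}" by blast
        have le1: "w \<le> 1" if "w \<in> ?S" for w using ucdf_1[of w] that 3 by force
        then have bd: "bdd_above ?S" by (auto simp: bdd_above_def)
        define s where "s = Sup ?S"
        have sS: "s \<in> ?S" unfolding s_def using ne bd cl by (rule closed_contains_Sup)
        have "?S = {..s}"
        proof (intro set_eqI iffI)
          fix w assume "w \<in> ?S" then show "w \<in> {..s}" unfolding s_def using bd by (simp add: cSup_upper)
        next
          fix w assume "w \<in> {..s}" then show "w \<in> ?S" using ucdf_lipschitz(1)[of w s] sS by simp
        qed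
        moreover have "ucdf s = u"
        proof -
          have "\<exists>w\<ge>s. w \<le> 1 \<and> ucdf w = u"
          proof (rule IVT')
            show "continuous_on {s..1} ucdf" using continuous_ucdf by (rule continuous_on_subset) simp
          qed (use sS le1 3 ucdf_1[of 1] in auto)
          then obtain w where w: "s \<le> w" "ucdf w = u" by blast
          then have "w \<le> s" unfolding s_def using bd by (simp add: cSup_upper)
          then show ?thesis using w by simp
        qed
        ultimately show ?thesis using 3 mu[of "{..s}"] by (simp add: ucdf_def)
      qed
    qed
    finally show ?thesis .
  qed
  have c2: "measure Om {..u} = max 0 (min 1 u)" for u
  proof -
    have "measure Om {..u} = measure lborel ({0..1} \<inter> {..u}) / measure lborel {0..1::real}"
      by (rule measure_uniform_measure) auto
    also have "{0..1} \<inter> {..u} = {0..min 1 u}" by auto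
    finally show ?thesis by (auto simp: max_def min_def)
  qed
  show ?thesis
  proof (rule cdf_unique)
    show "real_distribution (distr (uniform_measure lborel A) borel ucdf)"
      by unfold_locales auto
    show "real_distribution Om" by unfold_locales auto
    show "cdf (distr (uniform_measure lborel A) borel ucdf) = cdf Om"
      unfolding cdf_def fun_eq_iff using c1 c2 by simp
  qed
qed

end

lemma measurable_countable_cases:
  fixes F :: "nat \<Rightarrow> 'w \<Rightarrow> 'b"
  assumes "I \<in> M \<rightarrow>\<^sub>M count_space (UNIV :: nat set)" "\<And>k. F k \<in> M \<rightarrow>\<^sub>M N"
  shows "(\<lambda>w. F (I w) w) \<in> M \<rightarrow>\<^sub>M N"
  using measurable_compose_countable[of F M N I] assms by simp

lemma suminf_index:
  fixes F :: "nat \<Rightarrow> ennreal"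
  shows "(\<Sum>k. F k * indicator {w. I w = k} z) = F (I z)"
proof -
  have "(\<Sum>k. F k * indicator {w. I w = k} z) = (\<Sum>k. if k = I z then F k else 0)"
    by (intro suminf_cong) (auto simp: indicator_def)
  then show ?thesis using sums_unique[OF sums_single[of "I z" F]] by simp
qed

lemma nn_integral_index:
  fixes F :: "nat \<Rightarrow> 'w \<Rightarrow> ennreal"
  assumes "I \<in> M \<rightarrow>\<^sub>M count_space (UNIV :: nat set)" "\<And>k. F k \<in> borel_measurable M"
  shows "(\<integral>\<^sup>+z. F (I z) z \<partial>M) = (\<Sum>k. \<integral>\<^sup>+z. F k z * indicator {w. I w = k} z \<partial>M)"
proof -
  have m: "{w \<in> space M. I w = k} \<in> sets M" for k using assms(1) by measurable
  have "(\<integral>\<^sup>+z. F (I z) z \<partial>M) = (\<integral>\<^sup>+z. (\<Sum>k. F k z * indicator {w. I w = k} z) \<partial>M)"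
    by (subst suminf_index) simp
  also have "\<dots> = (\<integral>\<^sup>+z. (\<Sum>k. F k z * indicator {w \<in> space M. I w = k} z) \<partial>M)"
    by (intro nn_integral_cong suminf_cong) (auto simp: indicator_def)
  also have "\<dots> = (\<Sum>k. \<integral>\<^sup>+z. F k z * indicator {w \<in> space M. I w = k} z \<partial>M)"
    using assms(2) m by (intro nn_integral_suminf) auto
  also have "\<dots> = (\<Sum>k. \<integral>\<^sup>+z. F k z * indicator {w. I w = k} z \<partial>M)"
    by (intro suminf_cong nn_integral_cong) (auto simp: indicator_def)
  finally show ?thesis .
qed

text \<open>X may determine w completely, so no X' on the same space need have the joint law \<pi>
  with X. If only the cell index of X has to be matched, the randomness left inside each cell is
  enough: there \<open>ucdf\<close> produces a fresh uniform variable, from which the conditional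
  law of the second coordinate is generated.\<close>

lemma transfer_index:
  fixes X :: "real \<Rightarrow> 'x::euclidean_space"
  assumes real: "\<And>\<nu> :: 'x measure. \<nu> \<in> P2 \<Longrightarrow> \<exists>Y. sq_int Y \<and> distr Om borel Y = \<nu>"
    and X: "X \<in> borel_measurable borel" "distr Om borel X = \<mu>"
    and \<pi>: "\<pi> \<in> couplings \<mu> \<mu>'" "\<mu> \<in> P2" "\<mu>' \<in> P2"
    and I[measurable]: "I \<in> borel \<rightarrow>\<^sub>M count_space (UNIV :: nat set)"
  obtains X' :: "real \<Rightarrow> 'x" where "X' \<in> borel_measurable borel"
    "\<And>G :: nat \<Rightarrow> 'x \<Rightarrow> ennreal. (\<And>k. G k \<in> borel_measurable borel) \<Longrightarrow>
      (\<integral>\<^sup>+w. G (I (X w)) (X' w) \<partial>Om) = (\<integral>\<^sup>+z. G (I (fst z)) (snd z) \<partial>\<pi>)"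
proof -
  note X(1)[measurable]
  note \<pi>p = couplingD[OF \<pi>]
  interpret p: prob_space \<pi> by (rule \<pi>p(1))
  define A where "A k = {w \<in> {0..1}. I (X w) = k}" for k
  define S where "S k = {z :: 'x \<times> 'x. I (fst z) = k}" for k
  have A[measurable]: "A k \<in> sets borel" for k
  proof -
    have "A k = {0..1} \<inter> {w \<in> space borel. I (X w) = k}" by (auto simp: A_def)
    then show ?thesis by simp
  qed
  have Asub: "A k \<subseteq> {0..1}" for k by (auto simp: A_def)
  have If: "(\<lambda>z. I (fst z)) \<in> (borel :: ('x \<times> 'x) measure) \<rightarrow>\<^sub>M count_space UNIV" by measurable
  have S: "S k \<in> sets borel" for k
  proof -
    have "S k = {z \<in> space (borel :: ('x \<times> 'x) measure). I (fst z) = k}" by (auto simp: S_def)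
    also have "\<dots> \<in> sets borel" using If by measurable
    finally show ?thesis .
  qed
  have S': "S k \<in> sets \<pi>" for k using S \<pi>p(2) by simp
  have AS: "emeasure lborel (A k) = emeasure \<pi> (S k)" for k
  proof -
    have m: "{x. I x = k} \<in> sets (borel :: 'x measure)"
    proof -
      have "{x \<in> space (borel :: 'x measure). I x = k} \<in> sets borel" by measurable
      then show ?thesis by simp
    qed
    have "emeasure \<pi> (S k) = emeasure (distr \<pi> borel fst) {x. I x = k}"
      using \<pi>p(3,6) m by (subst emeasure_distr) (auto simp: S_def vimage_def)
    also have "\<dots> = emeasure (distr Om borel X) {x. I x = k}" using \<pi>p(4) X(2) by simp
    also have "\<dots> = emeasure Om {w. I (X w) = k}"
      using m X(1) by (subst emeasure_distr) (auto simp: vimage_def measurable_Om)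
    also have "\<dots> = emeasure lborel ({0..1} \<inter> {w. I (X w) = k}) / emeasure lborel {0..1::real}"
    proof (rule emeasure_uniform_measure)
      have "{w \<in> space borel. I (X w) = k} \<in> sets borel" by measurable
      then show "{w. I (X w) = k} \<in> sets lborel" by simp
    qed auto
    also have "{0..1} \<inter> {w. I (X w) = k} = A k" by (auto simp: A_def)
    finally show ?thesis by (simp add: divide_ennreal_def)
  qed
  define a where "a k = measure lborel (A k)" for k
  have afin: "emeasure lborel (A k) = ennreal (a k)" for k
  proof -
    have "emeasure lborel (A k) \<le> emeasure lborel {0..1::real}" using Asub by (intro emeasure_mono) auto
    then show ?thesis unfolding a_def by (intro emeasure_eq_ennreal_measure) (auto simp: top_unique)
  qed
  \<comment> \<open>The law of the second coordinate conditioned on the cell of the first.\<close>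
  define \<nu> where "\<nu> k = distr (uniform_measure \<pi> (S k)) borel snd" for k
  have \<nu>P: "\<nu> k \<in> P2" if k: "0 < a k" for k
    unfolding \<nu>_def
  proof (rule sqi_distr_P2)
    have e: "emeasure \<pi> (S k) = ennreal (a k)" using AS afin by simp
    show "prob_space (uniform_measure \<pi> (S k))" using e k by (intro prob_space_uniform_measure) auto
    have m: "snd \<in> borel_measurable (uniform_measure \<pi> (S k))"
      using \<pi>p(7) by (simp add: measurable_cong_sets[OF sets_uniform_measure refl])
    show "sqi (uniform_measure \<pi> (S k)) snd"
      unfolding sqi_def
    proof
      show "integrable (uniform_measure \<pi> (S k)) (\<lambda>w. (norm (snd w))\<^sup>2)"
      proof (rule integrableI_bounded)
        have mn: "(\<lambda>w. (norm (snd w))\<^sup>2) \<in> borel_measurable \<pi>" using \<pi>p(7) by simp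
        show "(\<lambda>w. (norm (snd w))\<^sup>2) \<in> borel_measurable (uniform_measure \<pi> (S k))" using m by simp
        have "(\<integral>\<^sup>+ x. ennreal (norm ((norm (snd x))\<^sup>2)) \<partial>uniform_measure \<pi> (S k)) =
            (\<integral>\<^sup>+ x. ennreal (norm ((norm (snd x))\<^sup>2)) * indicator (S k) x \<partial>\<pi>) / emeasure \<pi> (S k)"
          using mn S' by (intro nn_integral_uniform_measure) auto
        also have "\<dots> \<le> (\<integral>\<^sup>+ x. ennreal (norm ((norm (snd x))\<^sup>2)) \<partial>\<pi>) / emeasure \<pi> (S k)"
          by (intro divide_right_mono_ennreal nn_integral_mono) (auto simp: indicator_def)
        also have "\<dots> < \<infinity>"
        proof -
          have "(\<integral>\<^sup>+ x. ennreal (norm ((norm (snd x))\<^sup>2)) \<partial>\<pi>) < \<infinity>"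
            using \<pi>p(9) by (simp add: sqi_def integrable_iff_bounded)
          then show ?thesis unfolding e using k by (simp add: ennreal_divide_eq_top_iff less_top[symmetric] divide_ennreal_def ennreal_mult_eq_top_iff)
        qed
        finally show "(\<integral>\<^sup>+ x. ennreal (norm ((norm (snd x))\<^sup>2)) \<partial>uniform_measure \<pi> (S k)) < \<infinity>" .
      qed
    qed (rule m)
  qed
  have "\<forall>k. \<exists>Y. Y \<in> borel_measurable borel \<and> (0 < a k \<longrightarrow> distr Om borel Y = \<nu> k)"
  proof
    fix k
    show "\<exists>Y. Y \<in> borel_measurable borel \<and> (0 < a k \<longrightarrow> distr Om borel Y = \<nu> k)"
    proof (cases "0 < a k")
      case True
      then show ?thesis using real[OF \<nu>P[OF True]] by (auto simp: sq_int_def measurable_Om)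
    next
      case False
      then show ?thesis by (intro exI[of _ "\<lambda>_. 0"]) simp
    qed
  qed
  then obtain Y where Y: "\<And>k. Y k \<in> borel_measurable borel" "\<And>k. 0 < a k \<Longrightarrow> distr Om borel (Y k) = \<nu> k" by metis
  \<comment> \<open>Cells of mass 0 carry no conditional law; the value 0 there does not affect any
    integral.\<close>
  define V where "V k w = (if 0 < a k then Y k (ucdf (A k) w) else 0)" for k w
  have V: "V k \<in> borel_measurable borel" for k
  proof (cases "0 < a k")
    case True
    then have "ucdf (A k) \<in> borel_measurable borel"
      using continuous_ucdf[OF A Asub] by (intro borel_measurable_continuous_onI) (simp add: a_def)
    then have "(\<lambda>w. Y k (ucdf (A k) w)) \<in> borel_measurable borel" by (rule measurable_compose[OF _ Y(1)])
    moreover have "V k = (\<lambda>w. Y k (ucdf (A k) w))" using True by (simp add: V_def fun_eq_iff)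
    ultimately show ?thesis by simp
  next
    case False
    then have "V k = (\<lambda>w. 0)" by (simp add: V_def fun_eq_iff)
    then show ?thesis by simp
  qed
  have IX: "(\<lambda>w. I (X w)) \<in> borel \<rightarrow>\<^sub>M count_space UNIV" by measurable
  define X' where "X' w = V (I (X w)) w" for w
  show thesis
  proof
    show "X' \<in> borel_measurable borel" unfolding X'_def by (rule measurable_countable_cases[OF IX V])
    fix G :: "nat \<Rightarrow> 'x \<Rightarrow> ennreal" assume G: "\<And>k. G k \<in> borel_measurable borel"
    have GV: "(\<lambda>w. G k (V k w)) \<in> borel_measurable borel" for k using measurable_compose[OF V G] .
    have "(\<integral>\<^sup>+w. G (I (X w)) (X' w) \<partial>Om) = (\<integral>\<^sup>+w. G (I (X w)) (V (I (X w)) w) \<partial>Om)" by (simp add: X'_def)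
    also have "\<dots> = (\<Sum>k. \<integral>\<^sup>+w. G k (V k w) * indicator {w. I (X w) = k} w \<partial>Om)"
      by (rule nn_integral_index) (use IX GV in \<open>simp_all add: measurable_cong_sets[OF sets_Om refl]\<close>)
    also have "\<dots> = (\<Sum>k. \<integral>\<^sup>+z. G k (snd z) * indicator {z. I (fst z) = k} z \<partial>\<pi>)"
    proof (rule suminf_cong)
      fix k
      have ind: "indicator {w. I (X w) = k} \<in> borel_measurable (borel :: real measure)"
      proof -
        have "{w \<in> space borel. I (X w) = k} \<in> sets borel" by measurable
        then show ?thesis by (intro borel_measurable_indicator) simp
      qed
      have "(\<integral>\<^sup>+w. G k (V k w) * indicator {w. I (X w) = k} w \<partial>Om) =
          (\<integral>\<^sup>+w. G k (V k w) * indicator {w. I (X w) = k} w * indicator {0..1} w \<partial>lborel)"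
        using GV ind by (intro nn_integral_Om borel_measurable_times_ennreal)
      also have "\<dots> = (\<integral>\<^sup>+w. G k (V k w) * indicator (A k) w \<partial>lborel)"
        by (intro nn_integral_cong) (auto simp: A_def indicator_def)
      finally have L: "(\<integral>\<^sup>+w. G k (V k w) * indicator {w. I (X w) = k} w \<partial>Om) =
          (\<integral>\<^sup>+w. G k (V k w) * indicator (A k) w \<partial>lborel)" .
      show "(\<integral>\<^sup>+w. G k (V k w) * indicator {w. I (X w) = k} w \<partial>Om) =
          (\<integral>\<^sup>+z. G k (snd z) * indicator {z. I (fst z) = k} z \<partial>\<pi>)"
      proof (cases "0 < a k")
        case True
        then have pos: "0 < measure lborel (A k)" by (simp add: a_def)
        have um: "ucdf (A k) \<in> borel_measurable (uniform_measure lborel (A k))"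
          using continuous_ucdf[OF A Asub pos]
          by (simp add: borel_measurable_eq_borel[of "uniform_measure lborel (A k)"] borel_measurable_continuous_onI)
        have e0: "ennreal (a k) \<noteq> 0" "ennreal (a k) \<noteq> \<top>" using True by auto
        have divide_right_cancel: "x / c = y / c \<longleftrightarrow> x = y" if "c \<noteq> 0" "c \<noteq> \<top>" for x y c :: ennreal
          using mult_divide_eq_ennreal[OF that, of x] mult_divide_eq_ennreal[OF that, of y]
          by (metis ennreal_times_divide mult.commute)
        have GY: "(\<lambda>v. G k (Y k v)) \<in> borel_measurable borel" using measurable_compose[OF Y(1) G] .
        have Gs: "(\<lambda>z. G k (snd z)) \<in> borel_measurable \<pi>" using measurable_compose[OF \<pi>p(7) G] .
        have "(\<integral>\<^sup>+w. G k (V k w) * indicator (A k) w \<partial>lborel) / emeasure lborel (A k) =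
            (\<integral>\<^sup>+w. G k (V k w) \<partial>uniform_measure lborel (A k))"
          using GV A by (intro nn_integral_uniform_measure[symmetric]) auto
        also have "\<dots> = (\<integral>\<^sup>+w. G k (Y k (ucdf (A k) w)) \<partial>uniform_measure lborel (A k))"
          using True by (simp add: V_def)
        also have "\<dots> = (\<integral>\<^sup>+v. G k (Y k v) \<partial>distr (uniform_measure lborel (A k)) borel (ucdf (A k)))"
          using um GY by (intro nn_integral_distr[symmetric]) auto
        also have "\<dots> = (\<integral>\<^sup>+v. G k (Y k v) \<partial>Om)" by (simp only: distr_ucdf[OF A Asub pos])
        also have "\<dots> = (\<integral>\<^sup>+y. G k y \<partial>distr Om borel (Y k))"
          using Y(1) G by (intro nn_integral_distr[symmetric]) (auto simp: measurable_Om)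
        also have "\<dots> = (\<integral>\<^sup>+y. G k y \<partial>\<nu> k)" using Y(2)[OF True] by simp
        also have "\<dots> = (\<integral>\<^sup>+z. G k (snd z) \<partial>uniform_measure \<pi> (S k))"
          unfolding \<nu>_def using \<pi>p(7) G
          by (intro nn_integral_distr) (simp_all add: measurable_cong_sets[OF sets_uniform_measure refl])
        also have "\<dots> = (\<integral>\<^sup>+z. G k (snd z) * indicator (S k) z \<partial>\<pi>) / emeasure \<pi> (S k)"
          using Gs S' by (intro nn_integral_uniform_measure) auto
        finally have "(\<integral>\<^sup>+w. G k (V k w) * indicator (A k) w \<partial>lborel) / ennreal (a k) =
            (\<integral>\<^sup>+z. G k (snd z) * indicator (S k) z \<partial>\<pi>) / ennreal (a k)"
          using AS[of k] afin[of k] by simp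
        then have "(\<integral>\<^sup>+w. G k (V k w) * indicator (A k) w \<partial>lborel) = (\<integral>\<^sup>+z. G k (snd z) * indicator (S k) z \<partial>\<pi>)"
          using divide_right_cancel[OF e0] by simp
        then show ?thesis using L by (simp add: S_def)
      next
        case False
        then have "a k = 0" using measure_nonneg[of lborel "A k"] by (simp add: a_def)
        then have z: "emeasure lborel (A k) = 0" "emeasure \<pi> (S k) = 0" using afin AS by auto
        have "(\<integral>\<^sup>+w. G k (V k w) * indicator (A k) w \<partial>lborel) = 0"
          using z(1) A GV by (subst nn_integral_0_iff_AE) (auto intro!: AE_I'[of "A k"] simp: null_sets_def indicator_def)
        moreover have "(\<integral>\<^sup>+z. G k (snd z) * indicator (S k) z \<partial>\<pi>) = 0"
          using z(2) S' measurable_compose[OF \<pi>p(7) G]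
          by (subst nn_integral_0_iff_AE) (auto intro!: AE_I'[of "S k"] simp: null_sets_def indicator_def)
        ultimately show ?thesis using L by (simp add: S_def)
      qed
    qed
    also have "\<dots> = (\<integral>\<^sup>+z. G (I (fst z)) (snd z) \<partial>\<pi>)"
    proof (rule nn_integral_index[symmetric])
      show "(\<lambda>z. I (fst z)) \<in> \<pi> \<rightarrow>\<^sub>M count_space UNIV" using measurable_compose[OF \<pi>p(6) I] .
      show "(\<lambda>z. G k (snd z)) \<in> borel_measurable \<pi>" for k using measurable_compose[OF \<pi>p(7) G] .
    qed
    finally show "(\<integral>\<^sup>+w. G (I (X w)) (X' w) \<partial>Om) = (\<integral>\<^sup>+z. G (I (fst z)) (snd z) \<partial>\<pi>)" .
  qed
qed

text \<open>X is coupled through the index of a small ball that contains it. The error is the size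
  of the ball, hence the slack \<delta> in both costs, while the law of X + Y is exact.\<close>

lemma transfer_coupling:
  fixes X :: "real \<Rightarrow> 'x::euclidean_space"
  assumes real: "\<And>\<nu> :: 'x measure. \<nu> \<in> P2 \<Longrightarrow> \<exists>Y. sq_int Y \<and> distr Om borel Y = \<nu>"
    and X: "sq_int X" "distr Om borel X = \<mu>"
    and \<pi>: "\<pi> \<in> couplings \<mu> \<mu>'" "\<mu> \<in> P2" "\<mu>' \<in> P2" and \<delta>: "0 < \<delta>"
  obtains Y where "sq_int Y" "distr Om borel (\<lambda>w. X w + Y w) = \<mu>'"
    "(\<integral>w. norm (Y w) \<partial>Om) \<le> cost \<pi> + \<delta>"
    "(\<integral>w. (norm (Y w))\<^sup>2 \<partial>Om) \<le> (\<integral>z. (norm (fst z - snd z))\<^sup>2 \<partial>\<pi>) + \<delta>"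
proof -
  note \<pi>p = couplingD[OF \<pi>]
  interpret p: prob_space \<pi> by (rule \<pi>p(1))
  interpret o: prob_space Om by (rule prob_space_Om)
  have Xm: "X \<in> borel_measurable borel" using X(1) by (simp add: sq_int_def measurable_Om)
  \<comment> \<open>The excess is 2 \<eta> in the mean and 4 \<eta> \<open>cost \<pi>\<close> + 4
    \<eta>^2 in the mean square. Both are at most \<eta> (4 \<open>cost \<pi>\<close> + 4), hence at
    most \<delta>.\<close>
  define \<eta> where "\<eta> = min 1 (\<delta> / (4 * cost \<pi> + 4))"
  have d: "0 < 4 * cost \<pi> + 4" using cost_nonneg[of \<pi>] by linarith
  have \<eta>: "0 < \<eta>" "\<eta> \<le> 1" using \<delta> d by (auto simp: \<eta>_def)
  have "\<eta> * (4 * cost \<pi> + 4) \<le> \<delta> / (4 * cost \<pi> + 4) * (4 * cost \<pi> + 4)" using d by (intro mult_right_mono) (auto simp: \<eta>_def)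
  then have \<eta>2: "\<eta> * (4 * cost \<pi> + 4) \<le> \<delta>" using d by simp
  obtain D :: "'x set" where D: "countable D" "\<And>X. open X \<Longrightarrow> X \<noteq> {} \<Longrightarrow> \<exists>d\<in>D. d \<in> X"
    by (rule countable_dense_setE) blast
  define c where "c = from_nat_into D"
  have "D \<noteq> {}" using D(2)[of UNIV] by auto
  then have c: "\<exists>k. dist x (c k) < \<eta>" for x
    using D(2)[of "ball x \<eta>"] \<eta> from_nat_into_surj[OF D(1)] unfolding c_def by (metis ball_eq_empty mem_ball not_le open_ball)
  \<comment> \<open>The least index picks one centre for each point and keeps the cell map
    measurable.\<close>
  define I where "I x = (LEAST k. dist x (c k) < \<eta>)" for x
  have I: "dist x (c (I x)) < \<eta>" for x unfolding I_def using c[of x] by (rule LeastI_ex)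
  have Im: "I \<in> borel \<rightarrow>\<^sub>M count_space UNIV" unfolding I_def by measurable
  obtain X' where X': "X' \<in> borel_measurable borel"
    "\<And>G :: nat \<Rightarrow> 'x \<Rightarrow> ennreal. (\<And>k. G k \<in> borel_measurable borel) \<Longrightarrow>
      (\<integral>\<^sup>+w. G (I (X w)) (X' w) \<partial>Om) = (\<integral>\<^sup>+z. G (I (fst z)) (snd z) \<partial>\<pi>)"
    using transfer_index[OF real Xm X(2) \<pi> Im] by metis
  have mX: "X' \<in> borel_measurable Om" "X \<in> borel_measurable Om" using X'(1) Xm by (auto simp: measurable_Om)
  have law: "distr Om borel X' = \<mu>'"
  proof (rule measure_eqI)
    fix B assume B: "B \<in> sets (distr Om borel X')"
    have "emeasure (distr Om borel X') B = (\<integral>\<^sup>+w. indicator B w \<partial>distr Om borel X')" using B by simp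
    also have "\<dots> = (\<integral>\<^sup>+w. indicator B (X' w) \<partial>Om)" using mX B by (intro nn_integral_distr) auto
    also have "\<dots> = (\<integral>\<^sup>+z. indicator B (snd z) \<partial>\<pi>)" using X'(2)[of "\<lambda>_. indicator B"] B by simp
    also have "\<dots> = (\<integral>\<^sup>+w. indicator B w \<partial>distr \<pi> borel snd)" using \<pi>p(7) B by (intro nn_integral_distr[symmetric]) auto
    also have "\<dots> = emeasure \<mu>' B" using B \<pi>p(5) P2D(2)[OF \<pi>(3)] by simp
    finally show "emeasure (distr Om borel X') B = emeasure \<mu>' B" .
  qed (simp add: P2D(2)[OF \<pi>(3)])
  have q: "sqi Om X" "sqi Om X'"
    using X(1) \<pi>(3) law sqi_iff_P2[OF prob_space_Om mX(1)] by (auto simp: sq_int_sqi)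
  define Y where "Y w = X' w - X w" for w
  have Yq: "sqi Om Y" unfolding Y_def by (rule sqi_diff[OF prob_space_Om q(2,1)])
  note Yi = sqi_integrable[OF prob_space_Om Yq]
  have Yi2: "integrable Om (\<lambda>w. (norm (Y w))\<^sup>2)" using Yq by (simp add: sqi_def)
  have b1: "norm (Y w) \<le> norm (c (I (X w)) - X' w) + \<eta>" for w
    using I[of "X w"] norm_triangle_ineq4[of "c (I (X w)) - X' w" "c (I (X w)) - X w"]
    by (simp add: Y_def dist_norm norm_minus_commute)
  have b2: "norm (c (I x) - y) \<le> norm (x - y) + \<eta>" for x y
    using I[of x] norm_triangle_ineq[of "c (I x) - x" "x - y"] by (simp add: dist_norm norm_minus_commute)
  \<comment> \<open>Needed for the identity and for the square. Replacing a point by the centre of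
    its cell costs \<eta> on \<open>Om\<close> and once more \<eta> on \<pi>.\<close>
  have E: "(\<integral>w. F (norm (Y w)) \<partial>Om) \<le> (\<integral>z. F (norm (fst z - snd z) + 2 * \<eta>) \<partial>\<pi>)"
    if F: "\<And>s t. 0 \<le> s \<Longrightarrow> s \<le> t \<Longrightarrow> 0 \<le> F s \<and> F s \<le> F t" "F \<in> borel_measurable borel" "integrable Om (\<lambda>w. F (norm (Y w)))"
      "integrable \<pi> (\<lambda>z. F (norm (fst z - snd z) + 2 * \<eta>))" for F :: "real \<Rightarrow> real"
  proof -
    have F0: "0 \<le> F s" if "0 \<le> s" for s using F(1)[OF that] by auto
    have "ennreal (\<integral>w. F (norm (Y w)) \<partial>Om) = (\<integral>\<^sup>+w. ennreal (F (norm (Y w))) \<partial>Om)"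
      using F(3) F0 by (intro nn_integral_eq_integral[symmetric]) auto
    also have "\<dots> \<le> (\<integral>\<^sup>+w. ennreal (F (norm (c (I (X w)) - X' w) + \<eta>)) \<partial>Om)"
      using F(1) b1 by (intro nn_integral_mono ennreal_leI) auto
    also have "\<dots> = (\<integral>\<^sup>+z. ennreal (F (norm (c (I (fst z)) - snd z) + \<eta>)) \<partial>\<pi>)"
      by (rule X'(2)[of "\<lambda>k y. ennreal (F (norm (c k - y) + \<eta>))"]) (use F(2) in measurable)
    also have "\<dots> \<le> (\<integral>\<^sup>+z. ennreal (F (norm (fst z - snd z) + 2 * \<eta>)) \<partial>\<pi>)"
    proof (intro nn_integral_mono ennreal_leI)
      fix z :: "'x \<times> 'x"
      show "F (norm (c (I (fst z)) - snd z) + \<eta>) \<le> F (norm (fst z - snd z) + 2 * \<eta>)"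
        using F(1)[of "norm (c (I (fst z)) - snd z) + \<eta>" "norm (fst z - snd z) + 2 * \<eta>"] b2[of "fst z" "snd z"] \<eta>(1) by auto
    qed
    also have "\<dots> = ennreal (\<integral>z. F (norm (fst z - snd z) + 2 * \<eta>) \<partial>\<pi>)"
      using F(4) F0 \<eta> by (intro nn_integral_eq_integral) auto
    finally show ?thesis using F0 \<eta> by (subst (asm) ennreal_le_iff) (auto intro!: integral_nonneg_AE)
  qed
  show thesis
  proof
    show "sq_int Y" using Yq by (simp add: sq_int_sqi)
    show "distr Om borel (\<lambda>w. X w + Y w) = \<mu>'" using law by (simp add: Y_def)
    have "(\<integral>w. norm (Y w) \<partial>Om) \<le> (\<integral>z. norm (fst z - snd z) + 2 * \<eta> \<partial>\<pi>)"
      by (rule E[of "\<lambda>x. x"]) (use Yi \<pi>p(10) in auto)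
    also have "\<dots> = cost \<pi> + 2 * \<eta>" using \<pi>p(10) p.prob_space by (simp add: cost_def)
    also have "2 * \<eta> \<le> \<eta> * (4 * cost \<pi> + 4)" using \<eta> mult_nonneg_nonneg[of \<eta> "cost \<pi>"] by (simp add: algebra_simps)
    also note \<eta>2
    finally show "(\<integral>w. norm (Y w) \<partial>Om) \<le> cost \<pi> + \<delta>" by simp
    have ex: "(norm (fst z - snd z) + 2 * \<eta>)\<^sup>2 = (norm (fst z - snd z))\<^sup>2 + 4 * \<eta> * norm (fst z - snd z) + 4 * \<eta>\<^sup>2" for z :: "'x \<times> 'x"
      by (simp add: power2_eq_square algebra_simps)
    have "(\<integral>w. (norm (Y w))\<^sup>2 \<partial>Om) \<le> (\<integral>z. (norm (fst z - snd z) + 2 * \<eta>)\<^sup>2 \<partial>\<pi>)"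
    proof (rule E[of "\<lambda>x. x\<^sup>2"])
      show "integrable \<pi> (\<lambda>z. (norm (fst z - snd z) + 2 * \<eta>)\<^sup>2)" unfolding ex using \<pi>p(10,11) by simp
    qed (use Yi2 in \<open>auto intro: power_mono\<close>)
    also have "\<dots> = (\<integral>z. (norm (fst z - snd z))\<^sup>2 \<partial>\<pi>) + (4 * \<eta> * cost \<pi> + 4 * \<eta>\<^sup>2)"
      unfolding ex using \<pi>p(10,11) p.prob_space by (simp add: cost_def)
    also have "4 * \<eta> * cost \<pi> + 4 * \<eta>\<^sup>2 \<le> \<eta> * (4 * cost \<pi> + 4)"
      using \<eta> mult_left_mono[of \<eta> 1 \<eta>] by (simp add: power2_eq_square algebra_simps)
    also note \<eta>2
    finally show "(\<integral>w. (norm (Y w))\<^sup>2 \<partial>Om) \<le> (\<integral>z. (norm (fst z - snd z))\<^sup>2 \<partial>\<pi>) + \<delta>" by simp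
  qed
qed

subsection \<open>Functions with a bounded L-derivative\<close>

text \<open>Near each point of the displacement path, h is compared with its linearization at a
  random variable of that law. The linear part is controlled by the mean of |Y|, because the
  derivative is bounded uniformly; the remainder sees only the mean square and carries the small
  factor e. This is why the first-order cost survives although the lift is differentiable only in
  the mean square.\<close>

lemma L_deriv_imp_lipschitz:
  fixes h :: "'x::euclidean_space measure \<Rightarrow> 'b::{banach, second_countable_topology}"
  assumes D: "\<And>\<nu>. \<nu> \<in> P2 \<Longrightarrow> has_L_deriv h (D \<nu>) \<nu>"
    and bnd: "\<And>\<nu> u. \<nu> \<in> P2 \<Longrightarrow> \<rho> \<le> mnorm 1 \<nu> \<Longrightarrow> norm (D \<nu> u) \<le> l" and l: "0 \<le> l"
    and \<pi>: "\<pi> \<in> couplings \<mu> \<mu>'" "\<mu> \<in> P2" "\<mu>' \<in> P2" and \<rho>: "\<rho> \<le> mnorm 1 \<mu> - cost \<pi>"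
  shows "norm (h \<mu> - h \<mu>') \<le> l * cost \<pi>"
proof -
  \<comment> \<open>Having an L-derivative at a law includes a realization of this law on
    [0, 1].\<close>
  have real: "\<exists>Y. sq_int Y \<and> distr Om borel Y = \<nu>" if "\<nu> \<in> P2" for \<nu> :: "'x measure"
    using D[OF that] unfolding has_L_deriv_def by blast
  define c2 where "c2 = sqrt (\<integral>z. (norm (fst z - snd z))\<^sup>2 \<partial>\<pi>)"
  have c2: "0 \<le> c2" "c2\<^sup>2 = (\<integral>z. (norm (fst z - snd z))\<^sup>2 \<partial>\<pi>)" by (simp_all add: c2_def)
  note AP = disp_P2[OF \<pi>]
  have loc: "\<exists>d>0. \<forall>t. 0 \<le> t \<longrightarrow> t \<le> 1 \<longrightarrow> \<bar>t - s\<bar> < d \<longrightarrow>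
      norm (h (disp \<pi> t) - h (disp \<pi> s)) \<le> (l * cost \<pi> + e * (l + c2 + e)) * \<bar>t - s\<bar>"
    if s: "0 \<le> s" "s \<le> 1" and e: "0 < e" for s e
  proof -
    have "\<bar>mnorm 1 (disp \<pi> s) - mnorm 1 \<mu>\<bar> \<le> cost \<pi>" by (rule mnorm_disp[OF \<pi> s])
    then have rs: "\<rho> \<le> mnorm 1 (disp \<pi> s)" using \<rho> by linarith
    obtain X where X: "sq_int X" "distr Om borel X = disp \<pi> s"
      "\<forall>e>0. \<exists>d>0. \<forall>Y. sq_int Y \<and> sqrt (\<integral>w. (norm (Y w))\<^sup>2 \<partial>Om) < d \<longrightarrow>
           norm (h (distr Om borel (\<lambda>w. X w + Y w)) - h (disp \<pi> s) - (\<integral>w. blinfun_apply (D (disp \<pi> s) (X w)) (Y w) \<partial>Om))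
             \<le> e * sqrt (\<integral>w. (norm (Y w))\<^sup>2 \<partial>Om)"
      using D[OF AP[of s]] unfolding has_L_deriv_def by blast
    obtain d where d: "d > 0" "\<And>Y. sq_int Y \<Longrightarrow> sqrt (\<integral>w. (norm (Y w))\<^sup>2 \<partial>Om) < d \<Longrightarrow>
           norm (h (distr Om borel (\<lambda>w. X w + Y w)) - h (disp \<pi> s) - (\<integral>w. blinfun_apply (D (disp \<pi> s) (X w)) (Y w) \<partial>Om))
             \<le> e * sqrt (\<integral>w. (norm (Y w))\<^sup>2 \<partial>Om)"
      using X(3) e by blast
    have ce: "0 < c2 + e" using c2 e by linarith
    show ?thesis
    proof (intro exI[of _ "d / (c2 + e)"] conjI allI impI)
      show "0 < d / (c2 + e)" using d ce by simp
      fix t assume t: "0 \<le> t" "t \<le> 1" "\<bar>t - s\<bar> < d / (c2 + e)"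
      show "norm (h (disp \<pi> t) - h (disp \<pi> s)) \<le> (l * cost \<pi> + e * (l + c2 + e)) * \<bar>t - s\<bar>"
      proof (cases "t = s")
        case False
        define \<tau> where "\<tau> = \<bar>t - s\<bar>"
        have tau: "0 < \<tau>" "\<tau> * (c2 + e) < d" using False t ce by (auto simp: \<tau>_def pos_less_divide_eq)
        obtain \<kappa> where k: "\<kappa> \<in> couplings (disp \<pi> s) (disp \<pi> t)" "cost \<kappa> = \<bar>s - t\<bar> * cost \<pi>"
          "(\<integral>z. (norm (fst z - snd z))\<^sup>2 \<partial>\<kappa>) = (s - t)\<^sup>2 * (\<integral>z. (norm (fst z - snd z))\<^sup>2 \<partial>\<pi>)"
          by (rule disp_coupling[OF \<pi>])
        have st: "\<bar>s - t\<bar> = \<tau>" "(s - t)\<^sup>2 = \<tau>\<^sup>2" by (auto simp: \<tau>_def power2_commute)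
        \<comment> \<open>Keeps the excess of the transferred coupling of order \<tau> e in the mean
          and of order (\<tau> e)^2 in the mean square.\<close>
        define \<delta> where "\<delta> = min (\<tau> * e) ((\<tau> * e)\<^sup>2)"
        have \<delta>: "0 < \<delta>" "\<delta> \<le> \<tau> * e" "\<delta> \<le> (\<tau> * e)\<^sup>2" using tau e by (auto simp: \<delta>_def)
        obtain Y where Y: "sq_int Y" "distr Om borel (\<lambda>w. X w + Y w) = disp \<pi> t"
          "(\<integral>w. norm (Y w) \<partial>Om) \<le> cost \<kappa> + \<delta>"
          "(\<integral>w. (norm (Y w))\<^sup>2 \<partial>Om) \<le> (\<integral>z. (norm (fst z - snd z))\<^sup>2 \<partial>\<kappa>) + \<delta>"
          by (rule transfer_coupling[OF real X(1,2) k(1) AP AP \<delta>(1)])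
        have Y1: "(\<integral>w. norm (Y w) \<partial>Om) \<le> \<tau> * cost \<pi> + \<tau> * e" using Y(3) k(2) st \<delta>(2) by simp
        have "(\<integral>w. (norm (Y w))\<^sup>2 \<partial>Om) \<le> \<tau>\<^sup>2 * c2\<^sup>2 + (\<tau> * e)\<^sup>2"
          using Y(4) k(3) st c2(2) \<delta>(3) by simp
        also have "\<dots> \<le> (\<tau> * (c2 + e))\<^sup>2" using tau c2(1) e by (simp add: power2_eq_square algebra_simps)
        finally have "sqrt (\<integral>w. (norm (Y w))\<^sup>2 \<partial>Om) \<le> sqrt ((\<tau> * (c2 + e))\<^sup>2)" by (rule real_sqrt_le_mono)
        then have Y2: "sqrt (\<integral>w. (norm (Y w))\<^sup>2 \<partial>Om) \<le> \<tau> * (c2 + e)" using tau ce by simp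
        let ?J = "\<integral>w. blinfun_apply (D (disp \<pi> s) (X w)) (Y w) \<partial>Om"
        have "norm (h (disp \<pi> t) - h (disp \<pi> s) - ?J) \<le> e * sqrt (\<integral>w. (norm (Y w))\<^sup>2 \<partial>Om)"
          using d(2)[OF Y(1)] Y2 tau(2) unfolding Y(2) by linarith
        also have "\<dots> \<le> e * (\<tau> * (c2 + e))" using Y2 e by (intro mult_left_mono) auto
        finally have r: "norm (h (disp \<pi> t) - h (disp \<pi> s) - ?J) \<le> e * (\<tau> * (c2 + e))" .
        have "norm ?J \<le> (\<integral>w. norm (blinfun_apply (D (disp \<pi> s) (X w)) (Y w)) \<partial>Om)" by (rule integral_norm_bound)
        also have "\<dots> \<le> (\<integral>w. l * norm (Y w) \<partial>Om)"
        proof (rule integral_mono')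
          show "integrable Om (\<lambda>w. l * norm (Y w))"
            using sqi_integrable[OF prob_space_Om Y(1)[unfolded sq_int_sqi]] by (rule integrable_mult_right)
          fix w
          have "norm (blinfun_apply (D (disp \<pi> s) (X w)) (Y w)) \<le> norm (D (disp \<pi> s) (X w)) * norm (Y w)" by (rule norm_blinfun)
          also have "\<dots> \<le> l * norm (Y w)" using bnd[OF AP rs] by (intro mult_right_mono) auto
          finally show "norm (blinfun_apply (D (disp \<pi> s) (X w)) (Y w)) \<le> l * norm (Y w)" .
          show "0 \<le> l * norm (Y w)" using l by simp
        qed
        also have "\<dots> = l * (\<integral>w. norm (Y w) \<partial>Om)" by simp
        also have "\<dots> \<le> l * (\<tau> * cost \<pi> + \<tau> * e)" using Y1 l by (intro mult_left_mono)
        finally have "norm ?J \<le> l * (\<tau> * cost \<pi> + \<tau> * e)" .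
        then have "norm (h (disp \<pi> t) - h (disp \<pi> s)) \<le> e * (\<tau> * (c2 + e)) + l * (\<tau> * cost \<pi> + \<tau> * e)"
          using r norm_triangle_sub[of "h (disp \<pi> t) - h (disp \<pi> s)" ?J] by linarith
        also have "\<dots> = (l * cost \<pi> + e * (l + c2 + e)) * \<tau>" by (simp add: algebra_simps)
        finally show ?thesis by (simp add: \<tau>_def)
      qed simp
    qed
  qed
  have glob: "norm (h \<mu> - h \<mu>') \<le> l * cost \<pi> + e * (l + c2 + e)" if e: "0 < e" for e
  proof -
    let ?k = "l * cost \<pi> + e * (l + c2 + e)"
    \<comment> \<open>The radius in \<open>loc\<close> depends on s, so the local bounds are joined
      by bisection, \<Psi> being additive over adjacent intervals.\<close>
    define \<Psi> where "\<Psi> a b \<longleftrightarrow> (0 \<le> a \<and> b \<le> 1 \<longrightarrow> norm (h (disp \<pi> b) - h (disp \<pi> a)) \<le> ?k * (b - a))" for a b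
    have "\<Psi> 0 1"
      using zero_le_one
    proof (induction rule: Bolzano)
      case (trans a b c)
      show ?case
        unfolding \<Psi>_def
      proof
        assume "0 \<le> a \<and> c \<le> 1"
        then have "norm (h (disp \<pi> b) - h (disp \<pi> a)) \<le> ?k * (b - a)" "norm (h (disp \<pi> c) - h (disp \<pi> b)) \<le> ?k * (c - b)"
          using trans by (auto simp: \<Psi>_def)
        then have "norm (h (disp \<pi> c) - h (disp \<pi> a)) \<le> ?k * (b - a) + ?k * (c - b)"
          using norm_triangle_ineq[of "h (disp \<pi> c) - h (disp \<pi> b)" "h (disp \<pi> b) - h (disp \<pi> a)"] by simp
        also have "\<dots> = ?k * (c - a)" by (simp only: distrib_left[symmetric]) simp
        finally show "norm (h (disp \<pi> c) - h (disp \<pi> a)) \<le> ?k * (c - a)" .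
      qed
    next
      case (local x)
      obtain d where d: "d > 0" "\<And>t. 0 \<le> t \<Longrightarrow> t \<le> 1 \<Longrightarrow> \<bar>t - x\<bar> < d \<Longrightarrow> norm (h (disp \<pi> t) - h (disp \<pi> x)) \<le> ?k * \<bar>t - x\<bar>"
        using loc[OF local(1,2) e] by blast
      show ?case
        unfolding \<Psi>_def
      proof (intro exI[of _ d] conjI allI impI)
        fix a b assume ab: "a \<le> x \<and> x \<le> b \<and> b - a < d" and "0 \<le> a \<and> b \<le> 1"
        then have "norm (h (disp \<pi> b) - h (disp \<pi> x)) \<le> ?k * \<bar>b - x\<bar>" "norm (h (disp \<pi> a) - h (disp \<pi> x)) \<le> ?k * \<bar>a - x\<bar>"
          by (intro d(2); simp)+
        then have "norm (h (disp \<pi> b) - h (disp \<pi> a)) \<le> ?k * \<bar>b - x\<bar> + ?k * \<bar>a - x\<bar>"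
          using norm_triangle_ineq4[of "h (disp \<pi> b) - h (disp \<pi> x)" "h (disp \<pi> a) - h (disp \<pi> x)"] by simp
        also have "\<dots> = ?k * (b - a)" using ab by (simp only: distrib_left[symmetric]) simp
        finally show "norm (h (disp \<pi> b) - h (disp \<pi> a)) \<le> ?k * (b - a)" .
      qed (use d in auto)
    qed
    then show ?thesis using disp_0[OF \<pi>] disp_1[OF \<pi>] by (simp add: \<Psi>_def norm_minus_commute)
  qed
  show ?thesis
  proof (rule field_le_epsilon)
    fix \<epsilon> :: real assume \<epsilon>: "0 < \<epsilon>"
    define e where "e = min 1 (\<epsilon> / (l + c2 + 1))"
    have k: "0 < l + c2 + 1" using l c2 by linarith
    have e: "0 < e" "e \<le> 1" using \<epsilon> k by (auto simp: e_def)
    have "e * (l + c2 + e) \<le> e * (l + c2 + 1)" using e by (intro mult_left_mono) auto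
    also have "\<dots> \<le> \<epsilon> / (l + c2 + 1) * (l + c2 + 1)" using k by (intro mult_right_mono) (auto simp: e_def)
    also have "\<dots> = \<epsilon>" using k by simp
    finally show "norm (h \<mu> - h \<mu>') \<le> l * cost \<pi> + \<epsilon>" using glob[OF e(1)] by linarith
  qed
qed

subsection \<open>A contraction principle with pointwise weights\<close>

lemma le_of_halving:
  fixes x a b :: real
  assumes "\<And>n::nat. x \<le> a + b / 2 ^ n"
  shows "x \<le> a"
proof -
  have "(\<lambda>n. (1 / 2 :: real) ^ n) \<longlonglongrightarrow> 0" using LIMSEQ_power_zero[of "1 / 2 :: real"] by simp
  then have "(\<lambda>n. a + b * (1 / 2) ^ n) \<longlonglongrightarrow> a + b * 0" by (intro tendsto_add tendsto_mult tendsto_const)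
  then have "(\<lambda>n. a + b / 2 ^ n) \<longlonglongrightarrow> a" by (simp add: power_divide)
  then show ?thesis using assms by (intro LIMSEQ_le_const) auto
qed

text \<open>2 * e is the fixed point of b -> b / 2 + e, and the excess over it is halved each
  time.\<close>

lemma halving_iteration:
  fixes P :: "real \<Rightarrow> bool" and e b :: real
  assumes "\<And>b. 0 \<le> b \<Longrightarrow> P b \<Longrightarrow> P (b / 2 + e)" "P b" "0 \<le> b" "0 \<le> e"
    and "\<And>a b. a \<le> b \<Longrightarrow> P a \<Longrightarrow> P b"
  shows "P (2 * e + b / 2 ^ n)"
proof (induction n)
  case 0
  show ?case by (rule assms(5)[OF _ assms(2)]) (use assms(4) in simp)
next
  case (Suc n)
  have "0 \<le> 2 * e + b / 2 ^ n" using assms(3,4) by simp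
  from assms(1)[OF this Suc] show ?case by (simp add: add_divide_distrib mult.commute)
qed

text \<open>Banach's argument carried out index by index. Completeness is used only in the values,
  and \<open>S\<close> has to be closed only under pointwise limits on \<open>I\<close>, so no
  metric on the space of functions is set up and unbounded weights do no harm.\<close>

lemma weighted_contraction:
  fixes S :: "('i \<Rightarrow> 'b::banach) set" and w :: "'i \<Rightarrow> real"
  assumes closed: "\<And>U u. (\<And>n::nat. U n \<in> S) \<Longrightarrow> (\<And>i. i \<in> I \<Longrightarrow> (\<lambda>n. U n i) \<longlonglongrightarrow> u i) \<Longrightarrow> u \<in> S"
    and maps: "\<And>u. u \<in> S \<Longrightarrow> F u \<in> S" and ne: "u0 \<in> S"
    and C: "0 \<le> C" and w: "\<And>i. i \<in> I \<Longrightarrow> 0 \<le> w i"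
    and bdd: "\<And>u v i. u \<in> S \<Longrightarrow> v \<in> S \<Longrightarrow> i \<in> I \<Longrightarrow> norm (u i - v i) \<le> C * w i"
    and contr: "\<And>u v b i. u \<in> S \<Longrightarrow> v \<in> S \<Longrightarrow> 0 \<le> b \<Longrightarrow> (\<And>i. i \<in> I \<Longrightarrow> norm (u i - v i) \<le> b * w i) \<Longrightarrow> i \<in> I \<Longrightarrow>
        norm (F u i - F v i) \<le> b / 2 * w i"
  obtains u where "u \<in> S" "\<And>i. i \<in> I \<Longrightarrow> F u i = u i"
proof -
  define U where "U n = (F ^^ n) u0" for n :: nat
  have U0: "U 0 = u0" and US: "U (Suc n) = F (U n)" for n by (simp_all add: U_def)
  have S: "U n \<in> S" for n by (induction n) (simp_all add: U0 US ne maps)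
  have step: "i \<in> I \<Longrightarrow> norm (U (Suc n) i - U n i) \<le> C / 2 ^ n * w i" for n i
  proof (induction n arbitrary: i)
    case 0
    then show ?case using bdd[OF S[of "Suc 0"] S[of 0]] by simp
  next
    case (Suc n)
    have "norm (F (U (Suc n)) i - F (U n) i) \<le> C / 2 ^ n / 2 * w i"
      by (rule contr[OF S S]) (use C Suc in auto)
    then show ?case by (simp add: US)
  qed
  \<comment> \<open>2 - 2 / 2^k is the partial sum of the geometric series.\<close>
  have far: "norm (U (n + k) i - U n i) \<le> (2 - 2 / 2 ^ k) * (C / 2 ^ n * w i)" if i: "i \<in> I" for n k i
  proof (induction k)
    case (Suc k)
    have "norm (U (Suc (n + k)) i - U n i) \<le> norm (U (Suc (n + k)) i - U (n + k) i) + norm (U (n + k) i - U n i)"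
      using norm_triangle_ineq[of "U (Suc (n + k)) i - U (n + k) i" "U (n + k) i - U n i"] by simp
    also have "\<dots> \<le> C / 2 ^ (n + k) * w i + (2 - 2 / 2 ^ k) * (C / 2 ^ n * w i)"
      by (intro add_mono step Suc i)
    also have "\<dots> = (1 / 2 ^ k) * (C / 2 ^ n * w i) + (2 - 2 / 2 ^ k) * (C / 2 ^ n * w i)"
      by (simp add: power_add)
    also have "\<dots> = (1 / 2 ^ k + (2 - 2 / 2 ^ k)) * (C / 2 ^ n * w i)" by (simp only: distrib_right)
    also have "1 / 2 ^ k + (2 - 2 / 2 ^ k) = 2 - 2 / (2::real) ^ Suc k" by simp
    finally show ?case by simp
  qed simp
  have far': "norm (U m i - U n i) \<le> 2 * C * w i / 2 ^ n" if i: "i \<in> I" and "n \<le> m" for n m i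
  proof -
    obtain k where k: "m = n + k" using \<open>n \<le> m\<close> le_Suc_ex by blast
    have "(2 - 2 / 2 ^ k) * (C / 2 ^ n * w i) \<le> 2 * (C / 2 ^ n * w i)"
      using C w[OF i] by (intro mult_right_mono) auto
    then have "norm (U m i - U n i) \<le> 2 * (C / 2 ^ n * w i)" unfolding k by (rule order_trans[OF far[OF i]])
    then show ?thesis by simp
  qed
  have cau: "Cauchy (\<lambda>n. U n i)" if i: "i \<in> I" for i
  proof (rule metric_CauchyI)
    fix e :: real assume e: "0 < e"
    have "(\<lambda>n. (2 * C * w i) * (1 / 2) ^ n) \<longlonglongrightarrow> (2 * C * w i) * 0"
      by (intro tendsto_intros LIMSEQ_power_zero) simp
    then have "eventually (\<lambda>n. (2 * C * w i) * (1 / 2) ^ n < e / 2) sequentially"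
      using e by (intro order_tendstoD(2)[where y = "(2 * C * w i) * 0"]) auto
    then obtain N where N: "(2 * C * w i) * (1 / 2) ^ N < e / 2" by (auto simp: eventually_sequentially)
    show "\<exists>N. \<forall>m\<ge>N. \<forall>n\<ge>N. dist (U m i) (U n i) < e"
    proof (intro exI[of _ N] allI impI)
      fix m n assume "N \<le> m" "N \<le> n"
      then have "dist (U m i) (U N i) < e / 2" "dist (U n i) (U N i) < e / 2"
        using far'[OF i, of N m] far'[OF i, of N n] N by (auto simp: dist_norm power_divide)
      then show "dist (U m i) (U n i) < e" by (rule dist_triangle_half_l)
    qed
  qed
  define u where "u i = lim (\<lambda>n. U n i)" for i
  have lim: "(\<lambda>n. U n i) \<longlonglongrightarrow> u i" if "i \<in> I" for i
    unfolding u_def using cau[OF that] by (simp add: Cauchy_convergent_iff convergent_LIMSEQ_iff)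
  have uS: "u \<in> S" using closed[OF S lim] .
  have near: "norm (u i - U n i) \<le> 2 * C / 2 ^ n * w i" if i: "i \<in> I" for n i
  proof -
    have "(\<lambda>m. norm (U m i - U n i)) \<longlonglongrightarrow> norm (u i - U n i)" by (intro tendsto_intros lim i)
    then show ?thesis
      by (rule LIMSEQ_le_const2) (use far'[OF i] in \<open>auto intro!: exI[of _ n]\<close>)
  qed
  show thesis
  proof (rule that[OF uS])
    fix i assume i: "i \<in> I"
    have "norm (F u i - u i) \<le> 0 + (2 * C * w i) / 2 ^ n" for n :: nat
    proof -
      have "norm (F u i - F (U n) i) \<le> 2 * C / 2 ^ n / 2 * w i"
        by (rule contr[OF uS S _ near i]) (use C in auto)
      moreover have "norm (u i - U (Suc n) i) \<le> 2 * C / 2 ^ Suc n * w i" by (rule near[OF i])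
      moreover have "norm (F u i - u i) \<le> norm (F u i - U (Suc n) i) + norm (u i - U (Suc n) i)"
        using norm_triangle_ineq4[of "F u i - U (Suc n) i" "u i - U (Suc n) i"] by simp
      ultimately show ?thesis by (simp add: US)
    qed
    then have "norm (F u i - u i) \<le> 0" by (rule le_of_halving)
    then show "F u i = u i" by simp
  qed
qed

lemma has_integral_sub:
  fixes f :: "real \<Rightarrow> 'b::euclidean_space"
  assumes "(f has_integral i) {a..b}" "(f has_integral j) {a..c}" "a \<le> b" "b \<le> c"
  shows "(f has_integral (j - i)) {b..c}"
proof -
  have "f integrable_on {b..c}"
    using integrable_on_subinterval[OF has_integral_integrable[OF assms(2)]] assms(3,4) by auto
  then obtain k where k: "(f has_integral k) {b..c}" by blast
  have "(f has_integral (i + k)) {a..c}" by (rule has_integral_combine[OF assms(3,4,1) k])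
  then have "j = i + k" using has_integral_unique assms(2) by blast
  then show ?thesis using k by simp
qed

subsection \<open>Forward-backward systems with Lipschitz coefficients\<close>

text \<open>The system after elimination of the control: B is the drift, A the local and \<Gamma>
  the nonlocal part of the backward driver. The first argument of \<Gamma> is the point where the
  average is evaluated, the last two belong to the integration variable. Lipschitz bounds are asked
  for on the cone only, where the control is well behaved.\<close>

locale fbode =
  fixes B A :: "'x::euclidean_space \<Rightarrow> 'x measure \<Rightarrow> 'x \<Rightarrow> 'x"
    and \<Gamma> :: "'x \<Rightarrow> 'x measure \<Rightarrow> 'x \<Rightarrow> 'x \<Rightarrow> 'x"
    and p :: "'x \<Rightarrow> 'x measure \<Rightarrow> 'x"
    and cone :: "'x \<Rightarrow> 'x measure \<Rightarrow> 'x \<Rightarrow> bool"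
    and L Lp :: real
  assumes L0: "0 < L" and Lp0: "0 < Lp"
    and cone_def: "cone x \<mu> z \<longleftrightarrow> norm z \<le> 2 * Lp * (1 + norm x + mnorm 1 \<mu>)"
    and B_lip: "\<mu> \<in> P2 \<Longrightarrow> \<mu>' \<in> P2 \<Longrightarrow> \<pi> \<in> couplings \<mu> \<mu>' \<Longrightarrow> cone x \<mu> z \<Longrightarrow> cone x' \<mu>' z' \<Longrightarrow>
      norm (B x \<mu> z - B x' \<mu>' z') \<le> L * (norm (x - x') + cost \<pi> + norm (z - z'))"
    and A_lip: "\<mu> \<in> P2 \<Longrightarrow> \<mu>' \<in> P2 \<Longrightarrow> \<pi> \<in> couplings \<mu> \<mu>' \<Longrightarrow> cone x \<mu> z \<Longrightarrow> cone x' \<mu>' z' \<Longrightarrow>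
      norm (A x \<mu> z - A x' \<mu>' z') \<le> L * (norm (x - x') + cost \<pi> + norm (z - z'))"
    and \<Gamma>_lip: "\<mu> \<in> P2 \<Longrightarrow> \<mu>' \<in> P2 \<Longrightarrow> \<pi> \<in> couplings \<mu> \<mu>' \<Longrightarrow> cone x \<mu> z \<Longrightarrow> cone x' \<mu>' z' \<Longrightarrow>
      norm (\<Gamma> u \<mu> x z - \<Gamma> u' \<mu>' x' z') \<le> L * (norm (u - u') + cost \<pi> + norm (x - x') + norm (z - z'))"
    and B_growth: "\<mu> \<in> P2 \<Longrightarrow> cone x \<mu> z \<Longrightarrow> norm (B x \<mu> z) \<le> L * (1 + norm x + mnorm 1 \<mu>)"
    and A_growth: "\<mu> \<in> P2 \<Longrightarrow> cone x \<mu> z \<Longrightarrow> norm (A x \<mu> z) \<le> L * (1 + norm x + mnorm 1 \<mu>)"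
    and \<Gamma>_growth: "\<mu> \<in> P2 \<Longrightarrow> cone x \<mu> z \<Longrightarrow> norm (\<Gamma> u \<mu> x z) \<le> L * (1 + norm u + norm x + mnorm 1 \<mu>)"
    and p_lip: "\<mu> \<in> P2 \<Longrightarrow> \<mu>' \<in> P2 \<Longrightarrow> \<pi> \<in> couplings \<mu> \<mu>' \<Longrightarrow> norm (p x \<mu> - p x' \<mu>') \<le> Lp * (norm (x - x') + cost \<pi>)"
    and p_growth: "\<mu> \<in> P2 \<Longrightarrow> norm (p x \<mu>) \<le> Lp * (1 + norm x + mnorm 1 \<mu>)"
begin

text \<open>The space M is arbitrary. With M = m, w is the initial state; with M a coupling,
  solutions from two initial laws live side by side on one space.\<close>

definition adm :: "'w measure \<Rightarrow> ('w \<Rightarrow> 'x) \<Rightarrow> ('w \<Rightarrow> 'x) \<Rightarrow> bool" where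
  "adm M X Z \<longleftrightarrow> prob_space M \<and> sqi M X \<and> Z \<in> borel_measurable M \<and> (\<forall>w. cone (X w) (distr M borel X) (Z w))"

definition \<Phi> :: "'w measure \<Rightarrow> ('w \<Rightarrow> 'x) \<Rightarrow> ('w \<Rightarrow> 'x) \<Rightarrow> 'w \<Rightarrow> 'x" where
  "\<Phi> M X Z w = A (X w) (distr M borel X) (Z w) + (\<integral>y. \<Gamma> (X w) (distr M borel X) (X y) (Z y) \<partial>M)"

lemma admD:
  assumes "adm M X Z"
  shows "prob_space M" "sqi M X" "X \<in> borel_measurable M" "Z \<in> borel_measurable M"
    "cone (X w) (distr M borel X) (Z w)" "distr M borel X \<in> P2" "integrable M (\<lambda>w. norm (X w))"
    "mnorm 1 (distr M borel X) = (\<integral>w. norm (X w) \<partial>M)"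
    "norm (Z w) \<le> 2 * Lp * (1 + norm (X w) + (\<integral>w. norm (X w) \<partial>M))"
    "integrable M (\<lambda>w. norm (Z w))"
proof -
  show *: "prob_space M" "sqi M X" "X \<in> borel_measurable M" "Z \<in> borel_measurable M" "cone (X w) (distr M borel X) (Z w)" for w
    using assms by (auto simp: adm_def sqi_def)
  show "distr M borel X \<in> P2" by (rule sqi_distr_P2[OF *(1,2)])
  show iX: "integrable M (\<lambda>w. norm (X w))" by (rule sqi_integrable[OF *(1,2)])
  show m: "mnorm 1 (distr M borel X) = (\<integral>w. norm (X w) \<partial>M)" by (rule mnorm_distr[OF *(1,2)])
  show Z: "norm (Z w) \<le> 2 * Lp * (1 + norm (X w) + (\<integral>w. norm (X w) \<partial>M))" for w
    using *(5)[of w] unfolding cone_def m .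
  interpret prob_space M by fact
  show "integrable M (\<lambda>w. norm (Z w))"
  proof (rule Bochner_Integration.integrable_bound)
    show "integrable M (\<lambda>w. 2 * Lp * (1 + norm (X w) + (\<integral>w. norm (X w) \<partial>M)))" using iX by simp
    show "AE w in M. norm (norm (Z w)) \<le> norm (2 * Lp * (1 + norm (X w) + (\<integral>w. norm (X w) \<partial>M)))"
      using order_trans[OF Z abs_ge_self] by simp
  qed (use *(4) in simp)
qed

lemma B_diff:
  assumes "adm M X Z" "adm M X' Z'"
  shows "norm (B (X w) (distr M borel X) (Z w) - B (X' w') (distr M borel X') (Z' w'))
    \<le> L * (norm (X w - X' w') + (\<integral>y. norm (X y - X' y) \<partial>M) + norm (Z w - Z' w'))"
  using B_lip[OF admD(6)[OF assms(1)] admD(6)[OF assms(2)] coupling_distr(1)[OF admD(3)[OF assms(1)] admD(3)[OF assms(2)]]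
      admD(5)[OF assms(1), of w] admD(5)[OF assms(2), of w']]
  by (simp only: coupling_distr(2)[OF admD(3)[OF assms(1)] admD(3)[OF assms(2)]])

lemma integrable_diff_norm:
  assumes "adm M X Z" "adm M X' Z'"
  shows "integrable M (\<lambda>w. norm (X w - X' w))" "integrable M (\<lambda>w. norm (Z w - Z' w))"
proof -
  note a = admD[OF assms(1)] and b = admD[OF assms(2)]
  show "integrable M (\<lambda>w. norm (X w - X' w))"
    by (rule Bochner_Integration.integrable_bound[OF Bochner_Integration.integrable_add[OF a(7) b(7)]])
      (use a(3) b(3) norm_triangle_ineq4 in auto)
  show "integrable M (\<lambda>w. norm (Z w - Z' w))"
    by (rule Bochner_Integration.integrable_bound[OF Bochner_Integration.integrable_add[OF a(10) b(10)]])
      (use a(4) b(4) norm_triangle_ineq4 in auto)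
qed

text \<open>Measurability is the issue: \<Gamma> is Lipschitz only on the cone. It is continuous on
  that set, and admissible pairs take their values there.\<close>

lemma \<Gamma>_integrable:
  assumes "adm M X Z"
  shows "integrable M (\<lambda>y. \<Gamma> u (distr M borel X) (X y) (Z y))"
proof (rule Bochner_Integration.integrable_bound)
  note a = admD[OF assms]
  interpret prob_space M by (rule a(1))
  let ?\<mu> = "distr M borel X"
  show "integrable M (\<lambda>y. L * (1 + norm u + norm (X y) + mnorm 1 ?\<mu>))" using a(7) by simp
  show "AE y in M. norm (\<Gamma> u ?\<mu> (X y) (Z y)) \<le> norm (L * (1 + norm u + norm (X y) + mnorm 1 ?\<mu>))"
    using order_trans[OF \<Gamma>_growth[OF a(6,5)] abs_ge_self] by simp
  define C where "C = {q. cone (fst q) ?\<mu> (snd q)}"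
  have lip: "norm (\<Gamma> u ?\<mu> x z - \<Gamma> u ?\<mu> x' z') \<le> L * (norm (x - x') + norm (z - z'))"
    if "cone x ?\<mu> z" "cone x' ?\<mu> z'" for x z x' z'
    using \<Gamma>_lip[OF a(6) a(6) diag_coupling(1)[OF a(6)] that, of u u] by (simp add: diag_coupling(2)[OF a(6)])
  have "continuous_on C (\<lambda>q. \<Gamma> u ?\<mu> (fst q) (snd q))"
  proof (rule lipschitz_on_continuous_on[of "2 * L"], rule lipschitz_onI)
    fix q q' assume "q \<in> C" "q' \<in> C"
    then have "dist (\<Gamma> u ?\<mu> (fst q) (snd q)) (\<Gamma> u ?\<mu> (fst q') (snd q')) \<le> L * (dist (fst q) (fst q') + dist (snd q) (snd q'))"
      using lip by (auto simp: C_def dist_norm)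
    also have "\<dots> \<le> L * (dist q q' + dist q q')"
      using L0 by (intro mult_left_mono add_mono dist_fst_le dist_snd_le) auto
    finally show "dist (\<Gamma> u ?\<mu> (fst q) (snd q)) (\<Gamma> u ?\<mu> (fst q') (snd q')) \<le> 2 * L * dist q q'" by simp
  qed (use L0 in simp)
  then have G: "(\<lambda>q. \<Gamma> u ?\<mu> (fst q) (snd q)) \<in> borel_measurable (restrict_space borel C)"
    by (rule borel_measurable_continuous_on_restrict)
  have "(\<lambda>y. (X y, Z y)) \<in> M \<rightarrow>\<^sub>M restrict_space borel C"
    by (rule measurable_restrict_space2) (use a(5) measurable_Pair_borel[OF a(3,4)] in \<open>auto simp: C_def\<close>)
  from measurable_compose[OF this G] show "(\<lambda>y. \<Gamma> u ?\<mu> (X y) (Z y)) \<in> borel_measurable M" by simp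
qed

text \<open>The coefficient 3 counts the law in A, the law in \<Gamma> and the integration variable
  of \<Gamma>; the coefficient 2 counts the state in A and the outer point of \<Gamma>.\<close>

lemma \<Phi>_diff:
  assumes "adm M X Z" "adm M X' Z'"
  shows "norm (\<Phi> M X Z w - \<Phi> M X' Z' w') \<le> L * (2 * norm (X w - X' w') + norm (Z w - Z' w')
    + 3 * (\<integral>y. norm (X y - X' y) \<partial>M) + (\<integral>y. norm (Z y - Z' y) \<partial>M))"
proof -
  note a = admD[OF assms(1)] and b = admD[OF assms(2)] and d = integrable_diff_norm[OF assms]
  interpret prob_space M by (rule a(1))
  note cp = coupling_distr[OF a(3) b(3)]
  let ?\<mu> = "distr M borel X" and ?\<mu>' = "distr M borel X'"
  define c where "c = (\<integral>y. norm (X y - X' y) \<partial>M)"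
  define c' where "c' = (\<integral>y. norm (Z y - Z' y) \<partial>M)"
  have 1: "norm (A (X w) ?\<mu> (Z w) - A (X' w') ?\<mu>' (Z' w')) \<le> L * (norm (X w - X' w') + c + norm (Z w - Z' w'))"
    using A_lip[OF a(6) b(6) cp(1) a(5)[of w] b(5)[of w']] by (simp only: cp(2) c_def)
  have "norm ((\<integral>y. \<Gamma> (X w) ?\<mu> (X y) (Z y) \<partial>M) - (\<integral>y. \<Gamma> (X' w') ?\<mu>' (X' y) (Z' y) \<partial>M)) =
      norm (\<integral>y. \<Gamma> (X w) ?\<mu> (X y) (Z y) - \<Gamma> (X' w') ?\<mu>' (X' y) (Z' y) \<partial>M)"
    by (subst Bochner_Integration.integral_diff[OF \<Gamma>_integrable[OF assms(1)] \<Gamma>_integrable[OF assms(2)]]) simp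
  also have "\<dots> \<le> (\<integral>y. norm (\<Gamma> (X w) ?\<mu> (X y) (Z y) - \<Gamma> (X' w') ?\<mu>' (X' y) (Z' y)) \<partial>M)"
    by (rule integral_norm_bound)
  also have "\<dots> \<le> (\<integral>y. L * (norm (X w - X' w') + c + norm (X y - X' y) + norm (Z y - Z' y)) \<partial>M)"
  proof (rule integral_mono')
    show "integrable M (\<lambda>y. L * (norm (X w - X' w') + c + norm (X y - X' y) + norm (Z y - Z' y)))" using d by simp
    fix y
    show "norm (\<Gamma> (X w) ?\<mu> (X y) (Z y) - \<Gamma> (X' w') ?\<mu>' (X' y) (Z' y))
        \<le> L * (norm (X w - X' w') + c + norm (X y - X' y) + norm (Z y - Z' y))"
      using \<Gamma>_lip[OF a(6) b(6) cp(1) a(5)[of y] b(5)[of y]] by (simp only: cp(2) c_def)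
    then show "0 \<le> L * (norm (X w - X' w') + c + norm (X y - X' y) + norm (Z y - Z' y))"
      by (rule order_trans[OF norm_ge_zero])
  qed
  also have "\<dots> = L * (norm (X w - X' w') + c + c + c')"
    using d prob_space by (simp add: c_def c'_def)
  finally have 2: "norm ((\<integral>y. \<Gamma> (X w) ?\<mu> (X y) (Z y) \<partial>M) - (\<integral>y. \<Gamma> (X' w') ?\<mu>' (X' y) (Z' y) \<partial>M))
      \<le> L * (norm (X w - X' w') + c + c + c')" .
  have "norm (\<Phi> M X Z w - \<Phi> M X' Z' w') \<le>
      L * (norm (X w - X' w') + c + norm (Z w - Z' w')) + L * (norm (X w - X' w') + c + c + c')"
    unfolding \<Phi>_def add_diff_add by (rule order_trans[OF norm_triangle_ineq add_mono[OF 1 2]])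
  also have "\<dots> = L * (2 * norm (X w - X' w') + norm (Z w - Z' w') + 3 * c + c')" by (simp add: algebra_simps)
  finally show ?thesis by (simp add: c_def c'_def)
qed

lemma \<Phi>_growth:
  assumes "adm M X Z"
  shows "norm (\<Phi> M X Z w) \<le> L * (2 + 2 * norm (X w) + 3 * (\<integral>y. norm (X y) \<partial>M))"
proof -
  note a = admD[OF assms]
  interpret prob_space M by (rule a(1))
  define m where "m = (\<integral>y. norm (X y) \<partial>M)"
  have 1: "norm (A (X w) (distr M borel X) (Z w)) \<le> L * (1 + norm (X w) + m)"
    using A_growth[OF a(6) a(5)[of w]] by (simp only: a(8) m_def)
  have "norm (\<integral>y. \<Gamma> (X w) (distr M borel X) (X y) (Z y) \<partial>M) \<le> (\<integral>y. norm (\<Gamma> (X w) (distr M borel X) (X y) (Z y)) \<partial>M)"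
    by (rule integral_norm_bound)
  also have "\<dots> \<le> (\<integral>y. L * (1 + norm (X w) + norm (X y) + m) \<partial>M)"
  proof (rule integral_mono')
    show "integrable M (\<lambda>y. L * (1 + norm (X w) + norm (X y) + m))" using a(7) by simp
    fix y
    show "norm (\<Gamma> (X w) (distr M borel X) (X y) (Z y)) \<le> L * (1 + norm (X w) + norm (X y) + m)"
      using \<Gamma>_growth[OF a(6) a(5)[of y]] by (simp only: a(8) m_def)
    then show "0 \<le> L * (1 + norm (X w) + norm (X y) + m)" by (rule order_trans[OF norm_ge_zero])
  qed
  also have "\<dots> = L * (1 + norm (X w) + m + m)" using a(7) prob_space by (simp add: m_def)
  finally have 2: "norm (\<integral>y. \<Gamma> (X w) (distr M borel X) (X y) (Z y) \<partial>M) \<le> L * (1 + norm (X w) + m + m)" .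
  have "norm (\<Phi> M X Z w) \<le> L * (1 + norm (X w) + m) + L * (1 + norm (X w) + m + m)"
    unfolding \<Phi>_def by (rule order_trans[OF norm_triangle_ineq add_mono[OF 1 2]])
  also have "\<dots> = L * (2 + 2 * norm (X w) + 3 * m)" by (simp add: algebra_simps)
  finally show ?thesis by (simp add: m_def)
qed

text \<open>The equations hold for every w, not almost surely, so that pointwise estimates can be
  iterated. The growth bound with unspecified C only starts the halving iteration in
  \<open>stability\<close>.\<close>

definition sol :: "'w measure \<Rightarrow> ('w \<Rightarrow> 'x) \<Rightarrow> real \<Rightarrow> real \<Rightarrow> (real \<Rightarrow> 'w \<Rightarrow> 'x) \<Rightarrow> (real \<Rightarrow> 'w \<Rightarrow> 'x) \<Rightarrow> bool" where
  "sol M \<xi> t T X Z \<longleftrightarrow> sqi M \<xi> \<and> (\<forall>s\<in>{t..T}. adm M (X s) (Z s)) \<and>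
    (\<exists>C\<ge>0. \<forall>s\<in>{t..T}. \<forall>w. norm (X s w) + norm (Z s w) \<le> C * (1 + norm (\<xi> w) + (\<integral>y. norm (\<xi> y) \<partial>M))) \<and>
    (\<forall>w. \<forall>s\<in>{t..T}.
      ((\<lambda>r. B (X r w) (distr M borel (X r)) (Z r w)) has_integral (X s w - \<xi> w)) {t..s} \<and>
      ((\<lambda>r. \<Phi> M (X r) (Z r) w) has_integral (Z s w - p (X T w) (distr M borel (X T)))) {s..T})"

end

section \<open>Estimates on a short horizon\<close>

locale fbode_short = fbode B A \<Gamma> p cone L Lp
  for B A :: "'x::euclidean_space \<Rightarrow> 'x measure \<Rightarrow> 'x \<Rightarrow> 'x" and \<Gamma> p cone L Lp +
  fixes t0 T :: real
  assumes t0T: "t0 \<le> T" and short: "(T - t0) * L * (100 * (1 + Lp)) \<le> 1" and short2: "(T - t0) * L * 12 \<le> Lp"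
begin

text \<open>The horizon in units of 1 / L. \<open>short\<close> makes e and e * Lp at most 1 / 100,
  which gives contraction; \<open>short2\<close> makes 12 * e at most Lp, which keeps Z in the
  cone.\<close>

definition e where "e = (T - t0) * L"

lemma e: "0 \<le> e" "e \<le> 1 / 100" "e * Lp \<le> 1 / 100" "12 * e \<le> Lp" "100 * e + 100 * (e * Lp) \<le> 1"
proof -
  show e0: "0 \<le> e" using t0T L0 by (simp add: e_def)
  show *: "100 * e + 100 * (e * Lp) \<le> 1" using short by (simp add: e_def algebra_simps)
  have "0 \<le> e * Lp" using e0 Lp0 by simp
  then show "e \<le> 1 / 100" "e * Lp \<le> 1 / 100" using * e0 by linarith+
  show "12 * e \<le> Lp" using short2 by (simp add: e_def)
qed

lemma integral_bound:
  fixes f :: "real \<Rightarrow> 'x"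
  assumes "(f has_integral i) {a..b}" "t0 \<le> a" "a \<le> b" "b \<le> T" "0 \<le> c" "\<And>r. a \<le> r \<Longrightarrow> r \<le> b \<Longrightarrow> norm (f r) \<le> L * c"
  shows "norm i \<le> e * c"
proof -
  have "norm i \<le> (L * c) * (b - a)" by (rule has_integral_norm_le[OF assms(1,3) _ assms(6)]) (use L0 assms(5) in auto)
  also have "\<dots> \<le> (L * c) * (T - t0)" using assms(2,4,5) L0 by (intro mult_left_mono) auto
  finally show ?thesis by (simp add: e_def ac_simps)
qed

lemma integral_diff_bound:
  fixes f g :: "real \<Rightarrow> 'x"
  assumes "(f has_integral i) {a..b}" "(g has_integral j) {a..b}" "t0 \<le> a" "a \<le> b" "b \<le> T" "0 \<le> c"
    "\<And>r. a \<le> r \<Longrightarrow> r \<le> b \<Longrightarrow> norm (f r - g r) \<le> L * c"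
  shows "norm (i - j) \<le> e * c"
  by (rule integral_bound[OF has_integral_diff[OF assms(1,2)] assms(3-7)])

text \<open>One Picard step for two inputs. With outputs equal to inputs it serves
  \<open>stability\<close>; with equal initial data it gives the contraction in
  \<open>fixed_point\<close>. The majorant V depends on w because the laws enter through its mean,
  while all other terms are taken at the same w.\<close>

lemma step_estimate:
  assumes adm: "\<And>r. r \<in> {t..T} \<Longrightarrow> adm M (X r) (Z r)" "\<And>r. r \<in> {t..T} \<Longrightarrow> adm M (X' r) (Z' r)"
    and V: "integrable M V" "\<And>r w. r \<in> {t..T} \<Longrightarrow> norm (X r w - X' r w) + norm (Z r w - Z' r w) \<le> V w"
    and t: "t0 \<le> t" and s: "s \<in> {t..T}"
    and Xt: "\<And>s w. s \<in> {t..T} \<Longrightarrow> ((\<lambda>r. B (X r w) (distr M borel (X r)) (Z r w)) has_integral (Xt s w - \<xi> w)) {t..s}"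
    and Xt': "\<And>s w. s \<in> {t..T} \<Longrightarrow> ((\<lambda>r. B (X' r w) (distr M borel (X' r)) (Z' r w)) has_integral (Xt' s w - \<xi>' w)) {t..s}"
    and Zt: "((\<lambda>r. \<Phi> M (X r) (Z r) w) has_integral (Zt w - p (Xt T w) (distr M borel (Xt T)))) {s..T}"
    and Zt': "((\<lambda>r. \<Phi> M (X' r) (Z' r) w) has_integral (Zt' w - p (Xt' T w) (distr M borel (Xt' T)))) {s..T}"
    and T: "sqi M (Xt T)" "sqi M (Xt' T)" "sqi M \<xi>" "sqi M \<xi>'"
  shows "norm (Xt s w - Xt' s w) + norm (Zt w - Zt' w) \<le>
    (1 + Lp) * (norm (\<xi> w - \<xi>' w) + (\<integral>y. norm (\<xi> y - \<xi>' y) \<partial>M)) + 1 / 20 * (V w + (\<integral>y. V y \<partial>M))"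
proof -
  have tT: "t \<in> {t..T}" "T \<in> {t..T}" using s by auto
  note a0 = admD[OF adm(1)[OF tT(1)]]
  interpret prob_space M by (rule a0(1))
  define v where "v = (\<integral>y. V y \<partial>M)"
  have V0: "0 \<le> V w" for w
    using V(2)[OF tT(1), of w] norm_ge_zero[of "X t w - X' t w"] norm_ge_zero[of "Z t w - Z' t w"] by linarith
  have v0: "0 \<le> v" unfolding v_def by (rule integral_nonneg_AE) (simp add: V0)
  have VX: "norm (X r w - X' r w) \<le> V w" and VZ: "norm (Z r w - Z' r w) \<le> V w" if "r \<in> {t..T}" for r w
    using V(2)[OF that, of w] norm_ge_zero[of "X r w - X' r w"] norm_ge_zero[of "Z r w - Z' r w"] by linarith+
  have vX: "(\<integral>y. norm (X r y - X' r y) \<partial>M) \<le> v" if "r \<in> {t..T}" for r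
    unfolding v_def by (rule integral_mono'[OF V(1)]) (use VX[OF that] V0 in auto)
  have vZ: "(\<integral>y. norm (Z r y - Z' r y) \<partial>M) \<le> v" if "r \<in> {t..T}" for r
    unfolding v_def by (rule integral_mono'[OF V(1)]) (use VZ[OF that] V0 in auto)
  have dX: "norm (Xt s w - Xt' s w) \<le> norm (\<xi> w - \<xi>' w) + e * (V w + v)" if s: "s \<in> {t..T}" for s w
  proof -
    have "norm ((Xt s w - \<xi> w) - (Xt' s w - \<xi>' w)) \<le> e * (V w + v)"
    proof (rule integral_diff_bound[OF Xt[OF s] Xt'[OF s] t])
      fix r assume r: "t \<le> r" "r \<le> s"
      then have r': "r \<in> {t..T}" using s by auto
      have "norm (X r w - X' r w) + (\<integral>y. norm (X r y - X' r y) \<partial>M) + norm (Z r w - Z' r w) \<le> V w + v"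
        using V(2)[OF r', of w] vX[OF r'] by linarith
      then have "L * (norm (X r w - X' r w) + (\<integral>y. norm (X r y - X' r y) \<partial>M) + norm (Z r w - Z' r w)) \<le> L * (V w + v)"
        using L0 by (intro mult_left_mono) auto
      then show "norm (B (X r w) (distr M borel (X r)) (Z r w) - B (X' r w) (distr M borel (X' r)) (Z' r w)) \<le> L * (V w + v)"
        by (rule order_trans[OF B_diff[OF adm(1)[OF r'] adm(2)[OF r']]])
    qed (use s V0[of w] v0 in auto)
    moreover have "Xt s w - Xt' s w = (\<xi> w - \<xi>' w) + ((Xt s w - \<xi> w) - (Xt' s w - \<xi>' w))" by simp
    ultimately show ?thesis using norm_triangle_ineq[of "\<xi> w - \<xi>' w" "(Xt s w - \<xi> w) - (Xt' s w - \<xi>' w)"] by simp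
  qed
  define \<theta> where "\<theta> = (\<integral>y. norm (\<xi> y - \<xi>' y) \<partial>M)"
  have i\<xi>: "integrable M (\<lambda>y. norm (\<xi> y - \<xi>' y))" by (rule sqi_integrable[OF a0(1) sqi_diff[OF a0(1) T(3,4)]])
  have \<theta>0: "0 \<le> \<theta>" by (simp add: \<theta>_def)
  have dT: "(\<integral>y. norm (Xt T y - Xt' T y) \<partial>M) \<le> \<theta> + e * (v + v)"
  proof -
    have "(\<integral>y. norm (Xt T y - Xt' T y) \<partial>M) \<le> (\<integral>y. norm (\<xi> y - \<xi>' y) + e * (V y + v) \<partial>M)"
    proof (rule integral_mono')
      show "integrable M (\<lambda>y. norm (\<xi> y - \<xi>' y) + e * (V y + v))" using i\<xi> V(1) by simp
    qed (use dX[OF tT(2)] e(1) V0 v0 in auto)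
    also have "\<dots> = \<theta> + e * (v + v)" using i\<xi> V(1) prob_space by (simp add: \<theta>_def v_def)
    finally show ?thesis .
  qed
  have mX: "Xt T \<in> borel_measurable M" "Xt' T \<in> borel_measurable M" using T by (auto simp: sqi_def)
  have "norm (p (Xt T w) (distr M borel (Xt T)) - p (Xt' T w) (distr M borel (Xt' T))) \<le>
      Lp * (norm (Xt T w - Xt' T w) + (\<integral>y. norm (Xt T y - Xt' T y) \<partial>M))"
    using p_lip[OF sqi_distr_P2[OF a0(1) T(1)] sqi_distr_P2[OF a0(1) T(2)] coupling_distr(1)[OF mX]]
    by (simp only: coupling_distr(2)[OF mX])
  also have "\<dots> \<le> Lp * ((norm (\<xi> w - \<xi>' w) + e * (V w + v)) + (\<theta> + e * (v + v)))"
    using Lp0 by (intro mult_left_mono add_mono dX dT tT) auto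
  finally have dp: "norm (p (Xt T w) (distr M borel (Xt T)) - p (Xt' T w) (distr M borel (Xt' T))) \<le>
      Lp * (norm (\<xi> w - \<xi>' w) + \<theta>) + (e * Lp) * (V w + 3 * v)" by (simp add: algebra_simps)
  have dI: "norm ((Zt w - p (Xt T w) (distr M borel (Xt T))) - (Zt' w - p (Xt' T w) (distr M borel (Xt' T)))) \<le> e * (2 * V w + 4 * v)"
  proof (rule integral_diff_bound[OF Zt Zt'])
    fix r assume r: "s \<le> r" "r \<le> T"
    then have r': "r \<in> {t..T}" using s by auto
    have "2 * norm (X r w - X' r w) + norm (Z r w - Z' r w) + 3 * (\<integral>y. norm (X r y - X' r y) \<partial>M) + (\<integral>y. norm (Z r y - Z' r y) \<partial>M)
        \<le> 2 * V w + 4 * v"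
      using V(2)[OF r', of w] VX[OF r', of w] vX[OF r'] vZ[OF r'] by linarith
    then have "L * (2 * norm (X r w - X' r w) + norm (Z r w - Z' r w) + 3 * (\<integral>y. norm (X r y - X' r y) \<partial>M) + (\<integral>y. norm (Z r y - Z' r y) \<partial>M))
        \<le> L * (2 * V w + 4 * v)" using L0 by (intro mult_left_mono) auto
    then show "norm (\<Phi> M (X r) (Z r) w - \<Phi> M (X' r) (Z' r) w) \<le> L * (2 * V w + 4 * v)"
      by (rule order_trans[OF \<Phi>_diff[OF adm(1)[OF r'] adm(2)[OF r']]])
  qed (use s t V0[of w] v0 in auto)
  have "Zt w - Zt' w = ((Zt w - p (Xt T w) (distr M borel (Xt T))) - (Zt' w - p (Xt' T w) (distr M borel (Xt' T))))
      + (p (Xt T w) (distr M borel (Xt T)) - p (Xt' T w) (distr M borel (Xt' T)))" by simp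
  then have dZ: "norm (Zt w - Zt' w) \<le> e * (2 * V w + 4 * v) + (Lp * (norm (\<xi> w - \<xi>' w) + \<theta>) + (e * Lp) * (V w + 3 * v))"
    using norm_triangle_mono[OF dI dp] by simp
  have "norm (Xt s w - Xt' s w) + norm (Zt w - Zt' w) \<le> (norm (\<xi> w - \<xi>' w) + e * (V w + v))
      + (e * (2 * V w + 4 * v) + (Lp * (norm (\<xi> w - \<xi>' w) + \<theta>) + (e * Lp) * (V w + 3 * v)))"
    by (rule add_mono[OF dX[OF s] dZ])
  also have "\<dots> \<le> (1 + Lp) * (norm (\<xi> w - \<xi>' w) + \<theta>) + 5 * (e * (V w + v)) + 3 * ((e * Lp) * (V w + v))"
  proof -
    have "0 \<le> e * V w" "0 \<le> e * v" "0 \<le> (e * Lp) * V w" using e(1) V0[of w] v0 Lp0 by auto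
    then show ?thesis using \<theta>0 by (simp add: algebra_simps)
  qed
  also have "\<dots> = (1 + Lp) * (norm (\<xi> w - \<xi>' w) + \<theta>) + (5 * e + 3 * (e * Lp)) * (V w + v)" by (simp add: algebra_simps)
  \<comment> \<open>100 * e + 100 * (e * Lp) is at most 1, hence the factor 1 / 20.\<close>
  also have "\<dots> \<le> (1 + Lp) * (norm (\<xi> w - \<xi>' w) + \<theta>) + 1 / 20 * (V w + v)"
  proof (intro add_left_mono mult_right_mono)
    have "0 \<le> e * Lp" using e(1) Lp0 by simp
    then show "5 * e + 3 * (e * Lp) \<le> 1 / 20" using e(5) e(1) by linarith
  qed (use V0[of w] v0 in auto)
  finally show ?thesis by (simp add: \<theta>_def v_def)
qed

text \<open>In place of a Gronwall argument, which does not fit a two-point problem, the crude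
  growth bounds give a first majorant and each application of \<open>step_estimate\<close> halves
  its excess over the claimed bound.\<close>

lemma stability:
  assumes S: "sol M \<xi> t T X Z" "sol M \<xi>' t T X' Z'" and t: "t0 \<le> t" and s: "s \<in> {t..T}"
  shows "norm (X s w - X' s w) + norm (Z s w - Z' s w) \<le>
    2 * (1 + Lp) * (norm (\<xi> w - \<xi>' w) + (\<integral>y. norm (\<xi> y - \<xi>' y) \<partial>M))"
proof -
  have adm: "\<And>r. r \<in> {t..T} \<Longrightarrow> adm M (X r) (Z r)" "\<And>r. r \<in> {t..T} \<Longrightarrow> adm M (X' r) (Z' r)"
    and q: "sqi M \<xi>" "sqi M \<xi>'" using S by (auto simp: sol_def)
  interpret prob_space M by (rule admD(1)[OF adm(1)[OF s]])
  note iq = sqi_integrable[OF prob_space_axioms q(1)] sqi_integrable[OF prob_space_axioms q(2)]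
  have i\<xi>: "integrable M (\<lambda>y. norm (\<xi> y - \<xi>' y))" by (rule sqi_integrable[OF prob_space_axioms sqi_diff[OF prob_space_axioms q]])
  define \<theta> where "\<theta> = (\<integral>y. norm (\<xi> y - \<xi>' y) \<partial>M)"
  have \<theta>0: "0 \<le> \<theta>" by (simp add: \<theta>_def)
  define \<Theta> where "\<Theta> w = norm (\<xi> w - \<xi>' w) + \<theta>" for w
  define n where "n = (\<integral>y. norm (\<xi> y) \<partial>M) + (\<integral>y. norm (\<xi>' y) \<partial>M)"
  have n0: "0 \<le> n" by (simp add: n_def)
  define W where "W w = 1 + norm (\<xi> w) + norm (\<xi>' w) + n" for w
  have \<Theta>0: "0 \<le> \<Theta> w" for w using \<theta>0 by (simp add: \<Theta>_def)
  have W0: "0 \<le> W w" for w using n0 by (simp add: W_def)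
  have i: "integrable M \<Theta>" "integrable M W" unfolding \<Theta>_def W_def using i\<xi> iq by auto
  \<comment> \<open>The mean \<theta> is itself a summand of \<Theta>, as n is of W, so the average
    of either is at most twice its value at any w.\<close>
  have I\<Theta>: "(\<integral>y. \<Theta> y \<partial>M) \<le> 2 * \<Theta> w" for w
    unfolding \<Theta>_def using i\<xi> prob_space by (simp add: \<theta>_def)
  have IW: "(\<integral>y. W y \<partial>M) \<le> 2 * W w" for w
    unfolding W_def using iq prob_space n0 by (simp add: n_def)
  obtain C where C: "0 \<le> C" "\<And>s w. s \<in> {t..T} \<Longrightarrow> norm (X s w) + norm (Z s w) \<le> C * (1 + norm (\<xi> w) + (\<integral>y. norm (\<xi> y) \<partial>M))"
    using S(1) unfolding sol_def by blast
  obtain C' where C': "0 \<le> C'" "\<And>s w. s \<in> {t..T} \<Longrightarrow> norm (X' s w) + norm (Z' s w) \<le> C' * (1 + norm (\<xi>' w) + (\<integral>y. norm (\<xi>' y) \<partial>M))"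
    using S(2) unfolding sol_def by blast
  define P where "P b \<longleftrightarrow> (\<forall>s\<in>{t..T}. \<forall>w. norm (X s w - X' s w) + norm (Z s w - Z' s w) \<le> 2 * (1 + Lp) * \<Theta> w + b * W w)" for b
  have "P (2 * 0 + (C + C') / 2 ^ k)" for k
  proof (rule halving_iteration[of P])
    show "P (C + C')"
      unfolding P_def
    proof (intro ballI allI)
      fix s w assume s: "s \<in> {t..T}"
      have "C * (1 + norm (\<xi> w) + (\<integral>y. norm (\<xi> y) \<partial>M)) \<le> C * W w" "C' * (1 + norm (\<xi>' w) + (\<integral>y. norm (\<xi>' y) \<partial>M)) \<le> C' * W w"
        using C(1) C'(1) by (intro mult_left_mono; simp add: W_def n_def)+
      then have "norm (X s w - X' s w) + norm (Z s w - Z' s w) \<le> C * W w + C' * W w"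
        using C(2)[OF s, of w] C'(2)[OF s, of w] norm_triangle_ineq4[of "X s w" "X' s w"] norm_triangle_ineq4[of "Z s w" "Z' s w"] by linarith
      also have "\<dots> \<le> 2 * (1 + Lp) * \<Theta> w + (C + C') * W w" using \<Theta>0[of w] Lp0 by (simp add: distrib_right)
      finally show "norm (X s w - X' s w) + norm (Z s w - Z' s w) \<le> 2 * (1 + Lp) * \<Theta> w + (C + C') * W w" .
    qed
    show "P b" if "a \<le> b" "P a" for a b
      using that W0 unfolding P_def by (meson add_left_mono mult_right_mono order_trans)
    fix b :: real assume b: "0 \<le> b" "P b"
    define V where "V w = 2 * (1 + Lp) * \<Theta> w + b * W w" for w
    have iV: "integrable M V" unfolding V_def using i by simp
    have vV: "(\<integral>y. V y \<partial>M) \<le> 2 * V w" for w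
    proof -
      have "(\<integral>y. V y \<partial>M) = 2 * (1 + Lp) * (\<integral>y. \<Theta> y \<partial>M) + b * (\<integral>y. W y \<partial>M)" unfolding V_def using i by simp
      also have "\<dots> \<le> 2 * (1 + Lp) * (2 * \<Theta> w) + b * (2 * W w)" using I\<Theta> IW b Lp0 by (intro add_mono mult_left_mono) auto
      finally show ?thesis by (simp add: V_def)
    qed
    show "P (b / 2 + 0)"
      unfolding P_def
    proof (intro ballI allI)
      fix s w assume s: "s \<in> {t..T}"
      have "norm (X s w - X' s w) + norm (Z s w - Z' s w) \<le>
          (1 + Lp) * (norm (\<xi> w - \<xi>' w) + (\<integral>y. norm (\<xi> y - \<xi>' y) \<partial>M)) + 1 / 20 * (V w + (\<integral>y. V y \<partial>M))"
      proof (rule step_estimate[OF adm iV _ t s, where Zt = "Z s" and Zt' = "Z' s"])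
        show "norm (X r w - X' r w) + norm (Z r w - Z' r w) \<le> V w" if "r \<in> {t..T}" for r w
          using b(2) that by (simp add: P_def V_def)
        show "sqi M (X T)" "sqi M (X' T)" using admD(2)[OF adm(1)] admD(2)[OF adm(2)] s by auto
      qed (use S s q in \<open>auto simp: sol_def\<close>)
      also have "\<dots> \<le> (1 + Lp) * \<Theta> w + 1 / 20 * (V w + 2 * V w)"
        using vV[of w] by (simp add: \<Theta>_def \<theta>_def)
      also have "\<dots> \<le> 2 * (1 + Lp) * \<Theta> w + b / 2 * W w"
      proof -
        \<comment> \<open>With V = 2 u + v and its average at most 2 V, the new bound has 26 / 20 of
          u, within 2 u, and 3 / 20 of v, within v / 2.\<close>
        have aux: "u + 1 / 20 * ((2 * u + v) + 2 * (2 * u + v)) \<le> 2 * u + v / 2" if "0 \<le> u" "0 \<le> v" for u v :: real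
          using that by (simp add: field_simps)
        have "0 \<le> (1 + Lp) * \<Theta> w" "0 \<le> b * W w" using \<Theta>0 Lp0 b W0 by auto
        moreover have "2 * (1 + Lp) * \<Theta> w = 2 * ((1 + Lp) * \<Theta> w)" "b / 2 * W w = b * W w / 2" by (simp_all only: mult.assoc)
        ultimately show ?thesis unfolding V_def
          using aux[of "(1 + Lp) * \<Theta> w" "b * W w"] by (simp only:)
      qed
      finally show "norm (X s w - X' s w) + norm (Z s w - Z' s w) \<le> 2 * (1 + Lp) * \<Theta> w + (b / 2 + 0) * W w" by simp
    qed
  qed (use C C' in auto)
  then have "norm (X s w - X' s w) + norm (Z s w - Z' s w) \<le> 2 * (1 + Lp) * \<Theta> w + ((C + C') * W w) / 2 ^ k" for k
    using s unfolding P_def by simp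
  then have "norm (X s w - X' s w) + norm (Z s w - Z' s w) \<le> 2 * (1 + Lp) * \<Theta> w" by (rule le_of_halving)
  then show ?thesis by (simp add: \<Theta>_def \<theta>_def)
qed

end

context fbode_short
begin

subsection \<open>Existence\<close>

context
  fixes t :: real and m :: "'x measure"
  assumes t: "t0 \<le> t" "t \<le> T" and m: "m \<in> P2"
begin

text \<open>The weight contains the mean of its own state-dependent part, so that its m-integral is
  at most twice its value at every point. This closes pointwise estimates that involve
  averages.\<close>

definition w where "w x = 1 + norm x + mnorm 1 m" for x :: 'x

lemma w1: "1 \<le> w x" "norm x \<le> w x" "mnorm 1 m \<le> w x"
  by (auto simp: w_def add_increasing)

lemma w_int: "integrable m w" "(\<integral>x. w x \<partial>m) = 1 + 2 * mnorm 1 m" "(\<integral>x. w x \<partial>m) \<le> 2 * w y"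
proof -
  interpret prob_space m by (rule P2D(1)[OF m])
  show "integrable m w" unfolding w_def using P2D(5)[OF m] by simp
  show *: "(\<integral>x. w x \<partial>m) = 1 + 2 * mnorm 1 m" unfolding w_def using P2D(5)[OF m] prob_space by (simp add: mnorm_1[OF m])
  show "(\<integral>x. w x \<partial>m) \<le> 2 * w y" unfolding * by (simp add: w_def)
qed

text \<open>The invariant set of the Picard map. All its conditions are closed under pointwise limits, and
  the second one keeps \<open>Z\<close> inside the cone.\<close>

definition SS :: "(real \<times> 'x \<Rightarrow> 'x \<times> 'x) set" where
  "SS = {u. \<forall>s\<in>{t..T}. \<forall>x.
      norm (fst (u (s, x)) - x) \<le> w x / 20 \<and>
      norm (snd (u (s, x))) \<le> 17 / 10 * Lp * w x \<and>
      (\<forall>y. norm (fst (u (s, x)) - fst (u (s, y))) \<le> 2 * norm (x - y) \<and>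
           norm (snd (u (s, x)) - snd (u (s, y))) \<le> (2 * Lp + 1) * norm (x - y)) \<and>
      (\<forall>r\<in>{t..T}. norm (fst (u (s, x)) - fst (u (r, x))) \<le> 6 * L * \<bar>s - r\<bar> * w x \<and>
           norm (snd (u (s, x)) - snd (u (r, x))) \<le> 6 * L * \<bar>s - r\<bar> * w x)}"

lemma SSD:
  assumes "u \<in> SS" "s \<in> {t..T}"
  shows "norm (fst (u (s, x)) - x) \<le> w x / 20" "norm (snd (u (s, x))) \<le> 17 / 10 * Lp * w x"
    "norm (fst (u (s, x)) - fst (u (s, y))) \<le> 2 * norm (x - y)"
    "norm (snd (u (s, x)) - snd (u (s, y))) \<le> (2 * Lp + 1) * norm (x - y)"
    "r \<in> {t..T} \<Longrightarrow> norm (fst (u (s, x)) - fst (u (r, x))) \<le> 6 * L * \<bar>s - r\<bar> * w x"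
    "r \<in> {t..T} \<Longrightarrow> norm (snd (u (s, x)) - snd (u (r, x))) \<le> 6 * L * \<bar>s - r\<bar> * w x"
  using assms unfolding SS_def by blast+

lemma meas_m: "F \<in> borel_measurable m \<longleftrightarrow> F \<in> borel_measurable borel"
  by (rule borel_measurable_eq_borel[OF P2D(2)[OF m]])

text \<open>The point contributes at most w / 20, and the mean of w / 20 at most w / 10. So the
  weight seen from the moved point and the moved law differs from w by at most 3 / 20 of w in either
  direction.\<close>

lemma near_id:
  assumes X: "X \<in> borel_measurable borel" "\<And>x. norm (X x - x) \<le> w x / 20"
  shows "sqi m X" "norm (X x) \<le> 2 * w x" "1 + norm (X x) + (\<integral>y. norm (X y) \<partial>m) \<le> 23 / 20 * w x"
    "17 / 20 * w x \<le> 1 + norm (X x) + (\<integral>y. norm (X y) \<partial>m)"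
proof -
  have up: "norm (X x) \<le> norm x + w x / 20" and lo: "norm x \<le> norm (X x) + w x / 20" for x
    using X(2)[of x] norm_triangle_sub[of "X x" x] norm_triangle_sub[of x "X x"] by (auto simp: norm_minus_commute)
  have up2: "norm (X x) \<le> 2 * w x" for x using up[of x] w1[of x] by linarith
  then show "norm (X x) \<le> 2 * w x" .
  show q: "sqi m X"
  proof (rule sqi_bound[OF P2D(1)[OF m], of "\<lambda>x. x"])
    show "sqi m (\<lambda>x. x)" unfolding sqi_def meas_m using P2D(4)[OF m] by simp
    show "X \<in> borel_measurable m" using X(1) by (simp add: meas_m)
    show "norm (X x) \<le> 2 * (1 + mnorm 1 m) + 2 * norm x" for x using up2[of x] by (simp add: w_def)
  qed auto
  have iX: "integrable m (\<lambda>y. norm (X y))" by (rule sqi_integrable[OF P2D(1)[OF m] q])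
  have "(\<integral>y. norm (X y) \<partial>m) \<le> (\<integral>y. norm y + w y / 20 \<partial>m)"
    by (rule integral_mono) (use iX up w_int(1) P2D(5)[OF m] in auto)
  also have "\<dots> = mnorm 1 m + (1 + 2 * mnorm 1 m) / 20"
    using w_int(1,2) P2D(5)[OF m] by (simp add: mnorm_1[OF m])
  finally have a: "(\<integral>y. norm (X y) \<partial>m) \<le> mnorm 1 m + (1 + 2 * mnorm 1 m) / 20" .
  have "mnorm 1 m = (\<integral>y. norm y \<partial>m)" by (rule mnorm_1[OF m])
  also have "\<dots> \<le> (\<integral>y. norm (X y) + w y / 20 \<partial>m)"
    by (rule integral_mono) (use iX lo w_int(1) P2D(5)[OF m] in auto)
  also have "\<dots> = (\<integral>y. norm (X y) \<partial>m) + (1 + 2 * mnorm 1 m) / 20" using w_int(1,2) iX by simp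
  finally have b: "mnorm 1 m \<le> (\<integral>y. norm (X y) \<partial>m) + (1 + 2 * mnorm 1 m) / 20" .
  have aux1: "1 + X + I \<le> 23 / 20 * (1 + n + c)" if "I \<le> c + (1 + 2 * c) / 20" "X \<le> n + (1 + n + c) / 20" "0 \<le> n" for X I n c :: real
    using that by (simp add: field_simps)
  have aux2: "17 / 20 * (1 + n + c) \<le> 1 + X + I" if "c \<le> I + (1 + 2 * c) / 20" "n \<le> X + (1 + n + c) / 20" "0 \<le> n" for X I n c :: real
    using that by (simp add: field_simps)
  show "1 + norm (X x) + (\<integral>y. norm (X y) \<partial>m) \<le> 23 / 20 * w x" using a up[of x] unfolding w_def by (rule aux1) simp
  show "17 / 20 * w x \<le> 1 + norm (X x) + (\<integral>y. norm (X y) \<partial>m)" using b lo[of x] unfolding w_def by (rule aux2) simp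
qed

lemma lipschitz_measurable:
  fixes F :: "'x \<Rightarrow> 'x"
  assumes "\<And>x y. norm (F x - F y) \<le> c * norm (x - y)"
  shows "F \<in> borel_measurable borel"
  using integrable_lipschitz(2)[OF m assms] by (rule borel_measurable_continuous_onI)

lemma SS_adm:
  assumes u: "u \<in> SS" and s: "s \<in> {t..T}"
  shows "adm m (\<lambda>x. fst (u (s, x))) (\<lambda>x. snd (u (s, x)))"
    and "1 + norm (fst (u (s, x))) + (\<integral>y. norm (fst (u (s, y))) \<partial>m) \<le> 23 / 20 * w x"
    and "norm (fst (u (s, x))) \<le> 2 * w x"
proof -
  have mX: "(\<lambda>x. fst (u (s, x))) \<in> borel_measurable borel" using SSD(3)[OF u s] by (rule lipschitz_measurable)
  have mZ: "(\<lambda>x. snd (u (s, x))) \<in> borel_measurable borel" using SSD(4)[OF u s] by (rule lipschitz_measurable)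
  note n = near_id[OF mX SSD(1)[OF u s]]
  show "1 + norm (fst (u (s, x))) + (\<integral>y. norm (fst (u (s, y))) \<partial>m) \<le> 23 / 20 * w x" "norm (fst (u (s, x))) \<le> 2 * w x"
    using n(2,3) by auto
  show "adm m (\<lambda>x. fst (u (s, x))) (\<lambda>x. snd (u (s, x)))"
    unfolding adm_def
  proof (intro conjI allI)
    show "prob_space m" by (rule P2D(1)[OF m])
    show "sqi m (\<lambda>x. fst (u (s, x)))" by (rule n(1))
    show "(\<lambda>x. snd (u (s, x))) \<in> borel_measurable m" using mZ by (simp add: meas_m)
    fix x
    \<comment> \<open>17 / 10 is 2 * 17 / 20: the bound on Z in \<open>SS\<close> is the cone bound
      after the loss from w to the weight of the moved point.\<close>
    have "17 / 10 * Lp * w x = 2 * Lp * (17 / 20 * w x)" by simp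
    also have "\<dots> \<le> 2 * Lp * (1 + norm (fst (u (s, x))) + (\<integral>y. norm (fst (u (s, y))) \<partial>m))"
      using n(4)[of x] Lp0 by (intro mult_left_mono) auto
    finally show "cone (fst (u (s, x))) (distr m borel (\<lambda>x. fst (u (s, x)))) (snd (u (s, x)))"
      unfolding cone_def mnorm_distr[OF P2D(1)[OF m] n(1)] by (rule order_trans[OF SSD(2)[OF u s]])
  qed
qed

definition Bu where "Bu u r x = B (fst (u (r, x))) (distr m borel (\<lambda>x. fst (u (r, x)))) (snd (u (r, x)))" for u :: "real \<times> 'x \<Rightarrow> 'x \<times> 'x"
definition Pu where "Pu u r x = \<Phi> m (\<lambda>x. fst (u (r, x))) (\<lambda>x. snd (u (r, x))) x" for u :: "real \<times> 'x \<Rightarrow> 'x \<times> 'x"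

lemma time_diff:
  assumes u: "u \<in> SS" and r: "r \<in> {t..T}" "r' \<in> {t..T}"
  shows "(\<integral>y. norm (fst (u (r, y)) - fst (u (r', y))) \<partial>m) \<le> 12 * L * \<bar>r - r'\<bar> * w x"
    "(\<integral>y. norm (snd (u (r, y)) - snd (u (r', y))) \<partial>m) \<le> 12 * L * \<bar>r - r'\<bar> * w x"
proof -
  have *: "6 * L * \<bar>r - r'\<bar> * (\<integral>y. w y \<partial>m) \<le> 12 * L * \<bar>r - r'\<bar> * w x"
    using mult_left_mono[OF w_int(3)[of x], of "6 * L * \<bar>r - r'\<bar>"] L0 by simp
  have i: "integrable m (\<lambda>y. 6 * L * \<bar>r - r'\<bar> * w y)" using w_int(1) by simp
  have eq: "(\<integral>y. 6 * L * \<bar>r - r'\<bar> * w y \<partial>m) = 6 * L * \<bar>r - r'\<bar> * (\<integral>y. w y \<partial>m)" by simp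
  have nn: "0 \<le> 6 * L * \<bar>r - r'\<bar> * w y" for y using L0 w1(1)[of y] by simp
  have "(\<integral>y. norm (fst (u (r, y)) - fst (u (r', y))) \<partial>m) \<le> (\<integral>y. 6 * L * \<bar>r - r'\<bar> * w y \<partial>m)"
    by (rule integral_mono'[OF i SSD(5)[OF u r] nn])
  then show "(\<integral>y. norm (fst (u (r, y)) - fst (u (r', y))) \<partial>m) \<le> 12 * L * \<bar>r - r'\<bar> * w x" unfolding eq by (rule order_trans[OF _ *])
  have "(\<integral>y. norm (snd (u (r, y)) - snd (u (r', y))) \<partial>m) \<le> (\<integral>y. 6 * L * \<bar>r - r'\<bar> * w y \<partial>m)"
    by (rule integral_mono'[OF i SSD(6)[OF u r] nn])
  then show "(\<integral>y. norm (snd (u (r, y)) - snd (u (r', y))) \<partial>m) \<le> 12 * L * \<bar>r - r'\<bar> * w x" unfolding eq by (rule order_trans[OF _ *])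
qed

lemma lipschitz_continuous_real:
  fixes F :: "real \<Rightarrow> 'x"
  assumes "\<And>r r'. r \<in> S \<Longrightarrow> r' \<in> S \<Longrightarrow> norm (F r - F r') \<le> c * \<bar>r - r'\<bar>"
  shows "continuous_on S F"
proof (rule lipschitz_on_continuous_on[of "\<bar>c\<bar>"], rule lipschitz_onI)
  fix r r' assume "r \<in> S" "r' \<in> S"
  then show "dist (F r) (F r') \<le> \<bar>c\<bar> * dist r r'"
    using assms[of r r'] mult_right_mono[OF abs_ge_self[of c] abs_ge_zero[of "r - r'"]] by (simp add: dist_norm)
qed simp

text \<open>This is what the time moduli in \<open>SS\<close> are for: both coefficients are
  continuous in time along u, laws included, hence integrable.\<close>

lemma Bu_continuous:
  assumes u: "u \<in> SS"
  shows "continuous_on {t..T} (\<lambda>r. Bu u r x)" "continuous_on {t..T} (\<lambda>r. Pu u r x)"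
proof -
  show "continuous_on {t..T} (\<lambda>r. Bu u r x)"
  proof (rule lipschitz_continuous_real[of _ _ "L * (24 * L * w x)"])
    fix r r' assume r: "r \<in> {t..T}" "r' \<in> {t..T}"
    have "norm (Bu u r x - Bu u r' x) \<le> L * (norm (fst (u (r, x)) - fst (u (r', x))) + (\<integral>y. norm (fst (u (r, y)) - fst (u (r', y))) \<partial>m)
        + norm (snd (u (r, x)) - snd (u (r', x))))"
      unfolding Bu_def by (rule B_diff[OF SS_adm(1)[OF u r(1)] SS_adm(1)[OF u r(2)]])
    also have "\<dots> \<le> L * (6 * L * \<bar>r - r'\<bar> * w x + 12 * L * \<bar>r - r'\<bar> * w x + 6 * L * \<bar>r - r'\<bar> * w x)"
      using L0 by (intro mult_left_mono add_mono SSD[OF u r(1)] r(2) time_diff[OF u r]) auto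
    also have "\<dots> = L * (24 * L * w x) * \<bar>r - r'\<bar>" by (simp add: algebra_simps)
    finally show "norm (Bu u r x - Bu u r' x) \<le> L * (24 * L * w x) * \<bar>r - r'\<bar>" .
  qed
  show "continuous_on {t..T} (\<lambda>r. Pu u r x)"
  proof (rule lipschitz_continuous_real[of _ _ "L * (66 * L * w x)"])
    fix r r' assume r: "r \<in> {t..T}" "r' \<in> {t..T}"
    have "norm (Pu u r x - Pu u r' x) \<le> L * (2 * norm (fst (u (r, x)) - fst (u (r', x))) + norm (snd (u (r, x)) - snd (u (r', x)))
        + 3 * (\<integral>y. norm (fst (u (r, y)) - fst (u (r', y))) \<partial>m) + (\<integral>y. norm (snd (u (r, y)) - snd (u (r', y))) \<partial>m))"
      unfolding Pu_def by (rule \<Phi>_diff[OF SS_adm(1)[OF u r(1)] SS_adm(1)[OF u r(2)]])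
    also have "\<dots> \<le> L * (2 * (6 * L * \<bar>r - r'\<bar> * w x) + 6 * L * \<bar>r - r'\<bar> * w x + 3 * (12 * L * \<bar>r - r'\<bar> * w x) + 12 * L * \<bar>r - r'\<bar> * w x)"
      using L0 by (intro mult_left_mono add_mono SSD[OF u r(1)] r(2) time_diff[OF u r]) auto
    also have "\<dots> = L * (66 * L * w x) * \<bar>r - r'\<bar>" by (simp add: algebra_simps)
    finally show "norm (Pu u r x - Pu u r' x) \<le> L * (66 * L * w x) * \<bar>r - r'\<bar>" .
  qed
qed

definition Xn where "Xn u s x = x + integral {t..s} (\<lambda>r. Bu u r x)" for u :: "real \<times> 'x \<Rightarrow> 'x \<times> 'x"
definition Zn where "Zn u s x = p (Xn u T x) (distr m borel (Xn u T)) + integral {s..T} (\<lambda>r. Pu u r x)" for u :: "real \<times> 'x \<Rightarrow> 'x \<times> 'x"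

lemma Xn_integral:
  assumes u: "u \<in> SS" and s: "s \<in> {t..T}"
  shows "((\<lambda>r. Bu u r x) has_integral (Xn u s x - x)) {t..s}"
    "((\<lambda>r. Pu u r x) has_integral (Zn u s x - p (Xn u T x) (distr m borel (Xn u T)))) {s..T}"
  using continuous_on_subset[OF Bu_continuous(1)[OF u], of "{t..s}" x] continuous_on_subset[OF Bu_continuous(2)[OF u], of "{s..T}" x] s
  by (simp_all add: Xn_def Zn_def has_integral_integral integrable_continuous_real flip: has_integral_integral)

lemmas Xn_integral' = Xn_integral[unfolded Bu_def Pu_def]

lemma Bu_bound:
  assumes u: "u \<in> SS" and r: "r \<in> {t..T}"
  shows "norm (Bu u r x) \<le> L * (2 * w x)" "norm (Pu u r x) \<le> L * (6 * w x)"
    "norm (Bu u r x - Bu u r y) \<le> L * ((3 + 2 * Lp) * norm (x - y))"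
    "norm (Pu u r x - Pu u r y) \<le> L * ((5 + 2 * Lp) * norm (x - y))"
proof -
  note a = SS_adm(1)[OF u r]
  define n where "n = (\<integral>y. norm (fst (u (r, y))) \<partial>m)"
  have n: "1 + norm (fst (u (r, x))) + n \<le> 23 / 20 * w x" "0 \<le> n" using SS_adm(2)[OF u r, of x] by (auto simp: n_def)
  have "norm (Bu u r x) \<le> L * (1 + norm (fst (u (r, x))) + n)"
    unfolding Bu_def using B_growth[OF admD(6)[OF a] admD(5)[OF a, of x]] by (simp only: admD(8)[OF a] n_def)
  also have "\<dots> \<le> L * (2 * w x)" using n(1) L0 w1(1)[of x] by (intro mult_left_mono) auto
  finally show "norm (Bu u r x) \<le> L * (2 * w x)" .
  have "norm (Pu u r x) \<le> L * (2 + 2 * norm (fst (u (r, x))) + 3 * n)" unfolding Pu_def n_def by (rule \<Phi>_growth[OF a])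
  also have "\<dots> \<le> L * (6 * w x)"
  proof (rule mult_left_mono)
    show "2 + 2 * norm (fst (u (r, x))) + 3 * n \<le> 6 * w x"
      using n w1(1)[of x] norm_ge_zero[of "fst (u (r, x))"] by linarith
  qed (use L0 in simp)
  finally show "norm (Pu u r x) \<le> L * (6 * w x)" .
  have "norm (Bu u r x - Bu u r y) \<le> L * (norm (fst (u (r, x)) - fst (u (r, y))) + (\<integral>y. norm (fst (u (r, y)) - fst (u (r, y))) \<partial>m)
        + norm (snd (u (r, x)) - snd (u (r, y))))"
    unfolding Bu_def by (rule B_diff[OF a a])
  also have "\<dots> \<le> L * (2 * norm (x - y) + 0 + (2 * Lp + 1) * norm (x - y))"
    using L0 by (intro mult_left_mono add_mono SSD[OF u r]) auto
  also have "\<dots> = L * ((3 + 2 * Lp) * norm (x - y))" by (simp add: algebra_simps)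
  finally show "norm (Bu u r x - Bu u r y) \<le> L * ((3 + 2 * Lp) * norm (x - y))" .
  have "norm (Pu u r x - Pu u r y) \<le> L * (2 * norm (fst (u (r, x)) - fst (u (r, y))) + norm (snd (u (r, x)) - snd (u (r, y)))
        + 3 * (\<integral>y. norm (fst (u (r, y)) - fst (u (r, y))) \<partial>m) + (\<integral>y. norm (snd (u (r, y)) - snd (u (r, y))) \<partial>m))"
    unfolding Pu_def by (rule \<Phi>_diff[OF a a])
  also have "\<dots> \<le> L * (2 * (2 * norm (x - y)) + (2 * Lp + 1) * norm (x - y) + 3 * 0 + 0)"
    using L0 by (intro mult_left_mono add_mono SSD[OF u r]) auto
  also have "\<dots> = L * ((5 + 2 * Lp) * norm (x - y))" by (simp add: algebra_simps)
  finally show "norm (Pu u r x - Pu u r y) \<le> L * ((5 + 2 * Lp) * norm (x - y))" .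
qed

text \<open>The constants of \<open>SS\<close> are a budget. The short horizon makes each integral
  term at most |x - y|, on top of |x - y| for X and of Lp * 2 |x - y| for the terminal datum of Z.
  The time modulus 6 L w is the sup bound of the integrands and needs no smallness.\<close>

lemma maps: 
  assumes u: "u \<in> SS"
  shows "(\<lambda>(s, x). (Xn u s x, Zn u s x)) \<in> SS"
proof -
  have tT: "T \<in> {t..T}" using t by auto
  have w0: "0 \<le> w x" for x using w1(1)[of x] by linarith
  have a: "norm (Xn u s x - x) \<le> w x / 20" if s: "s \<in> {t..T}" for s x
  proof -
    have "norm (Xn u s x - x) \<le> e * (2 * w x)"
      by (rule integral_bound[OF Xn_integral(1)[OF u s] t(1)]) (use s Bu_bound(1)[OF u] w0[of x] in auto)
    also have "\<dots> \<le> 1 / 100 * (2 * w x)" using e(2) w0[of x] by (intro mult_right_mono) auto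
    finally show ?thesis using w0[of x] by simp
  qed
  have c: "norm (Xn u s x - Xn u s y) \<le> 2 * norm (x - y)" if s: "s \<in> {t..T}" for s x y
  proof -
    have "norm ((Xn u s x - x) - (Xn u s y - y)) \<le> e * ((3 + 2 * Lp) * norm (x - y))"
      by (rule integral_diff_bound[OF Xn_integral(1)[OF u s] Xn_integral(1)[OF u s] t(1)]) (use s Bu_bound(3)[OF u] Lp0 in auto)
    also have "\<dots> = (3 * e + 2 * (e * Lp)) * norm (x - y)" by (simp add: algebra_simps)
    also have "\<dots> \<le> 1 * norm (x - y)" using e(2,3) by (intro mult_right_mono) auto
    finally have "norm ((Xn u s x - x) - (Xn u s y - y)) \<le> norm (x - y)" by simp
    moreover have "Xn u s x - Xn u s y = (x - y) + ((Xn u s x - x) - (Xn u s y - y))" by simp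
    ultimately show ?thesis using norm_triangle_ineq[of "x - y" "(Xn u s x - x) - (Xn u s y - y)"] by simp
  qed
  have mX: "Xn u T \<in> borel_measurable borel" using c[OF tT] by (rule lipschitz_measurable)
  note nX = near_id[OF mX a[OF tT]]
  note lawT = sqi_distr_P2[OF P2D(1)[OF m] nX(1)]
  have b: "norm (Zn u s x) \<le> 17 / 10 * Lp * w x" if s: "s \<in> {t..T}" for s x
  proof -
    have "norm (Zn u s x - p (Xn u T x) (distr m borel (Xn u T))) \<le> e * (6 * w x)"
      by (rule integral_bound[OF Xn_integral(2)[OF u s]]) (use s t Bu_bound(2)[OF u] w0[of x] in auto)
    \<comment> \<open>The running term gets half a weight. With 23 / 20 from the terminal datum this
      makes 33 / 20, below 17 / 10.\<close>
    also have "\<dots> = 12 * e * (w x / 2)" by simp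
    also have "\<dots> \<le> Lp * (w x / 2)" using e(4) w0[of x] by (intro mult_right_mono) auto
    finally have 1: "norm (Zn u s x - p (Xn u T x) (distr m borel (Xn u T))) \<le> Lp * (w x / 2)" .
    have "norm (p (Xn u T x) (distr m borel (Xn u T))) \<le> Lp * (1 + norm (Xn u T x) + (\<integral>y. norm (Xn u T y) \<partial>m))"
      using p_growth[OF lawT, of "Xn u T x"] by (simp only: mnorm_distr[OF P2D(1)[OF m] nX(1)])
    also have "\<dots> \<le> Lp * (23 / 20 * w x)" using nX(3)[of x] Lp0 by (intro mult_left_mono) auto
    finally have "norm (Zn u s x) \<le> Lp * (23 / 20 * w x) + Lp * (w x / 2)"
      using 1 norm_triangle_sub[of "Zn u s x" "p (Xn u T x) (distr m borel (Xn u T))"] by simp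
    also have "\<dots> = 33 / 20 * (Lp * w x)" by simp
    also have "\<dots> \<le> 17 / 10 * (Lp * w x)" using Lp0 w0[of x] by (intro mult_right_mono) auto
    finally show ?thesis by simp
  qed
  have d: "norm (Zn u s x - Zn u s y) \<le> (2 * Lp + 1) * norm (x - y)" if s: "s \<in> {t..T}" for s x y
  proof -
    let ?p = "\<lambda>x. p (Xn u T x) (distr m borel (Xn u T))"
    have "norm ((Zn u s x - ?p x) - (Zn u s y - ?p y)) \<le> e * ((5 + 2 * Lp) * norm (x - y))"
      by (rule integral_diff_bound[OF Xn_integral(2)[OF u s] Xn_integral(2)[OF u s]]) (use s t Bu_bound(4)[OF u] Lp0 in auto)
    also have "\<dots> = (5 * e + 2 * (e * Lp)) * norm (x - y)" by (simp add: algebra_simps)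
    also have "\<dots> \<le> 1 * norm (x - y)" using e(2,3) by (intro mult_right_mono) auto
    finally have 1: "norm ((Zn u s x - ?p x) - (Zn u s y - ?p y)) \<le> norm (x - y)" by simp
    have "norm (?p x - ?p y) \<le> Lp * (norm (Xn u T x - Xn u T y) + 0)"
      using p_lip[OF lawT lawT diag_coupling(1)[OF lawT]] by (simp only: diag_coupling(2)[OF lawT])
    also have "\<dots> \<le> Lp * (2 * norm (x - y))" using c[OF tT, of x y] Lp0 by (intro mult_left_mono) auto
    finally have 2: "norm (?p x - ?p y) \<le> Lp * (2 * norm (x - y))" .
    have "Zn u s x - Zn u s y = ((Zn u s x - ?p x) - (Zn u s y - ?p y)) + (?p x - ?p y)" by simp
    then have "norm (Zn u s x - Zn u s y) \<le> norm (x - y) + Lp * (2 * norm (x - y))"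
      using norm_triangle_mono[OF 1 2] by simp
    then show ?thesis by (simp add: algebra_simps)
  qed
  have subX: "norm (Xn u s x - Xn u r x) \<le> 6 * L * \<bar>s - r\<bar> * w x" if s: "s \<in> {t..T}" and r: "r \<in> {t..T}" and rs: "r \<le> s" for s r x
  proof -
    have "((\<lambda>r. Bu u r x) has_integral (Xn u s x - x - (Xn u r x - x))) {r..s}"
      by (rule has_integral_sub[OF Xn_integral(1)[OF u r] Xn_integral(1)[OF u s]]) (use r rs in auto)
    then have "norm (Xn u s x - x - (Xn u r x - x)) \<le> L * (2 * w x) * (s - r)"
      by (rule has_integral_norm_le) (use r s rs Bu_bound(1)[OF u] w0[of x] L0 in auto)
    also have "\<dots> \<le> L * (6 * w x) * (s - r)" using L0 w0[of x] rs by (intro mult_right_mono mult_left_mono) auto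
    also have "L * (6 * w x) * (s - r) = 6 * L * \<bar>s - r\<bar> * w x" unfolding abs_of_nonneg[OF diff_ge_0_iff_ge[THEN iffD2, OF rs]] by (simp only: ac_simps)
    finally show ?thesis by simp
  qed
  have subZ: "norm (Zn u s x - Zn u r x) \<le> 6 * L * \<bar>s - r\<bar> * w x" if s: "s \<in> {t..T}" and r: "r \<in> {t..T}" and rs: "r \<le> s" for s r x
  proof -
    have "(\<lambda>r. Pu u r x) integrable_on {r..s}"
      by (rule integrable_continuous_real, rule continuous_on_subset[OF Bu_continuous(2)[OF u]]) (use r s in auto)
    then obtain k where k: "((\<lambda>r. Pu u r x) has_integral k) {r..s}" by blast
    have "((\<lambda>r. Pu u r x) has_integral (k + (Zn u s x - p (Xn u T x) (distr m borel (Xn u T))))) {r..T}"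
      by (rule has_integral_combine[OF rs _ k Xn_integral(2)[OF u s]]) (use s in auto)
    then have "Zn u r x - Zn u s x = k" using has_integral_unique[OF Xn_integral(2)[OF u r]] by (simp add: algebra_simps)
    then have "norm (Zn u s x - Zn u r x) = norm k" by (simp add: norm_minus_commute)
    also have "norm k \<le> L * (6 * w x) * (s - r)"
      by (rule has_integral_norm_le[OF k rs]) (use r s Bu_bound(2)[OF u] w0[of x] L0 in auto)
    also have "L * (6 * w x) * (s - r) = 6 * L * \<bar>s - r\<bar> * w x" unfolding abs_of_nonneg[OF diff_ge_0_iff_ge[THEN iffD2, OF rs]] by (simp only: ac_simps)
    finally show ?thesis .
  qed
  have subX': "norm (Xn u s x - Xn u r x) \<le> 6 * L * \<bar>s - r\<bar> * w x" if "s \<in> {t..T}" "r \<in> {t..T}" for s r x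
    using subX[OF that, of x] subX[OF that(2,1), of x] by (cases "r \<le> s") (auto simp: norm_minus_commute abs_minus_commute)
  have subZ': "norm (Zn u s x - Zn u r x) \<le> 6 * L * \<bar>s - r\<bar> * w x" if "s \<in> {t..T}" "r \<in> {t..T}" for s r x
    using subZ[OF that, of x] subZ[OF that(2,1), of x] by (cases "r \<le> s") (auto simp: norm_minus_commute abs_minus_commute)
  show ?thesis unfolding SS_def using a b c d subX' subZ' by simp
qed

lemma fixed_point:
  obtains X Z where "(\<lambda>(s, x). (X s x, Z s x)) \<in> SS"
    "\<And>s x. s \<in> {t..T} \<Longrightarrow> Xn (\<lambda>(s, x). (X s x, Z s x)) s x = X s x"
    "\<And>s x. s \<in> {t..T} \<Longrightarrow> Zn (\<lambda>(s, x). (X s x, Z s x)) s x = Z s x"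
proof -
  have w0: "0 \<le> w x" for x using w1(1)[of x] by linarith
  have tT: "T \<in> {t..T}" using t by auto
  define F where "F u = (\<lambda>(s, x). (Xn u s x, Zn u s x))" for u
  have FX: "fst (F u (s, x)) = Xn u s x" "snd (F u (s, x)) = Zn u s x" for u s x by (simp_all add: F_def)
  have pairn: "norm a \<le> norm (fst a) + norm (snd a)" "norm (fst a) \<le> norm a" "norm (snd a) \<le> norm a" for a :: "'x \<times> 'x"
    using norm_triangle_ineq[of "(fst a, 0)" "(0, snd a)"] norm_fst_le[of "fst a" "snd a"] norm_snd_le[of "snd a" "fst a"] by (simp_all add: norm_Pair)
  have ne: "(\<lambda>(s, x). (x, 0)) \<in> SS"
    unfolding SS_def using w0 Lp0[THEN less_imp_le] L0[THEN less_imp_le] by simp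
  have "\<exists>u\<in>SS. \<forall>i\<in>{t..T} \<times> UNIV. F u i = u i"
  proof (rule weighted_contraction[where I = "{t..T} \<times> UNIV" and S = SS and F = F and C = "1 + 4 * Lp" and w = "\<lambda>i. w (snd i)"])
    fix U :: "nat \<Rightarrow> real \<times> 'x \<Rightarrow> 'x \<times> 'x" and u
    assume U: "\<And>n. U n \<in> SS" and lim: "\<And>i. i \<in> {t..T} \<times> UNIV \<Longrightarrow> (\<lambda>n. U n i) \<longlonglongrightarrow> u i"
    have l: "(\<lambda>n. fst (U n (s, x))) \<longlonglongrightarrow> fst (u (s, x))" "(\<lambda>n. snd (U n (s, x))) \<longlonglongrightarrow> snd (u (s, x))" if "s \<in> {t..T}" for s x
      using lim[of "(s, x)"] that by (auto intro: tendsto_fst tendsto_snd)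
    have lb: "norm a \<le> c" if "f \<longlonglongrightarrow> a" "\<And>n. norm (f n) \<le> c" for f :: "nat \<Rightarrow> 'x" and a c
      by (rule LIMSEQ_le_const2[OF tendsto_norm[OF that(1)]]) (use that(2) in auto)
    show "u \<in> SS"
      unfolding SS_def
    proof (intro CollectI ballI allI conjI)
      fix s r x y assume s: "s \<in> {t..T}"
      show "norm (fst (u (s, x)) - x) \<le> w x / 20" by (rule lb[OF tendsto_diff[OF l(1)[OF s] tendsto_const] SSD(1)[OF U s]])
      show "norm (snd (u (s, x))) \<le> 17 / 10 * Lp * w x" by (rule lb[OF l(2)[OF s] SSD(2)[OF U s]])
      show "norm (fst (u (s, x)) - fst (u (s, y))) \<le> 2 * norm (x - y)"
        by (rule lb[OF tendsto_diff[OF l(1)[OF s] l(1)[OF s]] SSD(3)[OF U s]])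
      show "norm (snd (u (s, x)) - snd (u (s, y))) \<le> (2 * Lp + 1) * norm (x - y)"
        by (rule lb[OF tendsto_diff[OF l(2)[OF s] l(2)[OF s]] SSD(4)[OF U s]])
      assume r: "r \<in> {t..T}"
      show "norm (fst (u (s, x)) - fst (u (r, x))) \<le> 6 * L * \<bar>s - r\<bar> * w x"
        by (rule lb[OF tendsto_diff[OF l(1)[OF s] l(1)[OF r]] SSD(5)[OF U s r]])
      show "norm (snd (u (s, x)) - snd (u (r, x))) \<le> 6 * L * \<bar>s - r\<bar> * w x"
        by (rule lb[OF tendsto_diff[OF l(2)[OF s] l(2)[OF r]] SSD(6)[OF U s r]])
    qed
  next
    fix u assume "u \<in> SS" then show "F u \<in> SS" unfolding F_def by (rule maps)
  next
    show "(\<lambda>(s, x). (x, 0)) \<in> SS" by (rule ne)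
  next
    fix u v and i :: "real \<times> 'x" assume u: "u \<in> SS" and v: "v \<in> SS" and i: "i \<in> {t..T} \<times> UNIV"
    obtain s x where sx: "i = (s, x)" "s \<in> {t..T}" using i by auto
    have "norm (u i - v i) \<le> norm (fst (u i - v i)) + norm (snd (u i - v i))" by (rule pairn)
    also have "norm (fst (u i - v i)) \<le> w x / 20 + w x / 20"
      using SSD(1)[OF u sx(2), of x] SSD(1)[OF v sx(2), of x] norm_triangle_ineq4[of "fst (u i) - x" "fst (v i) - x"] sx(1) by simp
    also have "norm (snd (u i - v i)) \<le> 17 / 10 * Lp * w x + 17 / 10 * Lp * w x"
      using SSD(2)[OF u sx(2), of x] SSD(2)[OF v sx(2), of x] norm_triangle_ineq4[of "snd (u i)" "snd (v i)"] sx(1) by simp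
    also have "w x / 20 + w x / 20 + (17 / 10 * Lp * w x + 17 / 10 * Lp * w x) \<le> (1 + 4 * Lp) * w x"
    proof -
      have aux: "a / 20 + a / 20 + (17 / 10 * k + 17 / 10 * k) \<le> a + 4 * k" if "0 \<le> a" "0 \<le> k" for a k :: real
        using that by simp
      show ?thesis using aux[of "w x" "Lp * w x"] w0[of x] Lp0 by (simp add: distrib_right)
    qed
    finally show "norm (u i - v i) \<le> (1 + 4 * Lp) * w (snd i)" using sx(1) by simp
  next
    fix u v and b :: real and i :: "real \<times> 'x"
    assume u: "u \<in> SS" and v: "v \<in> SS" and b: "0 \<le> b" and i: "i \<in> {t..T} \<times> UNIV"
      and uv: "\<And>i. i \<in> {t..T} \<times> UNIV \<Longrightarrow> norm (u i - v i) \<le> b * w (snd i)"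
    obtain s x where sx: "i = (s, x)" "s \<in> {t..T}" using i by auto
    note Fu = maps[OF u] and Fv = maps[OF v]
    have q: "sqi m (Xn u T)" "sqi m (Xn v T)"
      using admD(2)[OF SS_adm(1)[OF Fu tT]] admD(2)[OF SS_adm(1)[OF Fv tT]] by auto
    have qid: "sqi m (\<lambda>x. x)" unfolding sqi_def meas_m using P2D(4)[OF m] by simp
    have "norm (F u i - F v i) \<le> norm (Xn u s x - Xn v s x) + norm (Zn u s x - Zn v s x)"
      using pairn(1)[of "F u i - F v i"] sx(1) by (simp add: F_def)
    \<comment> \<open>The norm of a pair bounds each component, so the sum of both is at most 2 b w.
      With the average this leaves 6 / 20 of b w, below one half.\<close>
    also have "\<dots> \<le> (1 + Lp) * (norm (x - x) + (\<integral>y. norm (y - y) \<partial>m)) + 1 / 20 * (2 * b * w x + (\<integral>y. 2 * b * w y \<partial>m))"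
    proof (rule step_estimate[where t = t and M = m and X = "\<lambda>r x. fst (u (r, x))" and Z = "\<lambda>r x. snd (u (r, x))"
          and X' = "\<lambda>r x. fst (v (r, x))" and Z' = "\<lambda>r x. snd (v (r, x))" and V = "\<lambda>y. 2 * b * w y"
          and Xt = "Xn u" and Xt' = "Xn v" and Zt = "Zn u s" and Zt' = "Zn v s" and \<xi> = "\<lambda>x. x" and \<xi>' = "\<lambda>x. x",
          OF SS_adm(1)[OF u] SS_adm(1)[OF v] _ _ t(1) sx(2)])
      show "integrable m (\<lambda>y. 2 * b * w y)" using w_int(1) by simp
      show "norm (fst (u (r, y)) - fst (v (r, y))) + norm (snd (u (r, y)) - snd (v (r, y))) \<le> 2 * b * w y" if "r \<in> {t..T}" for r y
        using uv[of "(r, y)"] that pairn(2,3)[of "u (r, y) - v (r, y)"] by simp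
      show "sqi m (Xn u T)" "sqi m (Xn v T)" "sqi m (\<lambda>x. x)" "sqi m (\<lambda>x. x)" by (fact q qid)+
    qed (assumption | rule Xn_integral'[OF u] Xn_integral'[OF v] sx(2))+
    also have "\<dots> = 1 / 20 * (2 * b * w x + 2 * b * (\<integral>y. w y \<partial>m))" by simp
    also have "\<dots> \<le> 1 / 20 * (2 * b * w x + 2 * b * (2 * w x))"
      using w_int(3)[of x] b by (intro mult_left_mono add_mono) auto
    also have "\<dots> = 3 / 10 * (b * w x)" by simp
    also have "\<dots> \<le> 1 / 2 * (b * w x)" using b w0[of x] by (intro mult_right_mono) auto
    finally show "norm (F u i - F v i) \<le> b / 2 * w (snd i)" using sx(1) by simp
  next
    show "0 \<le> 1 + 4 * Lp" "\<And>i. 0 \<le> w (snd i)" using w0 Lp0 by auto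
  next
    fix u assume "u \<in> SS" "\<And>i. i \<in> {t..T} \<times> UNIV \<Longrightarrow> F u i = u i"
    then show "\<exists>u\<in>SS. \<forall>i\<in>{t..T} \<times> UNIV. F u i = u i" by blast
  qed
  then obtain u where u: "u \<in> SS" "\<And>i. i \<in> {t..T} \<times> UNIV \<Longrightarrow> F u i = u i" by blast
  define X where "X s x = fst (u (s, x))" for s x
  define Z where "Z s x = snd (u (s, x))" for s x
  have eq: "(\<lambda>(s, x). (X s x, Z s x)) = u" by (auto simp: X_def Z_def)
  show thesis
  proof (rule that[of X Z])
    show "(\<lambda>(s, x). (X s x, Z s x)) \<in> SS" unfolding eq by (rule u(1))
    fix s x assume "s \<in> {t..T}"
    then have "F u (s, x) = u (s, x)" using u(2) by simp
    then show "Xn (\<lambda>(s, x). (X s x, Z s x)) s x = X s x" "Zn (\<lambda>(s, x). (X s x, Z s x)) s x = Z s x"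
      unfolding eq FX[symmetric] by (simp_all add: X_def Z_def)
  qed
qed

end

end

section \<open>From estimates along couplings to continuity in the Wasserstein distance\<close>

lemma mnorm_diff_le_Wass:
  assumes "\<mu> \<in> P2" "\<nu> \<in> P2"
  shows "\<bar>mnorm 1 \<mu> - mnorm 1 \<nu>\<bar> \<le> Wass 2 \<mu> \<nu>"
proof (rule field_le_epsilon)
  fix e :: real assume "0 < e"
  then have "Wass 2 \<mu> \<nu> < Wass 2 \<mu> \<nu> + e" by simp
  then obtain \<pi> where "\<pi> \<in> couplings \<mu> \<nu>" "cost \<pi> < Wass 2 \<mu> \<nu> + e" by (rule Wass2_less_coupling[OF assms])
  then show "\<bar>mnorm 1 \<mu> - mnorm 1 \<nu>\<bar> \<le> Wass 2 \<mu> \<nu> + e" using mnorm_diff_le_cost[OF _ assms] by fastforce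
qed

text \<open>State and law are moved first, at the perturbed time, and time is moved last at the
  limit point. So the growing weight in the time modulus is evaluated only at a fixed point.\<close>

lemma cont_P2_on_lipschitzI:
  fixes F :: "real \<times> 'x::euclidean_space \<Rightarrow> 'x measure \<Rightarrow> 'b::real_normed_vector"
  assumes c: "0 \<le> c" "0 \<le> k"
    and lip: "\<And>t x x' m m' \<pi>. t \<in> S \<Longrightarrow> m \<in> P2 \<Longrightarrow> m' \<in> P2 \<Longrightarrow> \<pi> \<in> couplings m m' \<Longrightarrow>
      norm (F (t, x) m - F (t, x') m') \<le> c * (norm (x - x') + cost \<pi>)"
    and time: "\<And>t t' x m. t \<in> S \<Longrightarrow> t' \<in> S \<Longrightarrow> m \<in> P2 \<Longrightarrow> norm (F (t, x) m - F (t', x) m) \<le> k * \<bar>t - t'\<bar> * (1 + norm x + mnorm 1 m)"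
  shows "cont_P2_on (S \<times> UNIV) F"
  unfolding cont_P2_on_def
proof (intro ballI allI impI)
  fix z :: "real \<times> 'x" and m :: "'x measure" and e :: real
  assume z: "z \<in> S \<times> UNIV" and m: "m \<in> P2" and e: "0 < e"
  obtain t x where tx: "z = (t, x)" "t \<in> S" using z by auto
  \<comment> \<open>The extra 1 makes K positive and the final inequality strict.\<close>
  define K where "K = 2 * c + k * (1 + norm x + mnorm 1 m) + 1"
  have "0 \<le> k * (1 + norm x + mnorm 1 m)" using c by (intro mult_nonneg_nonneg add_nonneg_nonneg) auto
  then have K: "0 < K" using c unfolding K_def by linarith
  show "\<exists>d>0. \<forall>z'\<in>S \<times> UNIV. \<forall>m'\<in>P2. dist z' z < d \<and> Wass 2 m' m < d \<longrightarrow> dist (F z' m') (F z m) < e"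
  proof (intro exI[of _ "e / K"] conjI ballI impI)
    show "0 < e / K" using e K by simp
    fix z' :: "real \<times> 'x" and m' :: "'x measure"
    assume z': "z' \<in> S \<times> UNIV" and m': "m' \<in> P2" and d: "dist z' z < e / K \<and> Wass 2 m' m < e / K"
    obtain t' x' where tx': "z' = (t', x')" "t' \<in> S" using z' by auto
    obtain \<pi> where \<pi>: "\<pi> \<in> couplings m' m" "cost \<pi> < e / K" using Wass2_less_coupling[OF m' m] d by blast
    have dt: "\<bar>t' - t\<bar> < e / K" using d dist_fst_le[of z' z] unfolding tx tx' by (simp add: dist_real_def)
    have dx: "norm (x' - x) < e / K" using d dist_snd_le[of z' z] unfolding tx tx' by (simp add: dist_norm)
    have "norm (F (t', x') m' - F (t', x) m) \<le> c * (norm (x' - x) + cost \<pi>)" by (rule lip[OF tx'(2) m' m \<pi>(1)])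
    also have "\<dots> \<le> c * (e / K + e / K)" using c dx \<pi>(2) by (intro mult_left_mono) auto
    finally have 1: "norm (F (t', x') m' - F (t', x) m) \<le> c * (e / K + e / K)" .
    have "norm (F (t', x) m - F (t, x) m) \<le> k * \<bar>t' - t\<bar> * (1 + norm x + mnorm 1 m)" by (rule time[OF tx'(2) tx(2) m])
    also have "\<dots> \<le> k * (e / K) * (1 + norm x + mnorm 1 m)"
      using c dt by (intro mult_right_mono mult_left_mono add_nonneg_nonneg) auto
    finally have 2: "norm (F (t', x) m - F (t, x) m) \<le> k * (e / K) * (1 + norm x + mnorm 1 m)" .
    have "norm (F z' m' - F z m) \<le> c * (e / K + e / K) + k * (e / K) * (1 + norm x + mnorm 1 m)"
      using norm_triangle_mono[OF 1 2] unfolding tx tx' by simp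
    also have "\<dots> = (K - 1) * (e / K)"
    proof -
      have "c * (q + q) + k * q * W = (2 * c + k * W + 1 - 1) * q" for q W :: real by (simp add: algebra_simps)
      then show ?thesis by (simp only: K_def[symmetric])
    qed
    also have "\<dots> < K * (e / K)" using e K by (intro mult_strict_right_mono) auto
    also have "\<dots> = e" using K by simp
    finally show "dist (F z' m') (F z m) < e" by (simp add: dist_norm)
  qed
qed

context fbode_short
begin

subsection \<open>The decoupling field\<close>

definition is_fix :: "real \<Rightarrow> 'x measure \<Rightarrow> (real \<Rightarrow> 'x \<Rightarrow> 'x) \<times> (real \<Rightarrow> 'x \<Rightarrow> 'x) \<Rightarrow> bool" where
  "is_fix t m q \<longleftrightarrow> (\<lambda>(s, x). (fst q s x, snd q s x)) \<in> SS t m \<and>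
    (\<forall>s\<in>{t..T}. \<forall>x. Xn t m (\<lambda>(s, x). (fst q s x, snd q s x)) s x = fst q s x \<and> Zn t m (\<lambda>(s, x). (fst q s x, snd q s x)) s x = snd q s x)"

text \<open>A separate choice for each (t, m) gives no relation between different starts;
  \<open>XX_restart\<close> recovers it from stability.\<close>

definition XX where "XX t m = fst (SOME q. is_fix t m q)"
definition ZZ where "ZZ t m = snd (SOME q. is_fix t m q)"
definition \<gamma> where "\<gamma> t x m = ZZ t m t x"

lemma wD:
  assumes "m \<in> P2"
  shows "w m x = 1 + norm x + mnorm 1 m" "1 \<le> w m x" "0 \<le> w m x" "norm x \<le> w m x"
    "integrable m (w m)" "(\<integral>x. w m x \<partial>m) \<le> 2 * w m y"
proof -
  note c = order_refl t0T assms
  show "w m x = 1 + norm x + mnorm 1 m" by (rule w_def[OF c])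
  show "1 \<le> w m x" by (rule w1(1)[OF c])
  then show "0 \<le> w m x" by simp
  show "norm x \<le> w m x" by (rule w1(2)[OF c])
  show "integrable m (w m)" by (rule w_int(1)[OF c])
  show "(\<integral>x. w m x \<partial>m) \<le> 2 * w m y" by (rule w_int(3)[OF c])
qed

lemma XX_fix:
  assumes "t \<in> {t0..T}" "m \<in> P2"
  shows "(\<lambda>(s, x). (XX t m s x, ZZ t m s x)) \<in> SS t m"
    "s \<in> {t..T} \<Longrightarrow> Xn t m (\<lambda>(s, x). (XX t m s x, ZZ t m s x)) s x = XX t m s x"
    "s \<in> {t..T} \<Longrightarrow> Zn t m (\<lambda>(s, x). (XX t m s x, ZZ t m s x)) s x = ZZ t m s x"
proof -
  have tt: "t0 \<le> t" "t \<le> T" using assms by auto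
  obtain X Z where "(\<lambda>(s, x). (X s x, Z s x)) \<in> SS t m"
    "\<And>s x. s \<in> {t..T} \<Longrightarrow> Xn t m (\<lambda>(s, x). (X s x, Z s x)) s x = X s x"
    "\<And>s x. s \<in> {t..T} \<Longrightarrow> Zn t m (\<lambda>(s, x). (X s x, Z s x)) s x = Z s x"
    by (rule fixed_point[OF tt assms(2)]) blast
  then have "is_fix t m (X, Z)" by (simp add: is_fix_def)
  then have "is_fix t m (SOME q. is_fix t m q)" by (rule someI)
  then have *: "is_fix t m (XX t m, ZZ t m)" by (simp add: XX_def ZZ_def)
  show "(\<lambda>(s, x). (XX t m s x, ZZ t m s x)) \<in> SS t m"
    "s \<in> {t..T} \<Longrightarrow> Xn t m (\<lambda>(s, x). (XX t m s x, ZZ t m s x)) s x = XX t m s x"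
    "s \<in> {t..T} \<Longrightarrow> Zn t m (\<lambda>(s, x). (XX t m s x, ZZ t m s x)) s x = ZZ t m s x"
    using * by (simp_all add: is_fix_def)
qed

lemma XXD:
  assumes t: "t \<in> {t0..T}" and m: "m \<in> P2" and s: "s \<in> {t..T}"
  shows "adm m (XX t m s) (ZZ t m s)" "norm (XX t m s x - x) \<le> w m x / 20" "norm (ZZ t m s x) \<le> 17 / 10 * Lp * w m x"
    "r \<in> {t..T} \<Longrightarrow> norm (XX t m s x - XX t m r x) \<le> 6 * L * \<bar>s - r\<bar> * w m x"
    "r \<in> {t..T} \<Longrightarrow> norm (ZZ t m s x - ZZ t m r x) \<le> 6 * L * \<bar>s - r\<bar> * w m x"
    "XX t m s \<in> borel_measurable borel" "ZZ t m s \<in> borel_measurable borel"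
    "norm (XX t m s x) \<le> 2 * w m x"
    "17 / 20 * w m x \<le> 1 + norm (XX t m s x) + (\<integral>y. norm (XX t m s y) \<partial>m)"
    "1 + norm (XX t m s x) + (\<integral>y. norm (XX t m s y) \<partial>m) \<le> 23 / 20 * w m x"
    "((\<lambda>r. B (XX t m r x) (distr m borel (XX t m r)) (ZZ t m r x)) has_integral (XX t m s x - x)) {t..s}"
    "((\<lambda>r. \<Phi> m (XX t m r) (ZZ t m r) x) has_integral (ZZ t m s x - p (XX t m T x) (distr m borel (XX t m T)))) {s..T}"
    "continuous_on {t..T} (\<lambda>r. B (XX t m r x) (distr m borel (XX t m r)) (ZZ t m r x))"
    "continuous_on {t..T} (\<lambda>r. \<Phi> m (XX t m r) (ZZ t m r) x)"
proof -
  have tt: "t0 \<le> t" "t \<le> T" using t by auto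
  note c = tt m
  note u = XX_fix(1)[OF t m]
  show "adm m (XX t m s) (ZZ t m s)" using SS_adm(1)[OF c u s] by simp
  show X1: "norm (XX t m s x - x) \<le> w m x / 20" for x using SSD(1)[OF c u s, of x] by simp
  show "norm (ZZ t m s x) \<le> 17 / 10 * Lp * w m x" using SSD(2)[OF c u s, of x] by simp
  show "r \<in> {t..T} \<Longrightarrow> norm (XX t m s x - XX t m r x) \<le> 6 * L * \<bar>s - r\<bar> * w m x"
    using SSD(5)[OF c u s, of r x] by simp
  show "r \<in> {t..T} \<Longrightarrow> norm (ZZ t m s x - ZZ t m r x) \<le> 6 * L * \<bar>s - r\<bar> * w m x"
    using SSD(6)[OF c u s, of r x] by simp
  have lX: "norm (XX t m s x - XX t m s y) \<le> 2 * norm (x - y)" for x y using SSD(3)[OF c u s, of x y] by simp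
  have lZ: "norm (ZZ t m s x - ZZ t m s y) \<le> (2 * Lp + 1) * norm (x - y)" for x y using SSD(4)[OF c u s, of x y] by simp
  show X: "XX t m s \<in> borel_measurable borel" using lX by (rule lipschitz_measurable[OF c])
  show "ZZ t m s \<in> borel_measurable borel" using lZ by (rule lipschitz_measurable[OF c])
  note n = near_id[OF c X X1]
  show "norm (XX t m s x) \<le> 2 * w m x"
    "17 / 20 * w m x \<le> 1 + norm (XX t m s x) + (\<integral>y. norm (XX t m s y) \<partial>m)"
    "1 + norm (XX t m s x) + (\<integral>y. norm (XX t m s y) \<partial>m) \<le> 23 / 20 * w m x" by (rule n)+
  let ?u = "\<lambda>(s, x). (XX t m s x, ZZ t m s x)"
  show "((\<lambda>r. B (XX t m r x) (distr m borel (XX t m r)) (ZZ t m r x)) has_integral (XX t m s x - x)) {t..s}"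
    using Xn_integral'(1)[OF c u s, of x] unfolding XX_fix(2)[OF t m s] by simp
  have TT: "T \<in> {t..T}" using tt by simp
  have "Xn t m ?u T = XX t m T" using XX_fix(2)[OF t m TT] by (simp add: fun_eq_iff)
  then show "((\<lambda>r. \<Phi> m (XX t m r) (ZZ t m r) x) has_integral (ZZ t m s x - p (XX t m T x) (distr m borel (XX t m T)))) {s..T}"
    using Xn_integral'(2)[OF c u s, of x] unfolding XX_fix(3)[OF t m s] by simp
  show "continuous_on {t..T} (\<lambda>r. B (XX t m r x) (distr m borel (XX t m r)) (ZZ t m r x))"
    using Bu_continuous(1)[OF c u, of x] unfolding Bu_def[OF c] by simp
  show "continuous_on {t..T} (\<lambda>r. \<Phi> m (XX t m r) (ZZ t m r) x)"
    using Bu_continuous(2)[OF c u, of x] unfolding Pu_def[OF c] by simp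
qed

lemma XX_init:
  assumes t: "t \<in> {t0..T}" and m: "m \<in> P2"
  shows "XX t m t x = x"
proof -
  have "t \<in> {t..T}" using t by auto
  from XXD(11)[OF t m this, of x] show ?thesis by (simp add: has_integral_refl has_integral_iff)
qed

lemma sqi_id:
  assumes m: "m \<in> P2"
  shows "sqi m (\<lambda>x. x)" "prob_space m" "(\<lambda>x. x) \<in> borel_measurable m"
  using P2D(1,4)[OF m] by (auto simp: sqi_def borel_measurable_eq_borel[OF P2D(2)[OF m]])

lemma measurable_P2: "m \<in> P2 \<Longrightarrow> F \<in> borel_measurable borel \<Longrightarrow> F \<in> borel_measurable m"
  by (simp add: borel_measurable_eq_borel[OF P2D(2)])

lemma XX_sol:
  assumes t: "t \<in> {t0..T}" and m: "m \<in> P2"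
  shows "sol m (\<lambda>x. x) t T (XX t m) (ZZ t m)"
  unfolding sol_def
proof (intro conjI ballI allI)
  show "sqi m (\<lambda>x. x)" by (rule sqi_id[OF m])
  show "adm m (XX t m s) (ZZ t m s)" if "s \<in> {t..T}" for s using XXD(1)[OF t m that] .
  show "\<exists>C\<ge>0. \<forall>s\<in>{t..T}. \<forall>x. norm (XX t m s x) + norm (ZZ t m s x) \<le> C * (1 + norm x + (\<integral>y. norm y \<partial>m))"
  proof (intro exI[of _ "2 + 17 / 10 * Lp"] conjI ballI allI)
    show "0 \<le> 2 + 17 / 10 * Lp" using Lp0 by simp
    fix s x assume s: "s \<in> {t..T}"
    have "norm (XX t m s x) + norm (ZZ t m s x) \<le> 2 * w m x + 17 / 10 * Lp * w m x"
      using XXD(8)[OF t m s, of x] XXD(3)[OF t m s, of x] by simp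
    also have "\<dots> = (2 + 17 / 10 * Lp) * (1 + norm x + (\<integral>y. norm y \<partial>m))"
      unfolding wD(1)[OF m] mnorm_1[OF m] by (simp only: distrib_right)
    finally show "norm (XX t m s x) + norm (ZZ t m s x) \<le> (2 + 17 / 10 * Lp) * (1 + norm x + (\<integral>y. norm y \<partial>m))" .
  qed
  fix x s assume s: "s \<in> {t..T}"
  show "((\<lambda>r. B (XX t m r x) (distr m borel (XX t m r)) (ZZ t m r x)) has_integral (XX t m s x - x)) {t..s}" by (rule XXD(11)[OF t m s])
  show "((\<lambda>r. \<Phi> m (XX t m r) (ZZ t m r) x) has_integral (ZZ t m s x - p (XX t m T x) (distr m borel (XX t m T)))) {s..T}"
    by (rule XXD(12)[OF t m s])
qed

text \<open>The solution from the law m, evaluated along any random variable of law m, solves the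
  system on the space of that variable: only laws and pointwise values enter the equations. This is
  how solutions are brought to a common space.\<close>

lemma sol_comp:
  fixes \<phi> :: "'w \<Rightarrow> 'x"
  assumes t: "t \<in> {t0..T}" and m: "m \<in> P2" and M: "prob_space M" and \<phi>: "\<phi> \<in> borel_measurable M" "distr M borel \<phi> = m"
  shows "sol M \<phi> t T (\<lambda>s \<omega>. XX t m s (\<phi> \<omega>)) (\<lambda>s \<omega>. ZZ t m s (\<phi> \<omega>))"
proof -
  note S = XX_sol[OF t m, unfolded sol_def]
  have law: "distr M borel (\<lambda>\<omega>. XX t m s (\<phi> \<omega>)) = distr m borel (XX t m s)" if s: "s \<in> {t..T}" for s
    using distr_distr[of "XX t m s" borel borel \<phi> M] XXD(6)[OF t m s] \<phi> by (simp add: comp_def)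
  have q: "sqi M \<phi>" using sqi_iff_P2[OF M \<phi>(1)] \<phi>(2) m by simp
  have adm: "adm M (\<lambda>\<omega>. XX t m s (\<phi> \<omega>)) (\<lambda>\<omega>. ZZ t m s (\<phi> \<omega>))" if s: "s \<in> {t..T}" for s
    unfolding adm_def
  proof (intro conjI allI)
    note a = admD[OF XXD(1)[OF t m s]]
    show "prob_space M" by (rule M)
    have mX: "(\<lambda>\<omega>. XX t m s (\<phi> \<omega>)) \<in> borel_measurable M" using measurable_compose[OF \<phi>(1) XXD(6)[OF t m s]] .
    show "sqi M (\<lambda>\<omega>. XX t m s (\<phi> \<omega>))" using sqi_iff_P2[OF M mX] law[OF s] a(6) by simp
    show "(\<lambda>\<omega>. ZZ t m s (\<phi> \<omega>)) \<in> borel_measurable M" using measurable_compose[OF \<phi>(1) XXD(7)[OF t m s]] .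
    show "cone (XX t m s (\<phi> \<omega>)) (distr M borel (\<lambda>\<omega>. XX t m s (\<phi> \<omega>))) (ZZ t m s (\<phi> \<omega>))" for \<omega> unfolding law[OF s] by (rule a(5))
  qed
  have Phi: "\<Phi> M (\<lambda>\<omega>. XX t m s (\<phi> \<omega>)) (\<lambda>\<omega>. ZZ t m s (\<phi> \<omega>)) \<omega> = \<Phi> m (XX t m s) (ZZ t m s) (\<phi> \<omega>)" if s: "s \<in> {t..T}" for s \<omega>
  proof -
    have "(\<lambda>y. \<Gamma> (XX t m s (\<phi> \<omega>)) (distr m borel (XX t m s)) (XX t m s y) (ZZ t m s y)) \<in> borel_measurable borel"
      using borel_measurable_integrable[OF \<Gamma>_integrable[OF XXD(1)[OF t m s]]] by (simp add: borel_measurable_eq_borel[OF P2D(2)[OF m]])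
    from integral_distr[OF \<phi>(1) this] show ?thesis unfolding \<Phi>_def law[OF s] \<phi>(2) by simp
  qed
  have n: "(\<integral>y. norm (\<phi> y) \<partial>M) = (\<integral>y. norm y \<partial>m)"
    using integral_distr[OF \<phi>(1), of "\<lambda>y. norm y"] \<phi>(2) by simp
  show ?thesis
    unfolding sol_def n
  proof (intro conjI ballI allI q adm)
    show "\<exists>C\<ge>0. \<forall>s\<in>{t..T}. \<forall>w. norm (XX t m s (\<phi> w)) + norm (ZZ t m s (\<phi> w)) \<le> C * (1 + norm (\<phi> w) + (\<integral>y. norm y \<partial>m))"
      using S by blast
    fix \<omega> s assume s: "s \<in> {t..T}"
    have TT: "T \<in> {t..T}" using t by simp
    show "((\<lambda>r. B (XX t m r (\<phi> \<omega>)) (distr M borel (\<lambda>\<omega>. XX t m r (\<phi> \<omega>))) (ZZ t m r (\<phi> \<omega>))) has_integral (XX t m s (\<phi> \<omega>) - \<phi> \<omega>)) {t..s}"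
      by (rule has_integral_eq[OF _ XXD(11)[OF t m s]]) (use s law in auto)
    show "((\<lambda>r. \<Phi> M (\<lambda>\<omega>. XX t m r (\<phi> \<omega>)) (\<lambda>\<omega>. ZZ t m r (\<phi> \<omega>)) \<omega>) has_integral
        (ZZ t m s (\<phi> \<omega>) - p (XX t m T (\<phi> \<omega>)) (distr M borel (\<lambda>\<omega>. XX t m T (\<phi> \<omega>))))) {s..T}"
      unfolding law[OF TT] by (rule has_integral_eq[OF _ XXD(12)[OF t m s]]) (use s Phi in auto)
  qed
qed

text \<open>The space stays m while the initial variable becomes X_s, so that no change of measure
  is needed to restart.\<close>

lemma sol_restart:
  assumes t: "t \<in> {t0..T}" and m: "m \<in> P2" and s: "s \<in> {t..T}"
  shows "sol m (XX t m s) s T (XX t m) (ZZ t m)"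
  unfolding sol_def
proof (intro conjI ballI allI)
  show "sqi m (XX t m s)" using XXD(1)[OF t m s] by (simp add: adm_def)
  show "adm m (XX t m r) (ZZ t m r)" if "r \<in> {s..T}" for r using XXD(1)[OF t m] that s by simp
  show "\<exists>C\<ge>0. \<forall>r\<in>{s..T}. \<forall>x. norm (XX t m r x) + norm (ZZ t m r x) \<le> C * (1 + norm (XX t m s x) + (\<integral>y. norm (XX t m s y) \<partial>m))"
  \<comment> \<open>The growth bound has to be expressed by the new initial value; 20 / 17 inverts
    the lower weight bound of \<open>near_id\<close>.\<close>
  proof (intro exI[of _ "(2 + 17 / 10 * Lp) * (20 / 17)"] conjI ballI allI)
    show "0 \<le> (2 + 17 / 10 * Lp) * (20 / 17)" using Lp0 by simp
    fix r x assume "r \<in> {s..T}"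
    then have r: "r \<in> {t..T}" using s by auto
    have "norm (XX t m r x) + norm (ZZ t m r x) \<le> 2 * w m x + 17 / 10 * Lp * w m x"
      using XXD(8)[OF t m r, of x] XXD(3)[OF t m r, of x] by simp
    also have "\<dots> = (2 + 17 / 10 * Lp) * (20 / 17) * (17 / 20 * w m x)" by (simp add: distrib_right)
    also have "\<dots> \<le> (2 + 17 / 10 * Lp) * (20 / 17) * (1 + norm (XX t m s x) + (\<integral>y. norm (XX t m s y) \<partial>m))"
      by (rule mult_left_mono[OF XXD(9)[OF t m s]]) (use Lp0 in simp)
    finally show "norm (XX t m r x) + norm (ZZ t m r x) \<le> (2 + 17 / 10 * Lp) * (20 / 17) * (1 + norm (XX t m s x) + (\<integral>y. norm (XX t m s y) \<partial>m))" .
  qed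
  fix x r assume r: "r \<in> {s..T}"
  then have r': "r \<in> {t..T}" "t \<le> s" "s \<le> r" using s by auto
  have "((\<lambda>r. B (XX t m r x) (distr m borel (XX t m r)) (ZZ t m r x)) has_integral (XX t m r x - x - (XX t m s x - x))) {s..r}"
    by (rule has_integral_sub[OF XXD(11)[OF t m s] XXD(11)[OF t m r'(1)] r'(2,3)])
  then show "((\<lambda>r. B (XX t m r x) (distr m borel (XX t m r)) (ZZ t m r x)) has_integral (XX t m r x - XX t m s x)) {s..r}" by simp
  show "((\<lambda>r. \<Phi> m (XX t m r) (ZZ t m r) x) has_integral (ZZ t m r x - p (XX t m T x) (distr m borel (XX t m T)))) {r..T}"
    by (rule XXD(12)[OF t m r'(1)])
qed

text \<open>Both sides solve the system from time s with the same initial variable on the space m,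
  so the bound in \<open>stability\<close> is 0. The first part is the flow property, the second the
  decoupling relation.\<close>

lemma XX_restart:
  assumes t: "t \<in> {t0..T}" and m: "m \<in> P2" and s: "s \<in> {t..T}" and r: "r \<in> {s..T}"
  shows "XX t m r x = XX s (distr m borel (XX t m s)) r (XX t m s x)"
    "ZZ t m r x = ZZ s (distr m borel (XX t m s)) r (XX t m s x)"
proof -
  have s': "s \<in> {t0..T}" using s t by auto
  note a = admD[OF XXD(1)[OF t m s]]
  have "norm (XX t m r x - XX s (distr m borel (XX t m s)) r (XX t m s x)) + norm (ZZ t m r x - ZZ s (distr m borel (XX t m s)) r (XX t m s x))
    \<le> 2 * (1 + Lp) * (norm (XX t m s x - XX t m s x) + (\<integral>y. norm (XX t m s y - XX t m s y) \<partial>m))"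
    by (rule stability[OF sol_restart[OF t m s] sol_comp[OF s' a(6) a(1) a(3) refl] _ r]) (use s' in auto)
  also have "\<dots> = 0" by simp
  finally have "norm (XX t m r x - XX s (distr m borel (XX t m s)) r (XX t m s x)) + norm (ZZ t m r x - ZZ s (distr m borel (XX t m s)) r (XX t m s x)) \<le> 0" .
  then have "norm (XX t m r x - XX s (distr m borel (XX t m s)) r (XX t m s x)) \<le> 0"
    "norm (ZZ t m r x - ZZ s (distr m borel (XX t m s)) r (XX t m s x)) \<le> 0"
    by (smt (verit) norm_ge_zero)+
  then show "XX t m r x = XX s (distr m borel (XX t m s)) r (XX t m s x)"
    "ZZ t m r x = ZZ s (distr m borel (XX t m s)) r (XX t m s x)" by simp_all
qed

lemma ZZ_eq_\<gamma>:
  assumes "t \<in> {t0..T}" "m \<in> P2" "s \<in> {t..T}"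
  shows "ZZ t m s x = \<gamma> s (XX t m s x) (distr m borel (XX t m s))"
  unfolding \<gamma>_def by (rule XX_restart(2)[OF assms]) (use assms in auto)

text \<open>The coupling itself is the probability space, its two projections are the initial
  variables, and the bound is read at the point (x, x').\<close>

lemma XX_lipschitz:
  assumes t: "t \<in> {t0..T}" and m: "m \<in> P2" "m' \<in> P2" and \<pi>: "\<pi> \<in> couplings m m'" and s: "s \<in> {t..T}"
  shows "norm (XX t m s x - XX t m' s x') + norm (ZZ t m s x - ZZ t m' s x') \<le> 2 * (1 + Lp) * (norm (x - x') + cost \<pi>)"
proof -
  note c = couplingD[OF \<pi> m]
  have tt: "t0 \<le> t" using t by simp
  show ?thesis
    using stability[OF sol_comp[OF t m(1) c(1,6,4)] sol_comp[OF t m(2) c(1,7,5)] tt s, of "(x, x')"]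
    by (simp add: cost_def)
qed

lemma \<gamma>_lipschitz:
  assumes t: "t \<in> {t0..T}" and m: "m \<in> P2" "m' \<in> P2" and \<pi>: "\<pi> \<in> couplings m m'"
  shows "norm (\<gamma> t x m - \<gamma> t x' m') \<le> 2 * (1 + Lp) * (norm (x - x') + cost \<pi>)"
proof -
  have "t \<in> {t..T}" using t by auto
  from XX_lipschitz[OF t m \<pi> this, of x x'] show ?thesis unfolding \<gamma>_def
    using norm_ge_zero[of "XX t m t x - XX t m' t x'"] by linarith
qed

text \<open>At t' the earlier solution sits at X_{t'} and its law instead of x and m. The
  displacement is 6 L |t - t'| w at the point and at most twice that in the mean, and 2 * (6 + 12)
  is 36.\<close>

lemma XX_time1:
  assumes t: "t \<in> {t0..T}" and m: "m \<in> P2" and t': "t' \<in> {t..T}" and s: "s \<in> {t'..T}"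
  shows "norm (XX t m s x - XX t' m s x) + norm (ZZ t m s x - ZZ t' m s x) \<le> 36 * (1 + Lp) * L * \<bar>t - t'\<bar> * w m x"
proof -
  let ?\<mu> = "distr m borel (XX t m t')"
  have t1: "t' \<in> {t0..T}" "t \<in> {t..T}" using t t' by auto
  note a = admD[OF XXD(1)[OF t m t']]
  have id: "distr m borel (\<lambda>x. x) = m" using distr_id2[OF P2D(2)[OF m, symmetric]] by (simp add: id_def)
  note cp = coupling_distr[OF a(3) sqi_id(3)[OF m], unfolded id]
  have d: "norm (XX t m t' y - y) \<le> 6 * L * \<bar>t - t'\<bar> * w m y" for y
    using XXD(4)[OF t m t' t1(2), of y] by (simp add: XX_init[OF t m] abs_minus_commute)
  have i: "integrable m (\<lambda>y. 6 * L * \<bar>t - t'\<bar> * w m y)" using wD(5)[OF m] by simp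
  have "(\<integral>y. norm (XX t m t' y - y) \<partial>m) \<le> (\<integral>y. 6 * L * \<bar>t - t'\<bar> * w m y \<partial>m)"
    by (rule integral_mono'[OF i d order_trans[OF norm_ge_zero d]])
  also have "\<dots> = 6 * L * \<bar>t - t'\<bar> * (\<integral>y. w m y \<partial>m)" by simp
  also have "\<dots> \<le> 6 * L * \<bar>t - t'\<bar> * (2 * w m x)" using wD(6)[OF m, of x] L0 by (intro mult_left_mono) auto
  finally have I: "(\<integral>y. norm (XX t m t' y - y) \<partial>m) \<le> 6 * L * \<bar>t - t'\<bar> * (2 * w m x)" .
  have "norm (XX t m s x - XX t' m s x) + norm (ZZ t m s x - ZZ t' m s x) \<le>
      2 * (1 + Lp) * (norm (XX t m t' x - x) + (\<integral>y. norm (XX t m t' y - y) \<partial>m))"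
    using XX_lipschitz[OF t1(1) a(6) m cp(1) s, of "XX t m t' x" x]
    unfolding XX_restart[OF t m t' s, symmetric] cp(2) .
  also have "\<dots> \<le> 2 * (1 + Lp) * (6 * L * \<bar>t - t'\<bar> * w m x + 6 * L * \<bar>t - t'\<bar> * (2 * w m x))"
    using Lp0 by (intro mult_left_mono add_mono d I) auto
  also have "\<dots> = 36 * (1 + Lp) * L * \<bar>t - t'\<bar> * w m x" by (simp add: algebra_simps)
  finally show ?thesis .
qed

lemma XX_time:
  assumes t: "t \<in> {t0..s}" "t' \<in> {t0..s}" and m: "m \<in> P2" and s: "s \<in> {t0..T}"
  shows "norm (XX t m s x - XX t' m s x) + norm (ZZ t m s x - ZZ t' m s x) \<le> 36 * (1 + Lp) * L * \<bar>t - t'\<bar> * w m x"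
proof (cases "t \<le> t'")
  case True
  show ?thesis by (rule XX_time1[OF _ m]) (use True t s in auto)
next
  case False
  have "norm (XX t' m s x - XX t m s x) + norm (ZZ t' m s x - ZZ t m s x) \<le> 36 * (1 + Lp) * L * \<bar>t' - t\<bar> * w m x"
    by (rule XX_time1[OF _ m]) (use False t s in auto)
  then show ?thesis by (simp add: norm_minus_commute abs_minus_commute)
qed

text \<open>36 from the change of the starting time, and 6 from the motion of Z between t and
  t'.\<close>

lemma \<gamma>_time:
  assumes t: "t \<in> {t0..T}" "t' \<in> {t0..T}" and m: "m \<in> P2"
  shows "norm (\<gamma> t x m - \<gamma> t' x m) \<le> 42 * (1 + Lp) * L * \<bar>t - t'\<bar> * w m x"
proof -
  have 1: "norm (\<gamma> t x m - \<gamma> t' x m) \<le> 42 * (1 + Lp) * L * \<bar>t - t'\<bar> * w m x" if t: "t \<in> {t0..T}" and t': "t' \<in> {t..T}" for t t'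
  proof -
    have "norm (ZZ t m t' x - ZZ t m t x) \<le> 6 * L * \<bar>t' - t\<bar> * w m x"
      by (rule XXD(5)[OF t m t']) (use t in auto)
    moreover have "t' \<in> {t'..T}" using t' by auto
    from XX_time1[OF t m t' this, of x] have "norm (ZZ t m t' x - ZZ t' m t' x) \<le> 36 * (1 + Lp) * L * \<bar>t - t'\<bar> * w m x"
      using norm_ge_zero[of "XX t m t' x - XX t' m t' x"] by linarith
    ultimately have "norm (\<gamma> t x m - \<gamma> t' x m) \<le> 6 * L * \<bar>t - t'\<bar> * w m x + 36 * (1 + Lp) * L * \<bar>t - t'\<bar> * w m x"
      unfolding \<gamma>_def using norm_triangle_ineq4[of "ZZ t m t' x - ZZ t' m t' x" "ZZ t m t' x - ZZ t m t x"]
      by (simp add: abs_minus_commute)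
    also have "6 * L * \<bar>t - t'\<bar> * w m x \<le> 6 * (1 + Lp) * L * \<bar>t - t'\<bar> * w m x"
      using L0 Lp0 wD(3)[OF m, of x] by (intro mult_right_mono) auto
    finally show ?thesis by (simp add: algebra_simps)
  qed
  show ?thesis
  proof (cases "t \<le> t'")
    case True then show ?thesis using 1[of t t'] t by auto
  next
    case False then show ?thesis using 1[of t' t] t by (auto simp: norm_minus_commute abs_minus_commute)
  qed
qed

lemma \<gamma>_cont: "cont_P2_on ({t0..T} \<times> UNIV) (\<lambda>(s, x) \<mu>. \<gamma> s x \<mu>)"
  by (rule cont_P2_on_lipschitzI[where c = "2 * (1 + Lp)" and k = "42 * (1 + Lp) * L"])
    (use Lp0 L0 \<gamma>_lipschitz \<gamma>_time wD(1) in auto)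

lemma XX_cont:
  assumes s: "s \<in> {t0..T}"
  shows "cont_P2_on ({t0..s} \<times> UNIV) (\<lambda>(t, x) m. XX t m s x)" "cont_P2_on ({t0..s} \<times> UNIV) (\<lambda>(t, x) m. ZZ t m s x)"
proof -
  have split: "a \<le> c \<and> b \<le> c" if "a + b \<le> c" "0 \<le> a" "0 \<le> b" for a b c :: real using that by auto
  have lip: "norm (XX t m s x - XX t m' s x') \<le> 2 * (1 + Lp) * (norm (x - x') + cost \<pi>) \<and>
      norm (ZZ t m s x - ZZ t m' s x') \<le> 2 * (1 + Lp) * (norm (x - x') + cost \<pi>)"
    if "t \<in> {t0..s}" "m \<in> P2" "m' \<in> P2" "\<pi> \<in> couplings m m'" for t m m' \<pi> x x'
    by (rule split[OF XX_lipschitz[OF _ that(2-4)]]) (use that s in auto)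
  have time: "norm (XX t m s x - XX t' m s x) \<le> 36 * (1 + Lp) * L * \<bar>t - t'\<bar> * (1 + norm x + mnorm 1 m) \<and>
      norm (ZZ t m s x - ZZ t' m s x) \<le> 36 * (1 + Lp) * L * \<bar>t - t'\<bar> * (1 + norm x + mnorm 1 m)"
    if "t \<in> {t0..s}" "t' \<in> {t0..s}" "m \<in> P2" for t t' m x
    by (rule split[OF XX_time[OF that s, unfolded wD(1)[OF that(3)]]]) auto
  show "cont_P2_on ({t0..s} \<times> UNIV) (\<lambda>(t, x) m. XX t m s x)"
    by (rule cont_P2_on_lipschitzI[where c = "2 * (1 + Lp)" and k = "36 * (1 + Lp) * L"]) (use Lp0 L0 lip time in auto)
  show "cont_P2_on ({t0..s} \<times> UNIV) (\<lambda>(t, x) m. ZZ t m s x)"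
    by (rule cont_P2_on_lipschitzI[where c = "2 * (1 + Lp)" and k = "36 * (1 + Lp) * L"]) (use Lp0 L0 lip time in auto)
qed

lemma \<gamma>_bound:
  assumes t: "t \<in> {t0..T}" and m: "m \<in> P2"
  shows "norm (\<gamma> t x m) \<le> 2 * Lp * (1 + norm x + mnorm 1 m)"
proof -
  have tt: "t \<in> {t..T}" using t by auto
  have "norm (\<gamma> t x m) \<le> 17 / 10 * Lp * w m x" unfolding \<gamma>_def by (rule XXD(3)[OF t m tt])
  also have "\<dots> \<le> 2 * Lp * w m x" using Lp0 wD(3)[OF m, of x] by (intro mult_right_mono) auto
  finally show ?thesis by (simp add: wD(1)[OF m])
qed

lemma XX_deriv:
  assumes t: "t \<in> {t0..T}" and m: "m \<in> P2" and s: "s \<in> {t..T}"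
  shows "((\<lambda>r. XX t m r x) has_vector_derivative B (XX t m s x) (distr m borel (XX t m s)) (ZZ t m s x)) (at s within {t..T})"
    "((\<lambda>r. ZZ t m r x) has_vector_derivative - \<Phi> m (XX t m s) (ZZ t m s) x) (at s within {t..T})"
proof -
  let ?b = "\<lambda>r. B (XX t m r x) (distr m borel (XX t m r)) (ZZ t m r x)"
  let ?f = "\<lambda>r. \<Phi> m (XX t m r) (ZZ t m r) x"
  have tT: "t \<in> {t..T}" using t by auto
  have "((\<lambda>u. x + integral {t..u} ?b) has_vector_derivative 0 + ?b s) (at s within {t..T})"
    by (rule has_vector_derivative_add[OF has_vector_derivative_const integral_has_vector_derivative[OF XXD(13)[OF t m s] s]])
  then have "((\<lambda>u. x + integral {t..u} ?b) has_vector_derivative ?b s) (at s within {t..T})" by simp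
  then show "((\<lambda>r. XX t m r x) has_vector_derivative ?b s) (at s within {t..T})"
  proof (rule has_vector_derivative_transform[OF s, rotated])
    show "XX t m u x = x + integral {t..u} ?b" if "u \<in> {t..T}" for u
      using integral_unique[OF XXD(11)[OF t m that, of x]] by simp
  qed
  have "((\<lambda>u. ZZ t m t x - integral {t..u} ?f) has_vector_derivative 0 - ?f s) (at s within {t..T})"
    by (rule has_vector_derivative_diff[OF has_vector_derivative_const integral_has_vector_derivative[OF XXD(14)[OF t m s] s]])
  then have "((\<lambda>u. ZZ t m t x - integral {t..u} ?f) has_vector_derivative - ?f s) (at s within {t..T})" by simp
  then show "((\<lambda>r. ZZ t m r x) has_vector_derivative - ?f s) (at s within {t..T})"
  proof (rule has_vector_derivative_transform[OF s, rotated])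
    fix u assume u: "u \<in> {t..T}"
    have "?f integrable_on {t..u}"
      by (rule integrable_continuous_real, rule continuous_on_subset[OF XXD(14)[OF t m s]]) (use u in auto)
    then have k: "(?f has_integral integral {t..u} ?f) {t..u}" by (rule integrable_integral)
    \<comment> \<open>The backward integral is rewritten with fixed lower limit t, so that only the
      upper limit moves.\<close>
    have "(?f has_integral (integral {t..u} ?f + (ZZ t m u x - p (XX t m T x) (distr m borel (XX t m T))))) {t..T}"
      by (rule has_integral_combine[OF _ _ k XXD(12)[OF t m u]]) (use u in auto)
    from has_integral_unique[OF this XXD(12)[OF t m tT]]
    show "ZZ t m u x = ZZ t m t x - integral {t..u} ?f" by (simp add: algebra_simps)
  qed
qed

subsection \<open>Flows driven by a feedback\<close>

text \<open>The counterpart of \<open>is_flow\<close> for the abstract drift B and an arbitrary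
  feedback g, since a competing decoupling field has to be followed along its own flow.\<close>

definition isflow :: "(real \<Rightarrow> 'x \<Rightarrow> 'x measure \<Rightarrow> 'x) \<Rightarrow> real \<Rightarrow> 'x measure \<Rightarrow> (real \<Rightarrow> 'x \<Rightarrow> 'x) \<Rightarrow> bool" where
  "isflow g t m Y \<longleftrightarrow>
     (\<forall>s\<in>{t..T}. Y s \<in> borel_measurable borel \<and> distr m borel (Y s) \<in> P2 \<and>
        ((\<lambda>r. Wass 2 (distr m borel (Y r)) (distr m borel (Y s))) \<longlongrightarrow> 0) (at s within {t..T})) \<and>
     (\<forall>x. \<forall>s\<in>{t..T}.
        ((\<lambda>r. B (Y r x) (distr m borel (Y r)) (g r (Y r x) (distr m borel (Y r)))) has_integral (Y s x - x)) {t..s})"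

lemma XX_flow:
  assumes t: "t \<in> {t0..T}" and m: "m \<in> P2"
  shows "isflow \<gamma> t m (XX t m)"
  unfolding isflow_def
proof (intro conjI ballI allI)
  fix s assume s: "s \<in> {t..T}"
  show "XX t m s \<in> borel_measurable borel" by (rule XXD(6)[OF t m s])
  show "distr m borel (XX t m s) \<in> P2" by (rule admD(6)[OF XXD(1)[OF t m s]])
  have wq: "sqi m (w m)"
  proof (rule sqi_bound[OF sqi_id(2,1)[OF m]])
    show "w m \<in> borel_measurable m" using wD(5)[OF m] by (rule borel_measurable_integrable)
    show "norm (w m x) \<le> (1 + mnorm 1 m) + 1 * norm x" for x using wD(3)[OF m, of x] by (simp add: wD(1)[OF m])
  qed auto
  \<comment> \<open>The law is Lipschitz in time in \<open>Wass 2\<close>, with a constant given by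
    the mean square of the weight, finite because m is in \<open>P2\<close>.\<close>
  define K where "K = 6 * L * sqrt (\<integral>x. (w m x)\<^sup>2 \<partial>m)"
  have W: "Wass 2 (distr m borel (XX t m r)) (distr m borel (XX t m s)) \<le> K * \<bar>r - s\<bar>" if r: "r \<in> {t..T}" for r
  proof -
    note a = admD[OF XXD(1)[OF t m r]] and b = admD[OF XXD(1)[OF t m s]]
    have iw: "integrable m (\<lambda>y. (6 * L * \<bar>r - s\<bar>)\<^sup>2 * (w m y)\<^sup>2)" using wq by (simp add: sqi_def)
    have "Wass 2 (distr m borel (XX t m r)) (distr m borel (XX t m s)) \<le>
        sqrt (\<integral>z. (norm (fst z - snd z))\<^sup>2 \<partial>distr m borel (\<lambda>w. (XX t m r w, XX t m s w)))"
      by (rule Wass2_le[OF coupling_distr(1)[OF a(3) b(3)] a(6) b(6)])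
    also have "(\<integral>z. (norm (fst z - snd z))\<^sup>2 \<partial>distr m borel (\<lambda>w. (XX t m r w, XX t m s w))) = (\<integral>y. (norm (XX t m r y - XX t m s y))\<^sup>2 \<partial>m)"
      by (subst integral_distr[OF measurable_Pair_borel[OF a(3) b(3)]]) auto
    also have "sqrt \<dots> \<le> sqrt (\<integral>y. (6 * L * \<bar>r - s\<bar>)\<^sup>2 * (w m y)\<^sup>2 \<partial>m)"
    proof (rule real_sqrt_le_mono, rule integral_mono'[OF iw])
      fix y
      have "(norm (XX t m r y - XX t m s y))\<^sup>2 \<le> (6 * L * \<bar>r - s\<bar> * w m y)\<^sup>2"
        by (rule power_mono[OF XXD(4)[OF t m r s]]) simp
      then show "(norm (XX t m r y - XX t m s y))\<^sup>2 \<le> (6 * L * \<bar>r - s\<bar>)\<^sup>2 * (w m y)\<^sup>2" by (simp only: power_mult_distrib)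
    qed simp
    also have "\<dots> = 6 * L * \<bar>r - s\<bar> * sqrt (\<integral>y. (w m y)\<^sup>2 \<partial>m)"
      using L0 by (simp add: real_sqrt_mult)
    finally show ?thesis by (simp add: K_def ac_simps)
  qed
  show "((\<lambda>r. Wass 2 (distr m borel (XX t m r)) (distr m borel (XX t m s))) \<longlongrightarrow> 0) (at s within {t..T})"
  proof (rule Lim_null_comparison)
    show "\<forall>\<^sub>F r in at s within {t..T}. norm (Wass 2 (distr m borel (XX t m r)) (distr m borel (XX t m s))) \<le> K * \<bar>r - s\<bar>"
      unfolding eventually_at_filter by (rule always_eventually) (use W in \<open>auto simp: Wass_def\<close>)
    have "((\<lambda>r. K * \<bar>r - s\<bar>) \<longlongrightarrow> K * \<bar>s - s\<bar>) (at s within {t..T})" by (intro tendsto_intros)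
    then show "((\<lambda>r. K * \<bar>r - s\<bar>) \<longlongrightarrow> 0) (at s within {t..T})" by simp
  qed
next
  fix x s assume s: "s \<in> {t..T}"
  show "((\<lambda>r. B (XX t m r x) (distr m borel (XX t m r)) (\<gamma> r (XX t m r x) (distr m borel (XX t m r)))) has_integral (XX t m s x - x)) {t..s}"
    by (rule has_integral_eq[OF _ XXD(11)[OF t m s]]) (use s ZZ_eq_\<gamma>[OF t m] in auto)
qed

lemma flow_adm:
  assumes m: "m \<in> P2" and Y: "isflow g t m Y" and r: "r \<in> {t..T}"
    and gc: "\<And>\<mu>. \<mu> \<in> P2 \<Longrightarrow> continuous_on UNIV (\<lambda>x. g r x \<mu>)"
    and gb: "\<And>x \<mu>. \<mu> \<in> P2 \<Longrightarrow> norm (g r x \<mu>) \<le> 2 * Lp * (1 + norm x + mnorm 1 \<mu>)"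
  shows "adm m (Y r) (\<lambda>x. g r (Y r x) (distr m borel (Y r)))"
  unfolding adm_def
proof (intro conjI allI)
  have Yr: "Y r \<in> borel_measurable borel" "distr m borel (Y r) \<in> P2" using Y r by (auto simp: isflow_def)
  note mY = measurable_P2[OF m Yr(1)]
  show "prob_space m" by (rule P2D(1)[OF m])
  show "sqi m (Y r)" using sqi_iff_P2[OF P2D(1)[OF m] mY] Yr(2) by simp
  show "(\<lambda>x. g r (Y r x) (distr m borel (Y r))) \<in> borel_measurable m"
    using measurable_compose[OF mY borel_measurable_continuous_onI[OF gc[OF Yr(2)]]] .
  show "cone (Y r x) (distr m borel (Y r)) (g r (Y r x) (distr m borel (Y r)))" for x
    unfolding cone_def by (rule gb[OF Yr(2)])
qed

text \<open>A flow of an unknown feedback comes with no growth bound. Continuity of its law bounds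
  the first moments on the compact time interval; at fixed x the maximum of |Y s x| over time is
  then absorbed because e is small. The bound only starts the iteration in
  \<open>flow_close\<close>.\<close>

lemma flow_crude_bound:
  assumes t: "t \<in> {t0..T}" and m: "m \<in> P2" and Y: "isflow g t m Y"
    and gc: "\<And>r \<mu>. r \<in> {t0..T} \<Longrightarrow> \<mu> \<in> P2 \<Longrightarrow> continuous_on UNIV (\<lambda>x. g r x \<mu>)"
    and gb: "\<And>r x \<mu>. r \<in> {t0..T} \<Longrightarrow> \<mu> \<in> P2 \<Longrightarrow> norm (g r x \<mu>) \<le> 2 * Lp * (1 + norm x + mnorm 1 \<mu>)"
  shows "\<exists>C\<ge>0. \<forall>s\<in>{t..T}. \<forall>x. norm (Y s x) \<le> C * w m x"
proof -
  let ?l = "\<lambda>r. distr m borel (Y r)"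
  have YP: "?l r \<in> P2" if "r \<in> {t..T}" for r using Y that by (auto simp: isflow_def)
  have "continuous_on {t..T} (\<lambda>r. mnorm 1 (?l r))"
    unfolding continuous_on_def
  proof
    fix s assume s: "s \<in> {t..T}"
    have "((\<lambda>r. mnorm 1 (?l r) - mnorm 1 (?l s)) \<longlongrightarrow> 0) (at s within {t..T})"
    proof (rule Lim_null_comparison)
      show "((\<lambda>r. Wass 2 (?l r) (?l s)) \<longlongrightarrow> 0) (at s within {t..T})" using Y s by (auto simp: isflow_def)
      show "\<forall>\<^sub>F r in at s within {t..T}. norm (mnorm 1 (?l r) - mnorm 1 (?l s)) \<le> Wass 2 (?l r) (?l s)"
        unfolding eventually_at_filter by (rule always_eventually) (use mnorm_diff_le_Wass[OF YP YP] s in auto)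
    qed
    then show "((\<lambda>r. mnorm 1 (?l r)) \<longlongrightarrow> mnorm 1 (?l s)) (at s within {t..T})" by (rule LIM_zero_cancel)
  qed
  then have "compact ((\<lambda>r. mnorm 1 (?l r)) ` {t..T})" by (intro compact_continuous_image) auto
  then have "bdd_above ((\<lambda>r. mnorm 1 (?l r)) ` {t..T})" by (intro bounded_imp_bdd_above compact_imp_bounded)
  then obtain M0 where M0: "\<And>r. r \<in> {t..T} \<Longrightarrow> mnorm 1 (?l r) \<le> M0" unfolding bdd_above_def by blast
  have tT: "t \<in> {t..T}" using t by auto
  have M0': "0 \<le> M0" using M0[OF tT] mnorm_1_nonneg[of "?l t"] by linarith
  show ?thesis
  proof (intro exI[of _ "2 * (1 + M0)"] conjI ballI allI)
    show "0 \<le> 2 * (1 + M0)" using M0' by simp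
    fix s x assume s: "s \<in> {t..T}"
    let ?f = "\<lambda>r. B (Y r x) (?l r) (g r (Y r x) (?l r))"
    have I: "(?f has_integral (Y s x - x)) {t..s}" if "s \<in> {t..T}" for s using Y that by (auto simp: isflow_def)
    have "?f integrable_on {t..T}" using I[of T] t by auto
    then have "continuous_on {t..T} (\<lambda>s. x + integral {t..s} ?f)"
      by (intro continuous_intros indefinite_integral_continuous_1)
    moreover have "x + integral {t..s} ?f = Y s x" if "s \<in> {t..T}" for s using integral_unique[OF I[OF that]] by simp
    ultimately have "continuous_on {t..T} (\<lambda>s. Y s x)" by (rule continuous_on_eq)
    then have "continuous_on {t..T} (\<lambda>s. norm (Y s x))" by (rule continuous_on_norm)
    then obtain s1 where s1: "s1 \<in> {t..T}" "\<And>s. s \<in> {t..T} \<Longrightarrow> norm (Y s x) \<le> norm (Y s1 x)"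
      using continuous_attains_sup[of "{t..T}" "\<lambda>s. norm (Y s x)"] tT by auto
    define v where "v = norm (Y s1 x)"
    have "norm (Y s1 x - x) \<le> e * (1 + v + M0)"
    proof (rule integral_bound[OF I[OF s1(1)]])
      fix r assume r: "t \<le> r" "r \<le> s1"
      then have r': "r \<in> {t..T}" "r \<in> {t0..T}" using s1 t by auto
      note a = flow_adm[OF m Y r'(1) gc[OF r'(2)] gb[OF r'(2)]]
      have "norm (?f r) \<le> L * (1 + norm (Y r x) + mnorm 1 (?l r))" by (rule B_growth[OF YP[OF r'(1)] admD(5)[OF a]])
      also have "\<dots> \<le> L * (1 + v + M0)" using L0 s1(2)[OF r'(1)] M0[OF r'(1)] by (intro mult_left_mono) (auto simp: v_def)
      finally show "norm (?f r) \<le> L * (1 + v + M0)" .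
    qed (use t s1 M0' in \<open>auto simp: v_def\<close>)
    also have "\<dots> \<le> 1 / 2 * (1 + v + M0)" using e(2) M0' by (intro mult_right_mono) (auto simp: v_def)
    also have "\<dots> = (1 + v + M0) / 2" by simp
    finally have "v \<le> norm x + (1 + v + M0) / 2" using norm_triangle_sub[of "Y s1 x" x] unfolding v_def by linarith
    then have "v \<le> 2 * norm x + 1 + M0" by (simp add: field_simps)
    also have "\<dots> \<le> 2 * (1 + M0) * (1 + norm x)"
    proof -
      have "0 \<le> M0 * norm x" using M0' by simp
      then show ?thesis using M0' by (simp add: algebra_simps)
    qed
    also have "\<dots> \<le> 2 * (1 + M0) * w m x" using M0' by (intro mult_left_mono) (auto simp: wD(1)[OF m])
    finally show "norm (Y s x) \<le> 2 * (1 + M0) * w m x" using s1(2)[OF s] by (simp add: v_def)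
  qed
qed

text \<open>No Lipschitz bound on g is available. Its value at Y is first replaced by that of
  \<gamma> at the same point, at the price D, and only \<gamma> is moved from Y to the reference
  flow. The resulting recursion b -> b / 2 + 2 e D converges to 4 e D.\<close>

lemma flow_close:
  assumes t: "t \<in> {t0..T}" and m: "m \<in> P2" and Y: "isflow g t m Y"
    and gc: "\<And>r \<mu>. r \<in> {t0..T} \<Longrightarrow> \<mu> \<in> P2 \<Longrightarrow> continuous_on UNIV (\<lambda>x. g r x \<mu>)"
    and gb: "\<And>r x \<mu>. r \<in> {t0..T} \<Longrightarrow> \<mu> \<in> P2 \<Longrightarrow> norm (g r x \<mu>) \<le> 2 * Lp * (1 + norm x + mnorm 1 \<mu>)"
    and D: "0 \<le> D" "D \<le> 4 * Lp"
    and gD: "\<And>r x \<mu>. r \<in> {t0..T} \<Longrightarrow> \<mu> \<in> P2 \<Longrightarrow> norm (g r x \<mu> - \<gamma> r x \<mu>) \<le> D * (1 + norm x + mnorm 1 \<mu>)"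
    and s: "s \<in> {t..T}"
  shows "norm (Y s x - XX t m s x) \<le> 4 * e * D * w m x"
    "norm (g s (Y s x) (distr m borel (Y s)) - ZZ t m s x) \<le> 3 * D * w m x"
proof -
  let ?l = "\<lambda>r. distr m borel (Y r)"
  let ?Z = "\<lambda>r x. g r (Y r x) (?l r)"
  have r0: "r \<in> {t0..T}" if "r \<in> {t..T}" for r using that t by auto
  have YP: "?l r \<in> P2" if "r \<in> {t..T}" for r using Y that by (auto simp: isflow_def)
  have a: "adm m (Y r) (?Z r)" if "r \<in> {t..T}" for r by (rule flow_adm[OF m Y that gc[OF r0[OF that]] gb[OF r0[OF that]]])
  note w0 = wD(3)[OF m]
  define P where "P b \<longleftrightarrow> (\<forall>s\<in>{t..T}. \<forall>x. norm (Y s x - XX t m s x) \<le> b * w m x)" for b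
  have IX: "(\<integral>y. norm (Y r y - XX t m r y) \<partial>m) \<le> 2 * (b * w m x)" if P: "P b" "0 \<le> b" "r \<in> {t..T}" for b r x
  proof -
    have i: "integrable m (\<lambda>y. b * w m y)" using wD(5)[OF m] by simp
    have "(\<integral>y. norm (Y r y - XX t m r y) \<partial>m) \<le> (\<integral>y. b * w m y \<partial>m)"
      by (rule integral_mono'[OF i]) (use P w0 in \<open>auto simp: P_def\<close>)
    also have "\<dots> \<le> b * (2 * w m x)" using wD(6)[OF m, of x] P(2) by (simp add: mult_left_mono)
    finally show ?thesis by simp
  qed
  have dZ: "norm (?Z r x - ZZ t m r x) \<le> (D * (2 + 3 * b) + 6 * (1 + Lp) * b) * w m x" if P: "P b" "0 \<le> b" "r \<in> {t..T}" for b r x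
  proof -
    note aY = admD[OF a[OF P(3)]] and aX = admD[OF XXD(1)[OF t m P(3)]]
    have dX: "norm (Y r x - XX t m r x) \<le> b * w m x" using P by (auto simp: P_def)
    note I = IX[OF P, of x]
    have nI: "(\<integral>y. norm (Y r y) \<partial>m) \<le> (\<integral>y. norm (XX t m r y) \<partial>m) + 2 * (b * w m x)"
      using mnorm_diff_le_cost[OF coupling_distr(1)[OF aY(3) aX(3)] aY(6) aX(6)] I
      unfolding coupling_distr(2)[OF aY(3) aX(3)] aY(8) aX(8) by linarith
    have "norm (?Z r x - \<gamma> r (Y r x) (?l r)) \<le> D * (1 + norm (Y r x) + (\<integral>y. norm (Y r y) \<partial>m))"
      using gD[OF r0[OF P(3)] YP[OF P(3)], of "Y r x"] unfolding aY(8) .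
    also have "\<dots> \<le> D * ((2 + 3 * b) * w m x)"
    proof (rule mult_left_mono[OF _ D(1)])
      have "norm (Y r x) \<le> norm (XX t m r x) + b * w m x"
        using dX norm_triangle_sub[of "Y r x" "XX t m r x"] by linarith
      then have "1 + norm (Y r x) + (\<integral>y. norm (Y r y) \<partial>m) \<le> (1 + norm (XX t m r x) + (\<integral>y. norm (XX t m r y) \<partial>m)) + 3 * (b * w m x)"
        using nI by linarith
      also have "1 + norm (XX t m r x) + (\<integral>y. norm (XX t m r y) \<partial>m) \<le> 2 * w m x"
        using XXD(10)[OF t m P(3), of x] w0[of x] by linarith
      finally show "1 + norm (Y r x) + (\<integral>y. norm (Y r y) \<partial>m) \<le> (2 + 3 * b) * w m x" by (simp add: distrib_right)
    qed
    finally have 1: "norm (?Z r x - \<gamma> r (Y r x) (?l r)) \<le> D * ((2 + 3 * b) * w m x)" .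
    have "norm (\<gamma> r (Y r x) (?l r) - \<gamma> r (XX t m r x) (distr m borel (XX t m r))) \<le>
        2 * (1 + Lp) * (norm (Y r x - XX t m r x) + (\<integral>y. norm (Y r y - XX t m r y) \<partial>m))"
      using \<gamma>_lipschitz[OF r0[OF P(3)] aY(6) aX(6) coupling_distr(1)[OF aY(3) aX(3)]] unfolding coupling_distr(2)[OF aY(3) aX(3)] .
    also have "\<dots> \<le> 2 * (1 + Lp) * (b * w m x + 2 * (b * w m x))" using Lp0 by (intro mult_left_mono add_mono dX I) auto
    finally have 2: "norm (\<gamma> r (Y r x) (?l r) - \<gamma> r (XX t m r x) (distr m borel (XX t m r))) \<le> 2 * (1 + Lp) * (b * w m x + 2 * (b * w m x))" .
    have "norm (?Z r x - ZZ t m r x) \<le> D * ((2 + 3 * b) * w m x) + 2 * (1 + Lp) * (b * w m x + 2 * (b * w m x))"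
      using norm_triangle_mono[OF 1 2] unfolding ZZ_eq_\<gamma>[OF t m P(3)] by simp
    also have "\<dots> = (D * (2 + 3 * b) + 6 * (1 + Lp) * b) * w m x" by (simp add: algebra_simps)
    finally show ?thesis .
  qed
  have step: "P (b / 2 + 2 * e * D)" if b: "0 \<le> b" "P b" for b
    unfolding P_def
  proof (intro ballI allI)
    fix s x assume s: "s \<in> {t..T}"
    define c where "c = (3 * b + D * (2 + 3 * b) + 6 * (1 + Lp) * b) * w m x"
    have c0: "0 \<le> c" unfolding c_def using b D Lp0 w0[of x] by (intro mult_nonneg_nonneg add_nonneg_nonneg) auto
    have IY: "((\<lambda>r. B (Y r x) (?l r) (?Z r x)) has_integral (Y s x - x)) {t..s}" using Y s by (auto simp: isflow_def)
    have "norm ((Y s x - x) - (XX t m s x - x)) \<le> e * c"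
    proof (rule integral_diff_bound[OF IY XXD(11)[OF t m s]])
      fix r assume "t \<le> r" "r \<le> s"
      then have r: "r \<in> {t..T}" using s by auto
      have "norm (B (Y r x) (?l r) (?Z r x) - B (XX t m r x) (distr m borel (XX t m r)) (ZZ t m r x)) \<le>
          L * (norm (Y r x - XX t m r x) + (\<integral>y. norm (Y r y - XX t m r y) \<partial>m) + norm (?Z r x - ZZ t m r x))"
        by (rule B_diff[OF a[OF r] XXD(1)[OF t m r]])
      also have "\<dots> \<le> L * (b * w m x + 2 * (b * w m x) + (D * (2 + 3 * b) + 6 * (1 + Lp) * b) * w m x)"
        using L0 b(2) r by (intro mult_left_mono add_mono IX[OF b(2,1) r] dZ[OF b(2,1) r]) (auto simp: P_def)
      also have "\<dots> = L * c" by (simp add: c_def algebra_simps)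
      finally show "norm (B (Y r x) (?l r) (?Z r x) - B (XX t m r x) (distr m borel (XX t m r)) (ZZ t m r x)) \<le> L * c" .
    qed (use t s c0 in auto)
    then have "norm (Y s x - XX t m s x) \<le> e * c" by simp
    also have "\<dots> \<le> (b / 2 + 2 * e * D) * w m x"
    proof -
      \<comment> \<open>The product of the unknown b with D is made linear in b by D at most 4 Lp;
        all terms in b then add up to at most b / 2.\<close>
      have "e * (3 * b * D) \<le> e * (3 * b * (4 * Lp))" using e(1) b(1) D(2) by (intro mult_left_mono) auto
      also have "\<dots> = 12 * (b * (e * Lp))" by simp
      finally have "e * (3 * b + D * (2 + 3 * b) + 6 * (1 + Lp) * b) \<le> b * (9 * e + 18 * (e * Lp)) + 2 * e * D"
        by (simp add: algebra_simps)
      also have "b * (9 * e + 18 * (e * Lp)) \<le> b * (1 / 2)" using b(1) e(2,3) by (intro mult_left_mono) auto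
      finally have "e * (3 * b + D * (2 + 3 * b) + 6 * (1 + Lp) * b) \<le> b / 2 + 2 * e * D" by simp
      from mult_right_mono[OF this w0[of x]] show ?thesis by (simp only: c_def mult.assoc[symmetric])
    qed
    finally show "norm (Y s x - XX t m s x) \<le> (b / 2 + 2 * e * D) * w m x" .
  qed
  obtain C where C: "0 \<le> C" "\<And>s x. s \<in> {t..T} \<Longrightarrow> norm (Y s x) \<le> C * w m x"
    using flow_crude_bound[OF t m Y gc gb] by blast
  have P0: "P (C + 2)"
    unfolding P_def
  proof (intro ballI allI)
    fix s x assume s: "s \<in> {t..T}"
    show "norm (Y s x - XX t m s x) \<le> (C + 2) * w m x"
      using C(2)[OF s, of x] XXD(8)[OF t m s, of x] norm_triangle_ineq4[of "Y s x" "XX t m s x"] by (simp add: distrib_right)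
  qed
  have Pn: "P (2 * (2 * e * D) + (C + 2) / 2 ^ n)" for n :: nat
  proof (rule halving_iteration[of P, OF step P0])
    show "P b" if "a \<le> b" "P a" for a b
      unfolding P_def
    proof (intro ballI allI)
      fix s x assume "s \<in> {t..T}"
      then have "norm (Y s x - XX t m s x) \<le> a * w m x" using that(2) unfolding P_def by blast
      also have "\<dots> \<le> b * w m x" using that(1) w0 by (rule mult_right_mono)
      finally show "norm (Y s x - XX t m s x) \<le> b * w m x" .
    qed
  qed (use C(1) e(1) D(1) in auto)
  have lim: "norm (Y s x - XX t m s x) \<le> 4 * e * D * w m x + ((C + 2) * w m x) / 2 ^ n" if "s \<in> {t..T}" for n s x
  proof -
    have eq: "(2 * (2 * e * D) + (C + 2) / 2 ^ n) * w m x = 4 * e * D * w m x + ((C + 2) * w m x) / 2 ^ n"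
      by (simp add: distrib_right)
    have "norm (Y s x - XX t m s x) \<le> (2 * (2 * e * D) + (C + 2) / 2 ^ n) * w m x" by (rule Pn[of n, unfolded P_def, rule_format, OF that])
    then show ?thesis unfolding eq .
  qed
  have fin: "norm (Y s x - XX t m s x) \<le> 4 * e * D * w m x" if "s \<in> {t..T}" for s x
    by (rule le_of_halving[OF lim[OF that]])
  then show "norm (Y s x - XX t m s x) \<le> 4 * e * D * w m x" using s by blast
  have Pb: "P (4 * e * D)" using fin by (simp add: P_def)
  have b0: "0 \<le> 4 * e * D" using e(1) D(1) by simp
  have "norm (?Z s x - ZZ t m s x) \<le> (D * (2 + 3 * (4 * e * D)) + 6 * (1 + Lp) * (4 * e * D)) * w m x"
    by (rule dZ[OF Pb b0 s])
  also have "\<dots> \<le> (3 * D) * w m x"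
  proof (rule mult_right_mono[OF _ w0])
    have "e * D \<le> e * (4 * Lp)" using e(1) D(2) by (intro mult_left_mono) auto
    then have "e * D \<le> 4 / 100" using e(3) by simp
    then have "D * (e * D) \<le> D * (4 / 100)" using D(1) by (intro mult_left_mono) auto
    moreover have "D * e \<le> D * (1 / 100)" "D * (e * Lp) \<le> D * (1 / 100)" using D(1) e(2,3) by (intro mult_left_mono; simp)+
    moreover have "D * (2 + 3 * (4 * e * D)) + 6 * (1 + Lp) * (4 * e * D) = 2 * D + 12 * (D * (e * D)) + 24 * (D * e) + 24 * (D * (e * Lp))"
      by (simp add: algebra_simps)
    ultimately show "D * (2 + 3 * (4 * e * D)) + 6 * (1 + Lp) * (4 * e * D) \<le> 3 * D" using D(1) by linarith
  qed
  finally show "norm (?Z s x - ZZ t m s x) \<le> 3 * D * w m x" .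
qed

text \<open>The case g = \<gamma>, D = 0 of \<open>flow_close\<close>.\<close>

lemma flow_unique:
  assumes t: "t \<in> {t0..T}" and m: "m \<in> P2" and Y: "isflow \<gamma> t m Y" and s: "s \<in> {t..T}"
  shows "Y s x = XX t m s x"
proof -
  have gc: "continuous_on UNIV (\<lambda>x. \<gamma> r x \<mu>)" if "r \<in> {t0..T}" "\<mu> \<in> P2" for r \<mu>
    using integrable_lipschitz(2)[OF that(2), of "\<lambda>x. \<gamma> r x \<mu>" "2 * (1 + Lp)"]
      \<gamma>_lipschitz[OF that(1,2,2) diag_coupling(1)[OF that(2)]] diag_coupling(2)[OF that(2)] by simp
  have "norm (Y s x - XX t m s x) \<le> 4 * e * 0 * w m x"
    by (rule flow_close(1)[OF t m Y gc \<gamma>_bound]) (use Lp0 s in auto)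
  then show ?thesis by simp
qed

text \<open>A gap D between the fields gives gaps 4 e D in X and 3 D in Z, and the backward equation
  returns at most D / 2. The first gap is 4 Lp, the sum of the two growth bounds.\<close>

lemma decoupling_unique:
  assumes gc: "\<And>r \<mu>. r \<in> {t0..T} \<Longrightarrow> \<mu> \<in> P2 \<Longrightarrow> continuous_on UNIV (\<lambda>x. g r x \<mu>)"
    and gb: "\<And>r x \<mu>. r \<in> {t0..T} \<Longrightarrow> \<mu> \<in> P2 \<Longrightarrow> norm (g r x \<mu>) \<le> 2 * Lp * (1 + norm x + mnorm 1 \<mu>)"
    and dec: "\<And>s m. s \<in> {t0..T} \<Longrightarrow> m \<in> P2 \<Longrightarrow> \<exists>Y. isflow g s m Y \<and>
      (\<forall>x. ((\<lambda>r. \<Phi> m (Y r) (\<lambda>x. g r (Y r x) (distr m borel (Y r))) x) has_integral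
        (g s x m - p (Y T x) (distr m borel (Y T)))) {s..T})"
    and s: "s \<in> {t0..T}" and m: "m \<in> P2"
  shows "g s x m = \<gamma> s x m"
proof -
  define Q where "Q D \<longleftrightarrow> (\<forall>s\<in>{t0..T}. \<forall>m\<in>P2. \<forall>x. norm (g s x m - \<gamma> s x m) \<le> D * (1 + norm x + mnorm 1 m))" for D
  have Q0: "Q (4 * Lp)"
    unfolding Q_def
  proof (intro ballI allI)
    fix s m x assume "s \<in> {t0..T}" "(m :: 'x measure) \<in> P2"
    then show "norm (g s x m - \<gamma> s x m) \<le> 4 * Lp * (1 + norm x + mnorm 1 m)"
      using norm_triangle_ineq4[of "g s x m" "\<gamma> s x m"] gb[of s m x] \<gamma>_bound[of s m x] by linarith
  qed
  have step: "Q (D / 2)" if Q: "Q D" and D: "0 \<le> D" "D \<le> 4 * Lp" for D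
    unfolding Q_def
  proof (intro ballI allI)
    fix s x and m :: "'x measure" assume s: "s \<in> {t0..T}" and m: "m \<in> P2"
    obtain Y where Y: "isflow g s m Y"
      "\<And>x. ((\<lambda>r. \<Phi> m (Y r) (\<lambda>x. g r (Y r x) (distr m borel (Y r))) x) has_integral (g s x m - p (Y T x) (distr m borel (Y T)))) {s..T}"
      using dec[OF s m] by blast
    have gD: "norm (g r x \<mu> - \<gamma> r x \<mu>) \<le> D * (1 + norm x + mnorm 1 \<mu>)" if "r \<in> {t0..T}" "\<mu> \<in> P2" for r x \<mu>
      using Q that by (auto simp: Q_def)
    note close = flow_close[OF s m Y(1) gc gb D gD]
    have r0: "r \<in> {t0..T}" if "r \<in> {s..T}" for r using that s by auto
    have sT: "s \<in> {s..T}" "T \<in> {s..T}" using s by auto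
    let ?l = "\<lambda>r. distr m borel (Y r)"
    let ?Z = "\<lambda>r x. g r (Y r x) (?l r)"
    have a: "adm m (Y r) (?Z r)" if "r \<in> {s..T}" for r by (rule flow_adm[OF m Y(1) that gc[OF r0[OF that]] gb[OF r0[OF that]]])
    note w0 = wD(3)[OF m]
    define b where "b = 4 * e * D"
    have b0: "0 \<le> b" using e(1) D(1) by (simp add: b_def)
    have dX: "norm (Y r x - XX s m r x) \<le> b * w m x" and dZ: "norm (?Z r x - ZZ s m r x) \<le> 3 * D * w m x" if "r \<in> {s..T}" for r x
      using close[OF _ _ _ _ _ _ that, of x] by (auto simp: b_def)
    have int: "(\<integral>y. norm (F y) \<partial>m) \<le> 2 * (c * w m x)" if "\<And>y. norm (F y) \<le> c * w m y" "0 \<le> c" for F :: "'x \<Rightarrow> 'x" and c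
    proof -
      have i: "integrable m (\<lambda>y. c * w m y)" using wD(5)[OF m] by simp
      have "(\<integral>y. norm (F y) \<partial>m) \<le> (\<integral>y. c * w m y \<partial>m)"
        by (rule integral_mono'[OF i]) (use that w0 in auto)
      also have "\<dots> \<le> c * (2 * w m x)" using wD(6)[OF m, of x] that(2) by (simp add: mult_left_mono)
      finally show ?thesis by simp
    qed
    have IX: "(\<integral>y. norm (Y r y - XX s m r y) \<partial>m) \<le> 2 * (b * w m x)" if "r \<in> {s..T}" for r
      by (rule int[OF dX[OF that] b0])
    have IZ: "(\<integral>y. norm (?Z r y - ZZ s m r y) \<partial>m) \<le> 2 * (3 * D * w m x)" if "r \<in> {s..T}" for r
      by (rule int[OF dZ[OF that]]) (use D in simp)
    note aY = admD[OF a[OF sT(2)]] and aX = admD[OF XXD(1)[OF s m sT(2)]]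
    have "norm (p (Y T x) (?l T) - p (XX s m T x) (distr m borel (XX s m T))) \<le> Lp * (norm (Y T x - XX s m T x) + (\<integral>y. norm (Y T y - XX s m T y) \<partial>m))"
      using p_lip[OF aY(6) aX(6) coupling_distr(1)[OF aY(3) aX(3)]] unfolding coupling_distr(2)[OF aY(3) aX(3)] .
    also have "\<dots> \<le> Lp * (b * w m x + 2 * (b * w m x))" using Lp0 by (intro mult_left_mono add_mono dX IX sT) auto
    finally have 1: "norm (p (Y T x) (?l T) - p (XX s m T x) (distr m borel (XX s m T))) \<le> Lp * (b * w m x + 2 * (b * w m x))" .
    have 2: "norm ((g s x m - p (Y T x) (?l T)) - (ZZ s m s x - p (XX s m T x) (distr m borel (XX s m T)))) \<le> e * ((8 * b + 9 * D) * w m x)"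
    proof (rule integral_diff_bound[OF Y(2) XXD(12)[OF s m sT(1)]])
      fix r assume "s \<le> r" "r \<le> T"
      then have r: "r \<in> {s..T}" by auto
      have "norm (\<Phi> m (Y r) (?Z r) x - \<Phi> m (XX s m r) (ZZ s m r) x) \<le> L * (2 * norm (Y r x - XX s m r x) + norm (?Z r x - ZZ s m r x)
          + 3 * (\<integral>y. norm (Y r y - XX s m r y) \<partial>m) + (\<integral>y. norm (?Z r y - ZZ s m r y) \<partial>m))"
        by (rule \<Phi>_diff[OF a[OF r] XXD(1)[OF s m r]])
      also have "\<dots> \<le> L * (2 * (b * w m x) + 3 * D * w m x + 3 * (2 * (b * w m x)) + 2 * (3 * D * w m x))"
        using L0 by (intro mult_left_mono add_mono dX dZ IX IZ r) auto
      also have "\<dots> = L * ((8 * b + 9 * D) * w m x)" by (simp add: algebra_simps)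
      finally show "norm (\<Phi> m (Y r) (?Z r) x - \<Phi> m (XX s m r) (ZZ s m r) x) \<le> L * ((8 * b + 9 * D) * w m x)" .
    qed (use s b0 D w0[of x] in auto)
    have "g s x m - \<gamma> s x m = ((g s x m - p (Y T x) (?l T)) - (ZZ s m s x - p (XX s m T x) (distr m borel (XX s m T))))
        + (p (Y T x) (?l T) - p (XX s m T x) (distr m borel (XX s m T)))" by (simp add: \<gamma>_def)
    then have "norm (g s x m - \<gamma> s x m) \<le> e * ((8 * b + 9 * D) * w m x) + Lp * (b * w m x + 2 * (b * w m x))"
      using norm_triangle_mono[OF 2 1] by simp
    also have "\<dots> = (8 * e * b + 9 * e * D + 3 * (Lp * b)) * w m x" by (simp add: algebra_simps)
    also have "\<dots> \<le> (D / 2) * w m x"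
    proof (rule mult_right_mono[OF _ w0])
      have "D * e \<le> D * (1 / 100)" "D * (e * Lp) \<le> D * (1 / 100)" using D(1) e(2,3) by (intro mult_left_mono; simp)+
      moreover have "b \<le> D"
      proof -
        have "4 * e * D \<le> 1 * D" using e(2) D(1) by (intro mult_right_mono) auto
        then show ?thesis by (simp add: b_def)
      qed
      then have "e * b \<le> e * D" using e(1) by (intro mult_left_mono)
      moreover have "8 * e * b + 9 * e * D + 3 * (Lp * b) = 8 * (e * b) + 9 * (D * e) + 12 * (D * (e * Lp))" by (simp add: b_def)
      moreover have "e * D = D * e" by simp
      ultimately show "8 * e * b + 9 * e * D + 3 * (Lp * b) \<le> D / 2"
        using D(1) by linarith
    qed
    finally show "norm (g s x m - \<gamma> s x m) \<le> D / 2 * (1 + norm x + mnorm 1 m)" by (simp add: wD(1)[OF m])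
  qed
  have "Q (4 * Lp / 2 ^ n)" for n
  proof (induction n)
    case (Suc n)
    have "4 * Lp / 2 ^ n \<le> 4 * Lp / 1" using Lp0 by (intro divide_left_mono) auto
    then have "Q (4 * Lp / 2 ^ n / 2)" using Lp0 by (intro step Suc) auto
    then show ?case by (simp add: mult.commute)
  qed (use Q0 in simp)
  then have "norm (g s x m - \<gamma> s x m) \<le> 0 + (4 * Lp * (1 + norm x + mnorm 1 m)) / 2 ^ n" for n
    using s m by (simp add: Q_def)
  then have "norm (g s x m - \<gamma> s x m) \<le> 0" by (rule le_of_halving)
  then show ?thesis by simp
qed

end

subsection \<open>Partial derivatives\<close>

lemma fderiv_compose_blinfun:
  fixes F :: "'a::real_normed_vector \<Rightarrow> 'b::real_normed_vector" and J :: "'c::real_normed_vector \<Rightarrow>\<^sub>L 'a"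
  assumes "F differentiable at (c + blinfun_apply J x)"
  shows "((\<lambda>y. F (c + blinfun_apply J y)) has_derivative blinfun_apply (fderiv F (c + blinfun_apply J x) o\<^sub>L J)) (at x)"
proof -
  have "((\<lambda>y. c + blinfun_apply J y) has_derivative blinfun_apply J) (at x)"
    by (auto intro!: derivative_eq_intros)
  from has_derivative_compose[OF this, OF fderiv_works[OF assms]]
  show ?thesis by (rule has_derivative_eq_rhs) (simp add: fun_eq_iff)
qed

text \<open>J and J' will be inclusions of the factors of a product: equal inclusions give pure
  second partials, different ones the mixed partials.\<close>

lemma twice_diff_compose:
  fixes F :: "'a::real_normed_vector \<Rightarrow> 'b::real_normed_vector" and J :: "'c::real_normed_vector \<Rightarrow>\<^sub>L 'a"
    and J' :: "'d::real_normed_vector \<Rightarrow>\<^sub>L 'a"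
  assumes "twice_diff F"
  shows "(\<lambda>y. F (c + blinfun_apply J y)) differentiable at x"
    "(\<lambda>z. fderiv (\<lambda>y. F (c + blinfun_apply J' z + blinfun_apply J y)) x) differentiable at z0"
proof -
  have d: "F differentiable at q" "fderiv F differentiable at q" for q using assms by (auto simp: twice_diff_def)
  show "(\<lambda>y. F (c + blinfun_apply J y)) differentiable at x"
    using fderiv_compose_blinfun[OF d(1)] unfolding differentiable_def by blast
  have "fderiv (\<lambda>y. F (c + blinfun_apply J' z + blinfun_apply J y)) x = fderiv F ((c + blinfun_apply J x) + blinfun_apply J' z) o\<^sub>L J" for z
    using fderiv_eqI[OF fderiv_compose_blinfun[OF d(1), of "c + blinfun_apply J' z" J x]] by (simp add: ac_simps)
  moreover have "(\<lambda>z. fderiv F ((c + blinfun_apply J x) + blinfun_apply J' z) o\<^sub>L J) differentiable at z0"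
  proof -
    have "((\<lambda>z. fderiv F ((c + blinfun_apply J x) + blinfun_apply J' z)) has_derivative
        blinfun_apply (fderiv (fderiv F) ((c + blinfun_apply J x) + blinfun_apply J' z0) o\<^sub>L J')) (at z0)"
      by (rule fderiv_compose_blinfun[OF d(2)])
    from bounded_linear.has_derivative[OF bounded_bilinear.bounded_linear_left[OF bounded_bilinear_blinfun_compose] this]
    show ?thesis unfolding differentiable_def by blast
  qed
  ultimately show "(\<lambda>z. fderiv (\<lambda>y. F (c + blinfun_apply J' z + blinfun_apply J y)) x) differentiable at z0" by simp
qed

lemma twice_diff_partial:
  fixes h :: "'p::real_normed_vector \<Rightarrow> 'q::real_normed_vector \<Rightarrow> 'b::real_normed_vector"
  assumes "twice_diff (\<lambda>(x, a). h x a)"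
  shows "(\<lambda>y. h y a) differentiable at x" "(\<lambda>b. h x b) differentiable at a"
    "(\<lambda>z. fderiv (\<lambda>y. h y a) z) differentiable at x" "(\<lambda>b. fderiv (\<lambda>y. h y b) x) differentiable at a"
    "(\<lambda>b. fderiv (\<lambda>b. h x b) b) differentiable at a" "(\<lambda>z. fderiv (\<lambda>b. h z b) a) differentiable at x"
proof -
  define inl :: "'p \<Rightarrow>\<^sub>L ('p \<times> 'q)" where "inl = Blinfun (\<lambda>v. (v, 0))"
  define inr :: "'q \<Rightarrow>\<^sub>L ('p \<times> 'q)" where "inr = Blinfun (\<lambda>v. (0, v))"
  have inl: "blinfun_apply inl v = (v, 0)" for v unfolding inl_def
    by (subst bounded_linear_Blinfun_apply) (auto intro: bounded_linear_Pair bounded_linear_ident bounded_linear_zero)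
  have inr: "blinfun_apply inr v = (0, v)" for v unfolding inr_def
    by (subst bounded_linear_Blinfun_apply) (auto intro: bounded_linear_Pair bounded_linear_ident bounded_linear_zero)
  note T = twice_diff_compose[OF assms]
  show "(\<lambda>y. h y a) differentiable at x" using T(1)[of "(0, a)" inl x] by (simp add: inl)
  show "(\<lambda>b. h x b) differentiable at a" using T(1)[of "(x, 0)" inr a] by (simp add: inr)
  show "(\<lambda>b. fderiv (\<lambda>y. h y b) x) differentiable at a" using T(2)[of "(0, 0)" inr inl x a] by (simp add: inl inr)
  show "(\<lambda>z. fderiv (\<lambda>b. h z b) a) differentiable at x" using T(2)[of "(0, 0)" inl inr a x] by (simp add: inl inr)
  \<comment> \<open>Pure second partials are obtained as derivatives at 0 of translates; this
    returns them to the point z.\<close>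
  have sh: "fderiv (\<lambda>y. F (z + y)) 0 = fderiv F z" if "F differentiable at z"
    for F :: "'c::real_normed_vector \<Rightarrow> 'b" and z
  proof (rule fderiv_eqI)
    have "((\<lambda>y. z + y) has_derivative (\<lambda>v. v)) (at 0)" by (auto intro!: derivative_eq_intros)
    from has_derivative_compose[OF this, of F "blinfun_apply (fderiv F z)"] fderiv_works[OF that]
    show "((\<lambda>y. F (z + y)) has_derivative blinfun_apply (fderiv F z)) (at 0)" by simp
  qed
  have "(\<lambda>z. fderiv (\<lambda>y. h (z + y) a) 0) differentiable at x" using T(2)[of "(0, a)" inl inl 0 x] by (simp add: inl)
  then show "(\<lambda>z. fderiv (\<lambda>y. h y a) z) differentiable at x"
    using sh[of "\<lambda>y. h y a"] T(1)[of "(0, a)" inl] by (simp add: inl)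
  have "(\<lambda>z. fderiv (\<lambda>b. h x (z + b)) 0) differentiable at a" using T(2)[of "(x, 0)" inr inr 0 a] by (simp add: inr)
  then show "(\<lambda>b. fderiv (\<lambda>b. h x b) b) differentiable at a"
    using sh[of "\<lambda>b. h x b"] T(1)[of "(x, 0)" inr] by (simp add: inr)
qed

text \<open>A bound on how the y-derivative varies with b becomes one on how the b-derivative varies
  with y, by way of the symmetric second difference. The convex set \<open>S\<close> confines y to a
  region where a weighted bound is uniform.\<close>

lemma fderiv_swap_lipschitz:
  fixes F :: "'p::real_normed_vector \<Rightarrow> 'q::real_normed_vector \<Rightarrow> 'b::real_normed_vector"
  assumes "convex S" "y \<in> S" "y' \<in> S"
    and "\<And>z b. z \<in> S \<Longrightarrow> (\<lambda>z. F z b) differentiable at z"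
    and "\<And>z b b'. z \<in> S \<Longrightarrow> norm (fderiv (\<lambda>z. F z b) z - fderiv (\<lambda>z. F z b') z) \<le> l * norm (b - b')"
    and "F y differentiable at b0" "F y' differentiable at b0" "0 \<le> l"
  shows "norm (fderiv (F y) b0 - fderiv (F y') b0) \<le> l * norm (y - y')"
proof (rule fderiv_diff_le[OF assms(6,7) zero_less_one])
  show "0 \<le> l * norm (y - y')" using assms(8) by simp
  fix b
  have "norm ((F y b - F y b0) - (F y' b - F y' b0)) \<le> (l * norm (b - b0)) * norm (y - y')"
    by (rule increment_diff_le[of S "\<lambda>z. F z b" "\<lambda>z. F z b0"]) (use assms in auto)
  then show "norm ((F y b - F y' b) - (F y b0 - F y' b0)) \<le> l * norm (y - y') * norm (b - b0)"
    by (simp add: algebra_simps)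
qed

subsection \<open>Measure dependence of the derivatives\<close>

lemma regular2D:
  assumes "regular2 h K"
  shows "is_lfd h (lfd h)" "is_lfd2 h K"
    "\<mu> \<in> P2 \<Longrightarrow> lfd h \<mu> differentiable at u" "\<mu> \<in> P2 \<Longrightarrow> fderiv (lfd h \<mu>) differentiable at u"
    "\<mu> \<in> P2 \<Longrightarrow> K \<mu> x differentiable at y \<and> (\<lambda>u. fderiv (K \<mu> u) y) differentiable at x"
proof -
  have "\<exists>D. is_lfd h D" using assms unfolding regular2_def by blast
  then show "is_lfd h (lfd h)" unfolding lfd_def by (rule someI_ex)
  show "is_lfd2 h K" using assms unfolding regular2_def by blast
  show "\<mu> \<in> P2 \<Longrightarrow> lfd h \<mu> differentiable at u" "\<mu> \<in> P2 \<Longrightarrow> fderiv (lfd h \<mu>) differentiable at u"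
    using assms unfolding regular2_def twice_diff_def by blast+
  show "\<mu> \<in> P2 \<Longrightarrow> K \<mu> x differentiable at y \<and> (\<lambda>u. fderiv (K \<mu> u) y) differentiable at x"
    using assms unfolding regular2_def by blast
qed

text \<open>Only the gap between the two measure derivatives counts, not their sizes; h and h' will
  be one coefficient at two parameter values.\<close>

lemma mixed_measure_increment:
  fixes h h' :: "'x::euclidean_space measure \<Rightarrow> 'b::euclidean_space"
  assumes D: "is_lfd h D" "is_lfd h' D'" and \<pi>: "\<pi> \<in> couplings \<mu> \<nu>" "\<mu> \<in> P2" "\<nu> \<in> P2" and l: "0 \<le> l"
    and diff: "\<And>m u. m \<in> P2 \<Longrightarrow> D m differentiable at u" "\<And>m u. m \<in> P2 \<Longrightarrow> D' m differentiable at u"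
    and bnd: "\<And>\<theta> u. 0 \<le> \<theta> \<Longrightarrow> \<theta> \<le> 1 \<Longrightarrow> norm (fderiv (D (mix \<theta> \<mu> \<nu>)) u - fderiv (D' (mix \<theta> \<mu> \<nu>)) u) \<le> l"
  shows "norm ((h \<mu> - h' \<mu>) - (h \<nu> - h' \<nu>)) \<le> l * cost \<pi>"
proof (rule lfd_imp_lipschitz[OF is_lfd_diff[OF D] \<pi> l])
  fix \<theta> :: real and x y assume t: "0 \<le> \<theta>" "\<theta> \<le> 1"
  note m = mix_P2(1)[OF \<pi>(2,3) t]
  show "norm ((D (mix \<theta> \<mu> \<nu>) x - D' (mix \<theta> \<mu> \<nu>) x) - (D (mix \<theta> \<mu> \<nu>) y - D' (mix \<theta> \<mu> \<nu>) y)) \<le> l * norm (x - y)"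
    by (rule increment_diff_le[of UNIV]) (use diff[OF m] bnd[OF t] in auto)
qed

text \<open>Exchanges parameter and measure. The increment of h in q is Lipschitz in the measure
  with constant l |q - q0|; division by |q - q0| bounds the variation of the q-derivative. The
  radius r is there because decaying bounds are comparable only near q0.\<close>

lemma fderiv_param_measure_lipschitz:
  fixes h :: "'p::real_normed_vector \<Rightarrow> 'x::euclidean_space measure \<Rightarrow> 'b::euclidean_space"
  assumes D: "\<And>q. is_lfd (h q) (D q)" and \<pi>: "\<pi> \<in> couplings \<mu> \<nu>" "\<mu> \<in> P2" "\<nu> \<in> P2" and l: "0 \<le> l" and r: "0 < r"
    and diff: "\<And>q m u. m \<in> P2 \<Longrightarrow> D q m differentiable at u"
    and bnd: "\<And>q \<theta> u. norm (q - q0) < r \<Longrightarrow> 0 \<le> \<theta> \<Longrightarrow> \<theta> \<le> 1 \<Longrightarrow>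
      norm (fderiv (D q (mix \<theta> \<mu> \<nu>)) u - fderiv (D q0 (mix \<theta> \<mu> \<nu>)) u) \<le> l * norm (q - q0)"
    and d: "(\<lambda>q. h q \<mu>) differentiable at q0" "(\<lambda>q. h q \<nu>) differentiable at q0"
  shows "norm (fderiv (\<lambda>q. h q \<mu>) q0 - fderiv (\<lambda>q. h q \<nu>) q0) \<le> l * cost \<pi>"
proof (rule fderiv_diff_le[OF d r])
  show "0 \<le> l * cost \<pi>" using l by simp
  fix q assume q: "norm (q - q0) < r"
  have "norm ((h q \<mu> - h q0 \<mu>) - (h q \<nu> - h q0 \<nu>)) \<le> (l * norm (q - q0)) * cost \<pi>"
    by (rule mixed_measure_increment[OF D D \<pi> _ diff diff bnd[OF q]]) (use l in auto)
  then show "norm ((h q \<mu> - h q \<nu>) - (h q0 \<mu> - h q0 \<nu>)) \<le> l * cost \<pi> * norm (q - q0)"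
    by (simp add: algebra_simps)
qed

text \<open>The quadratic remainder of the expansion in the measure makes increments of the first
  derivative Lipschitz in the measure; the bound on increments passes to the derivative at
  u.\<close>

lemma fderiv_lfd_measure_lipschitz:
  fixes h :: "'x::euclidean_space measure \<Rightarrow> 'b::euclidean_space"
  assumes R: "regular2 h K" and \<pi>: "\<pi> \<in> couplings \<mu> \<nu>" "\<mu> \<in> P2" "\<nu> \<in> P2" and l: "0 \<le> l"
    and \<rho>: "\<rho> < mnorm 1 \<mu> - cost \<pi>"
    and bnd: "\<And>m x y. m \<in> P2 \<Longrightarrow> \<rho> \<le> mnorm 1 m \<Longrightarrow> norm (mixed_deriv (K m) x y) \<le> l"
  shows "norm (fderiv (lfd h \<mu>) u - fderiv (lfd h \<nu>) u) \<le> 6 * l * cost \<pi>"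
proof (rule fderiv_diff_le[OF regular2D(3)[OF R \<pi>(2)] regular2D(3)[OF R \<pi>(3)] zero_less_one])
  show "0 \<le> 6 * l * cost \<pi>" using l by simp
  fix v
  have "norm ((lfd h \<mu> v - lfd h \<mu> u) - (lfd h \<nu> v - lfd h \<nu> u)) \<le> 6 * l * cost \<pi> * norm (v - u)"
    by (rule lfd_lipschitz_measure[OF regular2D(1)[OF R] \<pi> l \<rho>],
        rule second_order_bound[OF regular2D(2)[OF R] regular2D(5)[OF R] bnd l])
  then show "norm ((lfd h \<mu> v - lfd h \<nu> v) - (lfd h \<mu> u - lfd h \<nu> u)) \<le> 6 * l * cost \<pi> * norm (v - u)"
    by (simp add: algebra_simps)
qed

text \<open>Within a quarter of the weight N, a bound c / N is available. Beyond it N is less than 4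
  d, and the sup bound 2 \<Lambda> already yields 8 \<Lambda> d.\<close>

lemma near_far:
  fixes N d \<Delta> \<Lambda> c :: real
  assumes "0 < N" "0 \<le> d" "0 \<le> c" "0 \<le> \<Lambda>" "\<Delta> \<le> 2 * \<Lambda>" "d \<le> N / 4 \<Longrightarrow> \<Delta> \<le> c / N * d"
  shows "N * \<Delta> \<le> (c + 8 * \<Lambda>) * d"
proof (cases "d \<le> N / 4")
  case True
  have "N * \<Delta> \<le> N * (c / N * d)" using assms(1) assms(6)[OF True] by (intro mult_left_mono) auto
  also have "\<dots> = c * d" using assms(1) by simp
  also have "\<dots> \<le> (c + 8 * \<Lambda>) * d" using assms by (intro mult_right_mono) auto
  finally show ?thesis .
next
  case False
  have "N * \<Delta> \<le> (4 * d) * (2 * \<Lambda>)" using False assms by (intro order_trans[OF mult_left_mono[of \<Delta> "2 * \<Lambda>" N] mult_right_mono]) auto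
  also have "\<dots> = 8 * \<Lambda> * d" by simp
  also have "\<dots> \<le> (c + 8 * \<Lambda>) * d" using assms by (intro mult_right_mono) auto
  finally show ?thesis .
qed

definition wt :: "'x::euclidean_space \<Rightarrow> 'x measure \<Rightarrow> real" where
  "wt x \<mu> = 1 + norm x + mnorm 1 \<mu>"

lemma wt_pos: "0 < wt x \<mu>" "1 \<le> wt x \<mu>"
proof -
  show "1 \<le> wt x \<mu>" by (simp add: wt_def)
  then show "0 < wt x \<mu>" by linarith
qed

lemma wt_le:
  assumes "\<pi> \<in> couplings \<mu> \<mu>'" "\<mu> \<in> P2" "\<mu>' \<in> P2"
  shows "wt x \<mu> \<le> wt x' \<mu>' + norm (x - x') + cost \<pi>"
  using mnorm_diff_le_cost[OF assms] norm_triangle_sub[of x x'] by (simp add: wt_def)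

lemma wt_le_x: "wt x \<mu> \<le> wt x' \<mu> + norm (x - x')"
  using norm_triangle_sub[of x x'] by (simp add: wt_def)

lemma wt_half: "mnorm 1 \<mu> - wt x \<mu> / 2 \<le> mnorm 1 m \<Longrightarrow> wt x \<mu> / 2 \<le> wt x m"
  by (simp add: wt_def field_simps)

lemma half_weight:
  assumes "0 \<le> l" "0 < n" "n / 2 \<le> m"
  shows "l / m \<le> 2 * l / (n::real)"
proof -
  have "l / m \<le> l / (n / 2)" using assms by (intro divide_left_mono mult_pos_pos) auto
  then show ?thesis by (simp add: mult.commute)
qed

text \<open>The weight moves with the base point at the cost of the sup norm \<open>\<Lambda>\<close>.\<close>

lemma chain_weighted:
  fixes F :: "'x::euclidean_space \<Rightarrow> 'x measure \<Rightarrow> 'a::real_normed_vector \<Rightarrow> 'b::real_normed_vector"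
  assumes \<pi>: "\<pi> \<in> couplings \<mu> \<mu>'" "\<mu> \<in> P2" "\<mu>' \<in> P2" and c: "0 \<le> c" "0 \<le> \<Lambda>"
    and F: "\<And>x a m. m \<in> P2 \<Longrightarrow> norm (F x m a) \<le> \<Lambda>"
    and x: "wt x \<mu> * norm (F x \<mu> a - F x' \<mu> a) \<le> c * norm (x - x')"
    and m: "wt x' \<mu> * norm (F x' \<mu> a - F x' \<mu>' a) \<le> c * cost \<pi>"
    and a: "wt x' \<mu>' * norm (F x' \<mu>' a - F x' \<mu>' a') \<le> c * norm (a - a')"
  shows "wt x \<mu> * norm (F x \<mu> a - F x' \<mu>' a') \<le> (c + 4 * \<Lambda>) * (norm (x - x') + cost \<pi> + norm (a - a'))"
proof -
  define X where "X = norm (x - x')"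
  define D where "D = norm (a - a')"
  have d2: "norm (F x m b - F x' m' b') \<le> 2 * \<Lambda>" if "m \<in> P2" "m' \<in> P2" for x x' m m' b b'
    using F[OF that(1), of x b] F[OF that(2), of x' b'] norm_triangle_ineq4[of "F x m b" "F x' m' b'"] by linarith
  have 1: "wt x \<mu> * norm (F x' \<mu> a - F x' \<mu>' a) \<le> c * cost \<pi> + X * (2 * \<Lambda>)"
  proof -
    have "wt x \<mu> * norm (F x' \<mu> a - F x' \<mu>' a) \<le> (wt x' \<mu> + X) * norm (F x' \<mu> a - F x' \<mu>' a)"
      unfolding X_def by (intro mult_right_mono wt_le_x) auto
    also have "\<dots> = wt x' \<mu> * norm (F x' \<mu> a - F x' \<mu>' a) + X * norm (F x' \<mu> a - F x' \<mu>' a)" by (rule distrib_right)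
    also have "\<dots> \<le> c * cost \<pi> + X * (2 * \<Lambda>)" using m d2[OF \<pi>(2,3)] by (intro add_mono mult_left_mono) (auto simp: X_def)
    finally show ?thesis .
  qed
  have 2: "wt x \<mu> * norm (F x' \<mu>' a - F x' \<mu>' a') \<le> c * D + (X + cost \<pi>) * (2 * \<Lambda>)"
  proof -
    have "wt x \<mu> * norm (F x' \<mu>' a - F x' \<mu>' a') \<le> (wt x' \<mu>' + (X + cost \<pi>)) * norm (F x' \<mu>' a - F x' \<mu>' a')"
      using wt_le[OF \<pi>, of x x'] by (intro mult_right_mono) (auto simp: X_def)
    also have "\<dots> = wt x' \<mu>' * norm (F x' \<mu>' a - F x' \<mu>' a') + (X + cost \<pi>) * norm (F x' \<mu>' a - F x' \<mu>' a')" by (rule distrib_right)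
    also have "\<dots> \<le> c * D + (X + cost \<pi>) * (2 * \<Lambda>)" using a d2[OF \<pi>(3,3)] by (intro add_mono mult_left_mono) (auto simp: X_def D_def)
    finally show ?thesis .
  qed
  have "norm (F x \<mu> a - F x' \<mu>' a') \<le> norm (F x \<mu> a - F x' \<mu> a) + norm (F x' \<mu> a - F x' \<mu>' a) + norm (F x' \<mu>' a - F x' \<mu>' a')"
    using norm_triangle_ineq[of "F x \<mu> a - F x' \<mu> a" "F x' \<mu> a - F x' \<mu>' a"]
      norm_triangle_ineq[of "F x \<mu> a - F x' \<mu>' a" "F x' \<mu>' a - F x' \<mu>' a'"] by simp
  then have "wt x \<mu> * norm (F x \<mu> a - F x' \<mu>' a') \<le>
      wt x \<mu> * (norm (F x \<mu> a - F x' \<mu> a) + norm (F x' \<mu> a - F x' \<mu>' a) + norm (F x' \<mu>' a - F x' \<mu>' a'))"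
    using wt_pos(1)[of x \<mu>] by (intro mult_left_mono) auto
  also have "\<dots> = wt x \<mu> * norm (F x \<mu> a - F x' \<mu> a) + wt x \<mu> * norm (F x' \<mu> a - F x' \<mu>' a) + wt x \<mu> * norm (F x' \<mu>' a - F x' \<mu>' a')"
    by (simp only: distrib_left)
  also have "\<dots> \<le> c * X + (c * cost \<pi> + X * (2 * \<Lambda>)) + (c * D + (X + cost \<pi>) * (2 * \<Lambda>))"
    by (intro add_mono x[folded X_def] 1 2)
  also have "\<dots> \<le> (c + 4 * \<Lambda>) * (X + cost \<pi> + D)"
  proof -
    have "0 \<le> \<Lambda> * D" "0 \<le> \<Lambda> * cost \<pi>" using c by (auto simp: D_def)
    then show ?thesis by (simp add: algebra_simps)
  qed
  finally show ?thesis by (simp add: X_def D_def)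
qed

subsection \<open>The drift\<close>

lemma dm_lfd: "dm f x \<mu> a u = fderiv (lfd (\<lambda>\<nu>. f x \<nu> a) \<mu>) u"
proof -
  have "lf f x \<mu> a = lfd (\<lambda>\<nu>. f x \<nu> a) \<mu>" by (simp add: lf_def fun_eq_iff)
  then show ?thesis by (simp add: dm_def)
qed

text \<open>\<open>K\<close> and \<open>M\<close> are parameters because the second-order measure
  derivatives are witnesses, not operators. All decaying bounds are written with the one weight
  \<open>wt\<close>.\<close>

locale coef_f =
  fixes f :: "real^'n \<Rightarrow> (real^'n) measure \<Rightarrow> real^'k \<Rightarrow> real^'n" and K
    and M :: "real^'n \<Rightarrow> (real^'n) measure \<Rightarrow> real^'k \<Rightarrow> real^'n \<Rightarrow> ((real^'n) \<Rightarrow>\<^sub>L (real^'k) \<Rightarrow>\<^sub>L (real^'n))"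
    and \<Lambda> l :: real
  assumes pos: "0 < \<Lambda>" "0 < l"
    and td: "\<And>\<mu>. \<mu> \<in> P2 \<Longrightarrow> twice_diff (\<lambda>(x, \<alpha>). f x \<mu> \<alpha>)"
    and dmdx: "\<And>x \<mu> \<alpha> u. \<mu> \<in> P2 \<Longrightarrow> (\<lambda>y. dm f y \<mu> \<alpha> u) differentiable at x"
    and bnd: "\<And>x \<mu> \<alpha> u. \<mu> \<in> P2 \<Longrightarrow> norm (da f x \<mu> \<alpha>) \<le> \<Lambda> \<and> norm (dm f x \<mu> \<alpha> u) \<le> \<Lambda> \<and> norm (dx f x \<mu> \<alpha>) \<le> \<Lambda>"
    and reg: "\<And>x \<alpha>. regular2 (\<lambda>\<nu>. f x \<nu> \<alpha>) (K x \<alpha>)"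
    and Mder: "\<And>x \<mu> \<alpha> b. \<mu> \<in> P2 \<Longrightarrow> has_L_deriv (\<lambda>\<nu>. blinfun_apply (da f x \<nu> \<alpha>) b)
           (\<lambda>u. Blinfun (\<lambda>y. blinfun_apply (blinfun_apply (M x \<mu> \<alpha> u) y) b)) \<mu>"
    and b_K: "\<And>x \<mu> \<alpha> u v. \<mu> \<in> P2 \<Longrightarrow> norm (mixed_deriv (K x \<alpha> \<mu>) u v) \<le> l / wt x \<mu>"
    and b_aa: "\<And>x \<mu> \<alpha>. \<mu> \<in> P2 \<Longrightarrow> norm (fderiv (da f x \<mu>) \<alpha>) \<le> l / wt x \<mu>"
    and b_M: "\<And>x \<mu> \<alpha> u. \<mu> \<in> P2 \<Longrightarrow> norm (M x \<mu> \<alpha> u) \<le> l / wt x \<mu>"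
    and b_ax: "\<And>x \<mu> \<alpha>. \<mu> \<in> P2 \<Longrightarrow> norm (fderiv (dx f x \<mu>) \<alpha>) \<le> l / wt x \<mu>"
    and b_xx: "\<And>x \<mu> \<alpha>. \<mu> \<in> P2 \<Longrightarrow> norm (fderiv (\<lambda>y. dx f y \<mu> \<alpha>) x) \<le> l / wt x \<mu>"
    and b_uu: "\<And>x \<mu> \<alpha> u. \<mu> \<in> P2 \<Longrightarrow> norm (fderiv (dm f x \<mu> \<alpha>) u) \<le> l / wt x \<mu>"
    and b_xm: "\<And>x \<mu> \<alpha> u. \<mu> \<in> P2 \<Longrightarrow> norm (fderiv (\<lambda>y. dm f y \<mu> \<alpha> u) x) \<le> l / wt x \<mu>"
begin

lemmas dff = twice_diff_partial[OF td, folded dx_def da_def]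

lemma dff_da: "\<mu> \<in> P2 \<Longrightarrow> da f x \<mu> differentiable at \<alpha>"
  and dff_dx: "\<mu> \<in> P2 \<Longrightarrow> dx f x \<mu> differentiable at \<alpha>"
  and dff_f: "\<mu> \<in> P2 \<Longrightarrow> f x \<mu> differentiable at \<alpha>"
  using dff(5)[of \<mu> x \<alpha>] dff(4)[of \<mu> x \<alpha>] dff(2)[of \<mu> x \<alpha>] by auto

definition lfa where "lfa x \<alpha> \<mu> = lf f x \<mu> \<alpha>"

lemma lfa: "is_lfd (\<lambda>\<nu>. f x \<nu> \<alpha>) (lfa x \<alpha>)" "\<mu> \<in> P2 \<Longrightarrow> lfa x \<alpha> \<mu> differentiable at u"
  "fderiv (lfa x \<alpha> \<mu>) u = dm f x \<mu> \<alpha> u" "\<mu> \<in> P2 \<Longrightarrow> dm f x \<mu> \<alpha> differentiable at u"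
proof -
  have eq: "lfa x \<alpha> = lfd (\<lambda>\<nu>. f x \<nu> \<alpha>)" by (auto simp: lfa_def lf_def fun_eq_iff)
  show "is_lfd (\<lambda>\<nu>. f x \<nu> \<alpha>) (lfa x \<alpha>)" unfolding eq by (rule regular2D(1)[OF reg])
  show "\<mu> \<in> P2 \<Longrightarrow> lfa x \<alpha> \<mu> differentiable at u" unfolding eq by (rule regular2D(3)[OF reg])
  show "fderiv (lfa x \<alpha> \<mu>) u = dm f x \<mu> \<alpha> u" by (simp add: lfa_def dm_def)
  have "dm f x \<mu> \<alpha> = fderiv (lfa x \<alpha> \<mu>)" by (simp add: fun_eq_iff lfa_def dm_def)
  then show "\<mu> \<in> P2 \<Longrightarrow> dm f x \<mu> \<alpha> differentiable at u" unfolding eq using regular2D(4)[OF reg] by simp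
qed

lemma f_lip:
  assumes \<pi>: "\<pi> \<in> couplings \<mu> \<mu>'" "\<mu> \<in> P2" "\<mu>' \<in> P2"
  shows "norm (f x \<mu> a - f x' \<mu>' a') \<le> \<Lambda> * (norm (x - x') + cost \<pi> + norm (a - a'))"
proof -
  have 1: "norm (f x \<mu> a - f x' \<mu> a) \<le> \<Lambda> * norm (x - x')"
    by (rule lipschitz_of_fderiv[of UNIV "\<lambda>y. f y \<mu> a"]) (use dff(1)[OF \<pi>(2)] bnd[OF \<pi>(2)] in \<open>auto simp: dx_def\<close>)
  have 2: "norm (f x' \<mu> a - f x' \<mu>' a) \<le> \<Lambda> * cost \<pi>"
  proof (rule lfd_imp_lipschitz[OF lfa(1) \<pi>])
    fix \<theta> :: real and u v assume t: "0 \<le> \<theta>" "\<theta> \<le> 1"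
    note m = mix_P2(1)[OF \<pi>(2,3) t]
    show "norm (lfa x' a (mix \<theta> \<mu> \<mu>') u - lfa x' a (mix \<theta> \<mu> \<mu>') v) \<le> \<Lambda> * norm (u - v)"
      by (rule lipschitz_of_fderiv[of UNIV]) (use lfa(2)[OF m] bnd[OF m] in \<open>auto simp: lfa(3)\<close>)
  qed (use pos in simp)
  have 3: "norm (f x' \<mu>' a - f x' \<mu>' a') \<le> \<Lambda> * norm (a - a')"
    by (rule lipschitz_of_fderiv[of UNIV "f x' \<mu>'"]) (use dff_f[OF \<pi>(3)] bnd[OF \<pi>(3)] in \<open>auto simp: da_def\<close>)
  have "f x \<mu> a - f x' \<mu>' a' = (f x \<mu> a - f x' \<mu> a) + (f x' \<mu> a - f x' \<mu>' a) + (f x' \<mu>' a - f x' \<mu>' a')" by simp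
  then have "norm (f x \<mu> a - f x' \<mu>' a') \<le> \<Lambda> * norm (x - x') + \<Lambda> * cost \<pi> + \<Lambda> * norm (a - a')"
    using norm_triangle_mono[OF norm_triangle_mono[OF 1 2] 3] by simp
  then show ?thesis by (simp add: distrib_left)
qed

lemma wt_cball: "y \<in> cball x (wt x \<mu> / 4) \<Longrightarrow> wt x \<mu> / 2 \<le> wt y \<mu>"
  using wt_le_x[of x \<mu> y] wt_pos(1)[of x \<mu>] by (simp add: dist_norm)

lemma wt_mix:
  assumes \<pi>: "\<pi> \<in> couplings \<mu> \<mu>'" "\<mu> \<in> P2" "\<mu>' \<in> P2" and t: "0 \<le> \<theta>" "\<theta> \<le> 1"
  shows "wt x \<mu> - cost \<pi> \<le> wt x (mix \<theta> \<mu> \<mu>')"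
proof -
  have "(1 - \<theta>) * mnorm 1 \<mu> - (1 - \<theta>) * mnorm 1 \<mu>' = (1 - \<theta>) * (mnorm 1 \<mu> - mnorm 1 \<mu>')" by (simp add: algebra_simps)
  also have "\<dots> \<le> (1 - \<theta>) * cost \<pi>" using mnorm_diff_le_cost[OF \<pi>] t by (intro mult_left_mono) auto
  also have "\<dots> \<le> 1 * cost \<pi>" using t by (intro mult_right_mono) auto
  finally show ?thesis using mix_P2(2)[OF \<pi>(2,3) t] by (simp add: wt_def algebra_simps)
qed

lemma x_dx: "\<mu> \<in> P2 \<Longrightarrow> wt x \<mu> * norm (dx f x \<mu> a - dx f x' \<mu> a) \<le> (12 * l + 8 * \<Lambda>) * norm (x - x')"
  and x_dm: "\<mu> \<in> P2 \<Longrightarrow> wt x \<mu> * norm (dm f x \<mu> a u - dm f x' \<mu> a u) \<le> (12 * l + 8 * \<Lambda>) * norm (x - x')"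
  and x_da: "\<mu> \<in> P2 \<Longrightarrow> wt x \<mu> * norm (da f x \<mu> a - da f x' \<mu> a) \<le> (12 * l + 8 * \<Lambda>) * norm (x - x')"
proof -
  assume \<mu>: "\<mu> \<in> P2"
  let ?S = "cball x (wt x \<mu> / 4)"
  note W = wt_pos(1)[of x \<mu>]
  have b: "l / wt y \<mu> \<le> 2 * l / wt x \<mu>" if "y \<in> ?S" for y by (rule half_weight[OF _ W wt_cball[OF that]]) (use pos in simp)
  \<comment> \<open>The factor 12 is forced by the measure dependence of \<open>dm\<close>; one
    constant is kept for all first derivatives.\<close>
  have weak: "2 * l / wt x \<mu> * d \<le> 12 * l / wt x \<mu> * d" if "0 \<le> d" for d
    using that pos W by (intro mult_right_mono divide_right_mono) auto
  have near: "x \<in> ?S \<and> x' \<in> ?S" if "norm (x - x') \<le> wt x \<mu> / 4" using that W by (simp add: dist_norm)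
  have l0: "0 \<le> 12 * l" "0 \<le> \<Lambda>" using pos by auto
  have d2: "norm (A - A') \<le> 2 * \<Lambda>" if "norm A \<le> \<Lambda>" "norm A' \<le> \<Lambda>" for A A' :: "'v::real_normed_vector"
    using that norm_triangle_ineq4[of A A'] by linarith
  show "wt x \<mu> * norm (dx f x \<mu> a - dx f x' \<mu> a) \<le> (12 * l + 8 * \<Lambda>) * norm (x - x')"
  proof (rule near_far[OF W norm_ge_zero l0])
    show "norm (dx f x \<mu> a - dx f x' \<mu> a) \<le> 2 * \<Lambda>" by (intro d2) (use bnd[OF \<mu>] in auto)
    assume n: "norm (x - x') \<le> wt x \<mu> / 4"
    have "norm (dx f x \<mu> a - dx f x' \<mu> a) \<le> 2 * l / wt x \<mu> * norm (x - x')"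
      by (rule lipschitz_of_fderiv[of ?S "\<lambda>y. dx f y \<mu> a"]) (use near[OF n] dff(3)[OF \<mu>] order_trans[OF b_xx[OF \<mu>] b] in auto)
    then show "norm (dx f x \<mu> a - dx f x' \<mu> a) \<le> 12 * l / wt x \<mu> * norm (x - x')" using weak[OF norm_ge_zero] by (rule order_trans)
  qed
  show "wt x \<mu> * norm (dm f x \<mu> a u - dm f x' \<mu> a u) \<le> (12 * l + 8 * \<Lambda>) * norm (x - x')"
  proof (rule near_far[OF W norm_ge_zero l0])
    show "norm (dm f x \<mu> a u - dm f x' \<mu> a u) \<le> 2 * \<Lambda>" by (intro d2) (use bnd[OF \<mu>] in auto)
    assume n: "norm (x - x') \<le> wt x \<mu> / 4"
    have "norm (dm f x \<mu> a u - dm f x' \<mu> a u) \<le> 2 * l / wt x \<mu> * norm (x - x')"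
      by (rule lipschitz_of_fderiv[of ?S "\<lambda>y. dm f y \<mu> a u"]) (use near[OF n] dmdx[OF \<mu>] order_trans[OF b_xm[OF \<mu>] b] in auto)
    then show "norm (dm f x \<mu> a u - dm f x' \<mu> a u) \<le> 12 * l / wt x \<mu> * norm (x - x')" using weak[OF norm_ge_zero] by (rule order_trans)
  qed
  show "wt x \<mu> * norm (da f x \<mu> a - da f x' \<mu> a) \<le> (12 * l + 8 * \<Lambda>) * norm (x - x')"
  proof (rule near_far[OF W norm_ge_zero l0])
    show "norm (da f x \<mu> a - da f x' \<mu> a) \<le> 2 * \<Lambda>" by (intro d2) (use bnd[OF \<mu>] in auto)
    assume n: "norm (x - x') \<le> wt x \<mu> / 4"
    have "norm (da f x \<mu> a - da f x' \<mu> a) \<le> 2 * l / wt x \<mu> * norm (x - x')"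
      unfolding da_def
    proof (rule fderiv_swap_lipschitz[where S = ?S and F = "\<lambda>y b. f y \<mu> b"])
      fix z b b' assume z: "z \<in> ?S"
      show "(\<lambda>z. f z \<mu> b) differentiable at z" by (rule dff(1)[OF \<mu>])
      have "norm (dx f z \<mu> b - dx f z \<mu> b') \<le> 2 * l / wt x \<mu> * norm (b - b')"
        by (rule lipschitz_of_fderiv[of UNIV "dx f z \<mu>"]) (use dff_dx[OF \<mu>] order_trans[OF b_ax[OF \<mu>] b[OF z]] in auto)
      then show "norm (fderiv (\<lambda>z. f z \<mu> b) z - fderiv (\<lambda>z. f z \<mu> b') z) \<le> 2 * l / wt x \<mu> * norm (b - b')"
        by (simp add: dx_def)
    qed (use near[OF n] dff_f[OF \<mu>] pos W in auto)
    then show "norm (da f x \<mu> a - da f x' \<mu> a) \<le> 12 * l / wt x \<mu> * norm (x - x')" using weak[OF norm_ge_zero] by (rule order_trans)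
  qed
qed

text \<open>Three derivatives, three routes: \<open>dx\<close> by exchanging state and measure in
  the bound on the x-derivative of \<open>dm\<close>, \<open>dm\<close> by the second-order
  expansion with \<open>K\<close>, and \<open>da\<close> by its L-derivative \<open>M\<close>. In
  each case the threshold on the first moment keeps the weight above half its value at
  \<mu>.\<close>

lemma m_dx: "\<pi> \<in> couplings \<mu> \<mu>' \<Longrightarrow> \<mu> \<in> P2 \<Longrightarrow> \<mu>' \<in> P2 \<Longrightarrow> wt x \<mu> * norm (dx f x \<mu> a - dx f x \<mu>' a) \<le> (12 * l + 8 * \<Lambda>) * cost \<pi>"
  and m_dm: "\<pi> \<in> couplings \<mu> \<mu>' \<Longrightarrow> \<mu> \<in> P2 \<Longrightarrow> \<mu>' \<in> P2 \<Longrightarrow> wt x \<mu> * norm (dm f x \<mu> a u - dm f x \<mu>' a u) \<le> (12 * l + 8 * \<Lambda>) * cost \<pi>"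
  and m_da: "\<pi> \<in> couplings \<mu> \<mu>' \<Longrightarrow> \<mu> \<in> P2 \<Longrightarrow> \<mu>' \<in> P2 \<Longrightarrow> wt x \<mu> * norm (da f x \<mu> a - da f x \<mu>' a) \<le> (12 * l + 8 * \<Lambda>) * cost \<pi>"
proof -
  assume \<pi>: "\<pi> \<in> couplings \<mu> \<mu>'" "\<mu> \<in> P2" "\<mu>' \<in> P2"
  note W = wt_pos(1)[of x \<mu>]
  have weak: "2 * l / wt x \<mu> * d \<le> 12 * l / wt x \<mu> * d" if "0 \<le> d" for d
    using that pos W by (intro mult_right_mono divide_right_mono) auto
  have l0: "0 \<le> 12 * l" "0 \<le> \<Lambda>" "0 \<le> l" using pos by auto
  have l2: "0 \<le> 2 * l / wt x \<mu>" using pos W by simp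
  have d2: "norm (A - A') \<le> 2 * \<Lambda>" if "norm A \<le> \<Lambda>" "norm A' \<le> \<Lambda>" for A A' :: "'v::real_normed_vector"
    using that norm_triangle_ineq4[of A A'] by linarith
  show "wt x \<mu> * norm (dx f x \<mu> a - dx f x \<mu>' a) \<le> (12 * l + 8 * \<Lambda>) * cost \<pi>"
  proof (rule near_far[OF W cost_nonneg l0(1,2)])
    show "norm (dx f x \<mu> a - dx f x \<mu>' a) \<le> 2 * \<Lambda>" by (intro d2) (use bnd[OF \<pi>(2)] bnd[OF \<pi>(3)] in auto)
    assume n: "cost \<pi> \<le> wt x \<mu> / 4"
    have "norm (dx f x \<mu> a - dx f x \<mu>' a) \<le> 2 * l / wt x \<mu> * cost \<pi>"
      unfolding dx_def
    proof (rule fderiv_param_measure_lipschitz[where h = "\<lambda>y \<nu>. f y \<nu> a" and D = "\<lambda>y. lfa y a" and r = "wt x \<mu> / 4", OF lfa(1) \<pi> l2 _ lfa(2)])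
      show "0 < wt x \<mu> / 4" using W by simp
      show "(\<lambda>q. f q \<mu> a) differentiable at x" "(\<lambda>q. f q \<mu>' a) differentiable at x" using dff(1) \<pi> by auto
      fix y u and \<theta> :: real assume y: "norm (y - x) < wt x \<mu> / 4" and t: "0 \<le> \<theta>" "\<theta> \<le> 1"
      let ?m = "mix \<theta> \<mu> \<mu>'"
      note m = mix_P2(1)[OF \<pi>(2,3) t]
      have b: "l / wt z ?m \<le> 2 * l / wt x \<mu>" if z: "z \<in> cball x (wt x \<mu> / 4)" for z
      proof (rule half_weight[OF l0(3) W])
        have "norm (x - z) \<le> wt x \<mu> / 4" using z by (simp add: dist_norm)
        then show "wt x \<mu> / 2 \<le> wt z ?m"
          using wt_mix[OF \<pi> t, of x] wt_le_x[of x ?m z] n by linarith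
      qed
      have "norm (dm f y ?m a u - dm f x ?m a u) \<le> 2 * l / wt x \<mu> * norm (y - x)"
        by (rule lipschitz_of_fderiv[of "cball x (wt x \<mu> / 4)" "\<lambda>y. dm f y ?m a u"])
          (use y W dmdx[OF m] order_trans[OF b_xm[OF m] b] in \<open>auto simp: dist_norm norm_minus_commute\<close>)
      then show "norm (fderiv (lfa y a ?m) u - fderiv (lfa x a ?m) u) \<le> 2 * l / wt x \<mu> * norm (y - x)" by (simp only: lfa(3))
    qed
    then show "norm (dx f x \<mu> a - dx f x \<mu>' a) \<le> 12 * l / wt x \<mu> * cost \<pi>" using weak[OF cost_nonneg] by (rule order_trans)
  qed
  show "wt x \<mu> * norm (dm f x \<mu> a u - dm f x \<mu>' a u) \<le> (12 * l + 8 * \<Lambda>) * cost \<pi>"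
  proof (rule near_far[OF W cost_nonneg l0(1,2)])
    show "norm (dm f x \<mu> a u - dm f x \<mu>' a u) \<le> 2 * \<Lambda>" by (intro d2) (use bnd[OF \<pi>(2)] bnd[OF \<pi>(3)] in auto)
    assume n: "cost \<pi> \<le> wt x \<mu> / 4"
    have "norm (fderiv (lfd (\<lambda>\<nu>. f x \<nu> a) \<mu>) u - fderiv (lfd (\<lambda>\<nu>. f x \<nu> a) \<mu>') u) \<le> 6 * (2 * l / wt x \<mu>) * cost \<pi>"
    proof (rule fderiv_lfd_measure_lipschitz[OF reg \<pi> l2])
      show "mnorm 1 \<mu> - wt x \<mu> / 2 < mnorm 1 \<mu> - cost \<pi>" using n W by linarith
      fix m :: "(real^'n) measure" and y v :: "real^'n" assume m: "m \<in> P2" "mnorm 1 \<mu> - wt x \<mu> / 2 \<le> mnorm 1 m"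
      have "wt x \<mu> / 2 \<le> wt x m" by (rule wt_half[OF m(2)])
      then show "norm (mixed_deriv (K x a m) y v) \<le> 2 * l / wt x \<mu>"
        by (rule order_trans[OF b_K[OF m(1)] half_weight[OF l0(3) W]])
    qed
    then show "norm (dm f x \<mu> a u - dm f x \<mu>' a u) \<le> 12 * l / wt x \<mu> * cost \<pi>" by (simp add: dm_lfd)
  qed
  show "wt x \<mu> * norm (da f x \<mu> a - da f x \<mu>' a) \<le> (12 * l + 8 * \<Lambda>) * cost \<pi>"
  proof (rule near_far[OF W cost_nonneg l0(1,2)])
    show "norm (da f x \<mu> a - da f x \<mu>' a) \<le> 2 * \<Lambda>" by (intro d2) (use bnd[OF \<pi>(2)] bnd[OF \<pi>(3)] in auto)
    assume n: "cost \<pi> \<le> wt x \<mu> / 4"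
    have "norm (da f x \<mu> a - da f x \<mu>' a) \<le> 2 * l / wt x \<mu> * cost \<pi>"
    proof (rule norm_blinfun_bound)
      show "0 \<le> 2 * l / wt x \<mu> * cost \<pi>" by (rule mult_nonneg_nonneg[OF l2 cost_nonneg])
      fix b
      have "norm (blinfun_apply (da f x \<mu> a) b - blinfun_apply (da f x \<mu>' a) b) \<le> (2 * l / wt x \<mu> * norm b) * cost \<pi>"
      proof (rule L_deriv_imp_lipschitz[OF Mder _ _ \<pi>])
        show "mnorm 1 \<mu> - wt x \<mu> / 2 \<le> mnorm 1 \<mu> - cost \<pi>" using n W by linarith
        show "0 \<le> 2 * l / wt x \<mu> * norm b" by (rule mult_nonneg_nonneg[OF l2 norm_ge_zero])
        fix m :: "(real^'n) measure" and u :: "real^'n" assume m: "m \<in> P2" "mnorm 1 \<mu> - wt x \<mu> / 2 \<le> mnorm 1 m"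
        have "wt x \<mu> / 2 \<le> wt x m" by (rule wt_half[OF m(2)])
        then have Mb: "norm (M x m a u) \<le> 2 * l / wt x \<mu>"
          by (rule order_trans[OF b_M[OF m(1)] half_weight[OF l0(3) W]])
        have bl: "bounded_linear (\<lambda>y. blinfun_apply (blinfun_apply (M x m a u) y) b)"
          by (rule bounded_linear_compose[OF blinfun.bounded_linear_left blinfun.bounded_linear_right])
        show "norm (Blinfun (\<lambda>y. blinfun_apply (blinfun_apply (M x m a u) y) b)) \<le> 2 * l / wt x \<mu> * norm b"
        proof (rule norm_blinfun_bound)
          show "0 \<le> 2 * l / wt x \<mu> * norm b" by (rule mult_nonneg_nonneg[OF l2 norm_ge_zero])
          fix y
          have "norm (blinfun_apply (blinfun_apply (M x m a u) y) b) \<le> norm (blinfun_apply (M x m a u) y) * norm b" by (rule norm_blinfun)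
          also have "\<dots> \<le> (norm (M x m a u) * norm y) * norm b" by (intro mult_right_mono norm_blinfun) auto
          also have "\<dots> \<le> (2 * l / wt x \<mu> * norm y) * norm b" by (intro mult_right_mono Mb) auto
          finally show "norm (blinfun_apply (Blinfun (\<lambda>y. blinfun_apply (blinfun_apply (M x m a u) y) b)) y) \<le> 2 * l / wt x \<mu> * norm b * norm y"
            by (simp add: bounded_linear_Blinfun_apply[OF bl] ac_simps)
        qed
      qed
      then show "norm (blinfun_apply (da f x \<mu> a - da f x \<mu>' a) b) \<le> 2 * l / wt x \<mu> * cost \<pi> * norm b"
        by (simp add: blinfun.diff_left ac_simps)
    qed
    then show "norm (da f x \<mu> a - da f x \<mu>' a) \<le> 12 * l / wt x \<mu> * cost \<pi>" using weak[OF cost_nonneg] by (rule order_trans)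
  qed
qed

lemma a_dx: "\<mu> \<in> P2 \<Longrightarrow> wt x \<mu> * norm (dx f x \<mu> a - dx f x \<mu> a') \<le> l * norm (a - a')"
  and a_da: "\<mu> \<in> P2 \<Longrightarrow> wt x \<mu> * norm (da f x \<mu> a - da f x \<mu> a') \<le> l * norm (a - a')"
  and u_dm: "\<mu> \<in> P2 \<Longrightarrow> wt x \<mu> * norm (dm f x \<mu> a u - dm f x \<mu> a u') \<le> l * norm (u - u')"
proof -
  assume \<mu>: "\<mu> \<in> P2"
  note W = wt_pos(1)[of x \<mu>]
  have s: "wt x \<mu> * t \<le> l * d" if "t \<le> l / wt x \<mu> * d" for t d
    using mult_left_mono[OF that, of "wt x \<mu>"] W by simp
  show "wt x \<mu> * norm (dx f x \<mu> a - dx f x \<mu> a') \<le> l * norm (a - a')"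
    by (rule s, rule lipschitz_of_fderiv[of UNIV "dx f x \<mu>"]) (use dff_dx[OF \<mu>] b_ax[OF \<mu>] in auto)
  show "wt x \<mu> * norm (da f x \<mu> a - da f x \<mu> a') \<le> l * norm (a - a')"
    by (rule s, rule lipschitz_of_fderiv[of UNIV "da f x \<mu>"]) (use dff_da[OF \<mu>] b_aa[OF \<mu>] in auto)
  show "wt x \<mu> * norm (dm f x \<mu> a u - dm f x \<mu> a u') \<le> l * norm (u - u')"
    by (rule s, rule lipschitz_of_fderiv[of UNIV "dm f x \<mu> a"]) (use lfa(4)[OF \<mu>] b_uu[OF \<mu>] in auto)
qed

text \<open>\<open>\<partial>\<^sub>\<alpha>\<partial>\<^sub>\<mu> f\<close> is not controlled by assumption; its bound comes from that of \<open>\<partial>\<^sub>\<mu>\<partial>\<^sub>\<alpha> f\<close>.\<close>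

lemma a_dm:
  assumes \<mu>: "\<mu> \<in> P2"
  shows "wt x \<mu> * norm (dm f x \<mu> a u - dm f x \<mu> a' u) \<le> 2 * (12 * l + 8 * \<Lambda>) * norm (a - a')"
proof -
  note W = wt_pos(1)[of x \<mu>]
  define C where "C = 12 * l + 8 * \<Lambda>"
  have C: "0 \<le> C" using pos by (simp add: C_def)
  have "norm (fderiv (lfa x a \<mu>) u - fderiv (lfa x a' \<mu>) u) \<le> 2 * C / wt x \<mu> * norm (a - a')"
  proof (rule fderiv_diff_le[OF lfa(2)[OF \<mu>] lfa(2)[OF \<mu>] zero_less_one])
    show "0 \<le> 2 * C / wt x \<mu> * norm (a - a')" using C W by simp
    fix v
    have "norm ((lfa x a \<mu> v - lfa x a' \<mu> v) - (lfa x a \<mu> u - lfa x a' \<mu> u)) \<le> (2 * C / wt x \<mu> * norm (a - a')) * norm (v - u)"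
    \<comment> \<open>Applied to f(a) - f(a') as a function of the measure. By \<open>m_da\<close>
      and the symmetry of second differences it is Lipschitz along couplings, and probing by point
      masses passes this to its linear functional derivative.\<close>
    proof (rule lipschitz_imp_lfd_lipschitz[OF is_lfd_diff[OF lfa(1) lfa(1)] \<mu>])
      show "mnorm 1 \<mu> - wt x \<mu> / 2 < mnorm 1 \<mu>" using W by simp
      fix \<nu> \<nu>' :: "(real^'n) measure" and \<pi> assume n: "\<nu> \<in> P2" "\<nu>' \<in> P2" "\<pi> \<in> couplings \<nu> \<nu>'" "mnorm 1 \<mu> - wt x \<mu> / 2 \<le> mnorm 1 \<nu>"
      have w: "wt x \<mu> / 2 \<le> wt x \<nu>" by (rule wt_half[OF n(4)])
      have k: "norm (da f x \<nu> b - da f x \<nu>' b) \<le> 2 * C / wt x \<mu> * cost \<pi>" for b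
      proof -
        have "norm (da f x \<nu> b - da f x \<nu>' b) \<le> C / wt x \<nu> * cost \<pi>"
          using m_da[OF n(3,1,2), of x b] wt_pos(1)[of x \<nu>] by (simp add: C_def pos_le_divide_eq mult.commute)
        also have "\<dots> \<le> 2 * C / wt x \<mu> * cost \<pi>" by (intro mult_right_mono half_weight[OF C W w]) auto
        finally show ?thesis .
      qed
      have "norm ((f x \<nu> a - f x \<nu>' a) - (f x \<nu> a' - f x \<nu>' a')) \<le> (2 * C / wt x \<mu> * cost \<pi>) * norm (a - a')"
        by (rule increment_diff_le[of UNIV "f x \<nu>" "f x \<nu>'"]) (use dff_f[OF n(1)] dff_f[OF n(2)] k in \<open>auto simp: da_def\<close>)
      then show "norm ((f x \<nu> a - f x \<nu> a') - (f x \<nu>' a - f x \<nu>' a')) \<le> (2 * C / wt x \<mu> * norm (a - a')) * cost \<pi>"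
        by (simp add: algebra_simps)
    qed
    then show "norm ((lfa x a \<mu> v - lfa x a' \<mu> v) - (lfa x a \<mu> u - lfa x a' \<mu> u)) \<le> 2 * C / wt x \<mu> * norm (a - a') * norm (v - u)" .
  qed
  from mult_left_mono[OF this, of "wt x \<mu>"] show ?thesis using W unfolding lfa(3) by (simp add: C_def)
qed

text \<open>2 (12 l + 8 \<Lambda>) + 4 \<Lambda>: the factor 2 comes from \<open>a_dm\<close>, the
  last term from moving the weight in \<open>chain_weighted\<close>.\<close>

definition Cf where "Cf = 24 * l + 20 * \<Lambda>"

lemma Cf: "0 < Cf" using pos by (simp add: Cf_def add_pos_pos)

lemma lip_dx:
  assumes \<pi>: "\<pi> \<in> couplings \<mu> \<mu>'" "\<mu> \<in> P2" "\<mu>' \<in> P2"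
  shows "wt x \<mu> * norm (dx f x \<mu> a - dx f x' \<mu>' a') \<le> Cf * (norm (x - x') + cost \<pi> + norm (a - a'))"
    and "wt x \<mu> * norm (da f x \<mu> a - da f x' \<mu>' a') \<le> Cf * (norm (x - x') + cost \<pi> + norm (a - a'))"
    and "wt x \<mu> * norm (dm f x \<mu> a u - dm f x' \<mu>' a' u') \<le> Cf * (norm (x - x') + cost \<pi> + norm (a - a') + norm (u - u'))"
proof -
  let ?c = "2 * (12 * l + 8 * \<Lambda>)"
  have c: "0 \<le> ?c" "0 \<le> \<Lambda>" "?c + 4 * \<Lambda> = Cf" "l \<le> Cf" using pos by (auto simp: Cf_def)
  have up: "t \<le> ?c * d" if "t \<le> (12 * l + 8 * \<Lambda>) * d" "0 \<le> d" for t d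
    by (rule order_trans[OF that(1) mult_right_mono[OF _ that(2)]]) (use pos in simp)
  have up': "t \<le> ?c * d" if "t \<le> l * d" "0 \<le> d" for t d
    by (rule order_trans[OF that(1) mult_right_mono[OF _ that(2)]]) (use pos in simp)
  show "wt x \<mu> * norm (dx f x \<mu> a - dx f x' \<mu>' a') \<le> Cf * (norm (x - x') + cost \<pi> + norm (a - a'))"
    unfolding c(3)[symmetric]
    by (rule chain_weighted[where F = "dx f", OF \<pi> c(1,2)])
      (use bnd x_dx[OF \<pi>(2)] m_dx[OF \<pi>] a_dx[OF \<pi>(3)] up up' in auto)
  show "wt x \<mu> * norm (da f x \<mu> a - da f x' \<mu>' a') \<le> Cf * (norm (x - x') + cost \<pi> + norm (a - a'))"
    unfolding c(3)[symmetric]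
    by (rule chain_weighted[where F = "da f", OF \<pi> c(1,2)])
      (use bnd x_da[OF \<pi>(2)] m_da[OF \<pi>] a_da[OF \<pi>(3)] up up' in auto)
  have 1: "wt x \<mu> * norm (dm f x \<mu> a u' - dm f x' \<mu>' a' u') \<le> Cf * (norm (x - x') + cost \<pi> + norm (a - a'))"
    unfolding c(3)[symmetric]
    by (rule chain_weighted[where F = "\<lambda>x \<mu> a. dm f x \<mu> a u'", OF \<pi> c(1,2)])
      (use bnd x_dm[OF \<pi>(2)] m_dm[OF \<pi>] a_dm[OF \<pi>(3)] up up' in auto)
  have "wt x \<mu> * norm (dm f x \<mu> a u - dm f x \<mu> a u') \<le> Cf * norm (u - u')"
    by (rule order_trans[OF u_dm[OF \<pi>(2)] mult_right_mono[OF c(4)]]) simp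
  moreover have "wt x \<mu> * norm (dm f x \<mu> a u - dm f x' \<mu>' a' u') \<le>
      wt x \<mu> * norm (dm f x \<mu> a u - dm f x \<mu> a u') + wt x \<mu> * norm (dm f x \<mu> a u' - dm f x' \<mu>' a' u')"
    unfolding distrib_left[symmetric] using wt_pos(1)[of x \<mu>]
      norm_triangle_ineq[of "dm f x \<mu> a u - dm f x \<mu> a u'" "dm f x \<mu> a u' - dm f x' \<mu>' a' u'"] by (intro mult_left_mono) auto
  ultimately show "wt x \<mu> * norm (dm f x \<mu> a u - dm f x' \<mu>' a' u') \<le> Cf * (norm (x - x') + cost \<pi> + norm (a - a') + norm (u - u'))"
    using 1 by (simp add: distrib_left)
qed

end

subsection \<open>The running cost\<close>

text \<open>The counterpart of \<open>chain_weighted\<close> for the running cost, whose second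
  derivatives are bounded but do not decay: z does not multiply them, so no weight has to be
  compensated.\<close>

lemma chain_plain:
  fixes F :: "'x::euclidean_space \<Rightarrow> 'x measure \<Rightarrow> 'a::real_normed_vector \<Rightarrow> 'b::real_normed_vector"
  assumes x: "norm (F x \<mu> a - F x' \<mu> a) \<le> c * norm (x - x')"
    and m: "norm (F x' \<mu> a - F x' \<mu>' a) \<le> c * k"
    and a: "norm (F x' \<mu>' a - F x' \<mu>' a') \<le> c * norm (a - a')"
  shows "norm (F x \<mu> a - F x' \<mu>' a') \<le> c * (norm (x - x') + k + norm (a - a'))"
proof -
  have "F x \<mu> a - F x' \<mu>' a' = (F x \<mu> a - F x' \<mu> a) + (F x' \<mu> a - F x' \<mu>' a) + (F x' \<mu>' a - F x' \<mu>' a')" by simp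
  then have "norm (F x \<mu> a - F x' \<mu>' a') \<le> c * norm (x - x') + c * k + c * norm (a - a')"
    using norm_triangle_mono[OF norm_triangle_mono[OF x m] a] by simp
  then show ?thesis by (simp add: distrib_left)
qed

locale coef_g =
  fixes g :: "real^'n \<Rightarrow> (real^'n) measure \<Rightarrow> real^'k \<Rightarrow> real" and K and \<Lambda> l :: real
  assumes pos: "0 < \<Lambda>" "0 < l"
    and td: "\<And>\<mu>. \<mu> \<in> P2 \<Longrightarrow> twice_diff (\<lambda>(x, \<alpha>). g x \<mu> \<alpha>)"
    and dmd: "\<And>x \<mu> \<alpha> u. \<mu> \<in> P2 \<Longrightarrow> (\<lambda>y. dm g y \<mu> \<alpha> u) differentiable at x \<and> (\<lambda>b. dm g x \<mu> b u) differentiable at \<alpha>"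
    and reg: "\<And>x \<alpha>. regular2 (\<lambda>\<nu>. g x \<nu> \<alpha>) (K x \<alpha>)"
    and b_K: "\<And>x \<mu> \<alpha> u v. \<mu> \<in> P2 \<Longrightarrow> norm (mixed_deriv (K x \<alpha> \<mu>) u v) \<le> \<Lambda>"
    and b_aa: "\<And>x \<mu> \<alpha>. \<mu> \<in> P2 \<Longrightarrow> norm (fderiv (da g x \<mu>) \<alpha>) \<le> \<Lambda>"
    and b_xm: "\<And>x \<mu> \<alpha> u. \<mu> \<in> P2 \<Longrightarrow> norm (fderiv (\<lambda>y. dm g y \<mu> \<alpha> u) x) \<le> \<Lambda>"
    and b_xx: "\<And>x \<mu> \<alpha>. \<mu> \<in> P2 \<Longrightarrow> norm (fderiv (\<lambda>y. dx g y \<mu> \<alpha>) x) \<le> \<Lambda>"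
    and b_uu: "\<And>x \<mu> \<alpha> u. \<mu> \<in> P2 \<Longrightarrow> norm (fderiv (dm g x \<mu> \<alpha>) u) \<le> \<Lambda>"
    and b_xa: "\<And>x \<mu> \<alpha>. \<mu> \<in> P2 \<Longrightarrow> norm (fderiv (\<lambda>y. da g y \<mu> \<alpha>) x) \<le> l"
    and b_am: "\<And>x \<mu> \<alpha> u. \<mu> \<in> P2 \<Longrightarrow> norm (fderiv (\<lambda>b. dm g x \<mu> b u) \<alpha>) \<le> l"
begin

lemmas dff = twice_diff_partial[OF td, folded dx_def da_def]

lemma dff_da: "\<mu> \<in> P2 \<Longrightarrow> da g x \<mu> differentiable at \<alpha>"
  and dff_g: "\<mu> \<in> P2 \<Longrightarrow> g x \<mu> differentiable at \<alpha>"
  using dff(5)[of \<mu> x \<alpha>] dff(2)[of \<mu> x \<alpha>] by auto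

definition lfa where "lfa x \<alpha> \<mu> = lf g x \<mu> \<alpha>"

lemma lfa: "is_lfd (\<lambda>\<nu>. g x \<nu> \<alpha>) (lfa x \<alpha>)" "\<mu> \<in> P2 \<Longrightarrow> lfa x \<alpha> \<mu> differentiable at u"
  "fderiv (lfa x \<alpha> \<mu>) u = dm g x \<mu> \<alpha> u" "\<mu> \<in> P2 \<Longrightarrow> dm g x \<mu> \<alpha> differentiable at u"
proof -
  have eq: "lfa x \<alpha> = lfd (\<lambda>\<nu>. g x \<nu> \<alpha>)" by (auto simp: lfa_def lf_def fun_eq_iff)
  show "is_lfd (\<lambda>\<nu>. g x \<nu> \<alpha>) (lfa x \<alpha>)" unfolding eq by (rule regular2D(1)[OF reg])
  show "\<mu> \<in> P2 \<Longrightarrow> lfa x \<alpha> \<mu> differentiable at u" unfolding eq by (rule regular2D(3)[OF reg])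
  show "fderiv (lfa x \<alpha> \<mu>) u = dm g x \<mu> \<alpha> u" by (simp add: lfa_def dm_def)
  have "dm g x \<mu> \<alpha> = fderiv (lfa x \<alpha> \<mu>)" by (simp add: fun_eq_iff lfa_def dm_def)
  then show "\<mu> \<in> P2 \<Longrightarrow> dm g x \<mu> \<alpha> differentiable at u" unfolding eq using regular2D(4)[OF reg] by simp
qed

text \<open>6 \<Lambda> from the dependence of \<open>dm\<close> on the measure, l from the
  derivatives that involve the control.\<close>

definition Cg where "Cg = 6 * \<Lambda> + l"

lemma Cg: "0 < Cg" "\<Lambda> \<le> Cg" "l \<le> Cg" using pos by (simp_all add: Cg_def add_pos_pos)

lemma up: "t \<le> c * d \<Longrightarrow> 0 \<le> d \<Longrightarrow> c \<le> Cg \<Longrightarrow> t \<le> Cg * d"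
  by (rule order_trans[OF _ mult_right_mono])

lemma x_da:
  assumes \<mu>: "\<mu> \<in> P2" shows "norm (da g x \<mu> a - da g x' \<mu> a) \<le> l * norm (x - x')"
  by (rule lipschitz_of_fderiv[of UNIV "\<lambda>y. da g y \<mu> a"]) (use dff(6)[OF \<mu>] b_xa[OF \<mu>] in auto)

lemma a_dx:
  assumes \<mu>: "\<mu> \<in> P2" shows "norm (dx g x \<mu> a - dx g x \<mu> a') \<le> l * norm (a - a')"
  unfolding dx_def
proof (rule fderiv_swap_lipschitz[where S = UNIV and F = "\<lambda>b y. g y \<mu> b"])
  show "(\<lambda>z. g b \<mu> z) differentiable at z" for b z using dff(2)[OF \<mu>] .
  show "norm (fderiv (\<lambda>z. g b \<mu> z) z - fderiv (\<lambda>z. g b' \<mu> z) z) \<le> l * norm (b - b')" for z b b'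
    using x_da[OF \<mu>] by (simp add: da_def)
qed (use dff(1)[OF \<mu>] pos in auto)

lemma m_dx:
  assumes \<pi>: "\<pi> \<in> couplings \<mu> \<mu>'" "\<mu> \<in> P2" "\<mu>' \<in> P2"
  shows "norm (dx g x \<mu> a - dx g x \<mu>' a) \<le> \<Lambda> * cost \<pi>"
  unfolding dx_def
proof (rule fderiv_param_measure_lipschitz[where h = "\<lambda>y \<nu>. g y \<nu> a" and D = "\<lambda>y. lfa y a" and r = 1, OF lfa(1) \<pi> _ _ lfa(2)])
  fix y u and \<theta> :: real assume t: "0 \<le> \<theta>" "\<theta> \<le> 1"
  note m = mix_P2(1)[OF \<pi>(2,3) t]
  show "norm (fderiv (lfa y a (mix \<theta> \<mu> \<mu>')) u - fderiv (lfa x a (mix \<theta> \<mu> \<mu>')) u) \<le> \<Lambda> * norm (y - x)"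
    unfolding lfa(3) by (rule lipschitz_of_fderiv[of UNIV "\<lambda>y. dm g y (mix \<theta> \<mu> \<mu>') a u"]) (use dmd[OF m] b_xm[OF m] in auto)
qed (use dff(1) \<pi> pos in auto)

lemma m_da:
  assumes \<pi>: "\<pi> \<in> couplings \<mu> \<mu>'" "\<mu> \<in> P2" "\<mu>' \<in> P2"
  shows "norm (da g x \<mu> a - da g x \<mu>' a) \<le> l * cost \<pi>"
  unfolding da_def
proof (rule fderiv_param_measure_lipschitz[where h = "\<lambda>b \<nu>. g x \<nu> b" and D = "\<lambda>b. lfa x b" and r = 1, OF lfa(1) \<pi> _ _ lfa(2)])
  fix b u and \<theta> :: real assume t: "0 \<le> \<theta>" "\<theta> \<le> 1"
  note m = mix_P2(1)[OF \<pi>(2,3) t]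
  show "norm (fderiv (lfa x b (mix \<theta> \<mu> \<mu>')) u - fderiv (lfa x a (mix \<theta> \<mu> \<mu>')) u) \<le> l * norm (b - a)"
    unfolding lfa(3) by (rule lipschitz_of_fderiv[of UNIV "\<lambda>b. dm g x (mix \<theta> \<mu> \<mu>') b u"]) (use dmd[OF m] b_am[OF m] in auto)
qed (use dff_g \<pi> pos in auto)

lemma lip_dx:
  assumes \<pi>: "\<pi> \<in> couplings \<mu> \<mu>'" "\<mu> \<in> P2" "\<mu>' \<in> P2"
  shows "norm (dx g x \<mu> a - dx g x' \<mu>' a') \<le> Cg * (norm (x - x') + cost \<pi> + norm (a - a'))"
    and "norm (da g x \<mu> a - da g x' \<mu>' a) \<le> l * (norm (x - x') + cost \<pi>)"
    and "norm (dm g x \<mu> a u - dm g x' \<mu>' a' u') \<le> Cg * (norm (x - x') + cost \<pi> + norm (a - a') + norm (u - u'))"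
proof -
  have xdx: "norm (dx g x \<mu> a - dx g x' \<mu> a) \<le> \<Lambda> * norm (x - x')"
    by (rule lipschitz_of_fderiv[of UNIV "\<lambda>y. dx g y \<mu> a"]) (use dff(3)[OF \<pi>(2)] b_xx[OF \<pi>(2)] in auto)
  show "norm (dx g x \<mu> a - dx g x' \<mu>' a') \<le> Cg * (norm (x - x') + cost \<pi> + norm (a - a'))"
    by (rule chain_plain[where F = "dx g"])
      (rule up[OF xdx _ Cg(2)] up[OF m_dx[OF \<pi>] _ Cg(2)] up[OF a_dx[OF \<pi>(3)] _ Cg(3)]; simp)+
  show "norm (da g x \<mu> a - da g x' \<mu>' a) \<le> l * (norm (x - x') + cost \<pi>)"
    using chain_plain[where F = "da g" and a' = a, OF x_da[OF \<pi>(2), of x a x'] m_da[OF \<pi>, of x' a]] by simp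
  have xdm: "norm (dm g x \<mu> a u - dm g x' \<mu> a u) \<le> \<Lambda> * norm (x - x')" for u
    by (rule lipschitz_of_fderiv[of UNIV "\<lambda>y. dm g y \<mu> a u"]) (use dmd[OF \<pi>(2)] b_xm[OF \<pi>(2)] in auto)
  have adm: "norm (dm g x' \<mu>' a u - dm g x' \<mu>' a' u) \<le> l * norm (a - a')" for u
    by (rule lipschitz_of_fderiv[of UNIV "\<lambda>b. dm g x' \<mu>' b u"]) (use dmd[OF \<pi>(3)] b_am[OF \<pi>(3)] in auto)
  have udm: "norm (dm g x \<mu> a u - dm g x \<mu> a u') \<le> \<Lambda> * norm (u - u')"
    by (rule lipschitz_of_fderiv[of UNIV "dm g x \<mu> a"]) (use lfa(4)[OF \<pi>(2)] b_uu[OF \<pi>(2)] in auto)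
  have mdm: "norm (dm g x' \<mu> a u - dm g x' \<mu>' a u) \<le> Cg * cost \<pi>" for u
  proof -
    have "norm (fderiv (lfd (\<lambda>\<nu>. g x' \<nu> a) \<mu>) u - fderiv (lfd (\<lambda>\<nu>. g x' \<nu> a) \<mu>') u) \<le> 6 * \<Lambda> * cost \<pi>"
      by (rule fderiv_lfd_measure_lipschitz[where \<rho> = "mnorm 1 \<mu> - cost \<pi> - 1", OF reg \<pi>]) (use pos b_K in auto)
    then have "norm (dm g x' \<mu> a u - dm g x' \<mu>' a u) \<le> 6 * \<Lambda> * cost \<pi>" by (simp add: dm_lfd)
    then show ?thesis by (rule up) (use pos in \<open>auto simp: Cg_def\<close>)
  qed
  have 1: "norm (dm g x \<mu> a u' - dm g x' \<mu>' a' u') \<le> Cg * (norm (x - x') + cost \<pi> + norm (a - a'))"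
    by (rule chain_plain[where F = "\<lambda>x \<mu> a. dm g x \<mu> a u'"])
      (rule up[OF xdm _ Cg(2)] mdm up[OF adm _ Cg(3)]; simp)+
  have 2: "norm (dm g x \<mu> a u - dm g x \<mu> a u') \<le> Cg * norm (u - u')" by (rule up[OF udm _ Cg(2)]) simp
  have "norm (dm g x \<mu> a u - dm g x' \<mu>' a' u') \<le> norm (dm g x \<mu> a u - dm g x \<mu> a u') + norm (dm g x \<mu> a u' - dm g x' \<mu>' a' u')"
    using norm_triangle_ineq[of "dm g x \<mu> a u - dm g x \<mu> a u'" "dm g x \<mu> a u' - dm g x' \<mu>' a' u'"] by simp
  then show "norm (dm g x \<mu> a u - dm g x' \<mu>' a' u') \<le> Cg * (norm (x - x') + cost \<pi> + norm (a - a') + norm (u - u'))"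
    using 1 2 by (simp add: distrib_left)
qed

end

subsection \<open>Contractions and gradients\<close>

text \<open>\<open>contr A\<close> is the adjoint of A, and \<open>grad\<close> below the Riesz
  representative of a functional; norms and differences are handled through these identities rather
  than in coordinates.\<close>

lemma contr_inner: "contr A z \<bullet> v = z \<bullet> blinfun_apply A v"
proof -
  have "row i (matrix (blinfun_apply A)) \<bullet> v = blinfun_apply A v $ i" for i
  proof -
    have "matrix (blinfun_apply A) *v v = blinfun_apply A v"
      by (rule matrix_works) (simp add: linear_matrix_vector_mul_eq bounded_linear.linear[OF blinfun.bounded_linear_right])
    then have "matrix (blinfun_apply A) $ i \<bullet> v = blinfun_apply A v $ i" by (metis matrix_vector_mul_component)
    then show ?thesis by (simp add: row_def)
  qed
  then have "contr A z \<bullet> v = (\<Sum>i\<in>UNIV. z $ i * blinfun_apply A v $ i)" by (simp add: contr_def inner_sum_left)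
  then show ?thesis by (simp add: inner_vec_def)
qed

lemma grad_inner: "grad A \<bullet> v = blinfun_apply A v"
proof -
  have l: "linear (blinfun_apply A)" by (rule bounded_linear.linear[OF blinfun.bounded_linear_right])
  have "blinfun_apply A v = blinfun_apply A (\<Sum>i\<in>UNIV. (v $ i) *\<^sub>R axis i 1)"
    using basis_expansion[of v] by (simp add: scalar_mult_eq_scaleR)
  also have "\<dots> = (\<Sum>i\<in>UNIV. (v $ i) *\<^sub>R blinfun_apply A (axis i 1))" by (simp add: linear_sum[OF l] linear_scale[OF l])
  finally show ?thesis by (simp add: grad_def inner_vec_def mult.commute)
qed

lemma norm_le_of_inner:
  fixes x :: "'a::real_inner"
  assumes "x \<bullet> x \<le> c * norm x" "0 \<le> c"
  shows "norm x \<le> c"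
proof (cases "x = 0")
  case False
  have "norm x * norm x \<le> c * norm x" using assms(1) by (simp add: power2_norm_eq_inner[symmetric] power2_eq_square)
  then show ?thesis using False by simp
qed (use assms in simp)

lemma norm_contr: "norm (contr A z) \<le> norm A * norm z"
proof (rule norm_le_of_inner)
  let ?c = "contr A z"
  have "?c \<bullet> ?c \<le> norm z * norm (blinfun_apply A ?c)" unfolding contr_inner by (rule norm_cauchy_schwarz)
  also have "\<dots> \<le> norm z * (norm A * norm ?c)" by (intro mult_left_mono norm_blinfun) auto
  finally show "?c \<bullet> ?c \<le> norm A * norm z * norm ?c" by (simp add: ac_simps)
qed simp

lemma norm_grad: "norm (grad A) \<le> norm A"
proof (rule norm_le_of_inner)
  show "grad A \<bullet> grad A \<le> norm A * norm (grad A)" unfolding grad_inner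
    using norm_blinfun[of A "grad A"] abs_ge_self[of "blinfun_apply A (grad A)"] by simp
qed simp

lemma contr_diff: "contr A z - contr A' z' = contr (A - A') z + contr A' (z - z')"
proof -
  have "(contr A z - contr A' z') \<bullet> v = (contr (A - A') z + contr A' (z - z')) \<bullet> v" for v
    by (simp add: inner_diff_left inner_add_left contr_inner blinfun.diff_left inner_diff_right)
  then show ?thesis by (metis vector_eq_rdot)
qed

lemma grad_diff: "grad A - grad A' = grad (A - A')"
proof -
  have "(grad A - grad A') \<bullet> v = grad (A - A') \<bullet> v" for v
    by (simp add: inner_diff_left grad_inner blinfun.diff_left)
  then show ?thesis by (metis vector_eq_rdot)
qed

lemma norm_contr_grad_diff:
  fixes A A' :: "(real^'c) \<Rightarrow>\<^sub>L (real^'n)"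
  shows "norm ((contr A z + grad G) - (contr A' z' + grad G')) \<le> norm z * norm (A - A') + norm A' * norm (z - z') + norm (G - G')"
proof -
  have "(contr A z + grad G) - (contr A' z' + grad G') = contr (A - A') z + contr A' (z - z') + grad (G - G')"
    using contr_diff[of A z A' z'] grad_diff[of G G'] by (simp add: algebra_simps)
  then show ?thesis
    using norm_triangle_mono[OF norm_triangle_mono[OF norm_contr[of "A - A'" z] norm_contr[of A' "z - z'"]] norm_grad[of "G - G'"]]
    by (simp add: mult.commute)
qed

text \<open>With \<open>dirac0\<close> as second law the right side is the first moment of \<mu>;
  this controls the law term when coefficients are compared with their values at the origin.\<close>

lemma cost_le_mnorm:
  assumes \<pi>: "\<pi> \<in> couplings \<mu> \<nu>" "\<mu> \<in> P2" "\<nu> \<in> P2"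
  shows "cost \<pi> \<le> mnorm 1 \<mu> + mnorm 1 \<nu>"
proof -
  note c = couplingD[OF \<pi>]
  have i: "integrable \<pi> (\<lambda>w. norm (fst w))" "integrable \<pi> (\<lambda>w. norm (snd w))"
    using sqi_integrable[OF c(1,8)] sqi_integrable[OF c(1,9)] by auto
  have "mnorm 1 \<mu> = (\<integral>w. norm (fst w) \<partial>\<pi>)" "mnorm 1 \<nu> = (\<integral>w. norm (snd w) \<partial>\<pi>)"
    using mnorm_distr[OF c(1,8)] mnorm_distr[OF c(1,9)] c(4,5) by auto
  then have "mnorm 1 \<mu> + mnorm 1 \<nu> = (\<integral>w. norm (fst w) + norm (snd w) \<partial>\<pi>)" using i by simp
  moreover have "cost \<pi> \<le> (\<integral>w. norm (fst w) + norm (snd w) \<partial>\<pi>)" unfolding cost_def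
  proof (rule integral_mono')
    show "integrable \<pi> (\<lambda>w. norm (fst w) + norm (snd w))" using i by simp
    show "norm (fst w - snd w) \<le> norm (fst w) + norm (snd w)" for w by (rule norm_triangle_ineq4)
  qed simp
  ultimately show ?thesis by simp
qed

subsection \<open>The optimal control\<close>

text \<open>\<kappa> is the convexity of g in the control, b the constant of the cone.
  \<open>small\<close> carries the weight so as to meet the growth of z on the cone.\<close>

locale control = F: coef_f f KF M \<Lambda>f ef + G: coef_g g KG \<Lambda>g eg
  for f :: "real^'n \<Rightarrow> (real^'n) measure \<Rightarrow> real^'k \<Rightarrow> real^'n" and KF M \<Lambda>f ef
    and g :: "real^'n \<Rightarrow> (real^'n) measure \<Rightarrow> real^'k \<Rightarrow> real" and KG \<Lambda>g eg +
  fixes \<kappa> b :: real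
  assumes lam: "0 < \<kappa>" and b: "0 < b"
    and ell: "\<And>x \<mu> \<alpha> \<xi>. \<mu> \<in> P2 \<Longrightarrow> \<kappa> * (norm \<xi>)\<^sup>2 \<le> blinfun_apply (blinfun_apply (fderiv (da g x \<mu>) \<alpha>) \<xi>) \<xi>"
    and small: "\<And>x \<mu> \<alpha>. \<mu> \<in> P2 \<Longrightarrow> norm (fderiv (da f x \<mu>) \<alpha>) * wt x \<mu> \<le> \<kappa> / (40 * b)"
begin

definition cone where "cone x \<mu> z \<longleftrightarrow> norm z \<le> 2 * b * (1 + norm x + mnorm 1 \<mu>)"
definition q where "q x \<mu> z a = f x \<mu> a \<bullet> z + g x \<mu> a"
definition H where "H x \<mu> z a = contr (da f x \<mu> a) z + grad (da g x \<mu> a)"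
definition c where "c = 19 / 20 * \<kappa>"

lemma c: "0 < c" using lam by (simp add: c_def)

lemma cone_wt: "cone x \<mu> z \<longleftrightarrow> norm z \<le> 2 * b * wt x \<mu>"
  by (simp add: cone_def wt_def)

lemma q_deriv:
  assumes "\<mu> \<in> P2"
  shows "(q x \<mu> z has_derivative (\<lambda>v. H x \<mu> z a \<bullet> v)) (at a)"
proof -
  have "((\<lambda>a. f x \<mu> a \<bullet> z) has_derivative (\<lambda>v. blinfun_apply (da f x \<mu> a) v \<bullet> z)) (at a)"
    unfolding da_def by (rule has_derivative_inner_left[OF fderiv_works[OF F.dff_f[OF assms]]])
  from has_derivative_add[OF this fderiv_works[OF G.dff_g[OF assms, of x a]]]
  have "(q x \<mu> z has_derivative (\<lambda>v. blinfun_apply (da f x \<mu> a) v \<bullet> z + blinfun_apply (da g x \<mu> a) v)) (at a)"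
    unfolding q_def[abs_def] by (simp only: da_def)
  then show ?thesis
    by (rule has_derivative_eq_rhs) (simp add: fun_eq_iff H_def inner_add_left contr_inner grad_inner inner_commute[of z])
qed

text \<open>On the cone the curvature of \<open>f\<close> costs at most a twentieth of that of \<open>g\<close>.\<close>

lemma H_mono:
  assumes \<mu>: "\<mu> \<in> P2" and z: "cone x \<mu> z"
  shows "c * (norm (a - a'))\<^sup>2 \<le> (H x \<mu> z a - H x \<mu> z a') \<bullet> (a - a')"
proof -
  define v where "v = a - a'"
  note W = wt_pos(1)[of x \<mu>]
  define k where "k = \<kappa> / (40 * b) / wt x \<mu>"
  have k: "norm (fderiv (da f x \<mu>) \<alpha>) \<le> k" for \<alpha>
    unfolding k_def using small[OF \<mu>, of x \<alpha>] by (simp only: pos_le_divide_eq[OF W])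
  have "norm (da f x \<mu> a - da f x \<mu> a') \<le> k * norm v" unfolding v_def
    by (rule lipschitz_of_fderiv[of UNIV "da f x \<mu>"]) (use F.dff_da[OF \<mu>] k in auto)
  then have "norm (blinfun_apply (da f x \<mu> a - da f x \<mu> a') v) \<le> k * norm v * norm v"
    by (intro order_trans[OF norm_blinfun] mult_right_mono) auto
  then have "norm z * norm (blinfun_apply (da f x \<mu> a - da f x \<mu> a') v) \<le> (2 * b * wt x \<mu>) * (k * norm v * norm v)"
    using z b W by (intro mult_mono) (auto simp: cone_wt)
  \<comment> \<open>The weight in the cone bound on z cancels the one in \<open>small\<close>, and 2
    b against 40 b leaves 1 / 20.\<close>
  also have "\<dots> = \<kappa> / 20 * (norm v)\<^sup>2" using b W by (simp add: k_def power2_eq_square field_simps)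
  finally have "\<bar>z \<bullet> blinfun_apply (da f x \<mu> a - da f x \<mu> a') v\<bar> \<le> \<kappa> / 20 * (norm v)\<^sup>2"
    by (rule order_trans[OF Cauchy_Schwarz_ineq2])
  moreover have "(contr (da f x \<mu> a) z - contr (da f x \<mu> a') z) \<bullet> v = z \<bullet> blinfun_apply (da f x \<mu> a - da f x \<mu> a') v"
    by (simp add: inner_diff_left contr_inner blinfun.diff_left inner_diff_right)
  ultimately have 1: "- (\<kappa> / 20 * (norm v)\<^sup>2) \<le> (contr (da f x \<mu> a) z - contr (da f x \<mu> a') z) \<bullet> v"
    by linarith
  have "\<exists>s>0. s < 1 \<and> blinfun_apply (da g x \<mu> (a' + 1 *\<^sub>R v)) v - blinfun_apply (da g x \<mu> (a' + 0 *\<^sub>R v)) v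
      = (1 - 0) * blinfun_apply (blinfun_apply (fderiv (da g x \<mu>) (a' + s *\<^sub>R v)) v) v"
  proof (rule MVT2[OF zero_less_one])
    fix s :: real
    have "((\<lambda>s. a' + s *\<^sub>R v) has_derivative (\<lambda>h. h *\<^sub>R v)) (at s)" by (auto intro!: derivative_eq_intros)
    from has_derivative_compose[OF this fderiv_works[OF G.dff_da[OF \<mu>]]]
    have "((\<lambda>s. da g x \<mu> (a' + s *\<^sub>R v)) has_derivative (\<lambda>h. blinfun_apply (fderiv (da g x \<mu>) (a' + s *\<^sub>R v)) (h *\<^sub>R v))) (at s)" .
    from bounded_linear.has_derivative[OF blinfun.bounded_linear_left this, of v]
    show "((\<lambda>s. blinfun_apply (da g x \<mu> (a' + s *\<^sub>R v)) v) has_real_derivative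
        blinfun_apply (blinfun_apply (fderiv (da g x \<mu>) (a' + s *\<^sub>R v)) v) v) (at s)"
      unfolding has_field_derivative_def by (rule has_derivative_eq_rhs) (simp add: fun_eq_iff blinfun.scaleR_right blinfun.scaleR_left)
  qed
  then obtain s where "blinfun_apply (da g x \<mu> a) v - blinfun_apply (da g x \<mu> a') v
      = blinfun_apply (blinfun_apply (fderiv (da g x \<mu>) (a' + s *\<^sub>R v)) v) v" by (auto simp: v_def)
  then have 2: "\<kappa> * (norm v)\<^sup>2 \<le> (grad (da g x \<mu> a) - grad (da g x \<mu> a')) \<bullet> v"
    using ell[OF \<mu>] by (simp add: inner_diff_left grad_inner)
  have "(H x \<mu> z a - H x \<mu> z a') \<bullet> v = (contr (da f x \<mu> a) z - contr (da f x \<mu> a') z) \<bullet> v + (grad (da g x \<mu> a) - grad (da g x \<mu> a')) \<bullet> v"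
    by (simp add: H_def inner_diff_left inner_add_left)
  then show ?thesis using 1 2 unfolding v_def[symmetric] c_def by (simp add: algebra_simps)
qed

text \<open>Strong convexity from the monotone gradient: the mean value theorem is applied to q
  minus a parabola along the segment, where \<open>H_mono\<close> controls the derivative by its
  value at a0.\<close>

lemma q_convex:
  assumes \<mu>: "\<mu> \<in> P2" and z: "cone x \<mu> z"
  shows "q x \<mu> z a0 + H x \<mu> z a0 \<bullet> (a - a0) + c / 2 * (norm (a - a0))\<^sup>2 \<le> q x \<mu> z a"
proof -
  define v where "v = a - a0"
  let ?h = "\<lambda>s. q x \<mu> z (a0 + s *\<^sub>R v) - c / 2 * (norm v)\<^sup>2 * s\<^sup>2"
  let ?h' = "\<lambda>s. H x \<mu> z (a0 + s *\<^sub>R v) \<bullet> v - c * (norm v)\<^sup>2 * s"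
  have "\<exists>s>0. s < 1 \<and> ?h 1 - ?h 0 = (1 - 0) * ?h' s"
  proof (rule MVT2[OF zero_less_one])
    fix s :: real
    have "((\<lambda>s. a0 + s *\<^sub>R v) has_derivative (\<lambda>h. h *\<^sub>R v)) (at s)" by (auto intro!: derivative_eq_intros)
    from has_derivative_compose[OF this q_deriv[OF \<mu>]]
    have "((\<lambda>s. q x \<mu> z (a0 + s *\<^sub>R v)) has_real_derivative H x \<mu> z (a0 + s *\<^sub>R v) \<bullet> v) (at s)"
      unfolding has_field_derivative_def by (rule has_derivative_eq_rhs) (simp add: fun_eq_iff)
    moreover have "((\<lambda>s. c / 2 * (norm v)\<^sup>2 * s\<^sup>2) has_real_derivative c * (norm v)\<^sup>2 * s) (at s)"
      by (auto intro!: derivative_eq_intros)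
    ultimately show "(?h has_real_derivative ?h' s) (at s)" by (rule DERIV_diff)
  qed
  then obtain s where s: "0 < s" "?h 1 - ?h 0 = ?h' s" by auto
  have "c * (norm (s *\<^sub>R v))\<^sup>2 \<le> (H x \<mu> z (a0 + s *\<^sub>R v) - H x \<mu> z a0) \<bullet> (s *\<^sub>R v)"
    using H_mono[OF \<mu> z, of "a0 + s *\<^sub>R v" a0] by simp
  then have "s * (c * (norm v)\<^sup>2 * s) \<le> s * ((H x \<mu> z (a0 + s *\<^sub>R v) - H x \<mu> z a0) \<bullet> v)"
    by (simp add: power2_eq_square algebra_simps)
  then have "c * (norm v)\<^sup>2 * s \<le> H x \<mu> z (a0 + s *\<^sub>R v) \<bullet> v - H x \<mu> z a0 \<bullet> v" using s(1) by (simp add: inner_diff_left)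
  then show ?thesis using s(2) by (simp add: v_def)
qed

lemma minimizer:
  assumes \<mu>: "\<mu> \<in> P2" and z: "cone x \<mu> z"
  shows "\<exists>a. H x \<mu> z a = 0 \<and> (\<forall>a'. q x \<mu> z a \<le> q x \<mu> z a')"
proof -
  let ?q = "q x \<mu> z"
  \<comment> \<open>Outside this ball the quadratic term outweighs the gradient at 0, so the values
    exceed that at 0.\<close>
  define R where "R = 2 * norm (H x \<mu> z 0) / c"
  have R: "0 \<le> R" using c by (simp add: R_def)
  have "continuous_on (cball 0 R) ?q"
    using has_derivative_continuous[OF q_deriv[OF \<mu>]] by (intro continuous_at_imp_continuous_on) blast
  then obtain a where a: "a \<in> cball 0 R" "\<And>a'. a' \<in> cball 0 R \<Longrightarrow> ?q a \<le> ?q a'"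
    using continuous_attains_inf[of "cball 0 R" ?q] R by auto
  have min: "?q a \<le> ?q a'" for a'
  proof (cases "a' \<in> cball 0 R")
    case False
    then have n: "2 * norm (H x \<mu> z 0) \<le> c * norm a'" using c by (simp add: R_def not_le pos_divide_less_eq mult.commute)
    have "- (norm (H x \<mu> z 0) * norm a') \<le> H x \<mu> z 0 \<bullet> a'" using Cauchy_Schwarz_ineq2[of "H x \<mu> z 0" a'] by linarith
    moreover have "2 * norm (H x \<mu> z 0) * norm a' \<le> c * norm a' * norm a'" using n by (rule mult_right_mono) simp
    ultimately have "?q 0 \<le> ?q a'" using q_convex[OF \<mu> z, of 0 a'] by (simp add: power2_eq_square)
    moreover have "?q a \<le> ?q 0" using a(2)[of 0] R by simp
    ultimately show ?thesis by simp
  qed (use a in auto)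
  have "(\<lambda>v. H x \<mu> z a \<bullet> v) = (\<lambda>v. 0)"
    by (rule differential_zero_maxmin[OF UNIV_I open_UNIV q_deriv[OF \<mu>]]) (use min in blast)
  then have "H x \<mu> z a \<bullet> H x \<mu> z a = 0" by (rule fun_cong)
  then show ?thesis using min by auto
qed

text \<open>The definite description in \<open>opt_ctrl\<close> is legitimate because quadratic
  growth around the minimizer makes it unique.\<close>

lemma opt_zero:
  assumes \<mu>: "\<mu> \<in> P2" and z: "cone x \<mu> z"
  shows "H x \<mu> z (opt_ctrl f g x \<mu> z) = 0"
proof -
  obtain a where a: "H x \<mu> z a = 0" "\<And>a'. q x \<mu> z a \<le> q x \<mu> z a'" using minimizer[OF \<mu> z] by blast
  have "opt_ctrl f g x \<mu> z = a" unfolding opt_ctrl_def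
  proof (rule the_equality)
    show "is_arg_min (\<lambda>b. f x \<mu> b \<bullet> z + g x \<mu> b) (\<lambda>_. True) a"
      using a(2) by (auto simp: is_arg_min_def q_def not_less)
    fix a' assume "is_arg_min (\<lambda>b. f x \<mu> b \<bullet> z + g x \<mu> b) (\<lambda>_. True) a'"
    then have "q x \<mu> z a' \<le> q x \<mu> z a" by (auto simp: is_arg_min_def q_def not_less)
    then have "c / 2 * (norm (a' - a))\<^sup>2 \<le> 0" using q_convex[OF \<mu> z, of a a'] a(1) by simp
    then have "(norm (a' - a))\<^sup>2 \<le> 0" using c by (simp add: mult_le_0_iff)
    then show "a' = a" by simp
  qed
  then show ?thesis using a(1) by simp
qed

definition La0 where "La0 = \<Lambda>f + 2 * b * F.Cf + eg"

lemma La0: "0 < La0" using F.pos G.pos F.Cf b by (simp add: La0_def add_pos_pos)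

text \<open>The gradient H vanishes at each optimal control with its own data. Monotonicity between
  a and a' therefore leaves only the change of H at fixed a' under the change of data, where the
  growth of z is compensated by the weight in the bound for \<open>da\<close>.\<close>

lemma opt_lip:
  assumes \<pi>: "\<pi> \<in> couplings \<mu> \<mu>'" "\<mu> \<in> P2" "\<mu>' \<in> P2" and z: "cone x \<mu> z" "cone x' \<mu>' z'"
  shows "c * norm (opt_ctrl f g x \<mu> z - opt_ctrl f g x' \<mu>' z') \<le> La0 * (norm (x - x') + cost \<pi> + norm (z - z'))"
proof -
  define a where "a = opt_ctrl f g x \<mu> z"
  define a' where "a' = opt_ctrl f g x' \<mu>' z'"
  define D where "D = norm (x - x') + cost \<pi>"
  define E where "E = norm (z - z')"
  have D: "0 \<le> D" "0 \<le> E" by (simp_all add: D_def E_def)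
  have h: "H x \<mu> z a = 0" "H x' \<mu>' z' a' = 0" unfolding a_def a'_def by (rule opt_zero[OF \<pi>(2) z(1)], rule opt_zero[OF \<pi>(3) z(2)])
  have fa: "norm z * norm (da f x \<mu> a' - da f x' \<mu>' a') \<le> 2 * b * (F.Cf * D)"
  proof -
    have "norm z * norm (da f x \<mu> a' - da f x' \<mu>' a') \<le> (2 * b * wt x \<mu>) * norm (da f x \<mu> a' - da f x' \<mu>' a')"
      using z(1) by (intro mult_right_mono) (auto simp: cone_wt)
    also have "\<dots> = 2 * b * (wt x \<mu> * norm (da f x \<mu> a' - da f x' \<mu>' a'))" by simp
    also have "\<dots> \<le> 2 * b * (F.Cf * D)"
      using F.lip_dx(2)[OF \<pi>, of x a' x' a'] b by (intro mult_left_mono) (auto simp: D_def)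
    finally show ?thesis .
  qed
  have "norm (H x \<mu> z a' - H x' \<mu>' z' a') \<le> norm z * norm (da f x \<mu> a' - da f x' \<mu>' a') + norm (da f x' \<mu>' a') * E + norm (da g x \<mu> a' - da g x' \<mu>' a')"
    unfolding H_def E_def by (rule norm_contr_grad_diff)
  also have "\<dots> \<le> 2 * b * (F.Cf * D) + \<Lambda>f * E + eg * D"
    using F.bnd[OF \<pi>(3), of x' a'] G.lip_dx(2)[OF \<pi>, of x a' x'] D
    by (intro add_mono fa mult_right_mono) (auto simp: D_def)
  also have "\<dots> \<le> La0 * (D + E)"
  proof -
    have "0 \<le> \<Lambda>f * D" "0 \<le> b * F.Cf * E" "0 \<le> eg * E" using D F.pos G.pos F.Cf b by auto
    then show ?thesis by (simp add: La0_def algebra_simps)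
  qed
  finally have n: "norm (H x \<mu> z a') \<le> La0 * (D + E)" using h by simp
  have "c * (norm (a - a'))\<^sup>2 \<le> norm (H x \<mu> z a') * norm (a - a')"
    using H_mono[OF \<pi>(2) z(1), of a a'] h(1) norm_cauchy_schwarz[of "- H x \<mu> z a'" "a - a'"] by simp
  also have "\<dots> \<le> La0 * (D + E) * norm (a - a')" by (rule mult_right_mono[OF n]) simp
  finally have m: "(c * norm (a - a')) * norm (a - a') \<le> (La0 * (D + E)) * norm (a - a')" by (simp add: power2_eq_square ac_simps)
  have "c * norm (a - a') \<le> La0 * (D + E)"
  proof (cases "a = a'")
    case True
    then show ?thesis using La0 D by simp
  next
    case False
    then show ?thesis using m by (simp add: mult_le_cancel_right)
  qed
  then show ?thesis by (simp add: a_def a'_def D_def E_def)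
qed

end

text \<open>1 / c is 20 / (19 \<kappa>), but the horizon may not depend on the convexity constant
  \<kappa>. Since La is at least 20 \<Lambda>f / (19 \<kappa>), the quotient La / \<Lambda>f
  dominates 1 / c.\<close>

definition lip_ctrl :: "real \<Rightarrow> real \<Rightarrow> real \<Rightarrow> real \<Rightarrow> real \<Rightarrow> real" where
  "lip_ctrl b \<Lambda>f ef eg La = La / \<Lambda>f * (\<Lambda>f + 2 * b * (24 * ef + 20 * \<Lambda>f) + eg)"

text \<open>The first line bounds the Lipschitz constants, the second the growth constants; their
  sum serves as the single L of the abstract system.\<close>

definition lip_coef :: "real \<Rightarrow> real \<Rightarrow> real \<Rightarrow> real \<Rightarrow> real \<Rightarrow> real \<Rightarrow> real \<Rightarrow> real \<Rightarrow> real" where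
  "lip_coef b Lf \<Lambda>f ef Lg \<Lambda>g eg La =
    (1 + lip_ctrl b \<Lambda>f ef eg La) * (2 * b * (24 * ef + 20 * \<Lambda>f) + \<Lambda>f + (6 * \<Lambda>g + eg)) +
    (Lf + Lg + 2 * b * \<Lambda>f + (\<Lambda>f + (6 * \<Lambda>g + eg)) * (1 + La + lip_ctrl b \<Lambda>f ef eg La * (1 + 2 * b)))"

locale control_bounds = control f KF M \<Lambda>f ef g KG \<Lambda>g eg \<kappa> b
  for f :: "real^'n \<Rightarrow> (real^'n) measure \<Rightarrow> real^'k \<Rightarrow> real^'n" and KF M \<Lambda>f ef
    and g :: "real^'n \<Rightarrow> (real^'n) measure \<Rightarrow> real^'k \<Rightarrow> real" and KG \<Lambda>g eg \<kappa> b +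
  fixes Lf Lg La :: real
  assumes base: "norm (f 0 dirac0 0) \<le> Lf" "norm (dx g 0 dirac0 0) \<le> Lg" "norm (dm g 0 dirac0 0 0) \<le> Lg"
      "norm (opt_ctrl f g 0 dirac0 0) \<le> La"
    and La_scale: "20 * \<Lambda>f / (19 * \<kappa>) \<le> La"
begin

abbreviation opt where "opt \<equiv> opt_ctrl f g"
definition Lc where "Lc = lip_ctrl b \<Lambda>f ef eg La"
definition Ga where "Ga = La + Lc * (1 + 2 * b)"
definition L where "L = lip_coef b Lf \<Lambda>f ef Lg \<Lambda>g eg La"
definition A where "A x \<mu> z = contr (dx f x \<mu> (opt x \<mu> z)) z + grad (dx g x \<mu> (opt x \<mu> z))"
definition \<Gamma> where "\<Gamma> u \<mu> x z = contr (dm f x \<mu> (opt x \<mu> z) u) z + grad (dm g x \<mu> (opt x \<mu> z) u)"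

lemma pos: "0 \<le> Lf" "0 \<le> Lg" "0 \<le> La" "0 \<le> Lc" "0 \<le> Ga" "0 < \<Lambda>f" "0 < ef" "0 < \<Lambda>g" "0 < eg" "0 < F.Cf" "0 < G.Cg"
proof -
  show 1: "0 \<le> Lf" "0 \<le> Lg" "0 \<le> La" using base norm_ge_zero order_trans by blast+
  show 2: "0 < \<Lambda>f" "0 < ef" "0 < \<Lambda>g" "0 < eg" "0 < F.Cf" "0 < G.Cg" using F.pos G.pos F.Cf G.Cg by auto
  have "0 \<le> 2 * b * (24 * ef + 20 * \<Lambda>f)" using b 2 by (intro mult_nonneg_nonneg) auto
  then show 3: "0 \<le> Lc" unfolding Lc_def lip_ctrl_def using 1 2 by (intro mult_nonneg_nonneg) auto
  show "0 \<le> Ga" using 1 3 b by (simp add: Ga_def)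
qed

lemma opt_lipschitz:
  assumes \<pi>: "\<pi> \<in> couplings \<mu> \<mu>'" "\<mu> \<in> P2" "\<mu>' \<in> P2" and z: "cone x \<mu> z" "cone x' \<mu>' z'"
  shows "norm (opt x \<mu> z - opt x' \<mu>' z') \<le> Lc * (norm (x - x') + cost \<pi> + norm (z - z'))"
proof -
  define E where "E = norm (x - x') + cost \<pi> + norm (z - z')"
  have E: "0 \<le> La0 * E" using La0 by (simp add: E_def)
  have "norm (opt x \<mu> z - opt x' \<mu>' z') \<le> La0 * E / c"
    using opt_lip[OF \<pi> z] c by (simp add: E_def pos_le_divide_eq mult.commute)
  also have "\<dots> = 20 * \<Lambda>f / (19 * \<kappa>) / \<Lambda>f * (La0 * E)" using pos(6) lam by (simp add: c_def field_simps)
  also have "\<dots> \<le> La / \<Lambda>f * (La0 * E)" using pos(6) by (intro mult_right_mono[OF _ E] divide_right_mono La_scale) auto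
  also have "\<dots> = Lc * E" by (simp add: Lc_def lip_ctrl_def La0_def F.Cf_def)
  finally show ?thesis by (simp add: E_def)
qed

lemma L_eq: "L = (1 + Lc) * (2 * b * F.Cf + \<Lambda>f + G.Cg) + (Lf + Lg + 2 * b * \<Lambda>f + (\<Lambda>f + G.Cg) * (1 + Ga))"
  by (simp add: L_def lip_coef_def Lc_def Ga_def F.Cf_def G.Cg_def add.assoc)

lemma L: "(1 + Lc) * (2 * b * F.Cf + \<Lambda>f + G.Cg) \<le> L" "Lf + Lg + 2 * b * \<Lambda>f + (\<Lambda>f + G.Cg) * (1 + Ga) \<le> L" "0 < L"
proof -
  have 1: "0 < (1 + Lc) * (2 * b * F.Cf + \<Lambda>f + G.Cg)"
    using pos b by (intro mult_pos_pos add_pos_pos add_pos_nonneg) auto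
  have 2: "0 \<le> Lf + Lg + 2 * b * \<Lambda>f + (\<Lambda>f + G.Cg) * (1 + Ga)"
    using pos b by (intro add_nonneg_nonneg mult_nonneg_nonneg) auto
  show "(1 + Lc) * (2 * b * F.Cf + \<Lambda>f + G.Cg) \<le> L" "Lf + Lg + 2 * b * \<Lambda>f + (\<Lambda>f + G.Cg) * (1 + Ga) \<le> L" "0 < L"
    unfolding L_eq using 1 2 by linarith+
qed

text \<open>D is the change in state and law, E that in z, a that in the control, t that in the
  point where a measure derivative is evaluated. Eliminating a costs the factor 1 + Lc.\<close>

lemma lip_bound:
  assumes "0 \<le> D" "0 \<le> E" "a \<le> Lc * (D + E)" "0 \<le> t" "0 \<le> a"
  shows "\<Lambda>f * (D + a) \<le> L * (D + E)"
    "2 * b * (F.Cf * (D + a + t)) + \<Lambda>f * E + G.Cg * (D + a + t) \<le> L * (t + D + E)"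
proof -
  define S where "S = 2 * b * F.Cf + G.Cg"
  have S: "0 \<le> S" "0 \<le> \<Lambda>f" "S + \<Lambda>f = 2 * b * F.Cf + \<Lambda>f + G.Cg" using pos b by (auto simp: S_def)
  have L': "(1 + Lc) * (S + \<Lambda>f) \<le> L" using L(1) unfolding S(3) .
  have Da: "D + a \<le> (1 + Lc) * (D + E)" using assms by (simp add: algebra_simps)
  have Dat: "D + a + t \<le> (1 + Lc) * (t + D + E)"
  proof -
    have "0 \<le> Lc * t" using pos(4) assms(4) by (rule mult_nonneg_nonneg)
    then show ?thesis using Da assms(2) by (simp add: algebra_simps)
  qed
  have c: "\<Lambda>f \<le> S + \<Lambda>f" using S by simp
  have "\<Lambda>f * (D + a) \<le> (S + \<Lambda>f) * ((1 + Lc) * (D + E))" using assms S by (intro mult_mono Da c) auto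
  also have "\<dots> = ((1 + Lc) * (S + \<Lambda>f)) * (D + E)" by simp
  also have "\<dots> \<le> L * (D + E)" using assms by (intro mult_right_mono L') auto
  finally show "\<Lambda>f * (D + a) \<le> L * (D + E)" .
  have "2 * b * (F.Cf * (D + a + t)) + \<Lambda>f * E + G.Cg * (D + a + t) = S * (D + a + t) + \<Lambda>f * E"
    by (simp add: S_def algebra_simps)
  also have "\<dots> \<le> S * ((1 + Lc) * (t + D + E)) + \<Lambda>f * ((1 + Lc) * (t + D + E))"
  proof (intro add_mono mult_left_mono Dat S)
    have "0 \<le> Lc * (t + D + E)" using pos(4) assms by simp
    then show "E \<le> (1 + Lc) * (t + D + E)" using assms by (simp add: algebra_simps)
  qed
  also have "\<dots> = ((1 + Lc) * (S + \<Lambda>f)) * (t + D + E)" by (simp add: algebra_simps)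
  also have "\<dots> \<le> L * (t + D + E)" using assms by (intro mult_right_mono L') auto
  finally show "2 * b * (F.Cf * (D + a + t)) + \<Lambda>f * E + G.Cg * (D + a + t) \<le> L * (t + D + E)" .
qed

lemma contr_grad_lipschitz:
  fixes S S' :: "(real^'n) \<Rightarrow>\<^sub>L (real^'n)" and R R' :: "(real^'n) \<Rightarrow>\<^sub>L real"
  assumes z: "cone x \<mu> z" and S: "wt x \<mu> * norm (S - S') \<le> F.Cf * (D + a + t)" "norm S' \<le> \<Lambda>f"
    and R: "norm (R - R') \<le> G.Cg * (D + a + t)"
    and *: "0 \<le> D" "a \<le> Lc * (D + norm (z - z'))" "0 \<le> t" "0 \<le> a"
  shows "norm ((contr S z + grad R) - (contr S' z' + grad R')) \<le> L * (t + D + norm (z - z'))"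
proof -
  have "norm z * norm (S - S') \<le> (2 * b * wt x \<mu>) * norm (S - S')"
    using z by (intro mult_right_mono) (auto simp: cone_wt)
  also have "\<dots> = 2 * b * (wt x \<mu> * norm (S - S'))" by simp
  also have "\<dots> \<le> 2 * b * (F.Cf * (D + a + t))" using b by (intro mult_left_mono S(1)) auto
  finally have 1: "norm z * norm (S - S') \<le> 2 * b * (F.Cf * (D + a + t))" .
  have "norm ((contr S z + grad R) - (contr S' z' + grad R')) \<le> norm z * norm (S - S') + norm S' * norm (z - z') + norm (R - R')"
    by (rule norm_contr_grad_diff)
  also have "\<dots> \<le> 2 * b * (F.Cf * (D + a + t)) + \<Lambda>f * norm (z - z') + G.Cg * (D + a + t)"
    by (intro add_mono 1 R mult_right_mono S(2)) auto
  also have "\<dots> \<le> L * (t + D + norm (z - z'))" by (rule lip_bound(2)[OF *(1) _ *(2-4)]) simp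
  finally show ?thesis .
qed

lemma coef_lipschitz:
  assumes \<pi>: "\<pi> \<in> couplings \<mu> \<mu>'" "\<mu> \<in> P2" "\<mu>' \<in> P2" and z: "cone x \<mu> z" "cone x' \<mu>' z'"
  shows "norm (drift f g x \<mu> z - drift f g x' \<mu>' z') \<le> L * (norm (x - x') + cost \<pi> + norm (z - z'))"
    "norm (A x \<mu> z - A x' \<mu>' z') \<le> L * (norm (x - x') + cost \<pi> + norm (z - z'))"
    "norm (\<Gamma> u \<mu> x z - \<Gamma> u' \<mu>' x' z') \<le> L * (norm (u - u') + cost \<pi> + norm (x - x') + norm (z - z'))"
proof -
  let ?a = "opt x \<mu> z" and ?a' = "opt x' \<mu>' z'"
  define D where "D = norm (x - x') + cost \<pi>"
  define a where "a = norm (?a - ?a')"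
  have D: "0 \<le> D" and a0: "0 \<le> a" by (auto simp: D_def a_def)
  have a: "a \<le> Lc * (D + norm (z - z'))" using opt_lipschitz[OF \<pi> z] by (simp add: D_def a_def)
  have "norm (drift f g x \<mu> z - drift f g x' \<mu>' z') \<le> \<Lambda>f * (D + a)"
    unfolding drift_def D_def a_def by (rule F.f_lip[OF \<pi>])
  also have "\<dots> \<le> L * (D + norm (z - z'))" by (rule lip_bound(1)[OF D norm_ge_zero a order_refl a0])
  finally show "norm (drift f g x \<mu> z - drift f g x' \<mu>' z') \<le> L * (norm (x - x') + cost \<pi> + norm (z - z'))" by (simp add: D_def)
  have "norm (A x \<mu> z - A x' \<mu>' z') \<le> L * (0 + D + norm (z - z'))" unfolding A_def
    by (rule contr_grad_lipschitz[OF z(1) _ _ _ D a _ a0])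
      (use F.lip_dx(1)[OF \<pi>, of x ?a x' ?a'] G.lip_dx(1)[OF \<pi>, of x ?a x' ?a'] F.bnd[OF \<pi>(3), of x' ?a'] in \<open>simp_all add: D_def a_def\<close>)
  then show "norm (A x \<mu> z - A x' \<mu>' z') \<le> L * (norm (x - x') + cost \<pi> + norm (z - z'))" by (simp add: D_def)
  have "norm (\<Gamma> u \<mu> x z - \<Gamma> u' \<mu>' x' z') \<le> L * (norm (u - u') + D + norm (z - z'))" unfolding \<Gamma>_def
    by (rule contr_grad_lipschitz[OF z(1) _ _ _ D a _ a0])
      (use F.lip_dx(3)[OF \<pi>, of x ?a u x' ?a' u'] G.lip_dx(3)[OF \<pi>, of x ?a u x' ?a' u'] F.bnd[OF \<pi>(3), of x' ?a' u'] in \<open>simp_all add: D_def a_def\<close>)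
  then show "norm (\<Gamma> u \<mu> x z - \<Gamma> u' \<mu>' x' z') \<le> L * (norm (u - u') + cost \<pi> + norm (x - x') + norm (z - z'))" by (simp add: D_def ac_simps)
qed

text \<open>Growth follows from the Lipschitz bounds by comparison with the origin, along the
  product coupling with \<open>dirac0\<close>; the triple (0, \<open>dirac0\<close>, 0) lies in the
  cone, so the optimal control may be compared there as well.\<close>

lemma coef_growth:
  assumes \<mu>: "\<mu> \<in> P2" and z: "cone x \<mu> z"
  shows "norm (drift f g x \<mu> z) \<le> L * wt x \<mu>" "norm (A x \<mu> z) \<le> L * wt x \<mu>" "norm (\<Gamma> u \<mu> x z) \<le> L * (wt x \<mu> + norm u)"
proof -
  let ?\<pi> = "\<mu> \<Otimes>\<^sub>M dirac0" and ?a = "opt x \<mu> z"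
  define N where "N = wt x \<mu>"
  have d: "(dirac0 :: (real^'n) measure) \<in> P2" by (rule return_P2)
  note \<pi> = product_coupling[OF \<mu> d] \<mu> d
  have xN: "norm x + cost ?\<pi> \<le> N" using cost_le_mnorm[OF \<pi>] by (simp add: N_def wt_def mnorm_return)
  have N: "1 \<le> N" "0 \<le> N" using wt_pos(2)[of x \<mu>] by (auto simp: N_def)
  have zN: "norm z \<le> 2 * b * N" using z by (simp add: cone_wt N_def)
  have cz: "cone 0 dirac0 (0::real^'n)" using b by (simp add: cone_def mnorm_return)
  have "norm (?a - opt 0 dirac0 0) \<le> Lc * (norm x + cost ?\<pi> + norm z)"
    using opt_lipschitz[OF \<pi> z cz] by simp
  also have "\<dots> \<le> Lc * (N + 2 * b * N)" using pos(4) by (intro mult_left_mono add_mono xN zN) auto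
  finally have "norm ?a \<le> La + Lc * (N + 2 * b * N)" using norm_triangle_sub[of ?a "opt 0 dirac0 0"] base(4) by linarith
  moreover have "La * 1 \<le> La * N" using pos(3) N(1) by (intro mult_left_mono) auto
  ultimately have aN: "norm ?a \<le> Ga * N" by (simp add: Ga_def algebra_simps)
  have k: "C0 + C * (norm x + cost ?\<pi> + norm ?a + v) \<le> C0 * N + C * ((1 + Ga) * N + v)" if "0 \<le> C0" "0 \<le> C" for C0 C v
  proof (rule add_mono)
    show "C0 \<le> C0 * N" using mult_left_mono[OF N(1) that(1)] by simp
    show "C * (norm x + cost ?\<pi> + norm ?a + v) \<le> C * ((1 + Ga) * N + v)"
      using xN aN by (intro mult_left_mono[OF _ that(2)]) (simp add: distrib_right)
  qed
  have fin: "C0 * N + C * ((1 + Ga) * N + v) + 2 * b * \<Lambda>f * N \<le> L * (N + v)"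
    if "0 \<le> C0" "0 \<le> C" "C0 \<le> Lf + Lg" "C \<le> \<Lambda>f + G.Cg" "0 \<le> v" for C0 C v
  proof -
    have "C * v \<le> C * (1 + Ga) * v" using that pos(5) by (intro mult_right_mono) (auto simp: algebra_simps)
    moreover have "0 \<le> (C0 + 2 * b * \<Lambda>f) * v" using that b pos(6) by (intro mult_nonneg_nonneg add_nonneg_nonneg) auto
    ultimately have "C0 * N + C * ((1 + Ga) * N + v) + 2 * b * \<Lambda>f * N \<le> (C0 + 2 * b * \<Lambda>f + C * (1 + Ga)) * (N + v)"
      by (simp add: algebra_simps)
    also have "\<dots> \<le> L * (N + v)"
    proof (rule mult_right_mono)
      have "C * (1 + Ga) \<le> (\<Lambda>f + G.Cg) * (1 + Ga)" using that pos(5) by (intro mult_right_mono) auto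
      then show "C0 + 2 * b * \<Lambda>f + C * (1 + Ga) \<le> L" using L(2) that(3) by linarith
    qed (use N that in auto)
    finally show ?thesis .
  qed
  have bf: "0 \<le> 2 * b * \<Lambda>f * N" using b pos(6) N(2) by simp
  have "norm (drift f g x \<mu> z) \<le> Lf + \<Lambda>f * (norm x + cost ?\<pi> + norm ?a + 0)"
    unfolding drift_def using F.f_lip[OF \<pi>, of x ?a 0 0] base(1) norm_triangle_sub[of "f x \<mu> ?a" "f 0 dirac0 0"] by simp
  also have "\<dots> \<le> Lf * N + \<Lambda>f * ((1 + Ga) * N + 0)" by (rule k) (use pos in auto)
  also have "\<dots> \<le> Lf * N + \<Lambda>f * ((1 + Ga) * N + 0) + 2 * b * \<Lambda>f * N" using bf by simp
  also have "\<dots> \<le> L * (N + 0)" by (rule fin) (use pos in auto)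
  finally show "norm (drift f g x \<mu> z) \<le> L * wt x \<mu>" by (simp add: N_def)
  have cg: "norm (contr S z + grad R) \<le> L * (N + v)"
    if "norm S \<le> \<Lambda>f" "norm R \<le> Lg + G.Cg * (norm x + cost ?\<pi> + norm ?a + v)" "0 \<le> v"
    for S :: "(real^'n) \<Rightarrow>\<^sub>L (real^'n)" and R :: "(real^'n) \<Rightarrow>\<^sub>L real" and v
  proof -
    have "norm (contr S z) \<le> \<Lambda>f * (2 * b * N)"
      by (rule order_trans[OF norm_contr mult_mono[OF that(1) zN]]) (use pos in auto)
    moreover have "norm (grad R) \<le> Lg * N + G.Cg * ((1 + Ga) * N + v)"
      by (rule order_trans[OF norm_grad order_trans[OF that(2) k]]) (use pos in auto)
    ultimately have "norm (contr S z + grad R) \<le> \<Lambda>f * (2 * b * N) + (Lg * N + G.Cg * ((1 + Ga) * N + v))" by (rule norm_triangle_mono)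
    also have "\<dots> = Lg * N + G.Cg * ((1 + Ga) * N + v) + 2 * b * \<Lambda>f * N" by simp
    also have "\<dots> \<le> L * (N + v)" by (rule fin) (use pos that in auto)
    finally show ?thesis .
  qed
  have "norm (dx g x \<mu> ?a) \<le> Lg + G.Cg * (norm x + cost ?\<pi> + norm ?a + 0)"
    using G.lip_dx(1)[OF \<pi>, of x ?a 0 0] base(2) norm_triangle_sub[of "dx g x \<mu> ?a" "dx g 0 dirac0 0"] by simp
  then have "norm (A x \<mu> z) \<le> L * (N + 0)" unfolding A_def by (intro cg) (use F.bnd[OF \<mu>] in auto)
  then show "norm (A x \<mu> z) \<le> L * wt x \<mu>" by (simp add: N_def)
  have "norm (dm g x \<mu> ?a u) \<le> Lg + G.Cg * (norm x + cost ?\<pi> + norm ?a + norm u)"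
    using G.lip_dx(3)[OF \<pi>, of x ?a u 0 0 0] base(3) norm_triangle_sub[of "dm g x \<mu> ?a u" "dm g 0 dirac0 0 0"] by simp
  then show "norm (\<Gamma> u \<mu> x z) \<le> L * (wt x \<mu> + norm u)" unfolding \<Gamma>_def N_def[symmetric] by (intro cg) (use F.bnd[OF \<mu>] in auto)
qed

lemma fbode:
  assumes p: "\<And>\<mu> \<mu>' \<pi> x x'. \<mu> \<in> P2 \<Longrightarrow> \<mu>' \<in> P2 \<Longrightarrow> \<pi> \<in> couplings \<mu> \<mu>' \<Longrightarrow> norm (p x \<mu> - p x' \<mu>') \<le> b * (norm (x - x') + cost \<pi>)"
    "\<And>\<mu> x. \<mu> \<in> P2 \<Longrightarrow> norm (p x \<mu>) \<le> b * (1 + norm x + mnorm 1 \<mu>)"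
  shows "fbode (drift f g) A \<Gamma> p cone L b"
proof
  show "0 < L" by (rule L(3))
  show "0 < b" by (rule b)
  show "cone x \<mu> z \<longleftrightarrow> norm z \<le> 2 * b * (1 + norm x + mnorm 1 \<mu>)" for x \<mu> z by (rule cone_def)
  fix x x' u u' z z' :: "real^'n" and \<mu> \<mu>' \<pi>
  show "\<mu> \<in> P2 \<Longrightarrow> norm (p x \<mu>) \<le> b * (1 + norm x + mnorm 1 \<mu>)" by (rule p(2))
  { assume g: "\<mu> \<in> P2" "cone x \<mu> z"
    note gr = coef_growth[OF g, unfolded wt_def]
    show "norm (drift f g x \<mu> z) \<le> L * (1 + norm x + mnorm 1 \<mu>)" "norm (A x \<mu> z) \<le> L * (1 + norm x + mnorm 1 \<mu>)" by (rule gr(1), rule gr(2))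
    show "norm (\<Gamma> u \<mu> x z) \<le> L * (1 + norm u + norm x + mnorm 1 \<mu>)" using gr(3)[of u] by (simp add: ac_simps) }
  assume m: "\<mu> \<in> P2" "\<mu>' \<in> P2" "\<pi> \<in> couplings \<mu> \<mu>'"
  show "norm (p x \<mu> - p x' \<mu>') \<le> b * (norm (x - x') + cost \<pi>)" by (rule p(1)[OF m])
  assume z: "cone x \<mu> z" "cone x' \<mu>' z'"
  note l = coef_lipschitz[OF m(3,1,2) z]
  show "norm (drift f g x \<mu> z - drift f g x' \<mu>' z') \<le> L * (norm (x - x') + cost \<pi> + norm (z - z'))" by (rule l(1))
  show "norm (A x \<mu> z - A x' \<mu>' z') \<le> L * (norm (x - x') + cost \<pi> + norm (z - z'))" by (rule l(2))
  show "norm (\<Gamma> u \<mu> x z - \<Gamma> u' \<mu>' x' z') \<le> L * (norm (u - u') + cost \<pi> + norm (x - x') + norm (z - z'))" by (rule l(3))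
qed

end

subsection \<open>Short-time well-posedness\<close>

lemma tri_norm_le_iff:
  "tri_norm t0 T \<gamma> \<le> ereal C \<longleftrightarrow> (\<forall>s\<in>{t0..T}. \<forall>x. \<forall>\<mu>\<in>P2. norm (\<gamma> s x \<mu>) \<le> C * (1 + norm x + mnorm 1 \<mu>))"
proof -
  have "norm (\<gamma> s x \<mu>) / (1 + norm x + mnorm 1 \<mu>) \<le> C \<longleftrightarrow> norm (\<gamma> s x \<mu>) \<le> C * (1 + norm x + mnorm 1 \<mu>)" for s x \<mu>
    using wt_pos(1)[of x \<mu>] unfolding wt_def by (rule pos_divide_le_eq)
  then show ?thesis unfolding tri_norm_def SUP_le_iff by fastforce
qed

text \<open>The conclusion of the theorem as one predicate, so that it can be proved under abstract
  bounds and folded into the final statement.\<close>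

definition well_posed :: "(real^'n \<Rightarrow> (real^'n) measure \<Rightarrow> real^'k \<Rightarrow> real^'n)
    \<Rightarrow> (real^'n \<Rightarrow> (real^'n) measure \<Rightarrow> real^'k \<Rightarrow> real)
    \<Rightarrow> (real^'n \<Rightarrow> (real^'n) measure \<Rightarrow> real^'n) \<Rightarrow> real \<Rightarrow> real \<Rightarrow> real \<Rightarrow> bool" where
  "well_posed f g p b t0 T \<longleftrightarrow> (\<exists>\<gamma>.
        cont_P2_on ({t0..T} \<times> UNIV) (\<lambda>(s, x) \<mu>. \<gamma> s x \<mu>) \<and>
        decoupling_field f g p t0 T \<gamma> \<and>
        tri_norm t0 T \<gamma> \<le> ereal (2 * b) \<and>
        (\<forall>\<gamma>'.
           cont_P2_on ({t0..T} \<times> UNIV) (\<lambda>(s, x) \<mu>. \<gamma>' s x \<mu>) \<and>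
           decoupling_field f g p t0 T \<gamma>' \<and>
           tri_norm t0 T \<gamma>' \<le> ereal (2 * b) \<longrightarrow>
           (\<forall>s\<in>{t0..T}. \<forall>x. \<forall>\<mu>\<in>P2. \<gamma>' s x \<mu> = \<gamma> s x \<mu>)) \<and>
        (\<exists>X :: real \<Rightarrow> (real^'n) measure \<Rightarrow> real \<Rightarrow> real^'n \<Rightarrow> real^'n.
           (\<forall>t\<in>{t0..T}. \<forall>m\<in>P2.
              is_flow f g \<gamma> t T m (X t m) \<and>
              (\<forall>Y. is_flow f g \<gamma> t T m Y \<longrightarrow> (\<forall>s\<in>{t..T}. \<forall>x. Y s x = X t m s x)) \<and>
              fbode_solution f g p t T m (X t m) (Z_of \<gamma> m (X t m)) \<and>
              (\<forall>x. cont_diff_on (\<lambda>s. X t m s x) {t..T} \<and>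
                   cont_diff_on (\<lambda>s. Z_of \<gamma> m (X t m) s x) {t..T}) \<and>
              (\<forall>s\<in>{t..T}. \<forall>x.
                 norm (Z_of \<gamma> m (X t m) s x)
                   \<le> 2 * b * (1 + norm (X t m s x) + (\<integral>y. norm (X t m s y) \<partial>m)) \<and>
                 (X t m s x, pushfwd (X t m s) m, Z_of \<gamma> m (X t m) s x) \<in> ctrl_cone (4 * b)) \<and>
              (\<forall>s\<in>{t..T}. \<forall>\<tau>\<in>{s..T}. \<forall>x.
                 X t m \<tau> x = X s (pushfwd (X t m s) m) \<tau> (X t m s x))) \<and>
           (\<forall>s\<in>{t0..T}.
              cont_P2_on ({t0..s} \<times> UNIV) (\<lambda>(t, x) m. X t m s x) \<and>
              cont_P2_on ({t0..s} \<times> UNIV) (\<lambda>(t, x) m. Z_of \<gamma> m (X t m) s x))))"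

context control_bounds
begin

text \<open>Identifies the concrete system with the abstract one: \<open>Phi_nonlocal\<close> is
  \<Gamma>, \<open>Phi\<close> is \<Phi>, and \<open>S.XX\<close> is the family of flows. Of a
  competing field, continuity in x at fixed time and law, together with its growth bound, enters the
  uniqueness argument.\<close>

lemma short_time:
  assumes p: "\<And>\<mu> \<mu>' \<pi> x x'. \<mu> \<in> P2 \<Longrightarrow> \<mu>' \<in> P2 \<Longrightarrow> \<pi> \<in> couplings \<mu> \<mu>' \<Longrightarrow> norm (p x \<mu> - p x' \<mu>') \<le> b * (norm (x - x') + cost \<pi>)"
    "\<And>\<mu> x. \<mu> \<in> P2 \<Longrightarrow> norm (p x \<mu>) \<le> b * (1 + norm x + mnorm 1 \<mu>)"
    and T: "t0 \<le> T" "(T - t0) * L * (100 * (1 + b)) \<le> 1" "(T - t0) * L * 12 \<le> b"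
  shows "well_posed f g p b t0 T"
proof -
  interpret fbode "drift f g" A \<Gamma> p cone L b by (rule fbode[OF p])
  interpret S: fbode_short "drift f g" A \<Gamma> p cone L b t0 T by unfold_locales (rule T)+
  have nonlocal: "Phi_nonlocal f g X Z m x = (\<lambda>y. \<Gamma> (X x) (distr m borel X) (X y) (Z y))" for X Z m x
    by (simp add: fun_eq_iff Phi_nonlocal_def Let_def \<Gamma>_def)
  have Phi: "Phi f g X Z m x = \<Phi> m X Z x" for X Z m x
    by (simp add: Phi_def \<Phi>_def nonlocal Let_def A_def)
  have flow: "is_flow f g h t T m Y \<longleftrightarrow> S.isflow h t m Y" for h t m Y
    by (simp only: is_flow_def S.isflow_def Z_of_def)
  have Z: "Z_of S.\<gamma> m (S.XX t m) s = S.ZZ t m s" if "t \<in> {t0..T}" "m \<in> P2" "s \<in> {t..T}" for t m s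
    by (simp add: fun_eq_iff Z_of_def S.ZZ_eq_\<gamma>[OF that])
  have int: "integrable m (Phi_nonlocal f g (S.XX t m s) (Z_of S.\<gamma> m (S.XX t m) s) m x)"
    if "t \<in> {t0..T}" "m \<in> P2" "s \<in> {t..T}" for t m s x
    unfolding Z[OF that] nonlocal by (rule \<Gamma>_integrable[OF S.XXD(1)[OF that]])
  have dZ: "((\<lambda>r. Z_of S.\<gamma> m (S.XX t m) r x) has_vector_derivative - \<Phi> m (S.XX t m s) (S.ZZ t m s) x) (at s within {t..T})"
    if "t \<in> {t0..T}" "m \<in> P2" "s \<in> {t..T}" for t m s x
    by (rule has_vector_derivative_transform[OF that(3) _ S.XX_deriv(2)[OF that]]) (simp add: Z[OF that(1,2)])
  show ?thesis unfolding well_posed_def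
  proof (intro exI[of _ S.\<gamma>] exI[of _ S.XX] conjI allI ballI impI)
    show "cont_P2_on ({t0..T} \<times> UNIV) (\<lambda>(s, x) \<mu>. S.\<gamma> s x \<mu>)" by (rule S.\<gamma>_cont)
    show "tri_norm t0 T S.\<gamma> \<le> ereal (2 * b)" unfolding tri_norm_le_iff using S.\<gamma>_bound by blast
    show "decoupling_field f g p t0 T S.\<gamma>" unfolding decoupling_field_def
    proof (intro ballI)
      fix s and m :: "(real^'n) measure" assume s: "s \<in> {t0..T}" and m: "m \<in> P2"
      have ss: "s \<in> {s..T}" using s by simp
      show "\<exists>X. is_flow f g S.\<gamma> s T m X \<and> (\<forall>x. (\<forall>r\<in>{s..T}. integrable m (Phi_nonlocal f g (X r) (Z_of S.\<gamma> m X r) m x)) \<and>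
           ((\<lambda>r. Phi f g (X r) (Z_of S.\<gamma> m X r) m x) has_integral (S.\<gamma> s x m - p (X T x) (pushfwd (X T) m))) {s..T})"
      proof (intro exI[of _ "S.XX s m"] conjI allI ballI)
        show "is_flow f g S.\<gamma> s T m (S.XX s m)" unfolding flow by (rule S.XX_flow[OF s m])
        fix x
        show "integrable m (Phi_nonlocal f g (S.XX s m r) (Z_of S.\<gamma> m (S.XX s m) r) m x)" if "r \<in> {s..T}" for r
          by (rule int[OF s m that])
        have "((\<lambda>r. \<Phi> m (S.XX s m r) (S.ZZ s m r) x) has_integral (S.\<gamma> s x m - p (S.XX s m T x) (pushfwd (S.XX s m T) m))) {s..T}"
          unfolding S.\<gamma>_def by (rule S.XXD(12)[OF s m ss])
        then show "((\<lambda>r. Phi f g (S.XX s m r) (Z_of S.\<gamma> m (S.XX s m) r) m x) has_integral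
            (S.\<gamma> s x m - p (S.XX s m T x) (pushfwd (S.XX s m T) m))) {s..T}"
          by (rule has_integral_eq[rotated]) (simp add: Phi Z[OF s m])
      qed
    qed
    {
      fix \<gamma>' assume g': "cont_P2_on ({t0..T} \<times> UNIV) (\<lambda>(s, x) \<mu>. \<gamma>' s x \<mu>) \<and> decoupling_field f g p t0 T \<gamma>' \<and> tri_norm t0 T \<gamma>' \<le> ereal (2 * b)"
      have gc: "continuous_on UNIV (\<lambda>x. \<gamma>' r x \<mu>)" if "r \<in> {t0..T}" "\<mu> \<in> P2" for r \<mu>
      proof -
        have "continuous_on ({t0..T} \<times> UNIV) (\<lambda>z. (\<lambda>(s, x) \<mu>. \<gamma>' s x \<mu>) z \<mu>)"
          using g' that(2) by (intro cont_P2_on_continuous) auto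
        then have "continuous_on UNIV (\<lambda>x. (\<lambda>(s, x) \<mu>. \<gamma>' s x \<mu>) (r, x) \<mu>)"
          by (rule continuous_on_compose2) (use that(1) in \<open>auto intro!: continuous_intros\<close>)
        then show ?thesis by simp
      qed
      have dec: "\<exists>Y. S.isflow \<gamma>' s m Y \<and> (\<forall>x. ((\<lambda>r. \<Phi> m (Y r) (\<lambda>x. \<gamma>' r (Y r x) (distr m borel (Y r))) x) has_integral
          (\<gamma>' s x m - p (Y T x) (distr m borel (Y T)))) {s..T})" if s: "s \<in> {t0..T}" and m: "m \<in> P2" for s m
      proof -
        have eq: "Z_of \<gamma>' m Y r = (\<lambda>x. \<gamma>' r (Y r x) (distr m borel (Y r)))" for Y r by (simp add: fun_eq_iff Z_of_def)
        have d: "decoupling_field f g p t0 T \<gamma>'" using g' by blast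
        show ?thesis by (rule ex_forward[OF bspec[OF bspec[OF d[unfolded decoupling_field_def flow Phi] s] m]]) (simp add: eq)
      qed
      show "\<gamma>' s x \<mu> = S.\<gamma> s x \<mu>" if "s \<in> {t0..T}" "\<mu> \<in> P2" for s x \<mu>
        using that S.decoupling_unique[OF gc _ dec] g' unfolding tri_norm_le_iff by blast
    }
    {
      fix t and m :: "(real^'n) measure" assume t: "t \<in> {t0..T}" and m: "m \<in> P2"
      note Zt = Z[OF t m]
      have TT: "T \<in> {t..T}" using t by simp
      show "is_flow f g S.\<gamma> t T m (S.XX t m)" unfolding flow by (rule S.XX_flow[OF t m])
      show "Y s x = S.XX t m s x" if "is_flow f g S.\<gamma> t T m Y" "s \<in> {t..T}" for Y s x
        using S.flow_unique[OF t m] that unfolding flow by blast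
      show "fbode_solution f g p t T m (S.XX t m) (Z_of S.\<gamma> m (S.XX t m))"
        unfolding fbode_solution_def
      proof (intro conjI ballI allI)
        fix x
        show "S.XX t m t x = x" by (rule S.XX_init[OF t m])
        show "Z_of S.\<gamma> m (S.XX t m) T x = p (S.XX t m T x) (pushfwd (S.XX t m T) m)"
          using S.XXD(12)[OF t m TT, of x] by (simp add: Zt[OF TT] has_integral_refl has_integral_iff)
        fix s assume s: "s \<in> {t..T}"
        show "S.XX t m s \<in> borel_measurable borel" by (rule S.XXD(6)[OF t m s])
        show "Z_of S.\<gamma> m (S.XX t m) s \<in> borel_measurable borel" unfolding Zt[OF s] by (rule S.XXD(7)[OF t m s])
        show "pushfwd (S.XX t m s) m \<in> P2" by (rule admD(6)[OF S.XXD(1)[OF t m s]])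
        show "integrable m (Phi_nonlocal f g (S.XX t m s) (Z_of S.\<gamma> m (S.XX t m) s) m x)" by (rule int[OF t m s])
        show "((\<lambda>r. S.XX t m r x) has_vector_derivative drift f g (S.XX t m s x) (pushfwd (S.XX t m s) m) (Z_of S.\<gamma> m (S.XX t m) s x)) (at s within {t..T})"
          unfolding Zt[OF s] by (rule S.XX_deriv(1)[OF t m s])
        show "((\<lambda>r. Z_of S.\<gamma> m (S.XX t m) r x) has_vector_derivative - Phi f g (S.XX t m s) (Z_of S.\<gamma> m (S.XX t m) s) m x) (at s within {t..T})"
          unfolding Zt[OF s] Phi by (rule dZ[OF t m s])
      qed
      show "cont_diff_on (\<lambda>s. S.XX t m s x) {t..T}" for x
        unfolding cont_diff_on_def using S.XXD(13)[OF t m TT] S.XX_deriv(1)[OF t m] by blast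
      show "cont_diff_on (\<lambda>s. Z_of S.\<gamma> m (S.XX t m) s x) {t..T}" for x
        unfolding cont_diff_on_def using continuous_on_minus[OF S.XXD(14)[OF t m TT]] dZ[OF t m] by blast
      fix s x assume s: "s \<in> {t..T}"
      note a = admD[OF S.XXD(1)[OF t m s]]
      show "norm (Z_of S.\<gamma> m (S.XX t m) s x) \<le> 2 * b * (1 + norm (S.XX t m s x) + (\<integral>y. norm (S.XX t m s y) \<partial>m))"
        unfolding Zt[OF s] by (rule a(9))
      show "(S.XX t m s x, pushfwd (S.XX t m s) m, Z_of S.\<gamma> m (S.XX t m) s x) \<in> ctrl_cone (4 * b)"
        using a(5)[of x] a(6) unfolding Zt[OF s] ctrl_cone_def cone_def by simp
      show "S.XX t m r x = S.XX s (pushfwd (S.XX t m s) m) r (S.XX t m s x)" if "r \<in> {s..T}" for r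
        by (rule S.XX_restart(1)[OF t m s that])
    }
    fix s assume s: "s \<in> {t0..T}"
    show "cont_P2_on ({t0..s} \<times> UNIV) (\<lambda>(t, x) m. S.XX t m s x)" by (rule S.XX_cont(1)[OF s])
    have "cont_P2_on ({t0..s} \<times> UNIV) (\<lambda>(t, x) m. Z_of S.\<gamma> m (S.XX t m) s x) \<longleftrightarrow>
        cont_P2_on ({t0..s} \<times> UNIV) (\<lambda>(t, x) m. S.ZZ t m s x)"
      unfolding cont_P2_on_def using s by (intro ball_cong refl all_cong ex_cong conj_cong) (auto simp: Z)
    then show "cont_P2_on ({t0..s} \<times> UNIV) (\<lambda>(t, x) m. Z_of S.\<gamma> m (S.XX t m) s x)" using S.XX_cont(2)[OF s] by simp
  qed
qed

end


section \<open>From the standing assumptions to the abstract bounds\<close>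

lemma decayingD: "decaying F l k \<Longrightarrow> \<mu> \<in> P2 \<Longrightarrow> norm (F x \<mu> \<alpha> u v) \<le> l / wt x \<mu>"
  by (simp add: decaying_def bounded_by_def wt_def)

lemma assm_a1_coef_f:
  fixes f :: "real^'n \<Rightarrow> (real^'n) measure \<Rightarrow> real^'k \<Rightarrow> real^'n"
  assumes "assm_a1 f lam_f Lam_f lbar_f Lip_f"
  shows "\<exists>K M. coef_f f K M Lam_f lbar_f"
proof -
  obtain K and M :: "real^'n \<Rightarrow> (real^'n) measure \<Rightarrow> real^'k \<Rightarrow> real^'n \<Rightarrow> ((real^'n) \<Rightarrow>\<^sub>L (real^'k) \<Rightarrow>\<^sub>L (real^'n))"
    where KM: "\<forall>x \<alpha>. regular2 (\<lambda>\<nu>. f x \<nu> \<alpha>) (K x \<alpha>)"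
        "\<forall>x. \<forall>\<mu>\<in>P2. \<forall>\<alpha> b. has_L_deriv (\<lambda>\<nu>. blinfun_apply (da f x \<nu> \<alpha>) b)
           (\<lambda>u. Blinfun (\<lambda>y. blinfun_apply (blinfun_apply (M x \<mu> \<alpha> u) y) b)) \<mu>"
        "decaying (\<lambda>x \<mu> \<alpha> u v. mixed_deriv (K x \<alpha> \<mu>) u v) lbar_f Lip_f"
        "decaying (\<lambda>x \<mu> \<alpha> u v. fderiv (da f x \<mu>) \<alpha>) lbar_f Lip_f"
        "decaying (\<lambda>x \<mu> \<alpha> u v. M x \<mu> \<alpha> u) lbar_f Lip_f"
        "decaying (\<lambda>x \<mu> \<alpha> u v. fderiv (dx f x \<mu>) \<alpha>) lbar_f Lip_f"
        "decaying (\<lambda>x \<mu> \<alpha> u v. fderiv (\<lambda>y. dx f y \<mu> \<alpha>) x) lbar_f Lip_f"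
        "decaying (\<lambda>x \<mu> \<alpha> u v. fderiv (dm f x \<mu> \<alpha>) u) lbar_f Lip_f"
        "decaying (\<lambda>x \<mu> \<alpha> u v. fderiv (\<lambda>y. dm f y \<mu> \<alpha> u) x) lbar_f Lip_f"
    using assms unfolding assm_a1_def by (elim conjE exE) (rule that; assumption)
  have "coef_f f K M Lam_f lbar_f"
  proof
    have h: "\<forall>\<mu>\<in>P2. twice_diff (\<lambda>(x, \<alpha>). f x \<mu> \<alpha>)" "\<forall>x. \<forall>\<mu>\<in>P2. \<forall>\<alpha> u. (\<lambda>y. dm f y \<mu> \<alpha> u) differentiable at x"
      "\<forall>x. \<forall>\<mu>\<in>P2. \<forall>\<alpha> u. norm (da f x \<mu> \<alpha>) \<le> Lam_f \<and> norm (dm f x \<mu> \<alpha> u) \<le> Lam_f \<and> norm (dx f x \<mu> \<alpha>) \<le> Lam_f"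
      "0 < Lam_f" "0 < lbar_f"
      using assms unfolding assm_a1_def by - (elim conjE; assumption)+
    show "0 < Lam_f" "0 < lbar_f" by (fact h)+
    fix x u v \<alpha> b and \<mu> :: "(real^'n) measure"
    show "regular2 (\<lambda>\<nu>. f x \<nu> \<alpha>) (K x \<alpha>)" using KM(1) by simp
    assume \<mu>: "\<mu> \<in> P2"
    show "twice_diff (\<lambda>(x, \<alpha>). f x \<mu> \<alpha>)" "(\<lambda>y. dm f y \<mu> \<alpha> u) differentiable at x"
      "norm (da f x \<mu> \<alpha>) \<le> Lam_f \<and> norm (dm f x \<mu> \<alpha> u) \<le> Lam_f \<and> norm (dx f x \<mu> \<alpha>) \<le> Lam_f"
      using h(1-3) \<mu> by simp_all
    show "has_L_deriv (\<lambda>\<nu>. blinfun_apply (da f x \<nu> \<alpha>) b)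
           (\<lambda>u. Blinfun (\<lambda>y. blinfun_apply (blinfun_apply (M x \<mu> \<alpha> u) y) b)) \<mu>" using KM(2) \<mu> by simp
    show "norm (mixed_deriv (K x \<alpha> \<mu>) u v) \<le> lbar_f / wt x \<mu>" by (rule decayingD[OF KM(3) \<mu>])
    show "norm (fderiv (da f x \<mu>) \<alpha>) \<le> lbar_f / wt x \<mu>" by (rule decayingD[OF KM(4) \<mu>])
    show "norm (M x \<mu> \<alpha> u) \<le> lbar_f / wt x \<mu>" by (rule decayingD[OF KM(5) \<mu>])
    show "norm (fderiv (dx f x \<mu>) \<alpha>) \<le> lbar_f / wt x \<mu>" by (rule decayingD[OF KM(6) \<mu>])
    show "norm (fderiv (\<lambda>y. dx f y \<mu> \<alpha>) x) \<le> lbar_f / wt x \<mu>" by (rule decayingD[OF KM(7) \<mu>])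
    show "norm (fderiv (dm f x \<mu> \<alpha>) u) \<le> lbar_f / wt x \<mu>" by (rule decayingD[OF KM(8) \<mu>])
    show "norm (fderiv (\<lambda>y. dm f y \<mu> \<alpha> u) x) \<le> lbar_f / wt x \<mu>" by (rule decayingD[OF KM(9) \<mu>])
  qed
  then show ?thesis by blast
qed

lemma assm_a2_coef_g:
  fixes g :: "real^'n \<Rightarrow> (real^'n) measure \<Rightarrow> real^'k \<Rightarrow> real"
  assumes "assm_a2 g lam_g Lam_g lbar_g l_g"
  shows "\<exists>K. coef_g g K Lam_g lbar_g"
proof -
  obtain K where K: "\<forall>x \<alpha>. regular2 (\<lambda>\<nu>. g x \<nu> \<alpha>) (K x \<alpha>)"
        "bounded_by (\<lambda>x \<mu> \<alpha> u v. mixed_deriv (K x \<alpha> \<mu>) u v) (\<lambda>_ _. Lam_g)"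
        "bounded_by (\<lambda>x \<mu> \<alpha> u v. fderiv (da g x \<mu>) \<alpha>) (\<lambda>_ _. Lam_g)"
        "bounded_by (\<lambda>x \<mu> \<alpha> u v. fderiv (\<lambda>y. dm g y \<mu> \<alpha> u) x) (\<lambda>_ _. Lam_g)"
        "bounded_by (\<lambda>x \<mu> \<alpha> u v. fderiv (\<lambda>y. dx g y \<mu> \<alpha>) x) (\<lambda>_ _. Lam_g)"
        "bounded_by (\<lambda>x \<mu> \<alpha> u v. fderiv (dm g x \<mu> \<alpha>) u) (\<lambda>_ _. Lam_g)"
        "bounded_by (\<lambda>x \<mu> \<alpha> u v. fderiv (\<lambda>y. da g y \<mu> \<alpha>) x) (\<lambda>_ _. lbar_g)"
        "bounded_by (\<lambda>x \<mu> \<alpha> u v. fderiv (\<lambda>b. dm g x \<mu> b u) \<alpha>) (\<lambda>_ _. lbar_g)"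
    using assms unfolding assm_a2_def by (elim conjE exE) (rule that; assumption)
  have "coef_g g K Lam_g lbar_g"
    by unfold_locales (use assms K in \<open>auto simp: assm_a2_def bounded_by_def\<close>)
  then show ?thesis by blast
qed

text \<open>The mean value inequality treats x, and the bounded L-derivative treats \<mu>. The
  latter bound holds at every law, so the threshold on the first moment can be taken as weak as
  required.\<close>

lemma assm_P_lipschitz:
  assumes P: "assm_P p L_p C" and C: "L_p \<le> C" "0 \<le> C" and \<pi>: "\<pi> \<in> couplings \<mu> \<mu>'" "\<mu> \<in> P2" "\<mu>' \<in> P2"
  shows "norm (p x \<mu> - p x' \<mu>') \<le> C * (norm (x - x') + cost \<pi>)"
proof -
  have d: "(\<lambda>y. p y \<mu>) differentiable at y" "norm (fderiv (\<lambda>y. p y \<mu>) y) \<le> C" for y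
  proof -
    have "\<forall>x. \<forall>\<mu>\<in>P2. (\<lambda>y. p y \<mu>) differentiable at x" "\<forall>x. \<forall>\<mu>\<in>P2. norm (fderiv (\<lambda>y. p y \<mu>) x) \<le> L_p"
      using P unfolding assm_P_def by - (elim conjE; assumption)+
    then show "(\<lambda>y. p y \<mu>) differentiable at y" "norm (fderiv (\<lambda>y. p y \<mu>) y) \<le> C"
      using \<pi>(2) C(1) order_trans by (simp, blast)
  qed
  have 1: "norm (p x \<mu> - p x' \<mu>) \<le> C * norm (x - x')"
    by (rule lipschitz_of_fderiv[of UNIV "\<lambda>y. p y \<mu>"]) (use d in auto)
  obtain Q where "\<forall>x. \<forall>\<mu>\<in>P2. has_L_deriv (p x) (Q x \<mu>) \<mu>" "\<forall>x. \<forall>\<mu>\<in>P2. \<forall>u. norm (Q x \<mu> u) \<le> L_p"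
    using P unfolding assm_P_def by (elim conjE exE) (rule that; assumption)
  then have Q: "has_L_deriv (p x) (Q x \<mu>) \<mu>" "norm (Q x \<mu> u) \<le> L_p" if "\<mu> \<in> P2" for x \<mu> u using that by auto
  have 2: "norm (p x' \<mu> - p x' \<mu>') \<le> C * cost \<pi>"
    by (rule L_deriv_imp_lipschitz[OF Q(1) order_trans[OF Q(2) C(1)] C(2) \<pi> order_refl])
  show ?thesis using norm_triangle_mono[OF 1 2] by (simp add: distrib_left)
qed

text \<open>The value 1 in the other case is a filler: positivity must hold before the hypotheses
  that make b and L positive are available.\<close>

definition short_horizon :: "real \<Rightarrow> real \<Rightarrow> real" where
  "short_horizon b L = (if 0 < b \<and> 0 < L then min (1 / (L * (100 * (1 + b)))) (b / (L * 12)) else 1)"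

lemma short_horizon:
  "0 < short_horizon b L"
  "0 < b \<Longrightarrow> 0 < L \<Longrightarrow> t \<le> short_horizon b L \<Longrightarrow> t * L * (100 * (1 + b)) \<le> 1 \<and> t * L * 12 \<le> b"
proof -
  show "0 < short_horizon b L" by (simp add: short_horizon_def)
  assume *: "0 < b" "0 < L" "t \<le> short_horizon b L"
  then have t: "t \<le> 1 / (L * (100 * (1 + b)))" "t \<le> b / (L * 12)" by (auto simp: short_horizon_def)
  have p: "0 < L * (100 * (1 + b))" "0 < L * 12" using *(1,2) by (auto intro!: mult_pos_pos)
  show "t * L * (100 * (1 + b)) \<le> 1 \<and> t * L * 12 \<le> b"
    using t unfolding pos_le_divide_eq[OF p(1)] pos_le_divide_eq[OF p(2)] by (simp only: mult.assoc)
qed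

lemma assm_well_posed:
  fixes f :: "real^'n \<Rightarrow> (real^'n) measure \<Rightarrow> real^'k \<Rightarrow> real^'n" and g p
  assumes b: "0 < b" and a1: "assm_a1 f lam_f Lam_f lbar_f Lip_f" and a2: "assm_a2 g lam_g Lam_g lbar_g l_g"
    and P: "L_p \<le> b" "assm_P p L_p b"
    and sup: "(SUP (x, \<mu>, \<alpha>)\<in>UNIV \<times> P2 \<times> UNIV. ereal (norm (fderiv (da f x \<mu>) \<alpha>) * (1 + norm x + mnorm 1 \<mu>)))
        \<le> ereal (lam_g / (40 * b))"
    and L: "L_f = L_f_const f Lam_f" "L_g = L_g_const g Lam_g lbar_g" "L_alpha = L_alpha_const f g (4 * b) Lam_f lbar_f lam_g lbar_g"
    and t: "t0 \<le> T" "T - t0 \<le> short_horizon b (lip_coef b L_f Lam_f lbar_f L_g Lam_g lbar_g L_alpha)"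
  shows "well_posed f g p b t0 T"
proof -
  obtain KF M where F: "coef_f f KF M Lam_f lbar_f" using assm_a1_coef_f[OF a1] by blast
  obtain KG where G: "coef_g g KG Lam_g lbar_g" using assm_a2_coef_g[OF a2] by blast
  interpret control_bounds f KF M Lam_f lbar_f g KG Lam_g lbar_g lam_g b L_f L_g L_alpha
  proof (intro control_bounds.intro control.intro F G; unfold_locales)
    show "0 < lam_g" using a2 by (simp add: assm_a2_def)
    show "0 < b" by (rule b)
    show "lam_g * (norm \<xi>)\<^sup>2 \<le> blinfun_apply (blinfun_apply (fderiv (da g x \<mu>) \<alpha>) \<xi>) \<xi>" if "\<mu> \<in> P2" for x \<mu> \<alpha> \<xi>
      using a2 that unfolding assm_a2_def by blast
    show "norm (fderiv (da f x \<mu>) \<alpha>) * wt x \<mu> \<le> lam_g / (40 * b)" if "\<mu> \<in> P2" for x \<mu> \<alpha>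
      using sup that unfolding SUP_le_iff wt_def by fastforce
  qed (simp_all add: L L_f_const_def L_g_const_def L_alpha_const_def)
  note h = short_horizon(2)[OF b control_bounds.L(3)[OF control_bounds_axioms] t(2)[folded L_def]]
  show ?thesis
    by (rule short_time[OF assm_P_lipschitz[OF P(2,1)] _ t(1)]) (use b h P(2) in \<open>auto simp: assm_P_def\<close>)
qed

theorem theorem7p3:
  fixes Lbar_p L_f Lam_f lbar_f L_g Lam_g lbar_g L_alpha :: real
  shows "\<exists>eps1>0.
    \<forall>(f :: real^'n \<Rightarrow> (real^'n) measure \<Rightarrow> real^'k \<Rightarrow> real^'n)
     (g :: real^'n \<Rightarrow> (real^'n) measure \<Rightarrow> real^'k \<Rightarrow> real)
     (p :: real^'n \<Rightarrow> (real^'n) measure \<Rightarrow> real^'n)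
     lam_f Lip_f lam_g l_g lam_k Lam_k L_p T.
      0 < T \<and> 0 < lam_k \<and> 0 < Lam_k \<and>
      assm_a1 f lam_f Lam_f lbar_f Lip_f \<and>
      assm_a2 g lam_g Lam_g lbar_g l_g \<and>
      Lbar_p = max (Lbar_k_const Lam_k) (L0_star CARD('n) lam_f Lam_f lam_g Lam_g lam_k Lam_k) \<and>
      L_p \<le> Lbar_p \<and>
      assm_P p L_p Lbar_p \<and>
      (SUP (x, \<mu>, \<alpha>)\<in>UNIV \<times> P2 \<times> UNIV.
         ereal (norm (fderiv (da f x \<mu>) \<alpha>) * (1 + norm x + mnorm 1 \<mu>)))
        \<le> ereal (lam_g / (40 * Lbar_p)) \<and>
      L_f = L_f_const f Lam_f \<and>
      L_g = L_g_const g Lam_g lbar_g \<and>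
      L_alpha = L_alpha_const f g (4 * Lbar_p) Lam_f lbar_f lam_g lbar_g
      \<longrightarrow>
      (\<forall>t0 T'. 0 \<le> t0 \<and> t0 \<le> T' \<and> T' \<le> T \<and> T' - t0 \<le> eps1 \<longrightarrow>
        (\<exists>\<gamma>.
          cont_P2_on ({t0..T'} \<times> UNIV) (\<lambda>(s, x) \<mu>. \<gamma> s x \<mu>) \<and>
          decoupling_field f g p t0 T' \<gamma> \<and>
          tri_norm t0 T' \<gamma> \<le> ereal (2 * Lbar_p) \<and>
          (\<forall>\<gamma>'.
             cont_P2_on ({t0..T'} \<times> UNIV) (\<lambda>(s, x) \<mu>. \<gamma>' s x \<mu>) \<and>
             decoupling_field f g p t0 T' \<gamma>' \<and>
             tri_norm t0 T' \<gamma>' \<le> ereal (2 * Lbar_p) \<longrightarrow>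
             (\<forall>s\<in>{t0..T'}. \<forall>x. \<forall>\<mu>\<in>P2. \<gamma>' s x \<mu> = \<gamma> s x \<mu>)) \<and>
          (\<exists>X :: real \<Rightarrow> (real^'n) measure \<Rightarrow> real \<Rightarrow> real^'n \<Rightarrow> real^'n.
             (\<forall>t\<in>{t0..T'}. \<forall>m\<in>P2.
                is_flow f g \<gamma> t T' m (X t m) \<and>
                (\<forall>Y. is_flow f g \<gamma> t T' m Y \<longrightarrow> (\<forall>s\<in>{t..T'}. \<forall>x. Y s x = X t m s x)) \<and>
                fbode_solution f g p t T' m (X t m) (Z_of \<gamma> m (X t m)) \<and>
                (\<forall>x. cont_diff_on (\<lambda>s. X t m s x) {t..T'} \<and>
                     cont_diff_on (\<lambda>s. Z_of \<gamma> m (X t m) s x) {t..T'}) \<and>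
                (\<forall>s\<in>{t..T'}. \<forall>x.
                   norm (Z_of \<gamma> m (X t m) s x)
                     \<le> 2 * Lbar_p * (1 + norm (X t m s x) + (\<integral>y. norm (X t m s y) \<partial>m)) \<and>
                   (X t m s x, pushfwd (X t m s) m, Z_of \<gamma> m (X t m) s x) \<in> ctrl_cone (4 * Lbar_p)) \<and>
                (\<forall>s\<in>{t..T'}. \<forall>\<tau>\<in>{s..T'}. \<forall>x.
                   X t m \<tau> x = X s (pushfwd (X t m s) m) \<tau> (X t m s x))) \<and>
             (\<forall>s\<in>{t0..T'}.
                cont_P2_on ({t0..s} \<times> UNIV) (\<lambda>(t, x) m. X t m s x) \<and>
                cont_P2_on ({t0..s} \<times> UNIV) (\<lambda>(t, x) m. Z_of \<gamma> m (X t m) s x)))))"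
proof (rule exI, intro conjI allI impI, fold well_posed_def)
  \<comment> \<open>The witness depends on the listed parameters alone: it is fixed before f, g, p
    and the convexity constants are introduced.\<close>
  show "0 < short_horizon Lbar_p (lip_coef Lbar_p L_f Lam_f lbar_f L_g Lam_g lbar_g L_alpha)" by (rule short_horizon(1))
qed (elim conjE, rule assm_well_posed, auto simp: Lbar_k_const_def less_max_iff_disj)

end
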